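(* Let $0\le\delta<\infty$, let $k\ge 1$ be an integer and let $1\le p<\infty$. If $\Omega\subsetneq\mathbb{R}^n$ is a $\delta$-Gromov hyperbolic domain which admits a global $p$-Poincaré inequality, then $W^{k,\infty}(\Omega)$ is dense in $W^{k,p}(\Omega)$.
   Context: A domain is a nonempty connected open set. For a domain $\Omega\subset\mathbb{R}^n$, $k\in\mathbb{N}$ and $p\in[1,\infty]$, $W^{k,p}(\Omega)=\{u\in L^1_{loc}(\Omega): D^{\alpha}u\in L^p(\Omega)\text{ for all multi-indices } |\alpha|\le k\}$ (distributional derivatives), equipped with the norm $\sum_{|\alpha|\le k}\|D^{\alpha}u\|_{L^p(\Omega)}$. The domain $\Omega$ admits a global $p$-Poincaré inequality if there is a constant $C=C(\Omega)$ such that for every $u\in L^1_{loc}(\Omega)$ with $p$-integrable weak first order derivatives one has $\int_{\Omega}|u-u_{\Omega}|^p\le C\int_{\Omega}|\nabla u|^p$, where $u_{\Omega}=\frac{1}{|\Omega|}\int_{\Omega}u$ is the average of $u$ over $\Omega$. It is understood as part of this condition that the average makes sense (in particular $|\Omega|<\infty$). For a domain $\Omega\subsetneq\mathbb{R}^n$ write $d_{\Omega}(z)=\mathrm{dist}(z,\partial\Omega)$. The quasihyperbolic distance is $k_{\Omega}(x,y)=\inf_{\gamma}\int_{\gamma}\frac{|dz|}{d_{\Omega}(z)}$, the infimum being over rectifiable curves $\gamma\subset\Omega$ joining $x$ and $y$. A quasihyperbolic geodesic joining $x$ and $y$ is a curve attaining this infimum (such curves always exist). The domain $\Omega\subsetneq\mathbb{R}^n$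 is $\delta$-Gromov hyperbolic if for any three points $x,y,z\in\Omega$, any quasihyperbolic geodesics $\Gamma_{xy},\Gamma_{yz},\Gamma_{zx}$ joining them pairwise, and any $w$ lying on one of these three geodesics, the ball $\{u\in\Omega: k_{\Omega}(u,w)\le\delta\}$ intersects the union of the other two geodesics. *)

theory Defs
  imports "HOL-Analysis.Analysis" "HOL-Probability.Essential_Supremum"
begin

section \<open>Weak derivatives\<close>

definition partial :: "'n \<Rightarrow> (real^'n \<Rightarrow> real) \<Rightarrow> real^'n \<Rightarrow> real" where
  "partial i f x = deriv (\<lambda>t. f (x + t *\<^sub>R axis i 1)) 0"

definition smooth :: "(real^'n \<Rightarrow> real) \<Rightarrow> bool" where
  "smooth f \<longleftrightarrow> (\<forall>is. (foldr partial is f) differentiable_on UNIV)"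

text \<open>A multi-index is a function from the coordinates to \<^typ>\<open>nat\<close>. Writing out the
  operator \<open>\<partial>\<^sub>1\<^bsup>\<alpha>\<^sub>1\<^esup> \<dots> \<partial>\<^sub>n\<^bsup>\<alpha>\<^sub>n\<^esup>\<close> needs an enumeration of the (unordered) index type. The choice
  is immaterial for smooth functions, the only ones to which \<open>multi_partial\<close> is applied.\<close>

definition coords :: "'n::finite list" where
  "coords = (SOME is. distinct is \<and> set is = UNIV)"

definition multi_partial :: "('n::finite \<Rightarrow> nat) \<Rightarrow> (real^'n \<Rightarrow> real) \<Rightarrow> real^'n \<Rightarrow> real" where
  "multi_partial \<alpha> f = foldr (\<lambda>i. partial i ^^ \<alpha> i) coords f"

definition mi_order :: "('n::finite \<Rightarrow> nat) \<Rightarrow> nat" where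
  "mi_order \<alpha> = (\<Sum>i\<in>UNIV. \<alpha> i)"

definition unit_mi :: "'n \<Rightarrow> 'n \<Rightarrow> nat" where
  "unit_mi i = (\<lambda>j. if j = i then 1 else 0)"

definition test_functions :: "(real^'n) set \<Rightarrow> (real^'n \<Rightarrow> real) set" where
  "test_functions \<Omega> = {\<phi>. smooth \<phi> \<and> compact (closure {x. \<phi> x \<noteq> 0}) \<and> closure {x. \<phi> x \<noteq> 0} \<subseteq> \<Omega>}"

text \<open>Functions on \<open>\<Omega>\<close> are represented by total functions whose values outside \<open>\<Omega>\<close> are
  irrelevant, and functions that agree almost everywhere are not identified.\<close>

definition locally_integrable :: "(real^'n) set \<Rightarrow> (real^'n \<Rightarrow> real) \<Rightarrow> bool" where
  "locally_integrable \<Omega> u \<longleftrightarrow> (\<forall>K. compact K \<and> K \<subseteq> \<Omega> \<longrightarrow> u absolutely_integrable_on K)"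

definition has_weak_deriv ::
  "(real^'n) set \<Rightarrow> ('n::finite \<Rightarrow> nat) \<Rightarrow> (real^'n \<Rightarrow> real) \<Rightarrow> (real^'n \<Rightarrow> real) \<Rightarrow> bool" where
  "has_weak_deriv \<Omega> \<alpha> u g \<longleftrightarrow> locally_integrable \<Omega> u \<and> locally_integrable \<Omega> g \<and>
     (\<forall>\<phi>\<in>test_functions \<Omega>.
        (LINT x:\<Omega>|lebesgue. u x * multi_partial \<alpha> \<phi> x) =
        (-1) ^ mi_order \<alpha> * (LINT x:\<Omega>|lebesgue. g x * \<phi> x))"

text \<open>A weak derivative is unique up to a null set, so every expression below that is
  invariant under changes on null sets does not depend on the choice made here.\<close>

definition weak_deriv ::
  "(real^'n) set \<Rightarrow> ('n::finite \<Rightarrow> nat) \<Rightarrow> (real^'n \<Rightarrow> real) \<Rightarrow> real^'n \<Rightarrow> real" where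
  "weak_deriv \<Omega> \<alpha> u = (SOME g. has_weak_deriv \<Omega> \<alpha> u g)"

section \<open>Lebesgue and Sobolev spaces\<close>

definition Lp :: "ennreal \<Rightarrow> (real^'n) set \<Rightarrow> (real^'n \<Rightarrow> real) set" where
  "Lp p \<Omega> = {f \<in> borel_measurable (lebesgue_on \<Omega>).
     if p = \<infinity> then esssup (lebesgue_on \<Omega>) (\<lambda>x. ennreal \<bar>f x\<bar>) < \<infinity>
     else integrable (lebesgue_on \<Omega>) (\<lambda>x. \<bar>f x\<bar> powr enn2real p)}"

definition Lp_norm :: "ennreal \<Rightarrow> (real^'n) set \<Rightarrow> (real^'n \<Rightarrow> real) \<Rightarrow> real" where
  "Lp_norm p \<Omega> f =
     (if p = \<infinity> then enn2real (esssup (lebesgue_on \<Omega>) (\<lambda>x. ennreal \<bar>f x\<bar>))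
      else (LINT x|lebesgue_on \<Omega>. \<bar>f x\<bar> powr enn2real p) powr (1 / enn2real p))"

definition sobolev :: "nat \<Rightarrow> ennreal \<Rightarrow> (real^'n::finite) set \<Rightarrow> (real^'n \<Rightarrow> real) set" where
  "sobolev k p \<Omega> = {u. locally_integrable \<Omega> u \<and>
     (\<forall>\<alpha>. mi_order \<alpha> \<le> k \<longrightarrow> (\<exists>g\<in>Lp p \<Omega>. has_weak_deriv \<Omega> \<alpha> u g))}"

definition sobolev_norm ::
  "nat \<Rightarrow> ennreal \<Rightarrow> (real^'n::finite) set \<Rightarrow> (real^'n \<Rightarrow> real) \<Rightarrow> real" where
  "sobolev_norm k p \<Omega> u = (\<Sum>\<alpha> | mi_order \<alpha> \<le> k. Lp_norm p \<Omega> (weak_deriv \<Omega> \<alpha> u))"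

text \<open>The sum above is a genuine one (a sum over an infinite set would be 0).\<close>

lemma finite_mi_order_le: "finite {\<alpha> :: 'n::finite \<Rightarrow> nat. mi_order \<alpha> \<le> k}"
proof (rule finite_subset)
  show "{\<alpha> :: 'n \<Rightarrow> nat. mi_order \<alpha> \<le> k} \<subseteq> Pi\<^sub>E UNIV (\<lambda>_. {..k})"
  proof
    fix \<alpha> :: "'n \<Rightarrow> nat" assume \<alpha>: "\<alpha> \<in> {\<alpha>. mi_order \<alpha> \<le> k}"
    have "\<alpha> i \<le> k" for i
    proof -
      have "\<alpha> i \<le> (\<Sum>i\<in>UNIV. \<alpha> i)"
        by (rule member_le_sum) simp_all
      also have "\<dots> \<le> k"
        using \<alpha> by (simp add: mi_order_def)
      finally show ?thesis .
    qed
    then show "\<alpha> \<in> Pi\<^sub>E UNIV (\<lambda>_. {..k})"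
      by (simp add: PiE_iff)
  qed
qed (rule finite_PiE, simp_all)

section \<open>The Poincar\'e inequality\<close>

text \<open>That the average makes sense, i.e. \<open>|\<Omega>| < \<infinity>\<close> and \<open>u \<in> L\<^sup>1(\<Omega>)\<close>, is part of the condition.
  The vector field \<open>G\<close> ranges over the representatives of the weak gradient of \<open>u\<close>.\<close>

definition global_poincare :: "real \<Rightarrow> (real^'n::finite) set \<Rightarrow> bool" where
  "global_poincare p \<Omega> \<longleftrightarrow> emeasure lebesgue \<Omega> < \<infinity> \<and>
     (\<exists>C::real. \<forall>u (G :: real^'n \<Rightarrow> real^'n).
        locally_integrable \<Omega> u \<and>
        (\<forall>i. has_weak_deriv \<Omega> (unit_mi i) u (\<lambda>x. G x $ i) \<and> (\<lambda>x. G x $ i) \<in> Lp (ennreal p) \<Omega>) \<longrightarrow>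
        integrable (lebesgue_on \<Omega>) u \<and>
        (let u\<^sub>\<Omega> = (LINT x|lebesgue_on \<Omega>. u x) / measure lebesgue \<Omega> in
           (\<integral>\<^sup>+x. ennreal (\<bar>u x - u\<^sub>\<Omega>\<bar> powr p) \<partial>lebesgue_on \<Omega>)
             \<le> ennreal C * (\<integral>\<^sup>+x. ennreal (norm (G x) powr p) \<partial>lebesgue_on \<Omega>)))"

section \<open>Gromov hyperbolicity in the quasihyperbolic metric\<close>

definition variation_sums :: "(real \<Rightarrow> 'a::metric_space) \<Rightarrow> real \<Rightarrow> real \<Rightarrow> real set" where
  "variation_sums \<gamma> a b = (\<lambda>d. \<Sum>K\<in>d. dist (\<gamma> (Inf K)) (\<gamma> (Sup K))) ` {d. d division_of {a..b}}"

definition curve_length :: "(real \<Rightarrow> 'a::metric_space) \<Rightarrow> real \<Rightarrow> real \<Rightarrow> real" where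
  "curve_length \<gamma> a b = Sup (variation_sums \<gamma> a b)"

definition rectifiable :: "(real \<Rightarrow> 'a::metric_space) \<Rightarrow> bool" where
  "rectifiable \<gamma> \<longleftrightarrow> path \<gamma> \<and> bdd_above (variation_sums \<gamma> 0 1)"

text \<open>The line integral with respect to arc length, as the Lebesgue-Stieltjes integral
  against the length function \<open>t \<mapsto> length(\<gamma>|[0,t])\<close>, which is extended to the real line as a
  constant on either side of \<open>[0,1]\<close> (there is no division point, hence length 0, for \<open>t < 0\<close>).\<close>

definition arclength_integral :: "(real \<Rightarrow> 'a::metric_space) \<Rightarrow> ('a \<Rightarrow> real) \<Rightarrow> real" where
  "arclength_integral \<gamma> f =
     (LINT t:{0..1}|interval_measure (\<lambda>t. curve_length \<gamma> 0 (min t 1)). f (\<gamma> t))"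

definition qh_length :: "(real^'n) set \<Rightarrow> (real \<Rightarrow> real^'n) \<Rightarrow> real" where
  "qh_length \<Omega> \<gamma> = arclength_integral \<gamma> (\<lambda>z. 1 / infdist z (frontier \<Omega>))"

definition rectifiable_curves ::
  "(real^'n) set \<Rightarrow> real^'n \<Rightarrow> real^'n \<Rightarrow> (real \<Rightarrow> real^'n) set" where
  "rectifiable_curves \<Omega> x y =
     {\<gamma>. rectifiable \<gamma> \<and> path_image \<gamma> \<subseteq> \<Omega> \<and> pathstart \<gamma> = x \<and> pathfinish \<gamma> = y}"

definition qh_dist :: "(real^'n) set \<Rightarrow> real^'n \<Rightarrow> real^'n \<Rightarrow> real" where
  "qh_dist \<Omega> x y = (INF \<gamma>\<in>rectifiable_curves \<Omega> x y. qh_length \<Omega> \<gamma>)"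

definition qh_geodesic :: "(real^'n) set \<Rightarrow> real^'n \<Rightarrow> real^'n \<Rightarrow> (real \<Rightarrow> real^'n) \<Rightarrow> bool" where
  "qh_geodesic \<Omega> x y \<gamma> \<longleftrightarrow> \<gamma> \<in> rectifiable_curves \<Omega> x y \<and> qh_length \<Omega> \<gamma> = qh_dist \<Omega> x y"

definition gromov_hyperbolic :: "real \<Rightarrow> (real^'n) set \<Rightarrow> bool" where
  "gromov_hyperbolic \<delta> \<Omega> \<longleftrightarrow>
     (\<forall>x\<in>\<Omega>. \<forall>y\<in>\<Omega>. \<forall>z\<in>\<Omega>. \<forall>\<gamma>xy \<gamma>yz \<gamma>zx.
        qh_geodesic \<Omega> x y \<gamma>xy \<and> qh_geodesic \<Omega> y z \<gamma>yz \<and> qh_geodesic \<Omega> z x \<gamma>zx \<longrightarrow>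
        (let A = path_image \<gamma>xy; B = path_image \<gamma>yz; C = path_image \<gamma>zx;
             ball = (\<lambda>w. {u\<in>\<Omega>. qh_dist \<Omega> u w \<le> \<delta>}) in
           (\<forall>w\<in>A. ball w \<inter> (B \<union> C) \<noteq> {}) \<and>
           (\<forall>w\<in>B. ball w \<inter> (A \<union> C) \<noteq> {}) \<and>
           (\<forall>w\<in>C. ball w \<inter> (A \<union> B) \<noteq> {})))"

definition is_domain :: "(real^'n) set \<Rightarrow> bool" where
  "is_domain \<Omega> \<longleftrightarrow> \<Omega> \<noteq> {} \<and> open \<Omega> \<and> connected \<Omega>"

end

theory Submission
  imports Defs "HOL-Computational_Algebra.Polynomial"
begin

text \<open>
  Mollification approximates a Sobolev function by functions with bounded derivatives away from the
  boundary. The difficulty is the part of \<open>Om\<close> that lies deeper than the mollification radius: there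
  the mollified function is not defined, and \<open>Om\<close> has no regularity that would allow an extension.
  Hyperbolicity of the quasihyperbolic metric supplies the missing geometry, and the Poincare
  inequality reduces the problem to the derivatives of order \<open>k\<close>.

  \<^emph>\<open>Geometry.\<close> The quasihyperbolic distance is realised here as an infimum \<open>K\<close> over polygonal chains.
  Its geodesics are the ones of the definition of hyperbolicity (\<open>geo_exists\<close>, \<open>geo_qh_geodesic\<close>), so
  geodesic triangles are thin. The central consequence is \<open>ball_separation\<close>: every connected set
  that joins the ends of a geodesic enters the component of a ball \<open>B(w, C d(w))\<close> around each point
  \<open>w\<close> of the geodesic. It follows from \<open>energy_bound\<close>. If a connected set \<open>E\<close> joined the ends but
  avoided the ball, the geodesics from \<open>w\<close> to the points of \<open>E\<close> would all cross many concentric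
  annuli; seen from \<open>w\<close>, however, \<open>E\<close> has a definite size in the visual quasimetric
  \<open>exp (- eps (a|b)\<^sub>w)\<close>, and the mass that \<open>E\<close> carries in this sense would have to pass through sets
  which, by a volume count, are too few to transport it.

  Fix a base point \<open>x0\<close> and a small scale \<open>r\<close>. A geodesic from \<open>x0\<close> that comes within distance \<open>r\<close> of
  the boundary does so at a cut point \<open>u\<close> with \<open>d(u) = r\<close>, and by separation a neighbourhood of \<open>u\<close> of
  diameter comparable to \<open>r\<close> shields everything behind \<open>u\<close> from \<open>x0\<close>. The points that no cut point shields
  form the core; the rest splits into tentacles (\<open>tentacle_decomposition\<close>). A small connected piece
  outside the core has a base point, a cut point that is not itself behind another one. Overlapping pieces deep inside a
  tentacle have the same base point, and in all other cases the base points are joined by a geodesic of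
  bounded length that stays at distance comparable to \<open>r\<close> from the boundary (\<open>linking\<close>).

  \<^emph>\<open>Gluing.\<close> Mollify all derivatives at a scale comparable to \<open>r\<close>. On the core the mollified function is kept;
  on a piece outside the core it is replaced by its Taylor polynomial of degree \<open>k - 1\<close> at the base point.
  A partition of unity over a grid of side comparable to \<open>r\<close>, applied to the components of the grid cubes, glues
  these functions. Taylor polynomials at linked points differ by at most the derivatives of order
  \<open>k\<close> near the connecting geodesic times the matching power of \<open>r\<close>, which cancels the negative powers of \<open>r\<close>
  that come from differentiating the partition. Hence the derivatives of order \<open>k\<close> of the glued function are
  bounded at each point by nearby derivatives of order \<open>k\<close> of the mollified function
  (\<open>glued_top\<close>), thus by averages of \<open>|D\<^sup>k u|\<close> over balls of radius comparable to \<open>r\<close>. A cutoff at infinity makes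
  all derivatives bounded. Since averages are bounded on \<open>L\<^sup>p\<close> and the glued function differs from
  the mollified one only near the boundary, its derivatives of order \<open>k\<close> converge in
  \<open>L\<^sup>p(Om)\<close>, and all its derivatives converge on compact sets (\<open>sobolev_approximation\<close>).

  \<^emph>\<open>Lower orders.\<close> The difference of the two functions has small derivatives of order \<open>k\<close>
  on \<open>Om\<close> and small derivatives of all orders on a fixed ball. The Poincare inequality bounds a function by
  its gradient and its restriction to the ball (\<open>poincare_local\<close>), so downward induction on the order makes
  all derivatives small on \<open>Om\<close> (\<open>sobolev_density\<close>).

  Derivatives of a function are carried along as a family indexed by multi-indices, a jet, so that
  Leibniz' rule, Taylor polynomials and mollification are operations on families.
\<close>

section \<open>Chains and the quasihyperbolic metric\<close>

text \<open>Both the quasihyperbolic distance and the visual metric below are infima of chain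
 costs; the relation \<open>c a b t\<close> says that the step from \<open>a\<close> to
 \<open>b\<close> may be taken at cost \<open>t\<close>.\<close>

inductive cost_chain :: "('a => 'a => real => bool) => 'a => 'a => real => bool" for c where
 refl: "cost_chain c a a 0"
| step: "cost_chain c a b s ==> c b b' t ==> cost_chain c a b' (s+t)"

definition chain_inf :: "('a => 'a => real => bool) => 'a => 'a => real" where
 "chain_inf c a b = Inf {s. cost_chain c a b s}"

lemma cost_chain_trans:
 assumes "cost_chain c a b s" "cost_chain c b d t"
 shows "cost_chain c a d (s+t)"
 using assms(2,1)
proof (induction arbitrary: s)
 case (step b b' t' b'' t)
 thus ?case
  using cost_chain.step[of c a b' "s+t'" b'' t] by(simp add: add.assoc)
qed simp

lemma cost_chain_single: "c a b t ==> cost_chain c a b t"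
 using cost_chain.step[OF cost_chain.refl] by fastforce

lemma cost_chain_sym:
 assumes "cost_chain c a b s" "!!a b t. c a b t ==> c b a t"
 shows "cost_chain c b a s"
 using assms(1)
proof induction
 case (step a b s b' t)
 from cost_chain_trans[OF cost_chain_single[of c b' b t, OF assms(2)[OF step(2)]] step(3)]
 show ?case by(simp add: add.commute)
qed (rule cost_chain.refl)

lemma cost_chain_nonneg:
 assumes "cost_chain c a b s" "!!a b t. c a b t ==> 0<=t"
 shows "0<=s"
 using assms(1)
proof induction
 case (step a b s b' t)
 thus ?case using assms(2)[OF step(2)] by linarith
qed simp

lemma chain_inf_le:
 assumes "cost_chain c a b s" "!!a b t. c a b t ==> 0<=t"
 shows "chain_inf c a b <= s"
 unfolding chain_inf_def
proof (rule cInf_lower)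
 show "bdd_below {s. cost_chain c a b s}"
  by(rule bdd_belowI[of _ 0]) (use cost_chain_nonneg[OF _ assms(2)] in auto)
qed (use assms in auto)

lemma chain_inf_ge:
 assumes "cost_chain c a b s0" "!!s. cost_chain c a b s ==> m<=s"
 shows "m <= chain_inf c a b"
 unfolding chain_inf_def using assms by(intro cInf_greatest) auto

lemma chain_inf_approx:
 assumes "cost_chain c a b s0" "0<e"
 obtains s where "cost_chain c a b s" "s < chain_inf c a b+e"
proof -
 have "{s. cost_chain c a b s} ~= {}" using assms(1) by auto
 hence "EX s:{s. cost_chain c a b s}. s < chain_inf c a b+e"
  unfolding chain_inf_def using assms(2) by(meson cInf_lessD less_add_same_cancel1)
 thus ?thesis using that by auto
qed

lemma chain_inf_triangle:
 assumes "cost_chain c a b s" "cost_chain c b d t" and pos: "!!a b t. c a b t ==> 0<=t"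
 shows "chain_inf c a d <= chain_inf c a b+chain_inf c b d"
proof (rule field_le_epsilon)
 fix e :: real assume "0<e"
 obtain s' where s': "cost_chain c a b s'" "s' < chain_inf c a b+e/2"
  using chain_inf_approx[OF assms(1), of "e/2"] `0 < e` by auto
 obtain t' where t': "cost_chain c b d t'" "t' < chain_inf c b d+e/2"
  using chain_inf_approx[OF assms(2), of "e/2"] `0 < e` by auto
 have "chain_inf c a d <= s'+t'"
  by(rule chain_inf_le[OF cost_chain_trans[OF s'(1) t'(1)] pos])
 thus "chain_inf c a d <= chain_inf c a b+chain_inf c b d+e" using s' t' by linarith
qed

locale proper_domain =
 fixes Om :: "(real^'n::finite) set"
 assumes open_dom: "open Om" and connected_dom: "connected Om"
  and nonempty_dom: "Om ~= {}" and not_UNIV_dom: "Om ~= UNIV"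
begin

definition bd :: "real^'n => real" where "bd x = infdist x (frontier Om)"

lemma frontier_nonempty: "frontier Om ~= {}"
 using nonempty_dom not_UNIV_dom frontier_eq_empty by blast

lemma bd_lip: "abs(bd x - bd y) <= dist x y"
 unfolding bd_def using infdist_triangle_abs[of x "frontier Om" y] by simp

lemma bd_nonneg: "0 <= bd x" by(simp add: bd_def infdist_nonneg)

lemma bd_le: "bd y <= bd x+dist x y" using bd_lip[of y x] by(simp add: dist_commute)

lemma bd_pos: "x:Om ==> 0 < bd x"
proof -
 assume x: "x:Om"
 hence "x ~: frontier Om" using open_dom by(simp add: frontier_def interior_open)
 thus ?thesis
  using infdist_pos_not_in_closed[of "frontier Om" x] frontier_nonempty
  by(simp add: bd_def)
qed

lemma ball_subset_dom:
 assumes "x:Om" shows "ball x (bd x) <= Om"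
proof (rule ccontr)
 assume "~ ?thesis"
 hence "ball x (bd x) - Om ~= {}" by blast
 moreover have "ball x (bd x) Int Om ~= {}" using assms bd_pos[OF assms] centre_in_ball by blast
 ultimately obtain y where y: "y:ball x (bd x)" "y:frontier Om"
  using connected_Int_frontier[of "ball x (bd x)" Om] by auto
 thus False using infdist_le[of y "frontier Om" x] by(auto simp: bd_def)
qed

lemma in_dom_if_near: "x:Om ==> dist x y < bd x ==> y:Om"
 using ball_subset_dom[of x] by auto

lemma closure_dom: "x:closure Om ==> 0 < bd x ==> x:Om"
 using open_dom by(metis DiffI bd_def frontier_def infdist_zero interior_open order_less_irrefl)

lemma continuous_bd: "continuous_on A bd"
 unfolding bd_def by(intro continuous_intros)

text \<open>A segment is charged its length divided by a lower bound of the distance to the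
 boundary along it. Chains of such steps have the same infimum as the integrals of
 \<open>1/d\<close> over rectifiable curves, see \<open>qh_dist_eq_K\<close>.\<close>

definition qh_step :: "real^'n => real^'n => real => bool" where
 "qh_step b c t \<longleftrightarrow> (EX m>0. (ALL p:closed_segment b c. p:Om & m <= bd p) & t = dist b c/m)"

definition K :: "real^'n => real^'n => real" where "K a b = chain_inf qh_step a b"

lemma qh_step_nonneg: "qh_step a b t ==> 0<=t" by(auto simp: qh_step_def)

lemma qh_step_sym: "qh_step a b t ==> qh_step b a t"
 by(auto simp: qh_step_def closed_segment_commute dist_commute)

lemma qh_step_near:
 assumes "a:Om" "dist a b < bd a"
 shows "qh_step a b (dist a b/(bd a - dist a b))"
 unfolding qh_step_def
proof (intro exI[of _ "bd a - dist a b"] conjI ballI)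
 fix p assume "p:closed_segment a b"
 hence "dist a p <= dist a b"
  using dist_in_closed_segment[of p a b] by(simp add: dist_commute)
 thus "p:Om" "bd a - dist a b <= bd p"
  using in_dom_if_near[OF assms(1), of p] assms(2) bd_le[of a p] by(auto simp: dist_commute)
qed (use assms in auto)

lemma qh_step_in_dom: "qh_step b c t ==> b:Om & c:Om"
 by(auto simp: qh_step_def)

text \<open>The set of points reachable from \<open>a\<close> is open, and so is its complement,
 since points in a small ball reach each other in one step.\<close>

lemma chain_exists:
 assumes "a:Om" "b:Om" obtains s where "cost_chain qh_step a b s"
proof -
 define R where "R = {x:Om. EX s. cost_chain qh_step a x s}"
 have near: "(EX s. cost_chain qh_step a x s) \<longleftrightarrow> (EX s. cost_chain qh_step a y s)"
  if "x:Om" "dist x y < bd x" for x y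
  using cost_chain.step[where c = qh_step, OF _ qh_step_near[OF that]]
   cost_chain.step[where c = qh_step, OF _ qh_step_sym[OF qh_step_near[OF that]]] by blast
 have nb: "EX e>0. ball x e <= Om & (ALL y:ball x e. y:R \<longleftrightarrow> x:R)" if "x:Om" for x
 proof (intro exI[of _ "bd x"] conjI ballI)
  fix y assume y: "y:ball x (bd x)"
  thus "(y:R) = (x:R)" using near[OF that, of y] in_dom_if_near[OF that, of y] that by(simp add: R_def)
 qed (use ball_subset_dom[OF that] bd_pos[OF that] in auto)
 have "EX e>0. ball x e <= R" if "x:R" for x
 proof -
  have "x:Om" using that by(simp add: R_def)
  from nb[OF this] obtain e where e: "e > 0" "ALL y:ball x e. (y:R) = (x:R)" by(elim exE conjE) rule
  hence "ball x e <= R" using that by blast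
  thus ?thesis using e(1) by blast
 qed
 hence "open R" unfolding open_contains_ball by blast
 have "EX e>0. ball x e <= Om - R" if "x:Om - R" for x
 proof -
  have "x:Om" using that by simp
  from nb[OF this] obtain e where e: "e > 0" "ball x e <= Om" "ALL y:ball x e. (y:R) = (x:R)" by(elim exE conjE) rule
  hence "ball x e <= Om - R" using that by blast
  thus ?thesis using e(1) by blast
 qed
 hence "open (Om - R)" unfolding open_contains_ball by blast
 have "a:R" using assms cost_chain.refl[of qh_step a] by(auto simp: R_def)
 have "Om - R = {}"
 proof (rule ccontr)
  assume "Om - R ~= {}"
  moreover have "R Int (Om - R) Int Om = {}" "Om <= R Un (Om - R)" "R Int Om ~= {}"
   using `a \<in> R` assms by blast+
  ultimately show False
   using connectedD[OF connected_dom `open R` `open (Om - R)`] by blast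
 qed
 thus ?thesis using that assms by(auto simp: R_def)
qed

lemma K_nonneg: 
 assumes "a:Om" "b:Om" shows "0 <= K a b"
proof -
 obtain s where "cost_chain qh_step a b s" using chain_exists[OF assms] .
 thus ?thesis unfolding K_def
  by(rule chain_inf_ge) (rule cost_chain_nonneg[OF _ qh_step_nonneg])
qed

lemma K_sym: "K a b = K b a"
proof -
 have "cost_chain qh_step a b s \<longleftrightarrow> cost_chain qh_step b a s" for s
  using cost_chain_sym[where c = qh_step, OF _ qh_step_sym] by blast
 thus ?thesis by(simp add: K_def chain_inf_def)
qed

lemma K_triangle:
 assumes "a:Om" "b:Om" "c:Om" shows "K a c <= K a b+K b c"
proof -
 obtain s where s: "cost_chain qh_step a b s" using chain_exists[OF assms(1,2)] .
 obtain t where t: "cost_chain qh_step b c t" using chain_exists[OF assms(2,3)] .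
 show ?thesis unfolding K_def by(rule chain_inf_triangle[OF s t qh_step_nonneg])
qed

lemma K_refl [simp]: "a:Om ==> K a a = 0"
 using chain_inf_le[OF cost_chain.refl[of qh_step a] qh_step_nonneg] K_nonneg[of a a]
 by(simp add: K_def)

lemma K_le_step: "qh_step a b t ==> K a b <= t"
 unfolding K_def by(rule chain_inf_le[OF cost_chain_single qh_step_nonneg])

lemma K_le_near: "a:Om ==> dist a b < bd a ==> K a b <= dist a b/(bd a - dist a b)"
 by(rule K_le_step[OF qh_step_near])

text \<open>Along a step the distance to the boundary is at most the starting value plus the
 length travelled, so integrating \<open>1/d\<close> produces at least this logarithm.\<close>

lemma chain_ge_ln:
 assumes "cost_chain qh_step a b s" "a:Om"
 shows "ln (1+dist a b/bd a) <= s"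
 using assms
proof induction
 case (step a b s c t)
 have a: "0 < bd a" using step bd_pos by blast
 obtain m where m: "m > 0" "m <= bd b" "t = dist b c/m" using step(2) by(auto simp: qh_step_def)
 have b: "bd b <= bd a+dist a b" using bd_le by blast
 have p0: "0 < bd a+dist a b" using a by(simp add: add_pos_nonneg)
 have p1: "0 < 1+dist a c/bd a" and p2: "0 < 1+dist a b/bd a"
  and p3: "0 < 1+dist b c/(bd a+dist a b)"
  using a by(simp_all add: add_pos_nonneg)
 have "bd a+dist a c <= bd a+dist a b+dist b c" using dist_triangle[of a c b] by simp
 moreover have "(1+dist a b/bd a)*(1+dist b c/(bd a+dist a b)) = (bd a+dist a b+dist b c)/bd a"
 proof -
  have "bd a+dist a b > 0" using a by(simp add: add_pos_nonneg)
  hence "1+dist b c/(bd a+dist a b) = (bd a+dist a b+dist b c)/(bd a+dist a b)"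
   by(simp add: add_divide_distrib)
  moreover have "1+dist a b/bd a = (bd a+dist a b)/bd a" using a by(simp add: add_divide_distrib)
  ultimately show ?thesis by auto
 qed
 ultimately have "1+dist a c/bd a <= (1+dist a b/bd a)*(1+dist b c/(bd a+dist a b))"
  using a `bd a + dist a c <= bd a + dist a b + dist b c`
  by(simp add: add_divide_distrib[symmetric] divide_right_mono add_divide_eq_iff)
 hence "ln (1+dist a c/bd a) <= ln ((1+dist a b/bd a)*(1+dist b c/(bd a+dist a b)))"
  using p1 by(simp only: ln_mono)
 also have "... = ln (1+dist a b/bd a)+ln (1+dist b c/(bd a+dist a b))"
  using p2 p3 by(rule ln_mult_pos)
 also have "ln (1+dist b c/(bd a+dist a b)) <= dist b c/(bd a+dist a b)"
  using p0 by(intro ln_add_one_self_le_self) simp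
 also have "dist b c/(bd a+dist a b) <= t"
  unfolding m(3) using m a b p0 by(intro divide_left_mono) auto
 finally show ?case using step.IH[OF step.prems] by linarith
qed simp

lemma K_ge_ln:
 assumes "a:Om" "b:Om" shows "ln (1+dist a b/bd a) <= K a b"
proof -
 obtain s where "cost_chain qh_step a b s" using chain_exists[OF assms] .
 thus ?thesis unfolding K_def
  by(rule chain_inf_ge) (rule chain_ge_ln[OF _ assms(1)])
qed

lemma dist_le_K:
 assumes "a:Om" "b:Om" shows "dist a b <= (exp (K a b) - 1)*bd a"
proof -
 have a: "0 < bd a" using bd_pos assms by blast
 have "exp (ln (1+dist a b/bd a)) <= exp (K a b)"
  using K_ge_ln[OF assms] by simp
 moreover have "0 < 1+dist a b/bd a" using a by(simp add: add_pos_nonneg)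
 ultimately have "1+dist a b/bd a <= exp (K a b)" by simp
 thus ?thesis using a by(simp add: field_simps)
qed

lemma bd_le_K: "a:Om ==> b:Om ==> bd b <= exp (K a b)*bd a"
 using dist_le_K[of a b] bd_le[of b a] by(simp add: algebra_simps)

lemma bd_ge_K: "a:Om ==> b:Om ==> exp (- K a b)*bd a <= bd b"
 using bd_le_K[of b a] by(simp add: K_sym[of b a] exp_minus field_simps)

lemma K_diff: "a:Om ==> b:Om ==> c:Om ==> abs(K c a - K c b) <= K a b"
 using K_triangle[of c a b] K_triangle[of c b a] K_sym[of a b] by simp

lemma K_le_twice: 
 assumes "a:Om" "dist a b <= bd a/2" shows "K a b <= 2*dist a b/bd a"
proof -
 have a: "0 < bd a" using bd_pos assms by blast
 hence "K a b <= dist a b/(bd a - dist a b)" using assms by(intro K_le_near) auto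
 also have "... <= dist a b/(bd a/2)" using a assms by(intro divide_left_mono) (auto)
 finally show ?thesis by(simp add: mult.commute)
qed

lemma continuous_K:
 assumes "c:Om" shows "continuous_on Om (K c)"
 unfolding continuous_on_iff
proof (intro ballI allI impI)
 fix a and e :: real assume a: "a:Om" and e: "0<e"
 let ?r = "min (bd a/2) (e*bd a/4)"
 have ba: "0 < bd a" using a bd_pos by blast
 show "EX r>0. ALL b:Om. dist b a < r --> dist (K c b) (K c a) < e"
 proof (intro exI[of _ ?r] conjI ballI impI)
  show "0 < ?r" using ba e by auto
  fix b assume b: "b:Om" "dist b a < ?r"
  have "K a b <= 2*dist a b/bd a" using b by(intro K_le_twice a) (auto simp: dist_commute)
  also have "2*dist a b < e*bd a"
   using b mult_pos_pos[OF e ba] by(simp add: dist_commute)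
  hence "2*dist a b/bd a < e" using ba by(simp add: field_simps)
  finally show "dist (K c b) (K c a) < e" using K_diff[OF a b(1) assms] by(simp add: dist_real_def abs_minus_commute)
 qed
qed

text \<open>Bounded quasihyperbolic distance means bounded Euclidean distance and, as
 \<open>ln\<close> of the ratio of boundary distances is dominated by \<open>K\<close>, a
 positive distance from the boundary.\<close>

lemma compact_K_ball:
 assumes "a:Om" shows "compact {b:Om. K a b <= R}"
proof (cases "0<=R")
 case True
 have a: "0 < bd a" using assms bd_pos by blast
 define B where "B = {b:Om. K a b <= R}"
 have dB: "exp (-R)*bd a <= bd b" if "b:B" for b
 proof -
  have "exp (-R)*bd a <= exp (-K a b)*bd a" using that a by(auto simp: B_def)
  also have "... <= bd b" using bd_ge_K[OF assms, of b] that by(auto simp: B_def)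
  finally show ?thesis .
 qed
 have "B <= cball a ((exp R - 1)*bd a)"
 proof
  fix b assume b: "b:B"
  hence "dist a b <= (exp (K a b) - 1)*bd a" using dist_le_K assms by(auto simp: B_def)
  also have "... <= (exp R - 1)*bd a" using b a by(auto simp: B_def)
  finally show "b:cball a ((exp R - 1)*bd a)" by simp
 qed
 hence "bounded B" using bounded_subset bounded_cball by blast
 moreover have "closed B"
  unfolding closed_sequential_limits
 proof (intro allI impI)
  fix x l assume xl: "(ALL n. x n:B) & x \<longlonglongrightarrow> l"
  have "(%n. bd (x n)) \<longlonglongrightarrow> bd l"
   by(rule continuous_on_tendsto_compose[OF continuous_bd[of UNIV]]) (use xl in auto)
  hence "exp (-R)*bd a <= bd l" using dB xl by(intro tendsto_lowerbound) auto
  hence "0 < bd l" using a by(smt (verit) exp_gt_zero mult_pos_pos)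
  moreover have "l:closure Om" using xl by(auto simp: closure_sequential B_def)
  ultimately have l: "l:Om" using closure_dom by blast
  have "(%n. K a (x n)) \<longlonglongrightarrow> K a l"
   by(rule continuous_on_tendsto_compose[OF continuous_K[OF assms]]) (use xl l in "auto simp: B_def")
  hence "K a l <= R" using xl by(intro tendsto_upperbound) (auto simp: B_def)
  thus "l:B" using l by(simp add: B_def)
 qed
 ultimately show ?thesis by(simp add: B_def compact_eq_bounded_closed)
next
 case False
 have "{b:Om. K a b <= R} = {}"
 proof (rule ccontr)
  assume "{b:Om. K a b <= R} ~= {}"
  then obtain b where "b:Om" "K a b <= R" by blast
  thus False using K_nonneg[OF assms, of b] False by linarith
 qed
 thus ?thesis by(simp only: compact_empty)
qed

end

section \<open>Quasihyperbolic geodesics\<close>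

context proper_domain begin

lemma K_eq_0: "a:Om ==> b:Om ==> K a b = 0 ==> a = b"
 using dist_le_K[of a b] by simp

lemma qh_step_sub:
 assumes "qh_step b c t" "p:closed_segment b c"
 obtains t1 t2 where "qh_step b p t1" "qh_step p c t2" "t1+t2 = t"
proof -
 obtain m where m: "m > 0" "ALL p:closed_segment b c. p:Om & m <= bd p" "t = dist b c/m"
  using assms by(auto simp: qh_step_def)
 have sub: "closed_segment b p <= closed_segment b c" "closed_segment p c <= closed_segment b c"
  using assms(2) by(simp_all add: subset_closed_segment)
 have "dist b p/m+dist p c/m = t"
  by(metis assms(2) between_mem_segment[of b c p] between[of b c p] m(3) add_divide_distrib[symmetric])
 moreover have "qh_step b p (dist b p/m)" "qh_step p c (dist p c/m)"
  using m sub by(auto simp: qh_step_def)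
 ultimately show ?thesis using that by blast
qed

text \<open>Along a chain the distance from \<open>a\<close> varies continuously, so it takes the
 value \<open>s\<close> on one of the segments, which is then divided.\<close>

lemma chain_intermediate:
 assumes "cost_chain qh_step a b S" "a:Om" "0<=s" "s <= K a b"
 shows "EX p:Om. K a p = s & K p b <= S - s"
 using assms
proof induction
 case (refl a)
 thus ?case by(intro bexI[of _ a]) auto
next
 case (step a b S c t)
 have b: "b:Om" and c: "c:Om" using qh_step_in_dom[OF step(2)] by auto
 show ?case
 proof (cases "s <= K a b")
  case True
  then obtain p where p: "p:Om" "K a p = s" "K p b <= S - s" using step by blast
  thus ?thesis
   by(smt (verit) K_triangle[OF p(1) b c] K_le_step[OF step(2)])
 next
  case False
  have seg: "closed_segment b c <= Om" using step(2) by(auto simp: qh_step_def)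
  have "EX x>=0. x<=1 & K a (linepath b c x) = s"
  proof (rule IVT')
   show "continuous_on {0..1} (%x. K a (linepath b c x))"
    by(rule continuous_on_compose2[OF continuous_K[OF step.prems(1)]])
      (use seg in "auto simp: linepath_image_01[symmetric] intro!: continuous_intros")
  qed (use False step.prems in "auto simp: linepath_def")
  then obtain x where x: "0<=x" "x<=1" "K a (linepath b c x) = s" by blast
  define p where "p = linepath b c x"
  have ps: "p:closed_segment b c" using x unfolding p_def by(auto simp: linepath_image_01[symmetric])
  hence p: "p:Om" using seg by blast
  obtain t1 t2 where t: "qh_step b p t1" "qh_step p c t2" "t1+t2 = t"
   using qh_step_sub[OF step(2) ps] by blast
  have "K a b <= S" unfolding K_def by(rule chain_inf_le[OF step(1) qh_step_nonneg])
  hence "s <= S+t1" using K_triangle[OF step.prems(1) b p] K_le_step[OF t(1)] x by(simp add: p_def)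
  hence "K p c <= S+t - s" using K_le_step[OF t(2)] t(3) by linarith
  thus ?thesis using p x by(auto simp: p_def)
 qed
qed

lemma compact_K_sphere:
 assumes "a:Om" "q:Om" shows "compact {p:Om. K a p <= R & K q p = s}"
proof -
 let ?S = "{b:Om. K a b <= R}"
 have "closedin (top_of_set ?S) {p:?S. K q p = s}"
  by(rule continuous_closedin_preimage_constant)
    (rule continuous_on_subset[OF continuous_K[OF assms(2)]], auto)
 hence "compact {p:?S. K q p = s}" using compact_K_ball[OF assms(1)] closedin_compact by blast
 thus ?thesis by simp
qed

text \<open>Chains of cost approaching \<open>K a b\<close> give points whose distances to
 \<open>a\<close> and \<open>b\<close> are almost right; a cluster point in a compact sphere is
 exact.\<close>

lemma between_exists:
 assumes "a:Om" "b:Om" "0<=s" "s <= K a b"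
 obtains p where "p:Om" "K a p = s" "K p b = K a b - s"
proof -
 obtain S0 where S0: "cost_chain qh_step a b S0" using chain_exists[OF assms(1,2)] .
 let ?C = "{p:Om. K a p <= s & K a p = s}"
 have "compact ?C" using compact_K_sphere[OF assms(1,1)] .
 moreover have "?C ~= {}" using chain_intermediate[OF S0 assms(1,3,4)] by auto
 moreover have "continuous_on ?C (K b)" by(rule continuous_on_subset[OF continuous_K[OF assms(2)]]) auto
 ultimately obtain p where p: "p : ?C" "!!q. q : ?C ==> K b p <= K b q"
  using continuous_attains_inf[of ?C "K b"] by blast
 have "K p b <= K a b - s"
 proof (rule field_le_epsilon)
  fix e :: real assume "0<e"
  then obtain S where S: "cost_chain qh_step a b S" "S < K a b+e"
   using chain_inf_approx[OF S0] unfolding K_def by blast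
  obtain q where "q:Om" "K a q = s" "K q b <= S - s" using chain_intermediate[OF S(1) assms(1,3,4)] by blast
  thus "K p b <= K a b - s+e" using p(2)[of q] S(2) K_sym by simp
 qed
 moreover have "K a b <= K a p+K p b" using K_triangle assms p(1) by blast
 ultimately show ?thesis using p(1) by(intro that[of p]) auto
qed

definition geo :: "real^'n => real^'n => (real => real^'n) => bool" where
 "geo a b g \<longleftrightarrow> g 0 = a & g (K a b) = b & (ALL s:{0..K a b}. g s:Om) &
   (ALL s:{0..K a b}. ALL t:{0..K a b}. K (g s) (g t) = abs(s - t))"

lemma finite_isometry_extend:
 assumes "finite F" "(0, a):F" "(L, b):F" "s:{0..L}" "fst ` F <= {0..L}" "snd ` F <= Om"
  and iso: "!!t q t' q'. (t, q):F ==> (t', q'):F ==> K q q' = abs(t - t')"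
 shows "EX p:Om. ALL (t, q):F. K q p = abs(s - t)"
proof -
 define lo where "lo = Max {t:fst ` F. t<=s}"
 define hi where "hi = Min {t:fst ` F. s<=t}"
 have f: "finite {t:fst ` F. t<=s}" "finite {t:fst ` F. s<=t}" using assms(1) by auto
 have "0:{t:fst ` F. t<=s}" "L:{t:fst ` F. s<=t}" using assms by force+
 hence "lo:{t:fst ` F. t<=s}" "hi:{t:fst ` F. s<=t}"
  unfolding lo_def hi_def using Max_in[OF f(1)] Min_in[OF f(2)] by blast+
 then obtain ql qh where l: "(lo, ql):F" "lo<=s" and h: "(hi, qh):F" "s<=hi" by auto
 have lom: "t<=lo" if "(t, q):F" "t<=s" for t q
  unfolding lo_def using Max_ge[OF f(1), of t] that by force
 have him: "hi<=t" if "(t, q):F" "s<=t" for t q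
  unfolding hi_def using Min_le[OF f(2), of t] that by force
 have inO: "q:Om" if "(t, q):F" for t q using that assms(6) by force
 have "K ql qh = hi - lo" using iso[OF l(1) h(1)] l h by simp
 then obtain p where p: "p:Om" "K ql p = s - lo" "K p qh = hi - s"
  using between_exists[OF inO[OF l(1)] inO[OF h(1)], of "s - lo"] l h by auto
 show ?thesis
 proof (intro bexI[OF _ p(1)] ballI, clarify)
  fix t q assume q: "(t, q):F"
  note tri = K_triangle[OF inO[OF q] inO[OF l(1)] p(1)] K_triangle[OF inO[OF q] p(1) inO[OF h(1)]]
   K_triangle[OF inO[OF q] inO[OF h(1)] p(1)] K_triangle[OF inO[OF q] p(1) inO[OF l(1)]]
  have sy: "K p ql = s - lo" "K qh p = hi - s" using p K_sym by auto
  show "K q p = abs(s - t)"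
  proof (cases "t<=s")
   case True
   have "t<=lo" using lom[OF q True] .
   thus ?thesis
    by(smt (verit) iso[OF q l(1)] iso[OF q h(1)] l(2) h(2) tri p sy True)
  next
   case False
   hence "hi<=t" using him[OF q] by simp
   hence "K q ql = t - lo" "K q qh = t - hi" using iso[OF q l(1)] iso[OF q h(1)] l(2) h(2) by auto
   thus ?thesis using tri p sy False by linarith
  qed
 qed
qed

text \<open>One more parameter can be added to a partial isometry: each of the conditions on the
 new point defines a compact set, and finitely many of them are compatible because the new point
 may be chosen between the two neighbouring values.\<close>

lemma isometry_extend:
 assumes "a:Om" "(0, a):M" "(L, b):M" "s:{0..L}" "fst ` M <= {0..L}" "snd ` M <= Om"
  and iso: "!!t q t' q'. (t, q):M ==> (t', q'):M ==> K q q' = abs(t - t')"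
 shows "EX p:Om. ALL (t, q):M. K q p = abs(s - t)"
proof -
 let ?S = "{p:Om. K a p <= L}"
 define T where "T = (%(t, q). {p:Om. K a p <= L & K q p = abs(s - t)})"
 have "?S Int \<Inter> (T ` M) ~= {}"
 proof (rule compact_imp_fip)
  show "compact ?S" using compact_K_ball[OF assms(1)] .
  fix X assume "X:T ` M"
  then obtain t q where "(t, q):M" "X = {p:Om. K a p <= L & K q p = abs(s - t)}"
   by(auto simp: T_def)
  moreover have "q:Om" using calculation assms(6) by force
  ultimately show "closed X" using compact_K_sphere[OF assms(1)] compact_imp_closed by blast
 next
  fix F' assume F': "finite F'" "F' <= T ` M"
  then obtain F where F: "finite F" "F<=M" "F' = T ` F" by(meson finite_subset_image)
  let ?F = "insert (0, a) (insert (L, b) F)"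
  have sub: "?F <= M" using F assms by auto
  have "EX p:Om. ALL (t, q):?F. K q p = abs(s - t)"
  proof (rule finite_isometry_extend[of _ a L b])
   show "fst ` ?F <= {0..L}" "snd ` ?F <= Om" using sub assms(5,6) by auto
   show "K q q' = abs(t - t')" if "(t, q) : ?F" "(t', q') : ?F" for t q t' q'
    using iso that sub by blast
  qed (use F assms(4) in simp_all)
  then obtain p where p: "p:Om" "!!t q. (t, q) : ?F ==> K q p = abs(s - t)" by blast
  have "K a p <= L"
   using p(2)[of 0 a] assms(4) by simp
  moreover have "p:T x" if "x:F" for x
   using p(1) p(2)[of "fst x" "snd x"] that `K a p <= L` by(simp add: T_def case_prod_beta)
  ultimately have "p : ?S Int \<Inter> F'" using p(1) F(3) by blast
  thus "?S Int \<Inter> F' ~= {}" by blast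
 qed
 then obtain p where p: "p : ?S" "p : \<Inter> (T ` M)" by blast
 have "K q p = abs(s - t)" if "(t, q):M" for t q
 proof -
  have "p:T (t, q)" using p(2) that by blast
  thus ?thesis by(simp add: T_def)
 qed
 thus ?thesis using p(1) by blast
qed

text \<open>A maximal partial isometry from \<open>[0, K a b]\<close>, given by Zorn's lemma, is
 defined everywhere by \<open>isometry_extend\<close>.\<close>

lemma geo_exists:
 assumes a: "a:Om" and b: "b:Om" obtains g where "geo a b g"
proof -
 define L where "L = K a b"
 have L: "0<=L" using K_nonneg assms by(simp add: L_def)
 define A where "A = {G. G <= {0..L} \<times> Om & (0, a):G & (L, b):G &
   (ALL x:G. ALL y:G. K (snd x) (snd y) = abs(fst x - fst y))}"
 have "{(0, a), (L, b)}:A" using a b L K_sym[of b a] by(auto simp: A_def L_def)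
 moreover have "\<Union> C:A" if "C ~= {}" "subset.chain A C" for C
 proof -
  have C: "C<=A" "!!X Y. X:C ==> Y:C ==> X<=Y | Y<=X"
   using that by(auto simp: subset_chain_def)
  have "K (snd x) (snd y) = abs(fst x - fst y)" if xy: "x : \<Union> C" "y : \<Union> C" for x y
  proof -
   obtain X Y where XY: "X:C" "x:X" "Y:C" "y:Y" using xy by blast
   hence "EX Z:C. x:Z & y:Z" using C(2)[OF XY(1,3)] by blast
   thus ?thesis using C(1) by(auto simp: A_def)
  qed
  moreover have "\<Union> C <= {0..L} \<times> Om" "(0, a) : \<Union> C" "(L, b) : \<Union> C"
   using C(1) that(1) unfolding A_def by auto
  ultimately show ?thesis unfolding A_def by blast
 qed
 ultimately obtain M where M: "M:A" "!!X. X:A ==> M<=X ==> X = M"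
  using subset_Zorn_nonempty[of A] by blast
 have M': "M <= {0..L} \<times> Om" "(0, a):M" "(L, b):M"
  "ALL x:M. ALL y:M. K (snd x) (snd y) = abs(fst x - fst y)"
  using M(1) by(auto simp: A_def)
 have Miso: "K q q' = abs(t - t')" if "(t, q):M" "(t', q'):M" for t q t' q'
  using M'(4)[rule_format, OF that] by simp
 have ex: "EX p. (s, p):M" if s: "s:{0..L}" for s
 proof -
  have "EX p:Om. ALL (t, q):M. K q p = abs(s - t)"
   by(rule isometry_extend[OF a M'(2,3) s _ _ Miso]) (use M'(1) in auto)
  then obtain p where p: "p:Om" "!!t q. (t, q):M ==> K q p = abs(s - t)" by blast
  have "K (snd x) (snd y) = abs(fst x - fst y)" if "x:insert (s, p) M" "y:insert (s, p) M" for x y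
   using that p(1) p(2)[of "fst x" "snd x"] p(2)[of "fst y" "snd y"] K_sym[of p "snd y"] Miso[of "fst x" "snd x" "fst y" "snd y"] by auto
  hence "insert (s, p) M:A" using M' p(1) s unfolding A_def by blast
  thus ?thesis using M(2) by blast
 qed
 define g where "g s = (SOME p. (s, p):M)" for s
 have g: "(s, g s):M" if "s:{0..L}" for s unfolding g_def using someI_ex[OF ex[OF that]] .
 have iso: "K (g s) (g t) = abs(s - t)" if "s:{0..L}" "t:{0..L}" for s t
  using Miso[OF g[OF that(1)] g[OF that(2)]] .
 have inO: "g s:Om" if "s:{0..L}" for s using g[OF that] M'(1) by blast
 have "geo a b g"
  using Miso[OF g[of 0] M'(2)] Miso[OF g[of L] M'(3)] L K_eq_0 inO a b iso by(simp add: geo_def L_def)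
 thus ?thesis using that by blast
qed

end

section \<open>Variation of a curve\<close>

text \<open>With this convention the empty interval contributes nothing, so restricting a division
 to a subinterval needs no case distinction.\<close>

definition osc :: "(real => 'a::metric_space) => real set => real" where
 "osc ga K = (if K = {} then 0 else dist (ga (Inf K)) (ga (Sup K)))"

lemma osc_nonneg: "0 <= osc ga K" by(simp add: osc_def)

lemma variation_sums_alt:
 "variation_sums ga a b = (%d. SUM K:d. osc ga K) ` {d. d division_of {a..b}}"
 unfolding variation_sums_def
proof (rule image_cong[OF HOL.refl])
 fix d assume "d:{d. d division_of {a..b}}"
 thus "(SUM K:d. dist (ga (Inf K)) (ga (Sup K))) = (SUM K:d. osc ga K)"
  by(intro sum.cong) (auto simp: osc_def division_of_def)
qed

lemma variation_sums_nonempty: "variation_sums ga a b ~= {}"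
proof -
 obtain d where "d division_of cbox a b" using elementary_interval[of a b] by blast
 thus ?thesis unfolding variation_sums_alt by auto
qed

lemma division_split_real:
 fixes a t s :: real
 assumes d: "d division_of {a..t}" and s: "a<=s" "s<=t"
 defines "l == %K. K Int {..s}" and "r == %K. K Int {s..}"
 shows "(l ` d - {{}}) division_of {a..s}" "(r ` d - {{}}) division_of {s..t}"
  "(SUM K:d. osc ga (l K)) = (SUM K:l ` d - {{}}. osc ga K)"
  "(SUM K:d. osc ga (r K)) = (SUM K:r ` d - {{}}. osc ga K)"
  "(SUM K:d. osc ga K) <= (SUM K:d. osc ga (l K))+(SUM K:d. osc ga (r K))"
proof -
 have fd: "finite d" using d by blast
 have box: "d division_of cbox a t" using d by simp
 have "{l Int {x. x \<bullet> 1<=s} |l. l:d & l Int {x. x \<bullet> 1<=s} ~= {}} division_of (cbox a t Int {x. x \<bullet> 1<=s})"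
  "{l Int {x. x \<bullet> 1 >= s} |l. l:d & l Int {x. x \<bullet> 1 >= s} ~= {}} division_of (cbox a t Int {x. x \<bullet> 1 >= s})"
  using division_split[OF box, of 1 s] by auto
 moreover have "{l Int {x. x \<bullet> 1<=s} |l. l:d & l Int {x. x \<bullet> 1<=s} ~= {}} = l ` d - {{}}"
  "{l Int {x. x \<bullet> 1 >= s} |l. l:d & l Int {x. x \<bullet> 1 >= s} ~= {}} = r ` d - {{}}"
  by(auto simp: l_def r_def)
 moreover have "cbox a t Int {x. x \<bullet> 1<=s} = {a..s}" "cbox a t Int {x. x \<bullet> 1 >= s} = {s..t}"
  using s by auto
 ultimately show "(l ` d - {{}}) division_of {a..s}" "(r ` d - {{}}) division_of {s..t}" by auto
 have Kint: "EX u v. K = {u..v} & u<=v" if "K:d" for K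
  using division_ofD(3,4)[OF d that] by auto
 have deg: "osc ga (K1 Int X) = 0"
  if K: "K1:d" "K2:d" "K1 ~= K2" "K1 Int X = K2 Int X" and X: "X = {..s} | X = {s..}" for K1 K2 X
 proof -
  obtain u1 v1 u2 v2 where uv: "K1 = {u1..v1}" "u1 <= v1" "K2 = {u2..v2}" "u2 <= v2"
   using Kint[OF K(1)] Kint[OF K(2)] by blast
  have "interior K1 Int interior K2 = {}" using division_ofD(5)[OF d K(1-3)] .
  hence e: "{u1<..<v1} Int {u2<..<v2} = {}" by(simp add: uv)
  obtain p q where pq: "K1 Int X = {p..q}"
   using X by(auto simp: uv) (metis Int_atLeastAtMostR2 Int_atLeastAtMostL2 Int_commute)+
  show ?thesis
  proof (cases "p<q")
   case True
   hence "{p..q} <= {u1..v1}" "{p..q} <= {u2..v2}" using pq K(4) uv by auto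
   hence "(p+q)/2:{u1<..<v1} Int {u2<..<v2}" using True by auto
   thus ?thesis using e by blast
  next
   case False
   hence "K1 Int X = {} | K1 Int X = {p}" unfolding pq by auto
   thus ?thesis by(auto simp: osc_def)
  qed
 qed
 have "sum (osc ga) (l ` d) = (SUM K:d. osc ga (l K))" "sum (osc ga) (r ` d) = (SUM K:d. osc ga (r K))"
  using deg by(subst sum.reindex_nontrivial[OF fd]; simp add: l_def r_def)+
 moreover have "sum (osc ga) (l ` d - {{}}) = sum (osc ga) (l ` d)" "sum (osc ga) (r ` d - {{}}) = sum (osc ga) (r ` d)"
  using fd by(intro sum.mono_neutral_left; auto simp: osc_def)+
 ultimately show "(SUM K:d. osc ga (l K)) = (SUM K:l ` d - {{}}. osc ga K)"
  "(SUM K:d. osc ga (r K)) = (SUM K:r ` d - {{}}. osc ga K)" by auto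
 have "osc ga K <= osc ga (l K) + osc ga (r K)" if "K:d" for K
 proof -
  obtain u v where uv: "K = {u..v}" "u<=v" using Kint[OF `K \<in> d`] by blast
  consider "v<s" | "s<u" | "u<=s" "s<=v" by linarith
  thus ?thesis
  proof cases
   case 1
   hence "l K = K" using uv by(auto simp: l_def)
   thus ?thesis using osc_nonneg[of ga "r K"] by simp
  next
   case 2
   hence "r K = K" using uv by(auto simp: r_def)
   thus ?thesis using osc_nonneg[of ga "l K"] by simp
  next
   case 3
   thus ?thesis
    using uv 3 dist_triangle[of "ga u" "ga v" "ga s"] by(auto simp: l_def r_def osc_def)
  qed
 qed
 hence "(SUM K:d. osc ga K) <= (SUM K:d. osc ga (l K) + osc ga (r K))" by(rule sum_mono)
 thus "(SUM K:d. osc ga K) <= (SUM K:d. osc ga (l K))+(SUM K:d. osc ga (r K))"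
  by(simp add: sum.distrib)
qed

lemma variation_sums_add:
 assumes "x:variation_sums ga a s" "y:variation_sums ga s t" "a<=s" "s<=t"
 shows "EX z:variation_sums ga a t. x+y <= z"
proof -
 obtain d1 d2 where d: "d1 division_of {a..s}" "d2 division_of {s..t}"
  and xy: "x = sum (osc ga) d1" "y = sum (osc ga) d2"
  using assms unfolding variation_sums_alt by auto
 have "interior {a..s} Int interior {s..t} = {}" by auto
 from division_disjoint_union[OF d this] have D: "(d1 Un d2) division_of {a..t}"
  using assms by(simp add: ivl_disj_un)
 have f: "finite d1" "finite d2" using d by auto
 have "osc ga K = 0" if "K:d1 Int d2" for K
 proof -
  have "K <= {a..s}" "K <= {s..t}" using division_ofD(2)[OF d(1)] division_ofD(2)[OF d(2)] that by auto
  hence "K <= {a..s} Int {s..t}" by(rule Int_greatest)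
  also have "... <= {s}" by auto
  finally have "K <= {s}" .
  hence "K = {} | K = {s}" by auto
  thus ?thesis by(auto simp: osc_def)
 qed
 hence "x+y = sum (osc ga) (d1 Un d2)"
  by(smt (verit) sum.union_inter[OF f, of "osc ga"] xy sum.neutral)
 thus ?thesis using D unfolding variation_sums_alt by auto
qed

lemma bdd_variation_sub:
 assumes "bdd_above (variation_sums ga a t)" "a<=s" "s<=t"
 shows "bdd_above (variation_sums ga a s)" "bdd_above (variation_sums ga s t)"
proof -
 obtain M where M: "!!x. x:variation_sums ga a t ==> x<=M" using assms(1) unfolding bdd_above_def by blast
 have nn: "0<=x" if "x:variation_sums ga u v" for x u v
  using that unfolding variation_sums_alt by(auto intro!: sum_nonneg osc_nonneg)
 have "x<=M & y<=M" if "x:variation_sums ga a s" "y:variation_sums ga s t" for x y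
  using variation_sums_add[OF that assms(2,3)] M nn that by fastforce
 thus "bdd_above (variation_sums ga a s)" "bdd_above (variation_sums ga s t)"
  unfolding bdd_above_def using variation_sums_nonempty[of ga a s] variation_sums_nonempty[of ga s t] by blast+
qed

lemma curve_length_add:
 assumes B: "bdd_above (variation_sums ga a t)" and s: "a<=s" "s<=t"
 shows "curve_length ga a t = curve_length ga a s+curve_length ga s t"
proof (rule antisym)
 note B' = bdd_variation_sub[OF B s]
 show "curve_length ga a t <= curve_length ga a s+curve_length ga s t"
  unfolding curve_length_def[of ga a t]
 proof (rule cSup_least[OF variation_sums_nonempty])
  fix x assume "x:variation_sums ga a t"
  then obtain d where d: "d division_of {a..t}" "x = sum (osc ga) d" unfolding variation_sums_alt by auto
  note D = division_split_real[OF d(1) s]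
  have "(SUM K:d. osc ga (K Int {..s})) <= curve_length ga a s"
   unfolding D(3) curve_length_def
   by(rule cSup_upper[OF _ B'(1)]) (use D(1) in "auto simp: variation_sums_alt")
  moreover have "(SUM K:d. osc ga (K Int {s..})) <= curve_length ga s t"
   unfolding D(4) curve_length_def
   by(rule cSup_upper[OF _ B'(2)]) (use D(2) in "auto simp: variation_sums_alt")
  ultimately show "x <= curve_length ga a s+curve_length ga s t" using D(5)[of ga] d(2) by linarith
 qed
 show "curve_length ga a s+curve_length ga s t <= curve_length ga a t"
 proof -
  have "x+y <= curve_length ga a t" if "x:variation_sums ga a s" "y:variation_sums ga s t" for x y
   using variation_sums_add[OF that s] cSup_upper[OF _ B] unfolding curve_length_def by fastforce
  hence "x <= curve_length ga a t - y" if "x:variation_sums ga a s" "y:variation_sums ga s t" for x y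
   using that by(simp add: algebra_simps)
  hence "curve_length ga a s <= curve_length ga a t - y" if "y:variation_sums ga s t" for y
   unfolding curve_length_def[of ga a s] using that by(intro cSup_least[OF variation_sums_nonempty]) auto
  hence "y <= curve_length ga a t - curve_length ga a s" if "y:variation_sums ga s t" for y
   using that by(simp add: algebra_simps)
  hence "curve_length ga s t <= curve_length ga a t - curve_length ga a s"
   unfolding curve_length_def[of ga s t] by(intro cSup_least[OF variation_sums_nonempty]) auto
  thus ?thesis by simp
 qed
qed

lemma curve_length_ge_dist:
 assumes "bdd_above (variation_sums ga s t)" "s<=t"
 shows "dist (ga s) (ga t) <= curve_length ga s t"
 unfolding curve_length_def
proof (rule cSup_upper[OF _ assms(1)])
 have "{{s..t}} division_of {s..t}" using division_of_self[of s t] assms(2) by simp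
 thus "dist (ga s) (ga t):variation_sums ga s t"
  unfolding variation_sums_alt by(intro image_eqI[of _ _ "{{s..t}}"]) (use assms(2) in "auto simp: osc_def")
qed

lemma curve_length_trivial: "t<=a ==> curve_length ga a t = 0"
proof -
 assume t: "t<=a"
 have "variation_sums ga a t <= {0}"
 proof
  fix x assume "x:variation_sums ga a t"
  then obtain d where d: "d division_of {a..t}" "x = sum (osc ga) d" unfolding variation_sums_alt by auto
  have "osc ga K = 0" if "K:d" for K
  proof -
   have "K <= {a}" using division_ofD(2)[OF d(1) that] t by auto
   hence "K = {} | K = {a}" by auto
   thus ?thesis by(auto simp: osc_def)
  qed
  thus "x:{0}" using d by simp
 qed
 hence "variation_sums ga a t = {0}" using variation_sums_nonempty[of ga a t] by blast
 thus ?thesis by(simp add: curve_length_def)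
qed

lemma curve_length_nonneg: "bdd_above (variation_sums ga s t) ==> 0 <= curve_length ga s t"
 by(cases "s<=t") (metis curve_length_ge_dist order_trans zero_le_dist, simp add: curve_length_trivial)

definition length_fun :: "(real => 'a::metric_space) => real => real" where
 "length_fun ga t = curve_length ga 0 (min t 1)"

context
 fixes ga :: "real => 'a::metric_space"
 assumes rect: "rectifiable ga"
begin

lemma length_bdd: "0<=s ==> s<=t ==> t<=1 ==> bdd_above (variation_sums ga s t)"
 using rect bdd_variation_sub[of ga 0 1 t] bdd_variation_sub[of ga 0 t s] by(simp add: rectifiable_def)

lemma length_fun_diff:
 assumes "0<=s" "s<=t" "t<=1"
 shows "length_fun ga t - length_fun ga s = curve_length ga s t"
 using curve_length_add[OF length_bdd[of 0 t] assms(1,2)] assms by(simp add: length_fun_def)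

lemma length_fun_neg: "t<=0 ==> length_fun ga t = 0"
 by(simp add: length_fun_def curve_length_trivial)

lemma length_fun_mono: "s<=t ==> length_fun ga s <= length_fun ga t"
proof -
 have *: "length_fun ga s <= length_fun ga t" if "0<=s" "s<=t" "t<=1" for s t
  using length_fun_diff[OF that] curve_length_nonneg[OF length_bdd[OF that]] by simp
 have eq: "length_fun ga x = length_fun ga (max 0 (min x 1))" for x
  by(auto simp: length_fun_def max_def curve_length_trivial)
 assume "s<=t"
 thus ?thesis using *[of "max 0 (min s 1)" "max 0 (min t 1)"] eq[of s] eq[of t] by auto
qed

text \<open>A division of the remaining interval whose sum is almost the length can be refined
 next to \<open>s\<close>; its first piece is short by continuity of the curve, so the length
 just after \<open>s\<close> is small.\<close>

lemma length_fun_right_cont: "continuous (at_right s) (length_fun ga)"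
proof -
 have cont: "continuous_on {0..1} ga" using rect by(simp add: rectifiable_def path_def)
 consider "s<0" | "1<=s" | "0<=s" "s<1" by linarith
 thus ?thesis
 proof cases
  case 1
  have "\<forall>\<^sub>F x in at_right s. length_fun ga x = length_fun ga s"
   using 1 by(intro eventually_at_rightI[of s 0]) (auto simp: length_fun_neg)
  thus ?thesis unfolding continuous_within by(rule tendsto_eventually)
 next
  case 2
  have "\<forall>\<^sub>F x in at_right s. length_fun ga x = length_fun ga s"
   using 2 by(intro eventually_at_rightI[of s "s+1"]) (auto simp: length_fun_def)
  thus ?thesis unfolding continuous_within by(rule tendsto_eventually)
 next
  case 3
  show ?thesis unfolding continuous_within
  proof (rule order_tendstoI)
   fix a assume "a < length_fun ga s"
   thus "\<forall>\<^sub>F x in at_right s. a < length_fun ga x"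
    by(intro eventually_at_rightI[of s "s+1"]) (auto intro: less_le_trans[OF _ length_fun_mono])
  next
   fix a assume a: "length_fun ga s < a"
   define e where "e = a - length_fun ga s"
   have e: "e > 0" using a by(simp add: e_def)
   have "EX x:variation_sums ga s 1. curve_length ga s 1 - e/2 < x"
   proof (rule less_cSup_iff[THEN iffD1])
    show "curve_length ga s 1 - e/2 < Sup (variation_sums ga s 1)" using e by(simp add: curve_length_def)
   qed (use variation_sums_nonempty length_bdd[of s 1] 3 in auto)
   then obtain d where d: "d division_of {s..1}" "curve_length ga s 1 - e/2 < sum (osc ga) d"
    unfolding variation_sums_alt by auto
   define e' where "e' = e/(4*(real (card d)+1))"
   have e': "e' > 0" using e by(simp add: e'_def)
   obtain eta where eta: "eta > 0" "!!t. t:{0..1} ==> dist t s < eta ==> dist (ga t) (ga s) < e'"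
    using cont e' 3 unfolding continuous_on_iff by(metis atLeastAtMost_iff less_eq_real_def)
   have "length_fun ga t < a" if t: "s<t" "t < min 1 (s+eta)" for t
   proof -
    have st: "s<=t" "t<=1" using t by auto
    note D = division_split_real[OF d(1) st]
    have near: "dist (ga x) (ga s) < e'" if "x:{s..t}" for x
     using eta(2)[of x] that t 3 by(simp add: dist_real_def)
    have "osc ga (K Int {..t}) <= 2*e'" if K: "K:d" for K
    proof (cases "K Int {..t} = {}")
     case False
     have "Inf (K Int {..t}):{s..t}" "Sup (K Int {..t}):{s..t}"
      using division_ofD(4)[OF d(1) K] False division_ofD(2)[OF d(1) K] by auto
     from near[OF this(1)] near[OF this(2)] show ?thesis
      using dist_triangle2[of "ga (Inf (K Int {..t}))" "ga (Sup (K Int {..t}))" "ga s"] False by(simp add: osc_def)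
    qed (use e' in "simp add: osc_def")
    hence "(SUM K:d. osc ga (K Int {..t})) <= real (card d)*(2*e')" by(rule sum_bounded_above)
    also have "... <= e/2" using e by(simp add: e'_def field_simps)
    finally have "(SUM K:d. osc ga (K Int {..t})) <= e/2" .
    moreover have "(SUM K:d. osc ga (K Int {t..})) <= curve_length ga t 1"
     unfolding D(4) curve_length_def
     by(rule cSup_upper[OF _ length_bdd]) (use D(2) 3 st in "auto simp: variation_sums_alt")
    ultimately have "curve_length ga s 1 < curve_length ga t 1+e" using D(5)[of ga] d(2) by linarith
    moreover have "length_fun ga t - length_fun ga s = curve_length ga s 1 - curve_length ga t 1"
     using length_fun_diff[of s 1] length_fun_diff[of t 1] 3 st by simp
    ultimately show ?thesis unfolding e_def by simp
   qed
   thus "\<forall>\<^sub>F x in at_right s. length_fun ga x < a"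
    by(intro eventually_at_rightI[of s "min 1 (s+eta)"]) (use 3 eta in auto)
  qed
 qed
qed

end

section \<open>Arc length integrals\<close>

context
 fixes ga :: "real => 'a::metric_space" and F :: "real => real"
 assumes rect: "rectifiable ga" and contF: "continuous_on {0..1} F"
begin

abbreviation "mu == interval_measure (length_fun ga)"

lemma emeasure_length: "s<=t ==> emeasure mu {s<..t} = ennreal (length_fun ga t - length_fun ga s)"
 by(rule emeasure_interval_measure_Ioc) (use length_fun_mono[OF rect] length_fun_right_cont[OF rect] in auto)

lemma measure_length: "s<=t ==> measure mu {s<..t} = length_fun ga t - length_fun ga s"
 by(rule measure_interval_measure_Ioc) (use length_fun_mono[OF rect] length_fun_right_cont[OF rect] in auto)

lemma measurable_F: "set_borel_measurable mu {0..1} F"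
 using borel_measurable_continuous_on_indicator[OF _ contF] by(simp add: set_borel_measurable_def)

lemma integrable_F: 
 assumes "A:sets borel" "A <= {0..1}"
 shows "set_integrable mu A F"
proof (rule set_integrable_subset[of _ "{0..1}"])
 have "bounded (F ` {0..1})" by(intro compact_imp_bounded compact_continuous_image contF) auto
 then obtain B where B: "!!x. x:{0..1} ==> abs(F x) <= B" unfolding bounded_iff by(metis image_eqI real_norm_def)
 have "emeasure mu {0..1} <= emeasure mu {-1<..1}" by(rule emeasure_mono) auto
 hence fin: "emeasure mu {0..1} < \<infinity>" using emeasure_length[of "-1" 1] by(simp add: le_less_trans)
 show "set_integrable mu {0..1} F"
  unfolding set_integrable_def
 proof (rule integrableI_bounded_set[where A = "{0..1}" and B = B])
  show "(%x. indicat_real {0..1} x *\<^sub>R F x):borel_measurable mu"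
   using measurable_F by(simp add: set_borel_measurable_def)
  show "AE x\<in>{0..1} in mu. norm (indicat_real {0..1} x *\<^sub>R F x) <= B" using B by simp
 qed (use fin in auto)
qed (use assms in auto)

lemma integral_F_closed: "(LINT t:{0..1}|mu. F t) = (LINT t:{0<..1}|mu. F t)"
proof (rule set_integral_cong_set)
 have "emeasure mu {0} <= emeasure mu {-1<..0}" by(rule emeasure_mono) auto
 also have "... = 0" using emeasure_length[of "-1" 0] by(simp add: length_fun_neg[OF rect])
 finally have "emeasure mu {0} = 0" by simp
 hence "AE x in mu. x ~= 0" by(subst AE_iff_measurable[of "{0}"]) auto
 thus "AE x in mu. (x:{0<..1}) = (x:{0..1})" by auto
 show "set_borel_measurable mu {0..1} F" by(rule measurable_F)
 have "(%x. indicat_real {0<..1} x *\<^sub>R F x):borel_measurable borel"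
  by(rule borel_measurable_continuous_on_indicator[OF _ continuous_on_subset[OF contF]]) auto
 thus "set_borel_measurable mu {0<..1} F" by(simp add: set_borel_measurable_def)
qed

text \<open>On a short interval the integrand is almost constant, and the measure of the interval
 is the length of the curve over it. These bounds replace a theory of Stieltjes
 integrals.\<close>

lemma integral_F_piece:
 assumes "0<=s" "s<=t" "t<=1"
 shows "(!!x. x:{s<..t} ==> m <= F x) ==> m*(length_fun ga t - length_fun ga s) <= (LINT t:{s<..t}|mu. F t)"
  and "(!!x. x:{s<..t} ==> F x <= m) ==> (LINT t:{s<..t}|mu. F t) <= m*(length_fun ga t - length_fun ga s)"
proof -
 have i: "set_integrable mu {s<..t} F" using assms by(intro integrable_F) auto
 have c: "set_integrable mu {s<..t} (%_. m)"
  unfolding set_integrable_def using emeasure_length[of s t] assms(2) by simp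
 have e: "(LINT t:{s<..t}|mu. m) = m*(length_fun ga t - length_fun ga s)"
  unfolding set_lebesgue_integral_def using measure_length[OF assms(2)] by simp
 show "(!!x. x:{s<..t} ==> m <= F x) ==> m*(length_fun ga t - length_fun ga s) <= (LINT t:{s<..t}|mu. F t)"
  using set_integral_mono[OF c i] e by simp
 show "(!!x. x:{s<..t} ==> F x <= m) ==> (LINT t:{s<..t}|mu. F t) <= m*(length_fun ga t - length_fun ga s)"
  using set_integral_mono[OF i c] e by simp
qed

lemma integral_F_split:
 "k<=N ==> 0<N ==> (LINT t:{0<..real k/real N}|mu. F t) = (SUM i<k. LINT t:{real i/real N<..real (Suc i)/real N}|mu. F t)"
proof (induction k)
 case 0
 thus ?case by(simp add: set_lebesgue_integral_def)
next
 case (Suc k)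
 have "{0<..real (Suc k)/real N} = {0<..real k/real N} Un {real k/real N<..real (Suc k)/real N}"
  using ivl_disj_un_two(6)[of 0 "real k/real N" "real (Suc k)/real N"] by(simp add: divide_right_mono)
 moreover have "(LINT t:{0<..real k/real N} Un {real k/real N<..real (Suc k)/real N}|mu. F t) =
  (LINT t:{0<..real k/real N}|mu. F t)+(LINT t:{real k/real N<..real (Suc k)/real N}|mu. F t)"
 proof (rule set_integral_Un)
  have k: "real k/real N <= 1" "real (Suc k)/real N <= 1" "0 <= real k/real N" using Suc.prems by auto
  hence "{0<..real k/real N} <= {0..1}" by auto
  moreover have "{real k/real N<..real (Suc k)/real N} <= {0..1}"
   using k by(intro subsetI) (simp only: greaterThanAtMost_iff atLeastAtMost_iff, linarith)
  ultimately show "set_integrable mu {0<..real k/real N} F" "set_integrable mu {real k/real N<..real (Suc k)/real N} F"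
   by(intro integrable_F; simp)+
 qed auto
 ultimately show ?case using Suc by simp
qed

lemma integral_F_sum:
 "0<N ==> (LINT t:{0..1}|mu. F t) = (SUM i<N. LINT t:{real i/real N<..real (Suc i)/real N}|mu. F t)"
 using integral_F_split[of N N] integral_F_closed by simp

end

context proper_domain begin

lemma qh_length_alt:
 "qh_length Om ga = (LINT t:{0..1}|interval_measure (length_fun ga). 1/bd (ga t))"
 unfolding qh_length_def arclength_integral_def bd_def length_fun_def ..

lemma continuous_inv_bd:
 assumes "rectifiable ga" "path_image ga <= Om"
 shows "continuous_on {0..1} (%t. 1/bd (ga t))"
proof -
 have c: "continuous_on {0..1} ga" using assms by(simp add: rectifiable_def path_def)
 have "continuous_on {0..1} (%t. bd (ga t))"
  by(rule continuous_on_compose2[OF continuous_bd[of UNIV] c]) auto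
 thus ?thesis
  by(rule continuous_on_divide[OF continuous_on_const]) (use assms bd_pos in "auto simp: path_image_def", metis image_subset_iff atLeastAtMost_iff order_less_irrefl)
qed

text \<open>Divide the parameter interval so finely that \<open>d\<close> is almost constant along
 each piece. The segments between consecutive points form a chain whose cost is at most the
 integral up to a factor close to one.\<close>

lemma qh_length_ge_K:
 assumes "ga:rectifiable_curves Om x y"
 shows "K x y <= qh_length Om ga"
proof -
 have r: "rectifiable ga" "path_image ga <= Om" "ga 0 = x" "ga 1 = y"
  using assms by(auto simp: rectifiable_curves_def pathstart_def pathfinish_def)
 note cF = continuous_inv_bd[OF r(1,2)]
 have c: "continuous_on {0..1} ga" using r by(simp add: rectifiable_def path_def)
 have inOm: "ga t:Om" if "t:{0..1}" for t using r(2) that by(auto simp: path_image_def)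
 have "compact ((%t. bd (ga t)) ` {0..1})"
  by(intro compact_continuous_image continuous_on_compose2[OF continuous_bd[of UNIV] c]) auto
 then obtain t0 where t0: "t0:{0..1}" "!!t. t:{0..1} ==> bd (ga t0) <= bd (ga t)"
  using compact_attains_inf[of "(%t. bd (ga t)) ` {0..1}"] by auto
 define be where "be = bd (ga t0)"
 have be: "0<be" "!!t. t:{0..1} ==> be <= bd (ga t)" using t0 bd_pos inOm by(auto simp: be_def)
 define I where "I = qh_length Om ga"
 have main: "K x y <= (be+eta)/(be - eta)*I" if eta: "0<eta" "eta<be" for eta
 proof -
  have "uniformly_continuous_on {0..1} ga" using c compact_uniformly_continuous by blast
  then obtain delta where delta: "delta > 0" "!!s t. s:{0..1} ==> t:{0..1} ==> dist t s < delta ==> dist (ga t) (ga s) < eta"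
   unfolding uniformly_continuous_on_def using eta(1) by metis
  obtain N where N: "0<N" "1/real N < delta" using delta(1) by(metis nat_approx_posE zero_less_Suc)
  define p where "p i = ga (real i/real N)" for i
  have in01: "real i/real N:{0..1}" if "i<=N" for i using that N by auto
  have p: "p i:Om" if "i<=N" for i unfolding p_def using inOm[OF in01[OF that]] .
  have step: "K (p i) (p (Suc i)) <= (be+eta)/(be - eta)*(LINT t:{real i/real N<..real (Suc i)/real N}|interval_measure (length_fun ga). 1/bd (ga t))"
   if i: "i<N" for i
  proof -
   define J where "J = (LINT t:{real i/real N<..real (Suc i)/real N}|interval_measure (length_fun ga). 1/bd (ga t))"
   have i1: "real i/real N:{0..1}" "real (Suc i)/real N:{0..1}" using i by auto
   have ii: "real i/real N <= real (Suc i)/real N" by(simp add: divide_right_mono)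
   have near: "dist (ga t) (p i) < eta" if "t:{real i/real N..real (Suc i)/real N}" for t
    unfolding p_def
   proof (rule delta(2))
    have "dist t (real i/real N) <= real (Suc i)/real N - real i/real N" using that by(simp add: dist_real_def)
    also have "... = 1/real N" using N by(simp add: field_simps)
    finally show "dist t (real i/real N) < delta" using N by simp
    show "t:{0..1}" using that i1 unfolding atLeastAtMost_iff by linarith
   qed (use i1 in auto)
   have b: "be <= bd (p i)" unfolding p_def using be(2)[OF i1(1)] .
   define D where "D = dist (p i) (p (Suc i))"
   have D: "0<=D" "D<eta" using near[of "real (Suc i)/real N"] ii by(auto simp: D_def p_def dist_commute)
   have "1/(bd (p i)+eta)*(length_fun ga (real (Suc i)/real N) - length_fun ga (real i/real N)) <= J"
    unfolding J_def
   proof (rule integral_F_piece(1)[OF r(1) cF])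
    fix t assume t: "t:{real i/real N<..real (Suc i)/real N}"
    hence "t:{0..1}" using i1 unfolding atLeastAtMost_iff greaterThanAtMost_iff by linarith
    hence "0 < bd (ga t)" using bd_pos inOm by blast
    moreover have "bd (ga t) <= bd (p i)+eta" using bd_le[of "ga t" "p i"] near[of t] t by(auto simp: dist_commute)
    ultimately show "1/(bd (p i)+eta) <= 1/bd (ga t)" by(intro divide_left_mono) auto
   qed (use i1 ii in auto)
   moreover have "D <= length_fun ga (real (Suc i)/real N) - length_fun ga (real i/real N)"
    unfolding D_def p_def using i1 ii
    by(subst length_fun_diff[OF r(1)]) (auto intro!: curve_length_ge_dist length_bdd[OF r(1)])
   ultimately have 1: "1/(bd (p i)+eta)*D <= J"
    using b be eta by(smt (verit) mult_left_mono divide_nonneg_pos)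
   have "K (p i) (p (Suc i)) <= D/(bd (p i) - D)"
    unfolding D_def using b D eta i by(intro K_le_near p) (auto simp: D_def)
   also have "... <= D/(bd (p i) - eta)" using D b eta by(intro divide_left_mono) auto
   also have "... = ((bd (p i)+eta)/(bd (p i) - eta))*(1/(bd (p i)+eta)*D)" using b eta by simp
   also have "... <= ((be+eta)/(be - eta))*(1/(bd (p i)+eta)*D)"
   proof (rule mult_right_mono)
    show "(bd (p i)+eta)/(bd (p i) - eta) <= (be+eta)/(be - eta)" using b eta
     by(simp add: divide_simps) (simp add: algebra_simps)
   qed (use D b eta in auto)
   also have "... <= ((be+eta)/(be - eta))*J" using 1 eta by(intro mult_left_mono) auto
   finally show ?thesis unfolding J_def .
  qed
  have chain: "K (p 0) (p k) <= (SUM i<k. K (p i) (p (Suc i)))" if "k<=N" for k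
   using that
  proof (induction k)
   case 0
   thus ?case using p[of 0] by simp
  next
   case (Suc k)
   thus ?case using K_triangle[OF p p p, of 0 k "Suc k"] by simp
  qed
  have "K x y = K (p 0) (p N)" using r N by(simp add: p_def)
  also have "... <= (SUM i<N. K (p i) (p (Suc i)))" using chain by simp
  also have "... <= (SUM i<N. (be+eta)/(be - eta)*(LINT t:{real i/real N<..real (Suc i)/real N}|interval_measure (length_fun ga). 1/bd (ga t)))"
   by(rule sum_mono) (use step in auto)
  also have "... = (be+eta)/(be - eta)*I"
   unfolding I_def qh_length_alt integral_F_sum[OF r(1) cF N(1)] by(simp add: sum_distrib_left)
  finally show ?thesis .
 qed
 have "((%eta. (be+eta)/(be - eta)*I) \<longlongrightarrow> (be+0)/(be - 0)*I) (at_right 0)"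
  using be by(intro tendsto_intros) auto
 moreover have "\<forall>\<^sub>F eta in at_right 0. K x y <= (be+eta)/(be - eta)*I"
  using main be by(intro eventually_at_rightI[of 0 be]) auto
 ultimately show ?thesis using tendsto_lowerbound[of _ _ "at_right (0::real)" "K x y"] be by(simp add: I_def)
qed

end

section \<open>Geodesics as rectifiable curves\<close>

lemma variation_sums_lipschitz:
 assumes "!!u v. s<=u ==> u<=v ==> v<=t ==> dist (ga u) (ga v) <= c*(v - u)"
  and "x:variation_sums ga s t" "s<=t"
 shows "x <= c*(t - s)"
proof -
 obtain d where d: "d division_of {s..t}" "x = sum (osc ga) d" using assms(2) unfolding variation_sums_alt by auto
 have "osc ga K <= c*measure lborel K" if K: "K:d" for K
 proof -
  obtain u v where uv: "K = {u..v}" "u<=v"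
   using division_ofD(3,4)[OF d(1) K] by auto
  thus ?thesis
   using division_ofD(2)[OF d(1) K] assms(1)[of u v] uv by(simp add: osc_def content_real)
 qed
 hence "x <= (SUM K:d. c*measure lborel K)" unfolding d(2) by(rule sum_mono)
 also have "... = c*measure lborel {s..t}"
  using additive_content_division[of d s t] d(1) by(simp add: sum_distrib_left[symmetric])
 finally show ?thesis using assms(3) by(simp add: content_real)
qed

lemma exp_minus_one_le: "0<=z ==> exp z - 1 <= z*exp (z::real)"
 using exp_ge_add_one_self[of "-z"] by(simp add: exp_minus field_simps)

context proper_domain begin

lemma geo_in: "geo a b g ==> 0<=s ==> s <= K a b ==> g s:Om" by(simp add: geo_def)
lemma geo_K: "geo a b g ==> 0<=s ==> s <= K a b ==> 0<=t ==> t <= K a b ==> K (g s) (g t) = abs(s - t)"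
 by(simp add: geo_def)
lemma geo_ends: "geo a b g ==> g 0 = a" "geo a b g ==> g (K a b) = b" by(auto simp: geo_def)

text \<open>A geodesic of \<open>K\<close> is locally Lipschitz with constant about
 \<open>d\<close> in the Euclidean metric, so the integral of \<open>1/d\<close> over a short
 piece is at most the change of the parameter up to a factor close to one.\<close>

lemma geo_curve:
 assumes ab: "a:Om" "b:Om" and g: "geo a b g"
 defines "ga == %t. g (K a b*t)"
 shows "ga:rectifiable_curves Om a b" "qh_length Om ga <= K a b" "path_image ga = g ` {0..K a b}"
proof -
 define L where "L = K a b"
 have L: "0<=L" using K_nonneg ab by(simp add: L_def)
 have Lt: "0 <= L*t" "L*t <= L" if "t:{0..1}" for t
  using that L by(auto simp: mult_left_le)
 have inOm: "ga t:Om" if "t:{0..1}" for t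
  using geo_in[OF g] Lt[OF that] by(simp add: ga_def L_def)
 have KK: "K (ga s) (ga t) = L*abs(s - t)" if "s:{0..1}" "t:{0..1}" for s t
  using geo_K[OF g, of "L * s" "L*t"] Lt[OF that(1)] Lt[OF that(2)] by(simp add: ga_def L_def abs_mult right_diff_distrib[symmetric])
 have d1: "dist (ga u) (ga v) <= L*exp (L*h)*bd (ga u)*(v - u)"
  if "u:{0..1}" "v:{0..1}" "u<=v" "v - u <= h" for u v h
 proof -
  have "dist (ga u) (ga v) <= (exp (L*(v - u)) - 1)*bd (ga u)"
   using dist_le_K[OF inOm[OF that(1)] inOm[OF that(2)]] KK[OF that(1,2)] that(3) by simp
  also have "exp (L*(v - u)) - 1 <= L*(v - u)*exp (L*(v - u))"
   using L that by(intro exp_minus_one_le) auto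
  also have "... <= L*(v - u)*exp (L*h)" using L that by(intro mult_left_mono) (auto intro!: mult_left_mono)
  finally show ?thesis using bd_nonneg[of "ga u"] by(simp add: mult_ac mult_right_mono)
 qed
 have d2: "bd (ga u) <= exp (L*h)*bd (ga w)" if "u:{0..1}" "w:{0..1}" "abs(u - w) <= h" for u w h
 proof -
  have "bd (ga u) <= exp (K (ga w) (ga u))*bd (ga w)" using bd_le_K inOm that by blast
  also have "... <= exp (L*h)*bd (ga w)"
   using KK[OF that(2,1)] that L bd_nonneg by(intro mult_right_mono) (auto intro!: mult_left_mono simp: abs_minus_commute)
  finally show ?thesis .
 qed
 have lip: "dist (ga u) (ga v) <= L*exp (L*h)*(exp (L*h)*bd (ga w))*(v - u)"
  if "w:{0..1}" "u:{0..1}" "v:{0..1}" "u<=v" "v - u <= h" "abs(u - w) <= h" for u v w h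
  using d1[OF that(2-5)] d2[OF that(2,1,6)] L that(4)
  by(elim order_trans) (intro mult_right_mono mult_left_mono; simp)
 define C where "C = L*exp L*(exp L*bd a)"
 have a: "ga 0 = a" "ga 1 = b" using geo_ends[OF g] by(simp_all add: ga_def)
 have lip1: "dist (ga u) (ga v) <= C*(v - u)" if "0<=u" "u<=v" "v<=1" for u v
  using lip[of 0 u v 1] that by(simp add: C_def a)
 have "C-lipschitz_on {0..1} ga"
 proof (rule lipschitz_onI)
  fix x y :: real assume xy: "x:{0..1}" "y:{0..1}"
  show "dist (ga x) (ga y) <= C*dist x y"
  proof (cases "x<=y")
   case True
   thus ?thesis using lip1[of x y] xy by(simp add: dist_real_def)
  next
   case False
   thus ?thesis using lip1[of y x] xy by(simp add: dist_real_def dist_commute)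
  qed
 qed (use L bd_nonneg[of a] in "simp add: C_def")
 hence "continuous_on {0..1} ga" by(rule lipschitz_on_continuous_on)
 moreover have "bdd_above (variation_sums ga 0 1)"
  by(rule bdd_aboveI[of _ "C*(1 - 0)"]) (rule variation_sums_lipschitz[of 0 1 ga C], use lip1 in auto)
 ultimately have rect: "rectifiable ga" by(simp add: rectifiable_def path_def)
 show "path_image ga = g ` {0..K a b}"
 proof -
  have "(%t. L*t) ` {0..1} = {0..L}" using L image_mult_atLeastAtMost[of L 0 1] by(cases "L = 0") (auto simp: image_constant_conv)
  thus ?thesis unfolding path_image_def ga_def L_def by(metis image_image)
 qed
 have pim: "path_image ga <= Om" using inOm by(auto simp: path_image_def)
 show "ga:rectifiable_curves Om a b"
  using rect pim a by(auto simp: rectifiable_curves_def pathstart_def pathfinish_def)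
 note cF = continuous_inv_bd[OF rect pim]
 have main: "qh_length Om ga <= L*exp (3*L*inverse (real (Suc m)))" for m
 proof -
  define N where "N = Suc m"
  have N: "0<N" by(simp add: N_def)
  define h where "h = 1/real N"
  have "(LINT t:{real i/real N<..real (Suc i)/real N}|interval_measure (length_fun ga). 1/bd (ga t))
    <= (L*exp (3*L*h))*h" if i: "i<N" for i
  proof -
   let ?s = "real i/real N" and ?t = "real (Suc i)/real N"
   have st: "?s:{0..1}" "?t:{0..1}" "?s <= ?t" "?t - ?s = h"
    using i by(auto simp: h_def field_simps)
   have sub: "u:{0..1}" "abs(u - ?s) <= h" "abs(?s - u) <= h" if "?s <= u" "u <= ?t" for u
   proof -
    have "0<=u" "u<=1" using st(1,2) that unfolding atLeastAtMost_iff by linarith+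
    thus "u:{0..1}" by simp
    show "abs(u - ?s) <= h" "abs(?s - u) <= h" using st(4) that by auto
   qed
   define B where "B = bd (ga ?s)"
   have B: "0<B" using bd_pos inOm[OF st(1)] by(simp add: B_def)
   have "length_fun ga ?t - length_fun ga ?s = curve_length ga ?s ?t"
    using length_fun_diff[OF rect] st by auto
   also have "... <= L*exp (L*h)*(exp (L*h)*B)*(?t - ?s)"
    unfolding curve_length_def
   proof (rule cSup_least[OF variation_sums_nonempty])
    fix x assume x: "x:variation_sums ga ?s ?t"
    show "x <= L*exp (L*h)*(exp (L*h)*B)*(?t - ?s)"
    proof (rule variation_sums_lipschitz[OF _ x st(3)])
     fix u v assume uv: "?s <= u" "u<=v" "v <= ?t"
     have "v - u <= h" using st(4) uv by simp
     moreover have "u <= ?t" "?s <= v" using uv by auto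
     ultimately show "dist (ga u) (ga v) <= L*exp (L*h)*(exp (L*h)*B)*(v - u)"
      unfolding B_def using lip[OF st(1), of u v h] sub uv by blast
    qed
   qed
   finally have V: "length_fun ga ?t - length_fun ga ?s <= L*exp (L*h)*(exp (L*h)*B)*h"
    using st(4) by simp
   have "(LINT t:{?s<..?t}|interval_measure (length_fun ga). 1/bd (ga t)) <= exp (L*h)/B*(length_fun ga ?t - length_fun ga ?s)"
   proof (rule integral_F_piece(2)[OF rect cF])
    fix x assume x: "x:{?s<..?t}"
    hence x': "x:{0..1}" "abs(?s - x) <= h" using sub by auto
    have "B <= exp (L*h)*bd (ga x)" unfolding B_def using d2[OF st(1) x'] .
    moreover have "0 < bd (ga x)" using bd_pos inOm x' by blast
    ultimately show "1/bd (ga x) <= exp (L*h)/B" using B by(simp add: field_simps)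
   qed (use st in auto)
   also have "... <= exp (L*h)/B*(L*exp (L*h)*(exp (L*h)*B)*h)"
    using V B by(intro mult_left_mono) auto
   also have "... = L*(exp (L*h)*exp (L*h)*exp (L*h))*h" using B by simp
   also have "exp (L*h)*exp (L*h)*exp (L*h) = exp (3*L*h)"
    by(simp add: exp_add[symmetric])
   finally show ?thesis .
  qed
  hence "qh_length Om ga <= (SUM i<N. (L*exp (3*L*h))*h)"
   unfolding qh_length_alt integral_F_sum[OF rect cF N] by(intro sum_mono) auto
  also have "... = L*exp (3*L*h)" using N by(simp add: h_def)
  finally show ?thesis by(simp add: h_def N_def inverse_eq_divide)
 qed
 have "(%m. L*exp (3*L*inverse (real (Suc m)))) \<longlonglongrightarrow> L*exp (3*L*0)"
  by(intro tendsto_intros LIMSEQ_inverse_real_of_nat)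
 thus "qh_length Om ga <= K a b"
  using LIMSEQ_le_const[of _ L "qh_length Om ga"] main by(simp add: L_def)
qed

lemma qh_dist_eq_K:
 assumes "a:Om" "b:Om" shows "qh_dist Om a b = K a b"
proof (rule antisym)
 obtain g where g: "geo a b g" using geo_exists[OF assms] .
 have "bdd_below (qh_length Om ` rectifiable_curves Om a b)"
  by(rule bdd_belowI[of _ "K a b"]) (use qh_length_ge_K in auto)
 hence "qh_dist Om a b <= qh_length Om (%t. g (K a b*t))"
  unfolding qh_dist_def by(rule cINF_lower) (rule geo_curve[OF assms g])
 thus "qh_dist Om a b <= K a b" using geo_curve(2)[OF assms g] by simp
 show "K a b <= qh_dist Om a b"
  unfolding qh_dist_def by(rule cINF_greatest) (use geo_curve(1)[OF assms g] qh_length_ge_K in auto)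
qed

lemma geo_qh_geodesic:
 assumes "a:Om" "b:Om" "geo a b g" shows "qh_geodesic Om a b (%t. g (K a b*t))"
 using geo_curve[OF assms] qh_length_ge_K[OF geo_curve(1)[OF assms]] qh_dist_eq_K[OF assms(1,2)]
 by(simp add: qh_geodesic_def)

text \<open>Hyperbolicity refers to curves that minimise the integral of \<open>1/d\<close>; after
 reparametrisation the geodesics of \<open>K\<close> are such curves.\<close>

lemma thin_triangle:
 assumes hyp: "gromov_hyperbolic delta Om" and abc: "a:Om" "b:Om" "c:Om"
  and g: "geo a b g1" "geo b c g2" "geo c a g3" and s: "0<=s" "s <= K a b"
 shows "(EX t:{0..K b c}. K (g2 t) (g1 s) <= delta) | (EX t:{0..K c a}. K (g3 t) (g1 s) <= delta)"
proof -
 note q = geo_qh_geodesic[OF abc(1,2) g(1)] geo_qh_geodesic[OF abc(2,3) g(2)] geo_qh_geodesic[OF abc(3,1) g(3)]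
 note pi = geo_curve(3)[OF abc(1,2) g(1)] geo_curve(3)[OF abc(2,3) g(2)] geo_curve(3)[OF abc(3,1) g(3)]
 have "ALL w:g1 ` {0..K a b}. {u:Om. qh_dist Om u w <= delta} Int (g2 ` {0..K b c} Un g3 ` {0..K c a}) ~= {}"
  using hyp[unfolded gromov_hyperbolic_def Let_def, rule_format, OF abc conjI[OF q(1) conjI[OF q(2,3)]]]
  unfolding pi by blast
 hence "{u:Om. qh_dist Om u (g1 s) <= delta} Int (g2 ` {0..K b c} Un g3 ` {0..K c a}) ~= {}" using s by auto
 then obtain u where u: "u:Om" "qh_dist Om u (g1 s) <= delta" "u:g2 ` {0..K b c} Un g3 ` {0..K c a}" by blast
 show ?thesis
  using u(2) qh_dist_eq_K[OF u(1) geo_in[OF g(1) s]] u(3) by auto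
qed

end

section \<open>Separated sets, chain sums and running maxima\<close>

text \<open>The balls of radius \<open>eta/2\<close> around the points are disjoint and lie in
 a ball of radius \<open>X + eta/2\<close>: compare volumes.\<close>

lemma card_separated_le:
 fixes V :: "'a::euclidean_space set"
 assumes "finite V" "V <= cball c X" "0<eta" "0<=X"
  and sep: "!!v v'. v:V ==> v':V ==> v ~= v' ==> eta <= dist v v'"
 shows "real (card V) <= (1+2*X/eta)^DIM('a)"
proof -
 let ?B = "measure lborel (ball (0::'a) 1)"
 have B: "0 < ?B" by simp
 have "disjoint_family_on (%v. ball v (eta/2)) V"
  unfolding disjoint_family_on_def
 proof (intro ballI impI)
  fix v v' assume "v:V" "v':V" "v ~= v'"
  hence "eta <= dist v v'" by(rule sep)
  thus "ball v (eta/2) Int ball v' (eta/2) = {}"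
   by(intro disjoint_ballI) simp
 qed
 hence "measure lborel (UN v:V. ball v (eta/2)) = (SUM v:V. measure lborel (ball v (eta/2)))"
  using emeasure_lborel_ball_finite[where ?'a = 'a] by(intro measure_finite_Union assms) (auto simp: less_top[symmetric])
 also have "... = (SUM v:V. (eta/2)^DIM('a)*?B)"
  using content_ball_conv_unit_ball[of "eta/2"] assms(3) by(intro sum.cong) auto
 finally have "real (card V)*((eta/2)^DIM('a)*?B) = measure lborel (UN v:V. ball v (eta/2))" by simp
 also have "... <= measure lborel (ball c (X+eta/2))"
 proof (rule measure_mono_fmeasurable)
  have "open (UN v:V. ball v (eta/2))" by auto
  thus "(UN v:V. ball v (eta/2)):sets lborel" by simp
  show "(UN v:V. ball v (eta/2)) <= ball c (X+eta/2)"
  proof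
   fix p assume "p:(UN v:V. ball v (eta/2))"
   then obtain v where "v:V" "dist v p < eta/2" by auto
   moreover have "dist c v <= X" using assms(2) calculation by auto
   ultimately show "p:ball c (X+eta/2)" using dist_triangle[of c p v] by simp
  qed
  show "ball c (X+eta/2):fmeasurable lborel" 
   using emeasure_lborel_ball_finite[of c "X+eta/2"] by(intro fmeasurableI) (auto simp: infinity_ennreal_def)
 qed
 also have "... = (X+eta/2)^DIM('a)*?B" using content_ball_conv_unit_ball[of "X+eta/2" c] assms by simp
 finally have "real (card V)*(eta/2)^DIM('a) <= (X+eta/2)^DIM('a)" by simp
 hence "real (card V) <= (X+eta/2)^DIM('a)/(eta/2)^DIM('a)" using assms(3) by(simp add: pos_le_divide_eq)
 also have "... = ((X+eta/2)/(eta/2))^DIM('a)" by(simp only: power_divide)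
 also have "(X+eta/2)/(eta/2) = 1+2*X/eta" using assms(3) by(simp add: field_simps)
 finally show ?thesis .
qed

lemma maximal_separated_subset:
 assumes "finite I" and sym: "!!i j. near i j ==> near j i" and refl: "!!i. i:I ==> near i i"
 shows "EX V<=I. (ALL v:V. ALL v':V. v ~= v' --> ~ near v v') & (ALL i:I. EX v:V. near v i)"
 using assms(1) refl
proof (induction I)
 case (insert i I)
 then obtain V where V: "V<=I" "ALL v:V. ALL v':V. v ~= v' --> ~ near v v'" "ALL i:I. EX v:V. near v i" by auto
 show ?case
 proof (cases "EX v:V. near v i")
  case True
  thus ?thesis using V by(intro exI[of _ V]) auto
 next
  case False
  thus ?thesis using V insert.prems sym by(intro exI[of _ "insert i V"]) auto
 qed
qed auto

lemma sum_lessThan_add: "(SUM i<a+b. c i) = (SUM i<a. c i)+(SUM i<b. c (a+i :: nat) :: real)"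
 by(induction b) (auto simp: add.assoc)

text \<open>Frink's lemma: a quasi-ultrametric with constant \<open>kappa\<close>,
 \<open>kappa\<^sup>2 \<le> 2\<close>, is at most twice any chain sum. Cut the chain where
 half of its sum is reached. By induction the two parts contribute at most the total sum each,
 and so does the single step between them; joining the three costs a factor
 \<open>kappa\<^sup>2\<close>.\<close>

lemma frink_chain:
 fixes q :: "'a => 'a => real"
 assumes kappa: "1<=kappa" "kappa*kappa <= 2" and nn: "!!a b. a:S ==> b:S ==> 0 <= q a b"
  and um: "!!a b c. a:S ==> b:S ==> c:S ==> q a c <= kappa*max (q a b) (q b c)"
 shows "0<m ==> (!!i. i<=m ==> z i:S) ==> q (z 0) (z m) <= 2*(SUM i<m. q (z i) (z (Suc i)))"
proof (induction m arbitrary: z rule: less_induct)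
 case (less m)
 define c where "c i = q (z i) (z (Suc i))" for i
 define T where "T = (SUM i<m. c i)"
 have c: "0 <= c i" if "i<m" for i using nn less.prems that by(simp add: c_def)
 have T: "0<=T" unfolding T_def by(intro sum_nonneg) (use c in auto)
 define j where "j = Max {j. j<m & (SUM i<j. c i) <= T/2}"
 have fin: "finite {j. j<m & (SUM i<j. c i) <= T/2}" by auto
 have "0:{j. j<m & (SUM i<j. c i) <= T/2}" using less.prems T by auto
 hence j: "j<m" "(SUM i<j. c i) <= T/2" using Max_in[OF fin] unfolding j_def by blast+
 have split: "T = (SUM i<j. c i)+c j+(SUM i<m - Suc j. c (Suc j+i))"
 proof -
  have "(SUM i<Suc j+(m - Suc j). c i) = (SUM i<Suc j. c i)+(SUM i<m - Suc j. c (Suc j+i))"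
   by(rule sum_lessThan_add)
  thus ?thesis using j(1) by(simp add: T_def)
 qed
 have "c j <= T"
  using split sum_nonneg[of "{..<j}" c] sum_nonneg[of "{..<m - Suc j}" "%i. c (Suc j+i)"] c j by simp
 have right: "q (z (Suc j)) (z m) <= T" if "Suc j < m"
 proof -
  have "T/2 < (SUM i<Suc j. c i)"
  proof (rule ccontr)
   assume "~ ?thesis"
   hence "Suc j:{j. j<m & (SUM i<j. c i) <= T/2}" using that by simp
   hence "Suc j <= j" using Max_ge[OF fin] unfolding j_def[symmetric] by blast
   thus False by simp
  qed
  hence "(SUM i<m - Suc j. c (Suc j+i)) <= T/2" using split by simp
  moreover have "q (z (Suc j+0)) (z (Suc j+(m - Suc j))) <= 2*(SUM i<m - Suc j. q (z (Suc j+i)) (z (Suc j+Suc i)))"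
   using less.IH[of "m - Suc j" "%i. z (Suc j+i)"] less.prems that by auto
  ultimately show ?thesis using that by(simp add: c_def)
 qed
 have tail: "q (z j) (z m) <= kappa*T"
 proof (cases "Suc j < m")
  case True
  have "q (z j) (z m) <= kappa*max (q (z j) (z (Suc j))) (q (z (Suc j)) (z m))" using um less.prems j by simp
  also have "... <= kappa*T" using right[OF True] `c j <= T` kappa by(intro mult_left_mono) (auto simp: c_def)
  finally show ?thesis .
 next
  case False
  hence "Suc j = m" using j by simp
  hence "q (z j) (z m) <= T" using `c j <= T` by(simp add: c_def)
  also have "... <= kappa*T" using kappa T mult_right_mono[of 1 kappa T] by simp
  finally show ?thesis .
 qed
 have "T <= kappa*T" using kappa T mult_right_mono[of 1 kappa T] by simp
 have "q (z 0) (z m) <= kappa*(kappa*T)"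
 proof (cases "j = 0")
  case True
  moreover have "kappa*T <= kappa*(kappa*T)" using kappa `T <= kappa * T` by simp
  ultimately show ?thesis using tail by simp
 next
  case False
  have "q (z 0) (z j) <= T"
   using less.IH[of j z] less.prems j False by(simp add: c_def)
  have "q (z 0) (z m) <= kappa*max (q (z 0) (z j)) (q (z j) (z m))" using um less.prems j by simp
  also have "... <= kappa*(kappa*T)" using kappa tail `q (z 0) (z j) <= T` `T <= kappa * T` by simp
  finally show ?thesis .
 qed
 also have "... <= 2*T" using mult_right_mono[OF kappa(2) T] by simp
 finally show ?case by(simp add: T_def c_def)
qed

text \<open>The increments of the running maximum distribute the growth of a sequence over its
 indices. Only records count, so indices whose values are close to each other receive little in
 total.\<close>

primrec running_max :: "(nat => real) => nat => real" where
 "running_max f 0 = f 0"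
| "running_max f (Suc i) = max (running_max f i) (f (Suc i))"

definition rise :: "(nat => real) => nat => real" where
 "rise f i = running_max f (Suc i) - running_max f i"

lemma rise_nonneg: "0 <= rise f i" by(simp add: rise_def)

lemma running_max_ge: "f i <= running_max f i" by(cases i) auto

lemma sum_rise: "a<=b ==> (SUM i:{a..<b}. rise f i) = running_max f b - running_max f a"
 unfolding rise_def by(rule sum_Suc_diff')

lemma running_max_le: "(!!i. i<=m ==> f i <= B) ==> running_max f m <= B"
 by(induction m) auto

lemma sum_rise_close:
 assumes "finite I" "0<=Q" "0<=Q'"
  and close: "!!i j. i:I ==> j:I ==> f (Suc i) - f (Suc j) <= Q"
  and step: "!!i. i:I ==> f (Suc i) - f i <= Q'"
 shows "(SUM i:I. rise f i) <= Q+Q'"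
proof -
 define I' where "I' = {i:I. 0 < rise f i}"
 have fin: "finite I'" "I'<=I" using assms(1) by(auto simp: I'_def)
 have eq: "(SUM i:I. rise f i) = (SUM i:I'. rise f i)"
  by(rule sum.mono_neutral_right[OF assms(1) fin(2)]) (use rise_nonneg[of f] in "force simp: I'_def order_less_le")
 show ?thesis
 proof (cases "I' = {}")
  case True
  thus ?thesis using eq assms by simp
 next
  case False
  define lo where "lo = Min I'"
  define hi where "hi = Max I'"
  have m: "lo:I'" "hi:I'" "lo<=hi" using fin False by(auto simp: lo_def hi_def)
  have "I' <= {lo..<Suc hi}" using fin by(auto simp: lo_def hi_def le_imp_less_Suc)
  hence "(SUM i:I'. rise f i) <= (SUM i:{lo..<Suc hi}. rise f i)"
   by(intro sum_mono2) (auto simp: rise_nonneg)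
  also have "... = running_max f (Suc hi) - running_max f lo" using m by(intro sum_rise) auto
  also have "running_max f (Suc hi) = f (Suc hi)" using m by(auto simp: I'_def rise_def split: if_splits)
  also have "f (Suc hi) - running_max f lo <= f (Suc hi) - f (Suc lo)+(f (Suc lo) - f lo)"
   using running_max_ge[of f lo] by simp
  also have "... <= Q+Q'" using close[of hi lo] step[of lo] m fin by(intro add_mono) auto
  finally show ?thesis using eq by simp
 qed
qed

section \<open>Gromov products and the visual quasimetric\<close>

locale hyp_domain = proper_domain Om for Om :: "(real^'n::finite) set" +
 fixes delta :: real
 assumes delta_nonneg: "0<=delta" and hyp: "gromov_hyperbolic delta Om"
begin

text \<open>The Gromov product \<open>(a|b)\<^sub>w\<close>; it vanishes when \<open>w\<close>
 lies on a geodesic from \<open>a\<close> to \<open>b\<close>.\<close>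

definition gp :: "real^'n => real^'n => real^'n => real" where
 "gp a b w = (K a w+K b w - K a b)/2"

lemma gp_nonneg: "a:Om ==> b:Om ==> w:Om ==> 0 <= gp a b w"
 using K_triangle[of a w b] K_sym[of w b] by(simp add: gp_def)

lemma gp_sym: "gp a b w = gp b a w" by(simp add: gp_def K_sym)

lemma gp_geo:
 assumes "a:Om" "b:Om" "geo a b g" "0<=s" "s <= K a b" shows "gp a b (g s) = 0"
using assms geo_K[OF assms(3), of 0 s] geo_K[OF assms(3), of "K a b" s] geo_ends[OF assms(3)] by(simp add: gp_def)

lemma gp_le_geo:
 assumes "a:Om" "b:Om" "w:Om" "geo a b g" "0<=s" "s <= K a b" shows "gp a b w <= K w (g s)"
proof -
 have p: "g s:Om" using geo_in assms by blast
 show ?thesis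
  using gp_geo[OF assms(1,2,4-6)] K_triangle[OF assms(1) p assms(3)] K_triangle[OF assms(2) p assms(3)] K_sym[of w "g s"]
  by(simp add: gp_def)
qed

text \<open>In a thin triangle with vertices \<open>a\<close>, \<open>c\<close>, \<open>w\<close>
 consider the point of the side from \<open>a\<close> to \<open>c\<close> at distance
 \<open>(c|w)\<^sub>a\<close> from \<open>a\<close>. It is \<open>delta\<close>-close to one
 of the other sides, and on either side the distances from the ends of that side give the
 bound.\<close>

lemma gp_near_geo:
 assumes abw: "a:Om" "c:Om" "w:Om" and g: "geo a c g"
 shows "EX s. 0<=s & s <= K a c & K w (g s) <= gp a c w+2*delta"
proof -
 define s where "s = (K w a+K c a - K w c)/2"
 have s0: "0<=s"
  using K_triangle[OF abw(3,1,2)] K_sym[of c a] by(simp add: s_def)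
 have s1: "s <= K a c"
  using K_triangle[OF abw(3,2,1)] K_sym[of c a] by(simp add: s_def)
 note s = s0 s1
 have s2: "2 * s = K a w+K a c - K c w" using K_sym[of w a] K_sym[of c a] K_sym[of w c] by(simp add: s_def)
 have g2e: "2*gp a c w = K a w+K c w - K a c" by(simp add: gp_def)
 obtain g2 where g2: "geo c w g2" using geo_exists[OF abw(2,3)] .
 obtain g3 where g3: "geo w a g3" using geo_exists[OF abw(3,1)] .
 have p: "g s:Om" using geo_in[OF g s] .
 have nn: "0 <= K a c" "0 <= K c w" "0 <= K w a" using K_nonneg abw by auto
 have Kas: "K a (g s) = s" "K c (g s) = K a c - s"
  using geo_K[OF g, of 0 s] geo_K[OF g, of "K a c" s] geo_ends[OF g] s by auto
 from thin_triangle[OF hyp abw g g2 g3 s] have "K w (g s) <= gp a c w+2*delta"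
 proof (elim disjE bexE)
  fix t assume t: "t:{0..K c w}" "K (g2 t) (g s) <= delta"
  have u: "g2 t:Om" using geo_in[OF g2] t by auto
  show ?thesis
   using geo_K[OF g2, of 0 t] geo_K[OF g2, of "K c w" t] geo_ends[OF g2] t nn K_triangle[OF abw(3) u p] K_triangle[OF abw(2) u p] t(2) Kas s2 g2e by auto
 next
  fix t assume t: "t:{0..K w a}" "K (g3 t) (g s) <= delta"
  have u: "g3 t:Om" using geo_in[OF g3] t by auto
  show ?thesis
   using geo_K[OF g3, of 0 t] geo_K[OF g3, of "K w a" t] geo_ends[OF g3] t nn K_sym[of w a] K_triangle[OF abw(3) u p] K_triangle[OF abw(1) u p] t(2) Kas s2 g2e by auto
 qed
 thus ?thesis using s by blast
qed

text \<open>The point that \<open>gp_near_geo\<close> finds on a geodesic from \<open>a\<close> to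
 \<open>c\<close> is \<open>delta\<close>-close to one of the two other sides of the triangle
 \<open>a\<close>, \<open>b\<close>, \<open>c\<close>, and no point of a side is nearer to
 \<open>w\<close> than the corresponding product.\<close>

lemma four_point:
 assumes "a:Om" "b:Om" "c:Om" "w:Om"
 shows "min (gp a b w) (gp b c w) - 3*delta <= gp a c w"
proof -
 obtain g where g: "geo a c g" using geo_exists[OF assms(1,3)] .
 obtain g2 where g2: "geo c b g2" using geo_exists[OF assms(3,2)] .
 obtain g3 where g3: "geo b a g3" using geo_exists[OF assms(2,1)] .
 obtain s where s: "0<=s" "s <= K a c" "K w (g s) <= gp a c w+2*delta" using gp_near_geo[OF assms(1,3,4) g] by blast
 have p: "g s:Om" using geo_in[OF g s(1,2)] .
 from thin_triangle[OF hyp assms(1,3,2) g g2 g3 s(1,2)] show ?thesis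
 proof (elim disjE bexE)
  fix t assume t: "t:{0..K c b}" "K (g2 t) (g s) <= delta"
  have u: "g2 t:Om" using geo_in[OF g2] t by auto
  have "gp c b w <= K w (g2 t)" using gp_le_geo[OF assms(3,2,4) g2] t by auto
  thus ?thesis using K_triangle[OF assms(4) p u] K_sym[of "g2 t" "g s"] t s gp_sym[of b c w] by linarith
 next
  fix t assume t: "t:{0..K b a}" "K (g3 t) (g s) <= delta"
  have u: "g3 t:Om" using geo_in[OF g3] t by auto
  have "gp b a w <= K w (g3 t)" using gp_le_geo[OF assms(2,1,4) g3] t by auto
  thus ?thesis using K_triangle[OF assms(4) p u] K_sym[of "g3 t" "g s"] t s gp_sym[of b a w] by linarith
 qed
qed

text \<open>Small enough for \<open>exp (3 delta eps)\<close> to have a square of at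
 most 2, as Frink's lemma demands.\<close>

definition eps :: real where "eps = 1/(12*(delta+1))"

lemma eps_pos: "0<eps" using delta_nonneg by(simp add: eps_def)

definition vis :: "real^'n => real^'n => real^'n => real" where
 "vis w a b = exp (- eps*gp a b w)"

lemma vis_ultra:
 assumes "a:Om" "b:Om" "c:Om" "w:Om"
 shows "vis w a c <= exp (3*delta*eps)*max (vis w a b) (vis w b c)"
proof -
 have "- eps*gp a c w <= - eps*(min (gp a b w) (gp b c w) - 3*delta)"
  using four_point[OF assms] eps_pos by simp
 also have "... = 3*delta*eps+max (- eps*gp a b w) (- eps*gp b c w)"
  using eps_pos by(auto simp: max_def algebra_simps)
 finally have "vis w a c <= exp (3*delta*eps+max (- eps*gp a b w) (- eps*gp b c w))" by(simp add: vis_def)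
 also have "... = exp (3*delta*eps)*max (vis w a b) (vis w b c)" by(auto simp: exp_add vis_def max_def)
 finally show ?thesis .
qed

lemma vis_const: "1 <= exp (3*delta*eps)" "exp (3*delta*eps)*exp (3*delta*eps) <= 2"
proof -
 show "1 <= exp (3*delta*eps)" using delta_nonneg eps_pos by simp
 have "exp (3*delta*eps)*exp (3*delta*eps) = exp (6*delta*eps)" by(simp add: exp_add[symmetric])
 also have "6*delta*eps <= 1/2" using delta_nonneg by(simp add: eps_def)
 hence "exp (6*delta*eps) <= exp (1/2)" by simp
 also have "... <= 2" by(rule exp_half_le2)
 finally show "exp (3*delta*eps)*exp (3*delta*eps) <= 2" .
qed

definition vis_step :: "real^'n => real^'n => real^'n => real => bool" where
 "vis_step w a b t \<longleftrightarrow> a:Om & b:Om & t = vis w a b"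

text \<open>The metric that Frink's lemma produces from the quasimetric
 \<open>vis\<close>.\<close>

definition vdist :: "real^'n => real^'n => real^'n => real" where
 "vdist w x z = chain_inf (vis_step w) x z"

lemma vis_step_nonneg: "vis_step w a b t ==> 0<=t" by(simp add: vis_step_def vis_def)

lemma vis_chain_seq:
 assumes "cost_chain (vis_step w) a b s" "a:Om"
 shows "EX m z. z 0 = a & z m = b & (ALL i<=m. z i:Om) & s = (SUM i<m. vis w (z i) (z (Suc i)))"
 using assms
proof induction
 case (refl a)
 thus ?case by(intro exI[of _ 0] exI[of _ "%_. a"]) auto
next
 case (step a b s b' t)
 then obtain m z where z: "z 0 = a" "z m = b" "ALL i<=m. z i:Om" "s = (SUM i<m. vis w (z i) (z (Suc i)))" by blast
 let ?z = "%i. if i <= m then z i else b'"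
 have "(SUM i<m. vis w (?z i) (?z (Suc i))) = s" unfolding z(4) by simp
 hence "s+t = (SUM i<Suc m. vis w (?z i) (?z (Suc i)))" using step(2) z(2) by(simp add: vis_step_def)
 thus ?case using z step(2) by(intro exI[of _ "Suc m"] exI[of _ ?z]) (auto simp: vis_step_def)
qed

lemma vis_single: "a:Om ==> b:Om ==> cost_chain (vis_step w) a b (vis w a b)"
 by(rule cost_chain_single) (simp add: vis_step_def)

lemma vdist_le: "a:Om ==> b:Om ==> vdist w a b <= vis w a b"
 unfolding vdist_def by(rule chain_inf_le[OF vis_single vis_step_nonneg[of w]])

lemma vdist_refl_le: "vdist w a a <= 0"
 unfolding vdist_def by(rule chain_inf_le[OF cost_chain.refl vis_step_nonneg[of w]])

lemma vdist_lip: "x:Om ==> a:Om ==> b:Om ==> vdist w x b - vdist w x a <= vis w a b"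
proof -
 assume x: "x:Om" and a: "a:Om" and b: "b:Om"
 have "chain_inf (vis_step w) x b <= chain_inf (vis_step w) x a+chain_inf (vis_step w) a b"
  by(rule chain_inf_triangle[OF vis_single[OF x a] vis_single[OF a b]]) (rule vis_step_nonneg)
 thus ?thesis using vdist_le[OF a b, of w] by(simp add: vdist_def)
qed

lemma vdist_ge:
 assumes "x:Om" "y:Om" "w:Om" "x ~= y" shows "vis w x y/2 <= vdist w x y"
 unfolding vdist_def
proof (rule chain_inf_ge[OF vis_single[OF assms(1,2)]])
 fix s assume "cost_chain (vis_step w) x y s"
 then obtain m z where z: "z 0 = x" "z m = y" "ALL i<=m. z i:Om" "s = (SUM i<m. vis w (z i) (z (Suc i)))"
  using vis_chain_seq[OF _ assms(1)] by blast
 have "0<m" using z assms(4) by(cases m) auto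
 have "vis w (z 0) (z m) <= 2*(SUM i<m. vis w (z i) (z (Suc i)))"
  by(rule frink_chain[where S = Om and q = "vis w", OF vis_const _ vis_ultra[OF _ _ _ assms(3)] `0 < m`])
    (use z in "auto simp: vis_def")
 thus "vis w x y/2 <= s" using z by simp
qed

text \<open>The points of \<open>E\<close> that can be reached from \<open>x\<close> by unit steps
 inside \<open>E\<close> form a relatively open and closed set.\<close>

lemma connected_unit_chain:
 assumes E: "connected E" "E<=Om" and xy: "x:E" "y:E"
 shows "EX m z. z 0 = x & z m = y & (ALL i<=m. z i:E) & (ALL i<m. K (z i) (z (Suc i)) <= 1)"
proof -
 define P where "P y = (EX m z. z 0 = x & z m = y & (ALL i<=m. z i:E) & (ALL i<m. K (z i) (z (Suc i)) <= 1))" for y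
 have step: "P b" if ab: "P a" "b:E" "K a b <= 1" for a b
 proof -
  obtain m z where z: "z 0 = x" "z m = a" "ALL i<=m. z i:E" "ALL i<m. K (z i) (z (Suc i)) <= 1"
   using ab(1) unfolding P_def by blast
  let ?z = "%i. if i <= m then z i else b"
  show ?thesis unfolding P_def
   by(intro exI[of _ "Suc m"] exI[of _ ?z]) (use z ab in "auto simp: less_Suc_eq")
 qed
 have near: "K a b <= 1" "K b a <= 1" if "a:E" "dist a b < bd a/2" for a b
 proof -
  have a: "a:Om" "0 < bd a" using that E bd_pos by auto
  have "K a b <= 2*dist a b/bd a" using K_le_twice[of a b] that a by simp
  also have "... <= 1" using that a by simp
  finally show "K a b <= 1" "K b a <= 1" using K_sym by simp_all
 qed
 define U where "U = (UN a:{a:E. P a}. ball a (bd a/2))"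
 define V where "V = (UN a:{a:E. ~ P a}. ball a (bd a/2))"
 have "P x" unfolding P_def by(intro exI[of _ 0] exI[of _ "%_. x"]) (use xy in auto)
 have self: "a:ball a (bd a/2)" if "a:E" for a using that E(2) bd_pos[of a] by auto
 have "open U" "open V" unfolding U_def V_def by auto
 moreover have "E <= U Un V" unfolding U_def V_def using self by blast
 moreover have "U Int V Int E = {}"
 proof (rule ccontr)
  assume "U Int V Int E ~= {}"
  then obtain p a b where p: "p:E" "a:E" "P a" "b:E" "~ P b" "dist a p < bd a/2" "dist b p < bd b/2"
   unfolding U_def V_def by auto
  show False
   by(metis p step[OF p(3,1)] near[OF p(2,6)] step[OF _ p(4)] near[OF p(4,7)])
 qed
 moreover have "U Int E ~= {}" unfolding U_def using self[OF xy(1)] xy(1) `P x` by blast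
 ultimately have "V Int E = {}" using connectedD[OF E(1)] by blast
 hence "P y" unfolding V_def using self[OF xy(2)] xy(2) by blast
 thus ?thesis unfolding P_def .
qed

end

section \<open>The energy bound\<close>

text \<open>Truncating a path between two levels shows only its steps across the annulus between
 them.\<close>

lemma clamp_path_sum:
 fixes h :: "nat => real"
 assumes "lo<=hi" "t1 <= N" "t2 <= N" "h t1 <= lo" "hi <= h t2"
 shows "hi - lo <= (SUM t<N. abs(max lo (min hi (h (Suc t))) - max lo (min hi (h t))))"
proof -
 define phi where "phi t = max lo (min hi (h t))" for t
 have *: "abs(phi b - phi a) <= (SUM t<N. abs(phi (Suc t) - phi t))" if "a<=b" "b<=N" for a b
 proof -
  have "phi b - phi a = (SUM t:{a..<b}. phi (Suc t) - phi t)" using that by(simp add: sum_Suc_diff')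
  hence "abs(phi b - phi a) <= (SUM t:{a..<b}. abs(phi (Suc t) - phi t))" by simp
  also have "... <= (SUM t<N. abs(phi (Suc t) - phi t))" using that by(intro sum_mono2) auto
  finally show ?thesis .
 qed
 have "phi t1 = lo" "phi t2 = hi" using assms by(auto simp: phi_def)
 hence "hi - lo <= (SUM t<N. abs(phi (Suc t) - phi t))"
  using *[of t1 t2] *[of t2 t1] assms(2,3) by(cases "t1 <= t2") auto
 thus ?thesis by(simp add: phi_def)
qed

lemma sum_geometric_le:
 fixes x :: real assumes "0<=x" "x<1" shows "(SUM t<T. x^t) <= 1/(1 - x)"
proof -
 have "(SUM t<T. x^t) <= (\<Sum>t. x^t)" using assms by(intro sum_le_suminf summable_geometric) auto
 thus ?thesis using assms suminf_geometric[of x] by simp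
qed

context hyp_domain begin

lemma dist_le_twice_bd:
 assumes "a:Om" "b:Om" "K a b <= 1" shows "dist a b <= 2*bd a" "dist a b <= 2*bd b"
proof -
 have e: "exp (K a b) - 1 <= 2" using exp_le_cancel_iff[of "K a b" 1] assms(3) exp_le by linarith
 have "dist a b <= (exp (K a b) - 1)*bd a" using dist_le_K assms by blast
 also have "... <= 2*bd a" using e bd_nonneg by(intro mult_right_mono) auto
 finally show "dist a b <= 2*bd a" .
 have "dist b a <= (exp (K b a) - 1)*bd b" using dist_le_K assms by blast
 also have "... <= 2*bd b" using e bd_nonneg K_sym by(intro mult_right_mono) auto
 finally show "dist a b <= 2*bd b" by(simp add: dist_commute)
qed

lemma separated_if_far:
 assumes "a:Om" "b:Om" "1 < K a b" shows "bd a/2 < dist a b"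
proof (rule ccontr)
 assume "~ ?thesis"
 hence d: "dist a b <= bd a/2" by simp
 have "0 < bd a" using bd_pos assms by blast
 have "K a b <= 2*dist a b/bd a" using K_le_twice[OF assms(1) d] .
 also have "... <= 1" using d `0 < bd a` by simp
 finally show False using assms by simp
qed

text \<open>The point at depth \<open>t\<close> on a geodesic that starts at the centre, constant
 once the end is reached.\<close>

definition depth_pt :: "(real => real^'n) => real => nat => real^'n" where
 "depth_pt g L t = g (min (real t) L)"

lemma depth_pt_props:
 assumes "w:Om" "z:Om" "geo w z g"
 shows "depth_pt g (K w z) t:Om"
  and "K (depth_pt g (K w z) t) (depth_pt g (K w z) (Suc t)) <= 1"
  and "K z (depth_pt g (K w z) t) = K w z - min (real t) (K w z)"
proof -
 have L: "0 <= K w z" using K_nonneg assms by blast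
 show "depth_pt g (K w z) t:Om" unfolding depth_pt_def using geo_in[OF assms(3)] L by simp
 show "K (depth_pt g (K w z) t) (depth_pt g (K w z) (Suc t)) <= 1"
  unfolding depth_pt_def using geo_K[OF assms(3), of "min (real t) (K w z)" "min (real (Suc t)) (K w z)"] L by simp
 show "K z (depth_pt g (K w z) t) = K w z - min (real t) (K w z)"
  unfolding depth_pt_def using geo_K[OF assms(3), of "K w z" "min (real t) (K w z)"] L geo_ends[OF assms(3)] by simp
qed

lemma depth_pt_near:
 assumes "w:Om" "z:Om" "geo w z g" "0<=s" "s <= K w z"
 shows "EX t<=nat \<lceil>K w z\<rceil>. K (g s) (depth_pt g (K w z) t) <= 1"
proof (intro exI conjI)
 define n where "n = nat \<lceil>s\<rceil>"
 show "n <= nat \<lceil>K w z\<rceil>" unfolding n_def using assms by(intro nat_mono ceiling_mono)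
 have n: "s <= real n" "real n <= s+1" using assms(4) by(auto simp: n_def)
 thus "K (g s) (depth_pt g (K w z) n) <= 1"
  unfolding depth_pt_def using geo_K[OF assms(3-5), of "min (real n) (K w z)"] assms(4,5)
  by(auto simp: min_def abs_if)
qed

text \<open>The path of samples is truncated between the levels \<open>8 rho\<close> and
 \<open>16 rho\<close> with \<open>rho = 64\<^sup>j R\<close>. A unit step from
 \<open>v\<close> moves by at most \<open>2 d(v)\<close>, which is comparable to the distance
 from \<open>c\<close>, so every step that is visible after truncation starts in the annulus from
 \<open>rho\<close> to \<open>64 rho\<close>.\<close>

lemma annulus_crossing:
 assumes w: "w:Om" and z: "z:Om" and g: "geo w z g" and R: "0<R"
  and bdR: "!!v. v:Om ==> bd v <= R+dist c v"
  and s1: "0<=s1" "s1 <= K w z" "dist c (g s1) <= R"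
  and s2: "0<=s2" "s2 <= K w z" "64^J*R <= dist c (g s2)"
  and j: "j<J"
 defines "p == depth_pt g (K w z)" and "N == nat \<lceil>K w z\<rceil>"
 shows "4 <= (\<Sum>t | t<N & 64^j*R <= dist c (p t) & dist c (p t) < 64^Suc j*R. bd (p t)/(64^j*R))"
proof -
 define rho where "rho = 64^j*R"
 have rho: "R<=rho" "0<rho" using R by(auto simp: rho_def)
 define h where "h t = dist c (p t)" for t
 have p: "p t:Om" for t unfolding p_def using depth_pt_props(1)[OF w z g] .
 have pp: "K (p t) (p (Suc t)) <= 1" for t unfolding p_def using depth_pt_props(2)[OF w z g] .
 have bp: "bd (p t) <= R+h t" for t unfolding h_def using bdR[OF p] .
 have hstep: "abs(h (Suc t) - h t) <= 2*bd (p t)" "abs(h (Suc t) - h t) <= 2*bd (p (Suc t))" for t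
  using dist_le_twice_bd[OF p p pp, of t] dist_triangle[of c "p t" "p (Suc t)"] dist_triangle[of c "p (Suc t)" "p t"] by(auto simp: h_def dist_commute)
 (* A unit step from a point \<open>u\<close> with \<open>h \<le> R\<close> moves by at most \<open>2 * bd u \<le> 4 * R\<close>. *)
 obtain t1 where t1: "t1 <= N" "h t1 <= 8*rho"
 proof -
  obtain t where t: "t<=N" "K (g s1) (p t) <= 1" using depth_pt_near[OF w z g s1(1,2)] by(auto simp: N_def p_def)
  have u: "g s1:Om" using geo_in[OF g s1(1,2)] .
  have "h t <= 5*R"
   using dist_le_twice_bd[OF u p t(2)] bdR[OF u] s1(3) dist_triangle[of c "p t" "g s1"] by(simp add: h_def)
  thus ?thesis using that[OF t(1)] rho R by simp
 qed
 obtain t2 where t2: "t2 <= N" "16*rho <= h t2"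
 proof -
  obtain t where t: "t<=N" "K (g s2) (p t) <= 1" using depth_pt_near[OF w z g s2(1,2)] by(auto simp: N_def p_def)
  have u: "g s2:Om" using geo_in[OF g s2(1,2)] .
  have a: "64^J*R <= 3*h t+2*R"
   using dist_le_twice_bd[OF u p t(2)] bp[of t] s2(3) dist_triangle[of c "g s2" "p t"] by(simp add: h_def dist_commute)
  have "64*rho = 64^Suc j*R" by(simp add: rho_def)
  also have "... <= 64^J*R" using j R by(intro mult_right_mono power_increasing) auto
  finally have "16*rho <= h t" using a rho by simp
  thus ?thesis using that[OF t(1)] by simp
 qed
 define phi where "phi t = max (8*rho) (min (16*rho) (h t))" for t
 define A where "A = {t. t<N & rho <= h t & h t < 64*rho}"
 have "16*rho - 8*rho <= (SUM t<N. abs(phi (Suc t) - phi t))"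
  unfolding phi_def by(rule clamp_path_sum[OF _ t1(1) t2(1) t1(2) t2(2)]) (use rho in auto)
 also have "... = (SUM t:A. abs(phi (Suc t) - phi t))"
 proof (rule sum.mono_neutral_right)
  (* Outside the annulus both ends of a step lie on the same side of the window. *)
  show "ALL t:{..<N} - A. abs(phi (Suc t) - phi t) = 0"
  proof
   fix t assume t: "t:{..<N} - A"
   have "(h t <= 8*rho & h (Suc t) <= 8*rho) | (16*rho <= h t & 16*rho <= h (Suc t))"
   proof -
    show ?thesis
     using t hstep[of t] bp[of t] bp[of "Suc t"] rho R by(auto simp: A_def)
   qed
   thus "abs(phi (Suc t) - phi t) = 0" by(auto simp: phi_def)
  qed
 qed (auto simp: A_def)
 also have "... <= (SUM t:A. 2*bd (p t))"
 proof (rule sum_mono)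
  fix t
  have "abs(phi (Suc t) - phi t) <= abs(h (Suc t) - h t)" unfolding phi_def by simp
  thus "abs(phi (Suc t) - phi t) <= 2*bd (p t)" using hstep(1)[of t] by linarith
 qed
 finally have "4*rho <= (SUM t:A. bd (p t))" by(simp add: sum_distrib_left[symmetric])
 hence "4 <= (SUM t:A. bd (p t))/rho" using rho by(simp add: le_divide_eq)
 also have "... = (SUM t:A. bd (p t)/rho)" by(simp add: sum_divide_distrib)
 also have "A = {t. t<N & 64^j*R <= dist c (p t) & dist c (p t) < 64^Suc j*R}"
  by(auto simp: A_def rho_def h_def)
 finally show ?thesis by(simp add: rho_def)
qed

text \<open>Indices with \<open>d(p i) \<le> s rho\<close> give the first summand. The others
 lie in unit clusters whose centres are separated by \<open>s rho / 2\<close> in a ball of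
 radius \<open>64 rho\<close>, so there are at most \<open>(321 / s)\<^sup>n\<close> clusters,
 and each carries mass at most \<open>Phi\<close>.\<close>

lemma mass_estimate:
 fixes p :: "nat => real^'n" and nu :: "nat => real"
 assumes fin: "finite I" and p: "!!i. i:I ==> p i:Om" and nu: "!!i. 0 <= nu i"
  and flow: "!!I'. I'<=I ==> (!!i j. i:I' ==> j:I' ==> K (p i) (p j) <= 2) ==> (SUM i:I'. nu i) <= Phi"
  and rho: "0<rho" and s: "0<s"
  and ann: "!!i. i:I ==> dist c (p i) <= 64*rho" and bdp: "!!i. i:I ==> bd (p i) <= 65*rho"
 shows "(SUM i:I. nu i*(bd (p i)/rho)) <= s*(SUM i:I. nu i)+65*(321/s)^CARD('n)*Phi"
proof -
 define I1 where "I1 = {i:I. s < bd (p i)/rho}"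
 have I1: "finite I1" "I1 <= I" using fin by(auto simp: I1_def)
 have Phi: "0<=Phi" using flow[of "{}"] by simp
 obtain V where V: "V<=I1" "ALL v:V. ALL v':V. v ~= v' --> ~ K (p v) (p v') <= 1"
  "ALL i:I1. EX v:V. K (p v) (p i) <= 1"
  using maximal_separated_subset[OF I1(1), of "%i j. K (p i) (p j) <= 1"] p I1(2) K_sym by(auto simp: subset_iff)
 have finV: "finite V" using V(1) I1 finite_subset by blast
 have card: "real (card V) <= (321/s)^CARD('n)"
 proof (cases "V = {}")
  case False
  then obtain v0 where "v0:I1" using V by blast
  hence "v0:I" "s < bd (p v0)/rho" by(auto simp: I1_def)
  moreover have "bd (p v0)/rho <= 65" using bdp[OF `v0 \<in> I`] rho by(simp add: divide_le_eq)
  ultimately have s65: "s<65" by simp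
  have sep: "s*rho/2 <= dist (p v) (p v')" if "v:V" "v':V" "v ~= v'" for v v'
  proof -
   have v: "v:I" "v':I" "s < bd (p v)/rho" using that V(1) by(auto simp: I1_def)
   have "bd (p v)/2 < dist (p v) (p v')"
    by(smt (verit) V(2) that separated_if_far p v)
   moreover have "s*rho < bd (p v)" using v(3) rho by(simp add: less_divide_eq)
   ultimately show ?thesis by simp
  qed
  have inj: "inj_on p V"
  proof (rule inj_onI)
   fix v v' assume "v:V" "v':V" "p v = p v'"
   thus "v = v'" using sep[of v v'] s rho mult_pos_pos[OF s rho] by force
  qed
  have "real (card (p ` V)) <= (1+2*(64*rho)/(s*rho/2))^DIM(real^'n)"
  proof (rule card_separated_le)
   show "p ` V <= cball c (64*rho)" using ann V(1) I1(2) by auto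
   show "s*rho/2 <= dist v v'" if vv: "v:p ` V" "v':p ` V" "v ~= v'" for v v'
    using vv sep by auto
  qed (use finV s rho in auto)
  also have "1+2*(64*rho)/(s*rho/2) = 1+256/s" using rho by simp
  finally have "real (card V) <= (1+256/s)^CARD('n)" using card_image[OF inj] by simp
  also have "... <= (321/s)^CARD('n)"
   using s s65 by(intro power_mono) (auto simp: field_simps)
  finally show ?thesis .
 qed (use s in simp)
 obtain r where r: "!!i. i:I1 ==> r i:V & K (p (r i)) (p i) <= 1" using V(3) by metis
 have "(SUM i:I1. nu i) = (SUM v:V. \<Sum>i | i:I1 & r i = v. nu i)"
  by(rule sum.group[symmetric, OF I1(1) finV]) (use r in auto)
 also have "... <= (SUM v:V. Phi)"
 proof (rule sum_mono)
  fix v assume "v:V"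
  hence v: "v:I" using V(1) I1(2) by blast
  show "(\<Sum>i | i:I1 & r i = v. nu i) <= Phi"
  proof (rule flow)
   fix i j assume "i:{i:I1. r i = v}" "j:{i:I1. r i = v}"
   hence ij: "i:I" "j:I" "K (p v) (p i) <= 1" "K (p v) (p j) <= 1" using r[of i] r[of j] I1(2) by auto
   show "K (p i) (p j) <= 2"
    using K_triangle[OF p p p, OF ij(1) v ij(2)] ij K_sym[of "p i" "p v"] by simp
  qed (use I1 in auto)
 qed
 also have "... = real (card V)*Phi" by simp
 also have "... <= (321/s)^CARD('n)*Phi" using card Phi by(intro mult_right_mono)
 finally have m1: "(SUM i:I1. nu i) <= (321/s)^CARD('n)*Phi" .
 have "(SUM i:I. nu i*(bd (p i)/rho)) = (SUM i:I - I1. nu i*(bd (p i)/rho))+(SUM i:I1. nu i*(bd (p i)/rho))"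
  using sum.subset_diff[OF I1(2) fin] .
 also have "(SUM i:I - I1. nu i*(bd (p i)/rho)) <= (SUM i:I - I1. nu i * s)"
  by(intro sum_mono mult_left_mono nu) (auto simp: I1_def)
 also have "... <= (SUM i:I. nu i * s)" using fin nu s by(intro sum_mono2) auto
 also have "(SUM i:I1. nu i*(bd (p i)/rho)) <= (SUM i:I1. nu i*65)"
  using I1(2) rho bdp by(intro sum_mono mult_left_mono nu) (auto simp: divide_le_eq)
 also have "... <= 65*((321/s)^CARD('n)*Phi)" using m1 by(simp add: sum_distrib_right[symmetric])
 finally show ?thesis by(simp add: sum_distrib_left mult_ac)
qed

lemma vdist_nonneg: 
 assumes "a:Om" "b:Om" shows "0 <= vdist w a b"
 unfolding vdist_def
proof (rule chain_inf_ge[OF vis_single[OF assms]])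
 fix s assume "cost_chain (vis_step w) a b s"
 thus "0<=s" by(rule cost_chain_nonneg) (rule vis_step_nonneg)
qed

lemma vis_le: "t <= gp a b w ==> vis w a b <= exp (- eps*t)"
 using eps_pos by(simp add: vis_def)

text \<open>The number of annuli that all geodesics from \<open>w\<close> to a set
 \<open>E\<close> cross is bounded, if \<open>E\<close> joins points \<open>x\<close>,
 \<open>y\<close> whose geodesic passes through \<open>w\<close>.

 Walk along \<open>E\<close> from \<open>x\<close> to \<open>y\<close> in unit steps
 \<open>z\<close>. Since \<open>(x|y)\<^sub>w = 0\<close>, the visual distance from
 \<open>x\<close> grows from 0 to at least \<open>1/2\<close>, and the increments of its running
 maximum are weights \<open>nu\<^sub>i\<close> of total mass between \<open>1/2\<close> and 1.
 Send the mass \<open>nu\<^sub>i\<close> along the geodesic from \<open>w\<close> to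
 \<open>z\<^sub>i\<close>, sampled at integer depths. Indices whose samples at depth
 \<open>t\<close> are close have points \<open>z\<^sub>i\<close> with Gromov product about
 \<open>t\<close>, hence carry mass of order \<open>exp (- eps t)\<close> only. In each
 annulus every geodesic spends steps of total relative size at least 4. By
 \<open>mass_estimate\<close>, with a threshold \<open>S\<^sub>t\<close> decaying geometrically
 in the depth, the steps of small relative size account for \<open>\<Sum>\<^sub>t S\<^sub>t
 mu\<^sub>j\<^sub>t\<close>, where \<open>mu\<^sub>j\<^sub>t\<close> is the mass in annulus
 \<open>j\<close> at depth \<open>t\<close>, and the others for at most 1, so that \<open>1 \<le>
 \<Sum>\<^sub>t S\<^sub>t mu\<^sub>j\<^sub>t\<close>. Summing over the annuli, which share the
 mass at each depth, bounds their number by \<open>\<Sum>\<^sub>t S\<^sub>t\<close>.\<close>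

theorem energy_bound:
 "EX J0. ALL w x y E c R J. w:Om --> connected E --> E<=Om --> x:E --> y:E --> gp x y w = 0 --> 0<R -->
   (ALL v:Om. bd v <= R+dist c v) -->
   (ALL z:E. ALL g. geo w z g --> (EX s:{0..K w z}. dist c (g s) <= R) & (EX s:{0..K w z}. 64^J*R <= dist c (g s)))
   --> real J <= J0"
proof -
 let ?n = "CARD('n)"
 (* Masses decay like \<open>a1 ^ (2 * t)\<close> in the depth. The threshold \<open>S t\<close>, of order \<open>a2 ^ t\<close>, admits \<open>a1 ^ (- t)\<close>
   clusters up to a constant, so the part above the threshold is still summable. *)
 define a1 where "a1 = exp (- eps/2)"
 define a2 where "a2 = exp (- eps/(2*real ?n))"
 have a1: "0<a1" "a1 < 1" using eps_pos by(auto simp: a1_def)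
 have a2: "0<a2" "a2 < 1" using eps_pos by(auto simp: a2_def)
 have a21: "a2^?n = a1" by(simp add: a2_def a1_def exp_of_nat_mult[symmetric])
 define C1 where "C1 = 65*(2*exp (2*eps))*321^?n*(1/(1 - a1))"
 define Th where "Th = max 1 C1"
 have Th: "1<=Th" "C1 <= Th" by(auto simp: Th_def)
 show ?thesis
 proof (intro exI[of _ "Th*(1/(1 - a2))"] allI impI)
  fix w x y E c R and J :: nat
  assume w: "w:Om" and E: "connected E" "E<=Om" and xy: "x:E" "y:E" and gp0: "gp x y w = 0"
   and R: "0 < (R::real)" and bdR: "ALL v:Om. bd v <= R+dist c v"
   and cross: "ALL z:E. ALL g. geo w z g --> (EX s:{0..K w z}. dist c (g s) <= R) & (EX s:{0..K w z}. 64^J*R <= dist c (g s))"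
  show "real J <= Th*(1/(1 - a2))"
  proof (cases "J = 0")
   case True
   thus ?thesis using Th a2 by simp
  next
   case False
   have xyOm: "x:Om" "y:Om" using xy E by auto
   have "x ~= y"
   proof
    assume "x = y"
    hence "K w x = 0" using gp0 xyOm K_sym[of x w] by(simp add: gp_def)
    obtain g where g: "geo w x g" using geo_exists[OF w xyOm(1)] .
    have "dist c (g 0) <= R" "64^J*R <= dist c (g 0)" using cross g xy `K w x = 0` by auto
    hence "64^J*R <= 1*R" by linarith
    hence "(64::real)^J <= 1" using R by simp
    moreover have "(1::real) < 64^J" using False by simp
    ultimately show False by simp
   qed
   obtain m z where z: "z 0 = x" "z m = y" "!!i. i<=m ==> z i:E" "!!i. i<m ==> K (z i) (z (Suc i)) <= 1"
    using connected_unit_chain[OF E xy] by blast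
   have zOm: "z i:Om" if "i<=m" for i using z(3)[OF that] E by blast
   define f where "f i = vdist w x (z i)" for i
   define G where "G i = (SOME g. geo w (z (Suc i)) g)" for i
   have G: "geo w (z (Suc i)) (G i)" if "i<m" for i
    unfolding G_def using geo_exists[OF w zOm[of "Suc i"]] that by(metis Suc_leI someI_ex)
   define N where "N i = nat \<lceil>K w (z (Suc i))\<rceil>" for i
   define p where "p i = depth_pt (G i) (K w (z (Suc i)))" for i
   note dp = depth_pt_props[OF w zOm G]
   have pOm: "p i t:Om" if "i<m" for i t unfolding p_def using dp(1)[of i] that by simp
   define M where "M = (SUM i<m. rise f i)"
   have M: "M = running_max f m - f 0" using sum_rise[of 0 m f] by(simp add: M_def lessThan_atLeast0)
   have f0: "f 0 = 0" using vdist_refl_le[of w x] vdist_nonneg[OF xyOm(1,1), of w] by(simp add: f_def z)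
   have "1/2 <= f m" using vdist_ge[OF xyOm w `x ~= y`] gp0 by(simp add: f_def z vis_def)
   hence M1: "1/2 <= M" using running_max_ge[of f m] by(simp add: M f0)
   have "f i <= 1" if "i<=m" for i
    using vdist_le[OF xyOm(1) zOm[OF that], of w] vis_le[OF gp_nonneg[OF xyOm(1) zOm[OF that] w]] by(simp add: f_def)
   hence M2: "M<=1" using running_max_le[of m f 1] by(simp add: M f0)
   (* Samples at depth \<open>t\<close> that are close force a Gromov product of at least \<open>t - 2\<close>. *)
   have flow: "(SUM i:I'. rise f i) <= 2*exp (- eps*(real t - 2))"
    if I': "I' <= {i. i<m & t < N i}" and close: "!!i j. i:I' ==> j:I' ==> K (p i t) (p j t) <= 2" for I' t
   proof -
    let ?Q = "exp (- eps*(real t - 2))"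
    have deep: "real t < K w (z (Suc i))+1" "i<m" if "i:I'" for i
    proof -
     have "t < N i" "i<m" using that I' by auto
     hence "int t < \<lceil>K w (z (Suc i))\<rceil>" unfolding N_def by simp
     thus "real t < K w (z (Suc i))+1" by linarith
     show "i<m" by fact
    qed
    have "(SUM i:I'. rise f i) <= ?Q+?Q"
    proof (rule sum_rise_close)
     show "finite I'" using I' finite_subset by fastforce
     fix i assume i: "i:I'"
     have iOm: "z i:Om" "z (Suc i):Om" using zOm deep[OF i] by auto
     show "f (Suc i) - f i <= ?Q"
      using K_triangle[OF w iOm] z(4)[of i] deep[OF i] K_sym[of w "z i"] K_sym[of w "z (Suc i)"] vdist_lip[OF xyOm(1) iOm, of w] vis_le[of "real t - 2" "z i" "z (Suc i)" w] by(simp add: gp_def f_def)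
     fix j assume j: "j:I'"
     have jOm: "z (Suc j):Om" using zOm deep[OF j] by auto
     note pi = pOm[OF deep(2)[OF i], of t] and pj = pOm[OF deep(2)[OF j], of t]
     define A where "A = min (real t) (K w (z (Suc i)))"
     define B where "B = min (real t) (K w (z (Suc j)))"
     have "K (z (Suc i)) (p i t) = K w (z (Suc i)) - A"
      "K (z (Suc j)) (p j t) = K w (z (Suc j)) - B"
      unfolding p_def A_def B_def using dp(3)[of i t] dp(3)[of j t] deep(2)[OF i] deep(2)[OF j] by auto
     moreover have "K (z (Suc j)) (z (Suc i)) <= K (z (Suc j)) (p j t)+(K (p j t) (p i t)+K (z (Suc i)) (p i t))"
      using K_triangle[OF jOm pj iOm(2)] K_triangle[OF pj pi iOm(2)] K_sym[of "p i t" "z (Suc i)"] by simp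
     moreover have "real t - 1 <= A" "real t - 1 <= B"
      unfolding A_def B_def using deep(1)[OF i] deep(1)[OF j] by auto
     ultimately have "2*(real t - 2) <= K w (z (Suc j))+K w (z (Suc i)) - K (z (Suc j)) (z (Suc i))"
      using close[OF j i] by(smt (verit))
     hence "real t - 2 <= gp (z (Suc j)) (z (Suc i)) w"
      using K_sym[of w "z (Suc j)"] K_sym[of w "z (Suc i)"] by(simp add: gp_def)
     thus "f (Suc i) - f (Suc j) <= ?Q"
      using vdist_lip[OF xyOm(1) jOm iOm(2), of w] vis_le[of "real t - 2" "z (Suc j)" "z (Suc i)" w] by(simp add: f_def)
    qed auto
    thus ?thesis by simp
   qed
   define P where "P i j t \<longleftrightarrow> t < N i & 64^j*R <= dist c (p i t) & dist c (p i t) < 64^Suc j*R" for i j t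
   define I where "I j t = {i. i<m & P i j t}" for j t
   have finI: "finite (I j t)" for j t by(simp add: I_def)
   define T where "T = (SUM i<m. N i)"
   have NT: "N i <= T" if "i<m" for i unfolding T_def using that by(intro member_le_sum) auto
   define S where "S t = Th*a2^t" for t
   have S: "0 < S t" for t using Th a2 by(simp add: S_def)
   have small: "65*(321/S t)^?n*(2*exp (- eps*(real t - 2))) <= (C1*(1 - a1)/Th)*a1^t" for t
   proof -
    have "exp (- eps*(real t - 2)) = exp (2*eps)*(a1^t*a1^t)"
     by(simp add: a1_def exp_of_nat_mult[symmetric] exp_add[symmetric] algebra_simps)
    moreover have "(321/S t)^?n = 321^?n/(Th^?n*a1^t)"
     by(simp add: S_def power_divide power_mult_distrib a21[symmetric] power_mult[symmetric] mult.commute)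
    ultimately have "65*(321/S t)^?n*(2*exp (- eps*(real t - 2))) =
      (65*(2*exp (2*eps))*321^?n)/Th^?n*a1^t"
     by simp
    also have "65*(2*exp (2*eps))*321^?n = C1*(1 - a1)" using a1 by(simp add: C1_def)
    also have "C1*(1 - a1)/Th^?n <= C1*(1 - a1)/Th"
    proof (rule divide_left_mono)
     show "Th <= Th^?n" using Th self_le_power[of Th ?n] by simp
     show "0 <= C1*(1 - a1)" by(simp add: C1_def)
    qed (use Th in auto)
    finally show ?thesis using a1 by(simp add: mult_right_mono)
   qed
   (* The annulus receives \<open>4 * M \<ge> 2\<close>, of which the part above the threshold carries at most 1. *)
   have main: "1 <= (SUM t<T. S t*(SUM i:I j t. rise f i))" if j: "j<J" for j
   proof -
    let ?rho = "64^j*R"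
    have rho: "0 < ?rho" "R <= ?rho" using R by auto
    have "4*M <= (SUM i<m. rise f i*(\<Sum>t | t:{..<T} & P i j t. bd (p i t)/?rho))"
    proof -
     have "4 <= (\<Sum>t | t:{..<T} & P i j t. bd (p i t)/?rho)" if i: "i<m" for i
     proof -
      have zi: "z (Suc i):E" "z (Suc i):Om" using z(3) zOm i by auto
      obtain s1 s2 where s: "s1:{0..K w (z (Suc i))}" "dist c (G i s1) <= R"
       "s2:{0..K w (z (Suc i))}" "64^J*R <= dist c (G i s2)" using cross zi(1) G[OF i] by blast
      have "4 <= (\<Sum>t | t < N i & 64^j*R <= dist c (p i t) & dist c (p i t) < 64^Suc j*R. bd (p i t)/(64^j*R))"
       unfolding p_def N_def
       by(rule annulus_crossing[OF w zi(2) G[OF i] R _ _ _ s(2) _ _ s(4) j]) (use bdR s in auto)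
      also have "{t. t < N i & 64^j*R <= dist c (p i t) & dist c (p i t) < 64^Suc j*R} = {t. t:{..<T} & P i j t}"
       using NT[OF i] by(auto simp: P_def)
      finally show ?thesis .
     qed
     hence "(SUM i<m. rise f i*4) <= (SUM i<m. rise f i*(\<Sum>t | t:{..<T} & P i j t. bd (p i t)/?rho))"
      by(intro sum_mono mult_left_mono rise_nonneg) auto
     thus ?thesis by(simp add: M_def sum_distrib_left mult.commute)
    qed
    also have "... = (SUM i:{..<m}. \<Sum>t | t:{..<T} & P i j t. rise f i*(bd (p i t)/?rho))"
     by(simp add: sum_distrib_left)
    also have "... = (SUM t:{..<T}. \<Sum>i | i:{..<m} & P i j t. rise f i*(bd (p i t)/?rho))"
     by(rule sum.swap_restrict) auto
    also have "... = (SUM t<T. SUM i:I j t. rise f i*(bd (p i t)/?rho))" by(simp add: I_def)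
    also have "... <= (SUM t<T. S t*(SUM i:I j t. rise f i)+(C1*(1 - a1)/Th)*a1^t)"
    proof (rule sum_mono)
     fix t
     have "(SUM i:I j t. rise f i*(bd (p i t)/?rho)) <= S t*(SUM i:I j t. rise f i)+65*(321/S t)^?n*(2*exp (- eps*(real t - 2)))"
     proof (rule mass_estimate[OF finI, where c = c])
      fix i assume i: "i:I j t"
      hence i': "i<m" "dist c (p i t) < 64*?rho" by(auto simp: I_def P_def)
      show "p i t:Om" using pOm i' by blast
      show "dist c (p i t) <= 64*?rho" using i' by simp
      show "bd (p i t) <= 65*?rho"
       by(smt (verit) bdR pOm[OF i'(1)] i' rho)
     next
      fix I' assume I': "I' <= I j t" "!!i k. i:I' ==> k:I' ==> K (p i t) (p k t) <= 2"
      show "(SUM i:I'. rise f i) <= 2*exp (- eps*(real t - 2))"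
       by(rule flow) (use I' in "auto simp: I_def P_def")
     qed (use S rho rise_nonneg in auto)
     thus "(SUM i:I j t. rise f i*(bd (p i t)/?rho)) <= S t*(SUM i:I j t. rise f i)+(C1*(1 - a1)/Th)*a1^t"
      using small[of t] by linarith
    qed
    also have "... = (SUM t<T. S t*(SUM i:I j t. rise f i))+(C1*(1 - a1)/Th)*(SUM t<T. a1^t)"
     by(simp add: sum.distrib sum_distrib_left)
    also have "(C1*(1 - a1)/Th)*(SUM t<T. a1^t) <= (C1*(1 - a1)/Th)*(1/(1 - a1))"
     using sum_geometric_le[of a1 T] a1 Th by(intro mult_left_mono) (auto simp: C1_def)
    also have "... <= 1" using Th by simp
    finally show ?thesis using M1 by linarith
   qed
   have "real J = (SUM j<J. 1)" by simp
   also have "... <= (SUM j<J. SUM t<T. S t*(SUM i:I j t. rise f i))" by(rule sum_mono) (use main in auto)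
   also have "... = (SUM t<T. S t*(SUM j<J. SUM i:I j t. rise f i))"
    by(subst sum.swap) (simp add: sum_distrib_left)
   also have "... <= (SUM t<T. S t*1)"
   proof (intro sum_mono mult_left_mono)
    fix t
    have "(SUM j<J. SUM i:I j t. rise f i) = sum (rise f) (UN j:{..<J}. I j t)"
    proof (rule sum.UNION_disjoint[symmetric])
     have "I j t Int I k t = {}" if "j<k" for j k
     proof -
      have "64^Suc j*R <= 64^k*R" using that R by(intro mult_right_mono power_increasing) auto
      thus ?thesis by(auto simp: I_def P_def)
     qed
     thus "ALL j:{..<J}. ALL k:{..<J}. j ~= k --> I j t Int I k t = {}" by(metis Int_commute linorder_neqE_nat)
    qed (use finI in auto)
    also have "... <= (SUM i<m. rise f i)" by(rule sum_mono2) (auto simp: I_def rise_nonneg)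
    finally show "(SUM j<J. SUM i:I j t. rise f i) <= 1" using M2 by(simp add: M_def)
   qed (use S less_imp_le in blast)
   also have "... = Th*(SUM t<T. a2^t)" by(simp add: S_def sum_distrib_left)
   also have "... <= Th*(1/(1 - a2))" using sum_geometric_le[of a2 T] a2 Th by(intro mult_left_mono) auto
   finally show ?thesis .
  qed
 qed
qed

end

section \<open>Separation by balls and linking\<close>

context hyp_domain begin

lemma geo_image_connected:
 assumes "a:Om" "b:Om" "geo a b g"
 shows "connected (g ` {0..K a b})" "g ` {0..K a b} <= Om" "a:g ` {0..K a b}" "b:g ` {0..K a b}"
proof -
 have "path (%t. g (K a b*t))" using geo_curve(1)[OF assms] by(simp add: rectifiable_curves_def rectifiable_def)
 thus "connected (g ` {0..K a b})" using connected_path_image geo_curve(3)[OF assms] by metis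
 have "g 0:g ` {0..K a b}" "g (K a b):g ` {0..K a b}"
  using K_nonneg assms by(intro imageI; simp)+
 thus "a:g ` {0..K a b}" "b:g ` {0..K a b}" using geo_ends[OF assms(3)] by simp_all
 show "g ` {0..K a b} <= Om" using geo_in[OF assms(3)] by auto
qed

text \<open>Otherwise every geodesic from \<open>w\<close> to a point of \<open>E\<close> leaves
 the ball \<open>B(w, 64\<^sup>J d(w))\<close> and so crosses \<open>J\<close> annuli, which
 \<open>energy_bound\<close> excludes for large \<open>J\<close>.\<close>

lemma ball_separation:
 "EX C>=1. ALL w x y E. w:Om --> connected E --> E<=Om --> x:E --> y:E --> gp x y w = 0 -->
   E Int connected_component_set (Om Int ball w (C*bd w)) w ~= {}"
proof -
 obtain J0 where J0: "!!w x y E c R J. w:Om ==> connected E ==> E<=Om ==> x:E ==> y:E ==> gp x y w = 0 ==> 0<R ==>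
   (ALL v:Om. bd v <= R+dist c v) ==>
   (ALL z:E. ALL g. geo w z g --> (EX s:{0..K w z}. dist c (g s) <= R) & (EX s:{0..K w z}. 64^J*R <= dist c (g s)))
   ==> real J <= J0" using energy_bound by blast
 define J where "J = Suc (nat \<lceil>J0\<rceil>)"
 have J: "J0 < real J" unfolding J_def by linarith
 show ?thesis
 proof (intro exI[of _ "64^J"] conjI allI impI)
  show "(1::real) <= 64^J" by simp
  fix w x y E
  assume w: "w:Om" and E: "connected E" "E<=Om" and xy: "x:E" "y:E" "gp x y w = 0"
  let ?S = "Om Int ball w (64^J*bd w)"
  have bw: "0 < bd w" using bd_pos w by blast
  show "E Int connected_component_set ?S w ~= {}"
  proof
   assume dis: "E Int connected_component_set ?S w = {}"
   have "real J <= J0"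
   proof (rule J0[OF w E xy bw])
    show "ALL v:Om. bd v <= bd w+dist w v" using bd_le by blast
    show "ALL z:E. ALL g. geo w z g --> (EX s:{0..K w z}. dist w (g s) <= bd w) & (EX s:{0..K w z}. 64^J*bd w <= dist w (g s))"
    proof (intro ballI allI impI conjI)
     fix z g assume z: "z:E" and g: "geo w z g"
     have zOm: "z:Om" using z E by blast
     show "EX s:{0..K w z}. dist w (g s) <= bd w"
      using geo_ends[OF g] bw K_nonneg[OF w zOm] by(intro bexI[of _ 0]) auto
     show "EX s:{0..K w z}. 64^J*bd w <= dist w (g s)"
     proof (rule ccontr)
      assume "~ ?thesis"
      hence "g ` {0..K w z} <= ?S" using geo_image_connected(2)[OF w zOm g] by(auto simp: not_le)
      hence "z:connected_component_set ?S w"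
       using connected_component_maximal[OF geo_image_connected(3)[OF w zOm g] geo_image_connected(1)[OF w zOm g]]
        geo_image_connected(4)[OF w zOm g] by blast
      thus False using dis z by blast
     qed
    qed
   qed
   thus False using J by simp
  qed
 qed
qed

text \<open>If the geodesic had a point \<open>w\<close> far from the ball \<open>B(c,
 rho)\<close> containing \<open>E\<close>, all geodesics from \<open>w\<close> to
 \<open>E\<close> would cross many annuli around \<open>c\<close>, from the outside this
 time.\<close>

lemma geodesic_proximity:
 "EX C>=1. ALL w x y E c rho. w:Om --> connected E --> E<=Om --> x:E --> y:E --> gp x y w = 0 -->
   0 < rho --> E <= cball c rho --> bd c <= rho --> dist c w <= C*rho"
proof -
 obtain J0 where J0: "!!w x y E c R J. w:Om ==> connected E ==> E<=Om ==> x:E ==> y:E ==> gp x y w = 0 ==> 0<R ==>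
   (ALL v:Om. bd v <= R+dist c v) ==>
   (ALL z:E. ALL g. geo w z g --> (EX s:{0..K w z}. dist c (g s) <= R) & (EX s:{0..K w z}. 64^J*R <= dist c (g s)))
   ==> real J <= J0" using energy_bound by blast
 define J where "J = Suc (nat \<lceil>J0\<rceil>)"
 have J: "J0 < real J" unfolding J_def by linarith
 show ?thesis
 proof (intro exI[of _ "64^J"] conjI allI impI)
  show "(1::real) <= 64^J" by simp
  fix w x y E c and rho :: real
  assume w: "w:Om" and E: "connected E" "E<=Om" and xy: "x:E" "y:E" "gp x y w = 0"
   and rho: "0<rho" "E <= cball c rho" "bd c <= rho"
  show "dist c w <= 64^J*rho"
  proof (rule ccontr)
   assume far: "~ ?thesis"
   have "real J <= J0"
   proof (rule J0[OF w E xy rho(1)])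
    show "ALL v:Om. bd v <= rho+dist c v" using bd_le[of _ c] rho(3) by(meson add_right_mono order_trans)
    show "ALL z:E. ALL g. geo w z g --> (EX s:{0..K w z}. dist c (g s) <= rho) & (EX s:{0..K w z}. 64^J*rho <= dist c (g s))"
    proof (intro ballI allI impI conjI)
     fix z g assume z: "z:E" and g: "geo w z g"
     have zOm: "z:Om" using z E by blast
     show "EX s:{0..K w z}. dist c (g s) <= rho"
      using geo_ends[OF g] rho(2) z K_nonneg[OF w zOm] by(intro bexI[of _ "K w z"]) auto
     show "EX s:{0..K w z}. 64^J*rho <= dist c (g s)"
      using geo_ends[OF g] far K_nonneg[OF w zOm] by(intro bexI[of _ 0]) auto
    qed
   qed
   thus False using J by simp
  qed
 qed
qed

text \<open>Points at distance 2 along the geodesic are more than one unit apart, hence separated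
 in the Euclidean metric by half their distance to the boundary.\<close>

lemma geo_separated_points:
 assumes "a:Om" "b:Om" "geo a b g" "0<eta" "!!s. 0<=s ==> s <= K a b ==> eta <= bd (g s)"
 shows "EX V. finite V & V <= g ` {0..K a b} & K a b <= 2*real (card V) &
   (ALL v:V. ALL v':V. v ~= v' --> eta/2 <= dist v v')"
proof -
 define L where "L = K a b"
 have L: "0<=L" using K_nonneg assms by(simp add: L_def)
 define m where "m = nat \<lfloor>L/2\<rfloor>"
 have m: "2*real m <= L" "L <= 2*(real m+1)"
 proof -
  have "real m = of_int \<lfloor>L/2\<rfloor>" using L by(simp add: m_def)
  moreover have "of_int \<lfloor>L/2\<rfloor> <= L/2" "L/2 < of_int \<lfloor>L/2\<rfloor>+1" by linarith+
  ultimately have "real m <= L/2" "L/2 < real m+1" by auto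
  note * = this
  show "2*real m <= L" using * by simp
  show "L <= 2*(real m+1)" using * by simp
 qed
 have i: "0 <= 2*real i" "2*real i <= K a b" if "i<=m" for i using m that by(auto simp: L_def)
 (* Distance 2 along the geodesic leaves room to exceed one unit strictly. *)
 define p where "p i = g (2*real i)" for i
 have sep: "eta/2 <= dist (p i) (p j)" if "i<=m" "j<=m" "i ~= j" for i j
 proof -
  have inOm: "p i:Om" "p j:Om" unfolding p_def using geo_in[OF assms(3)] i that by auto
  have "K (p i) (p j) = abs(2*real i - 2*real j)" unfolding p_def using geo_K[OF assms(3)] i that by auto
  hence "1 < K (p i) (p j)" using that(3) by linarith
  hence "bd (p i)/2 < dist (p i) (p j)" using separated_if_far inOm by blast
  moreover have "eta <= bd (p i)" unfolding p_def using assms(5) i that by blast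
  ultimately show ?thesis by simp
 qed
 have "inj_on p {..m}" using sep assms(4) by(intro inj_onI) force
 hence "card (p ` {..m}) = m+1" by(simp add: card_image)
 thus ?thesis
  by(intro exI[of _ "p ` {..m}"]) (use m sep i in "auto simp: L_def[symmetric] p_def")
qed

definition sepC :: real where "sepC = (SOME C. C >= 1 & (ALL w x y E. w:Om --> connected E --> E<=Om --> x:E --> y:E --> gp x y w = 0 -->
   E Int connected_component_set (Om Int ball w (C*bd w)) w ~= {}))"

lemma sepC: "1<=sepC"
 "w:Om ==> connected E ==> E<=Om ==> x:E ==> y:E ==> gp x y w = 0 ==>
   E Int connected_component_set (Om Int ball w (sepC*bd w)) w ~= {}"
 using someI_ex[OF ball_separation] unfolding sepC_def[symmetric] by auto

text \<open>Two points that can be joined by a small set and by a set far from the boundary are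
 joined by a short geodesic far from the boundary. Separation applied to \<open>E\<close> keeps
 the geodesic away from the boundary, proximity to \<open>F\<close> keeps it in a ball of radius
 comparable to \<open>r\<close>; then it is short, since it contains separated points in
 proportion to its length.\<close>

lemma linking:
 assumes \<Lambda>: "1 <= \<Lambda>"
 shows "EX M c C. 0<c & 0<C & (ALL r x y E F. 0<r --> bd x = r --> connected E --> E<=Om -->
   (ALL v:E. r <= bd v) --> x:E --> y:E --> connected F --> F <= Om Int cball x (\<Lambda>*r) --> x:F --> y:F -->
   K x y <= M & (EX g. geo x y g & (ALL s:{0..K x y}. c*r <= bd (g s) & dist x (g s) <= C*r)))"
proof -
 obtain C2 where C2: "1<=C2" "!!w x y E c rho. w:Om ==> connected E ==> E<=Om ==> x:E ==> y:E ==> gp x y w = 0 ==>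
   0 < rho ==> E <= cball c rho ==> bd c <= rho ==> dist c w <= C2*rho" using geodesic_proximity by blast
 (* Separation gives a point of \<open>E\<close> within \<open>sepC * bd (g s)\<close> of \<open>g s\<close>, and \<open>r \<le> bd\<close> on \<open>E\<close>. *)
 define c where "c = 1/(1+sepC)"
 define C where "C = C2*\<Lambda>"
 have c: "0<c" "0<C" using sepC(1) C2(1) \<Lambda> by(auto simp: c_def C_def)
 show ?thesis
 proof (rule exI[of _ "2*(1+2*C/(c/2))^DIM(real^'n)"], rule exI[of _ c], rule exI[of _ C], intro conjI c allI impI)
  fix r x y E F
  assume r: "0<r" "bd x = r" and E: "connected E" "E<=Om" "ALL v:E. r <= bd v" "x:E" "y:E"
   and F: "connected F" "F <= Om Int cball x (\<Lambda>*r)" "x:F" "y:F"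
  have xy: "x:Om" "y:Om" using E by auto
  obtain g where g: "geo x y g" using geo_exists[OF xy] .
  have pt: "c*r <= bd (g s)" "dist x (g s) <= C*r" if s: "0<=s" "s <= K x y" for s
  proof -
   have w: "g s:Om" using geo_in[OF g s] .
   have gp0: "gp x y (g s) = 0" using gp_geo[OF xy g s] .
   obtain e where e: "e:E" "e:connected_component_set (Om Int ball (g s) (sepC*bd (g s))) (g s)"
    using sepC(2)[OF w E(1,2,4,5) gp0] by blast
   hence "dist (g s) e < sepC*bd (g s)" using connected_component_subset by fastforce
   hence "r <= (1+sepC)*bd (g s)" using E(3) e(1) bd_le[of e "g s"] by(force simp: algebra_simps)
   thus "c*r <= bd (g s)" using sepC(1) by(simp add: c_def field_simps)
   show "dist x (g s) <= C*r"
    using r \<Lambda> C2(2)[OF w F(1) _ F(3,4) gp0, of "\<Lambda>*r" x] F(2) by(simp add: C_def)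
  qed
  have "0 < c*r" using c r by simp
  then obtain V where V: "finite V" "V <= g ` {0..K x y}" "K x y <= 2*real (card V)"
   "!!v v'. v:V ==> v':V ==> v ~= v' ==> c*r/2 <= dist v v'"
   using geo_separated_points[OF xy g, of "c*r"] pt(1) by blast
  have "real (card V) <= (1+2*(C*r)/(c*r/2))^DIM(real^'n)"
   by(rule card_separated_le[where c = x, OF V(1) _ _ _ V(4)]) (use V(2) pt(2) r c in auto)
  moreover have "2*(C*r)/(c*r/2) = 2*C/(c/2)" using r by simp
  ultimately show "K x y <= 2*(1+2*C/(c/2))^DIM(real^'n)" using V(3) by simp
  show "EX g. geo x y g & (ALL s:{0..K x y}. c*r <= bd (g s) & dist x (g s) <= C*r)"
   using g pt by auto
 qed
qed

text \<open>A geodesic far from the boundary has disjoint balls of fixed size along it, whose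
 number is bounded by the measure of the domain.\<close>

lemma star_bounded:
 assumes fin: "emeasure lebesgue Om < \<infinity>" and x0: "x0:Om" and r: "0<r"
 shows "EX B. ALL z:Om. ALL g. geo x0 z g --> (ALL s:{0..K x0 z}. r <= bd (g s)) --> dist x0 z <= B"
proof -
 let ?b = "(r/4)^DIM(real^'n)*measure lborel (ball (0::real^'n) 1)"
 have b: "0 < ?b" using r by simp
 define N where "N = 2*(measure lebesgue Om/?b)"
 show ?thesis
 proof (intro exI[of _ "(exp N - 1)*bd x0"] ballI allI impI)
  fix z g assume z: "z:Om" and g: "geo x0 z g" and deep: "ALL s:{0..K x0 z}. r <= bd (g s)"
  obtain V where V: "finite V" "V <= g ` {0..K x0 z}" "K x0 z <= 2*real (card V)"
   "!!v v'. v:V ==> v':V ==> v ~= v' ==> r/2 <= dist v v'"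
   using geo_separated_points[OF x0 z g r] deep by fastforce
  have "disjoint_family_on (%v. ball v (r/4)) V"
   unfolding disjoint_family_on_def
  proof (intro ballI impI)
   fix v v' assume "v:V" "v':V" "v ~= v'"
   hence "r/2 <= dist v v'" by(rule V(4))
   thus "ball v (r/4) Int ball v' (r/4) = {}" by(intro disjoint_ballI) simp
  qed
  hence "measure lborel (UN v:V. ball v (r/4)) = (SUM v:V. measure lborel (ball v (r/4)))"
   using emeasure_lborel_ball_finite[where ?'a = "real^'n"] by(intro measure_finite_Union V(1)) (auto simp: less_top[symmetric])
  also have "... = (SUM v:V. ?b)"
   using content_ball_conv_unit_ball[where ?'a = "real^'n", of "r/4"] r by simp
  finally have "real (card V)*?b = measure lborel (UN v:V. ball v (r/4))" by simp
  also have "... = measure lebesgue (UN v:V. ball v (r/4))"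
  proof -
   have "open (UN v:V. ball v (r/4))" by blast
   thus ?thesis by simp
  qed
  also have "... <= measure lebesgue Om"
  proof (rule measure_mono_fmeasurable)
   show "(UN v:V. ball v (r/4)) <= Om"
   proof
    fix p assume "p:(UN v:V. ball v (r/4))"
    then obtain v where v: "v:V" "dist v p < r/4" by auto
    then obtain s where "s:{0..K x0 z}" "v = g s" using V(2) by blast
    thus "p:Om" using in_dom_if_near[of v p] geo_in[OF g] deep v(2) r by fastforce
   qed
   show "(UN v:V. ball v (r/4)):sets lebesgue" by(intro sets.finite_UN V(1)) auto
   show "Om:fmeasurable lebesgue" using fin open_dom by(intro fmeasurableI) (auto simp: borel_open)
  qed
  finally have "real (card V) <= measure lebesgue Om/?b" using b by(simp only: pos_le_divide_eq)
  hence "K x0 z <= N" using V(3) by(simp add: N_def)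
  hence "(exp (K x0 z) - 1)*bd x0 <= (exp N - 1)*bd x0" using bd_nonneg by(intro mult_right_mono) auto
  thus "dist x0 z <= (exp N - 1)*bd x0" using dist_le_K[OF x0 z] by linarith
 qed
qed

end

section \<open>Cut points and the core\<close>

context hyp_domain begin

lemma geo_continuous:
 assumes "geo a b g" shows "continuous_on {0..K a b} g"
 unfolding continuous_on_def
proof
 fix s assume s: "s:{0..K a b}"
 show "(g \<longlongrightarrow> g s) (at s within {0..K a b})"
 proof (rule metric_tendsto_imp_tendsto)
  have "((%t. (exp (abs(s - t)) - 1)*bd (g s)) \<longlongrightarrow> (exp (abs(s - s)) - 1)*bd (g s)) (at s within {0..K a b})"
   by(intro tendsto_intros)
  thus "((%t. (exp (abs(s - t)) - 1)*bd (g s)) \<longlongrightarrow> 0) (at s within {0..K a b})" by simp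
  show "\<forall>\<^sub>F t in at s within {0..K a b}. dist (g t) (g s) <= dist ((exp (abs(s - t)) - 1)*bd (g s)) 0"
   unfolding eventually_at_filter
  proof (rule always_eventually, intro allI impI)
   fix t assume t: "t:{0..K a b}"
   have "dist (g s) (g t) <= (exp (K (g s) (g t)) - 1)*bd (g s)"
    using s t by(intro dist_le_K geo_in[OF assms]) auto
   also have "K (g s) (g t) = abs(s - t)" using geo_K[OF assms] s t by auto
   finally show "dist (g t) (g s) <= dist ((exp (abs(s - t)) - 1)*bd (g s)) 0" by(simp add: dist_commute)
  qed
 qed
qed

lemma geo_sub:
 assumes "geo a b g" "0<=s" "s <= K a b" shows "K a (g s) = s" "geo a (g s) g"
using assms geo_ends[OF assms(1)] by(auto simp: geo_def)

text \<open>The ball of \<open>ball_separation\<close> around a cut point. It is the component of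
 the ball that matters, since the domain may come close to itself.\<close>

definition nbh :: "real => real^'n => (real^'n) set" where
 "nbh r u = connected_component_set (Om Int ball u (sepC*r)) u"

definition small :: "real => (real^'n) set => bool" where
 "small D S \<longleftrightarrow> connected S & S<=Om & (ALL x:S. ALL y:S. dist x y <= D)"

lemma small_Un:
 assumes "small a S" "small b T" "S Int T ~= {}" shows "small (a+b) (S Un T)"
proof -
 obtain p where p: "p:S" "p:T" using assms(3) by blast
 have "0<=a" "0<=b" using p assms(1,2) unfolding small_def by(metis dist_self)+
 have ST: "dist x y <= a+b" if "x:S" "y:T" for x y
 proof -
  have "dist x p <= a" "dist p y <= b" using assms(1,2) that p unfolding small_def by auto
  thus ?thesis using dist_triangle[of x y p] by linarith
 qed
 have "dist x y <= a+b" if xy: "x:S Un T" "y:S Un T" for x y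
 proof -
  consider "x:S" "y:S" | "x:S" "y:T" | "x:T" "y:S" | "x:T" "y:T" using xy by blast
  thus ?thesis
  proof cases
   case 1
   hence "dist x y <= a" using assms(1) by(simp add: small_def)
   thus ?thesis using `0 <= b` by linarith
  next
   case 4
   hence "dist x y <= b" using assms(2) by(simp add: small_def)
   thus ?thesis using `0 <= a` by linarith
  qed (use ST[of x y] ST[of y x] in "auto simp: dist_commute")
 qed
 moreover have "connected (S Un T)" using assms by(intro connected_Un) (auto simp: small_def)
 ultimately show ?thesis using assms unfolding small_def by blast
qed

lemma nbh_props:
 assumes "u:Om" "0<r"
 shows "u:nbh r u" "connected (nbh r u)" "nbh r u <= Om" "small (2*(sepC*r)) (nbh r u)" "nbh r u <= ball u (sepC*r)"
proof -
 show "u:nbh r u"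
  using sepC(1) assms by(simp add: nbh_def)
 show c: "connected (nbh r u)" by(simp add: nbh_def)
 have sub: "nbh r u <= Om Int ball u (sepC*r)" unfolding nbh_def by(rule connected_component_subset)
 thus "nbh r u <= Om" "nbh r u <= ball u (sepC*r)" by auto
 have "dist x y <= 2*(sepC*r)" if "x:nbh r u" "y:nbh r u" for x y
 proof -
  have "dist u x < sepC*r" "dist u y < sepC*r" using that sub by auto
  thus ?thesis using dist_triangle2[of x y u] by(simp add: dist_commute)
 qed
 thus "small (2*(sepC*r)) (nbh r u)" using c sub by(auto simp: small_def)
qed

lemma ball_subset_nbh:
 assumes "u:Om" "bd u = r" shows "ball u r <= nbh r u"
 unfolding nbh_def
proof (rule connected_component_maximal)
 have r: "0<r" using assms bd_pos by blast
 show "u:ball u r" using r by simp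
 have "ball u r <= ball u (sepC*r)" using sepC(1) r by(intro subset_ball) simp
 thus "ball u r <= Om Int ball u (sepC*r)" using ball_subset_dom[OF assms(1)] assms(2) by auto
qed auto

definition small_scale :: "real^'n => real => bool" where
 "small_scale x0 r \<longleftrightarrow> x0:Om & 0<r & (sepC+1)*r < bd x0"

text \<open>Where a geodesic from \<open>x0\<close> first comes within distance \<open>r\<close>
 of the boundary.\<close>

definition cut :: "real^'n => real => (real^'n) set" where
 "cut x0 r = {u:Om. bd u = r & (EX g. geo x0 u g & (ALL s:{0..K x0 u}. r <= bd (g s)))}"

text \<open>The part of the domain that the neighbourhood of \<open>u\<close> does not shield from
 \<open>x0\<close>.\<close>

definition home :: "real^'n => real => real^'n => (real^'n) set" where
 "home x0 r u = connected_component_set (Om - nbh r u) x0"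

text \<open>\<open>u\<close> is separated from \<open>x0\<close> by the neighbourhood of
 \<open>v\<close>.\<close>

definition behind :: "real^'n => real => real^'n => real^'n => bool" where
 "behind x0 r u v \<longleftrightarrow> nbh r u Int (nbh r v Un home x0 r v) = {}"

end

locale scaled_domain = hyp_domain Om delta for Om :: "(real^'n::finite) set" and delta +
 fixes x0 :: "real^'n" and r :: real
 assumes sc: "small_scale x0 r"
begin

lemma x0: "x0:Om" and r_pos: "0<r" and r_small: "(sepC+1)*r < bd x0"
 using sc by(auto simp: small_scale_def)

lemma cutD: "u:cut x0 r ==> u:Om" "u:cut x0 r ==> bd u = r" by(auto simp: cut_def)

lemma bd_nbh: "u:cut x0 r ==> p:nbh r u ==> bd p < (sepC+1)*r"
 using nbh_props(5)[OF cutD(1) r_pos, of u] cutD(2)[of u] bd_le[of p u] by(force simp: algebra_simps)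

lemma home_props:
 assumes "u:cut x0 r"
 shows "x0:home x0 r u" "connected (home x0 r u)" "home x0 r u <= Om - nbh r u"
proof -
 show "x0:home x0 r u"
  using bd_nbh[OF assms] r_small x0 by(force simp: home_def)
 show "connected (home x0 r u)" by(simp add: home_def)
 show "home x0 r u <= Om - nbh r u" unfolding home_def by(rule connected_component_subset)
qed

lemma subset_home:
 assumes u: "u:cut x0 r" and A: "connected A" "A<=Om" "A Int nbh r u = {}" "A Int home x0 r u ~= {}"
 shows "A <= home x0 r u"
proof -
 have "A Un home x0 r u <= connected_component_set (Om - nbh r u) x0"
  by(rule connected_component_maximal) (use home_props[OF u] A in "auto intro!: connected_Un")
 thus ?thesis by(simp add: home_def)
qed

text \<open>A geodesic to \<open>z\<close> that comes within distance \<open>r\<close> of the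
 boundary first does so at a cut point \<open>u\<close>; by separation no connected set joins
 \<open>x0\<close> to \<open>z\<close> outside the neighbourhood of \<open>u\<close>.\<close>

lemma home_star:
 assumes z: "z:Om" "!!u. u:cut x0 r ==> z:home x0 r u" and g: "geo x0 z g" and s: "0<=s" "s <= K x0 z"
 shows "r < bd (g s)"
proof (rule ccontr)
 assume "~ ?thesis"
 define L where "L = K x0 z"
 define Z where "Z = {t:{0..L}. bd (g t) <= r}"
 have cb: "continuous_on {0..L} (%t. bd (g t))"
  unfolding L_def by(rule continuous_on_compose2[OF continuous_bd[of UNIV] geo_continuous[OF g]]) auto
 have "closed ({0..L} Int (%t. bd (g t)) -` {..r})"
  by(rule continuous_closed_preimage[OF cb]) auto
 moreover have "{0..L} Int (%t. bd (g t)) -` {..r} = Z" by(auto simp: Z_def)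
 ultimately have "closed Z" by simp
 moreover have "s:Z" using s `~ r < bd (g s)` by(simp add: Z_def L_def)
 moreover have bb: "bdd_below Z" by(auto simp: Z_def)
 ultimately have t1: "Inf Z:Z" using closed_contains_Inf[of Z] by blast
 define t where "t = Inf Z"
 have t: "0<=t" "t <= K x0 z" "bd (g t) <= r" using t1 by(auto simp: Z_def t_def L_def)
 have before: "r < bd (g t')" if "0<=t'" "t'<t" for t'
 proof (rule ccontr)
  assume "~ ?thesis"
  hence "t':Z" using that t by(auto simp: Z_def L_def)
  hence "t<=t'" unfolding t_def using bb by(rule cInf_lower)
  thus False using that by simp
 qed
 have "1*r <= sepC*r" using sepC(1) r_pos by simp
 moreover have "(sepC+1)*r = sepC*r+r" by(simp add: algebra_simps)
 ultimately have r0: "r < bd (g 0)" unfolding geo_ends(1)[OF g] using r_small r_pos by linarith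
 have "bd (g t) = r"
 proof (rule ccontr)
  assume "bd (g t) ~= r"
  hence lt: "bd (g t) < r" using t by simp
  have "EX x>=0. x<=t & bd (g x) = r"
   by(rule IVT2') (use lt r0 t continuous_on_subset[OF cb] in "auto simp: L_def")
  then obtain x where "0<=x" "x<=t" "bd (g x) = r" by blast
  thus False using before[of x] lt by(cases "x = t") auto
 qed
 define u where "u = g t"
 note sub = geo_sub[OF g t(1,2)]
 have uOm: "u:Om" using geo_in[OF g t(1,2)] by(simp add: u_def)
 have "r <= bd (g s')" if "s':{0..K x0 u}" for s'
  using before[of s'] that sub(1) `bd (g t) = r` unfolding u_def by(cases "s' = t") auto
 hence u: "u:cut x0 r" using uOm `bd (g t) = r` sub(2) unfolding cut_def u_def by auto
 have "gp x0 z u = 0" unfolding u_def using gp_geo[OF x0 z(1) g t(1,2)] .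
 hence "home x0 r u Int connected_component_set (Om Int ball u (sepC*bd u)) u ~= {}"
  using home_props[OF u] z(2)[OF u] by(intro sepC(2)[OF uOm]) auto
 thus False using home_props(3)[OF u] cutD(2)[OF u] by(auto simp: nbh_def)
qed

lemma behind_home:
 assumes u: "u:cut x0 r" and v: "v:cut x0 r" and b: "behind x0 r u v"
 shows "home x0 r v Un nbh r v <= home x0 r u"
proof -
 define C where "C = connected_component_set (Om - nbh r v) u"
 have nu: "u:nbh r u" "connected (nbh r u)" "nbh r u <= Om" using nbh_props[OF cutD(1)[OF u] r_pos] by auto
 have nv: "connected (nbh r v)" "nbh r v <= Om" using nbh_props[OF cutD(1)[OF v] r_pos] by auto
 have dis: "nbh r u Int nbh r v = {}" "nbh r u Int home x0 r v = {}" using b by(auto simp: behind_def)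
 have uC: "nbh r u <= C" unfolding C_def by(rule connected_component_maximal) (use nu dis in auto)
 have "C:components (Om - nbh r v)" unfolding C_def using nu dis by(intro componentsI) auto
 hence con: "connected (Om - C)"
  using component_diff_connected[OF nv(1) connected_dom nv(2)] by blast
 have hC: "home x0 r v Int C = {}"
 proof (rule ccontr)
  assume "home x0 r v Int C ~= {}"
  hence "home x0 r v = C" unfolding home_def C_def
   using connected_component_nonoverlap[of "Om - nbh r v" x0 u] home_props(1)[OF v] nu dis by(auto simp: home_def)
  thus False using uC nu dis by blast
 qed
 have "C <= Om - nbh r v" unfolding C_def by(rule connected_component_subset)
 hence sub: "home x0 r v Un nbh r v <= Om - C" using hC home_props(3)[OF v] nv by blast
 have "Om - C <= home x0 r u"
  by(rule subset_home[OF u con]) (use uC home_props(1)[OF u] home_props(1)[OF v] sub x0 in auto)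
 thus ?thesis using sub by blast
qed

lemma behind_trans:
 assumes "u:cut x0 r" "v:cut x0 r" "w:cut x0 r" "behind x0 r u v" "behind x0 r v w"
 shows "behind x0 r u w"
 using behind_home[OF assms(2,3,5)] assms(4) by(auto simp: behind_def)

text \<open>The cut points that are not behind others, where the tentacles are attached.\<close>

definition maxcut :: "(real^'n) set" where
 "maxcut = {u:cut x0 r. ~ (EX v:cut x0 r. behind x0 r u v)}"

text \<open>Immediate from \<open>star_bounded\<close>; here the finite measure of the domain
 enters.\<close>

lemma cut_bounded:
 assumes "emeasure lebesgue Om < \<infinity>" shows "bounded (cut x0 r)"
proof -
 obtain B where "!!z g. z:Om ==> geo x0 z g ==> (ALL s:{0..K x0 z}. r <= bd (g s)) ==> dist x0 z <= B"
  using star_bounded[OF assms x0 r_pos] by blast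
 hence "cut x0 r <= cball x0 B" by(auto simp: cut_def)
 thus ?thesis using bounded_cball bounded_subset by blast
qed

text \<open>Cut points that are successively behind one another have disjoint balls of radius
 comparable to \<open>r\<close> in a bounded set, so a chain of them ends.\<close>

lemma maxcut_exists:
 assumes fin: "emeasure lebesgue Om < \<infinity>" and u: "u:cut x0 r"
 shows "EX v:maxcut. home x0 r v <= home x0 r u"
proof (rule ccontr)
 assume no: "~ ?thesis"
 have ex: "EX w:cut x0 r. behind x0 r v w" if "v = u | v:cut x0 r & behind x0 r u v" for v
 proof -
  have v: "v:cut x0 r" using that u by blast
  have "v ~: maxcut"
   using that behind_home[OF u v] no by blast
  thus ?thesis using v by(simp add: maxcut_def)
 qed
 have "EX X t. finite X & card X = Suc n & X <= cut x0 r & t:X & (t = u | behind x0 r u t) &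
   (ALL a:X. a = t | behind x0 r a t) & (ALL a:X. ALL b:X. a ~= b --> r <= dist a b)" for n
 proof (induction n)
  case 0
  thus ?case using u by auto
 next
  case (Suc n)
  then obtain X t where X: "finite X" "card X = Suc n" "X <= cut x0 r" "t:X" "t = u | behind x0 r u t"
   "ALL a:X. a = t | behind x0 r a t" "ALL a:X. ALL b:X. a ~= b --> r <= dist a b" by blast
  have t: "t:cut x0 r" using X by blast
  obtain w where w: "w:cut x0 r" "behind x0 r t w" using ex[of t] X(5) t by blast
  have bw: "behind x0 r a w" if a: "a:X" for a
  proof (cases "a = t")
   case False
   hence "behind x0 r a t" "a:cut x0 r" using X(3,6) a by auto
   thus ?thesis using behind_trans[OF _ t w(1) _ w(2)] by simp
  qed (use w in simp)
  have far: "r <= dist a w" if "a:X" for a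
  proof -
   have a: "a:cut x0 r" using that X by blast
   have "a ~: nbh r w"
    using nbh_props(1) cutD(1)[OF a] r_pos bw[OF that] by(auto simp: behind_def)
   hence "a ~: ball w r" using ball_subset_nbh[OF cutD[OF w(1)]] by blast
   thus ?thesis by(simp add: dist_commute)
  qed
  have "w ~: X" using far[of w] r_pos by auto
  have uw: "w = u | behind x0 r u w"
  proof (cases "t = u")
   case False
   thus ?thesis using X(5) behind_trans[OF u t w(1) _ w(2)] by simp
  qed (use w in simp)
  have "finite (insert w X)" "card (insert w X) = Suc (Suc n)" "insert w X <= cut x0 r" "w:insert w X"
   "ALL a:insert w X. a = w | behind x0 r a w"
   "ALL a:insert w X. ALL b:insert w X. a ~= b --> r <= dist a b"
   using X(1,2,3,7) w(1) bw far `w \<notin> X` by(simp_all add: dist_commute)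
  thus ?case using uw by blast
 qed
 note seq = this
 obtain B where "ALL y:cut x0 r. dist x0 y <= B"
  using cut_bounded[OF fin] bounded_any_center[of "cut x0 r" x0] by blast
 hence B: "cut x0 r <= cball x0 B" by auto
 define B' where "B' = max B 0"
 define n where "n = nat \<lceil>(1+2*B'/r)^DIM(real^'n)\<rceil>"
 obtain X where X: "finite X" "card X = Suc n" "X <= cut x0 r" "ALL a:X. ALL b:X. a ~= b --> r <= dist a b"
  using seq[of n] by blast
 have "real (card X) <= (1+2*B'/r)^DIM(real^'n)"
  by(rule card_separated_le[where c = x0, OF X(1)]) (use X B r_pos in "auto simp: B'_def")
 also have "... <= real n" unfolding n_def by linarith
 finally show False using X(2) by simp
qed

definition core :: "(real^'n) set" where
 "core = {z:Om. ALL u:maxcut. z:home x0 r u}"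

lemma core_home:
 assumes "emeasure lebesgue Om < \<infinity>" "z:core" "u:cut x0 r" shows "z:home x0 r u"
 using maxcut_exists[OF assms(1,3)] assms(2) by(auto simp: core_def)

lemma maxcut_cut: "u:maxcut ==> u:cut x0 r" by(simp add: maxcut_def)

lemma maxcut_disjoint:
 assumes "u:maxcut" "v:maxcut" "nbh r u Int nbh r v = {}"
 shows "nbh r v <= home x0 r u"
proof (rule ccontr)
 assume no: "~ ?thesis"
 have v: "v:cut x0 r" and u: "u:cut x0 r" using assms maxcut_cut by auto
 have "behind x0 r v u"
  using subset_home[OF u nbh_props(2,3)[OF cutD(1)[OF v] r_pos]] assms(3) no by(auto simp: behind_def)
 thus False using assms(2) u by(auto simp: maxcut_def)
qed

lemma compact_in_core:
 assumes "connected Q" "Q<=Om" "x0:Q" "!!q. q:Q ==> (sepC+1)*r <= bd q"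
 shows "Q<=core"
proof -
 have "Q <= home x0 r u" if "u:maxcut" for u
 proof (rule subset_home[OF maxcut_cut[OF that] assms(1,2)])
  show "Q Int nbh r u = {}" using bd_nbh[OF maxcut_cut[OF that]] assms(4) by force
  show "Q Int home x0 r u ~= {}" using home_props(1)[OF maxcut_cut[OF that]] assms(3) by blast
 qed
 thus ?thesis using assms(2) by(auto simp: core_def)
qed

end

section \<open>The tentacle decomposition\<close>

context scaled_domain begin

definition piece :: "(real^'n) set => bool" where "piece A \<longleftrightarrow> small r A & A ~= {}"

definition far :: "(real^'n) set => bool" where
 "far A \<longleftrightarrow> A Int core = {} & (ALL u:maxcut. A Int nbh r u = {})"

text \<open>A piece that meets the neighbourhood of a maximal cut point is based there. Any other
 piece outside the core lies in the interior of a tentacle; then the base is chosen by a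
 description that overlapping pieces share.\<close>

definition base :: "(real^'n) set => real^'n" where
 "base A = (if EX u:maxcut. A Int nbh r u ~= {} then (SOME u. u:maxcut & A Int nbh r u ~= {})
   else (SOME u. u:maxcut & A Int home x0 r u = {}))"

lemma pieceD: "piece A ==> small r A" "piece A ==> A ~= {}" "piece A ==> A<=Om"
 by(auto simp: piece_def small_def)

lemma farD: "far A ==> A Int core = {}" "far A ==> u:maxcut ==> A Int nbh r u = {}"
 by(auto simp: far_def)

lemma small_mono: "small a S ==> a<=b ==> small b S" by(force simp: small_def)

lemma subset_home':
 assumes "u:maxcut" "small a A" "A Int nbh r u = {}" "A Int home x0 r u ~= {}" shows "A <= home x0 r u"
 using subset_home[OF maxcut_cut[OF assms(1)] _ _ assms(3,4)] assms(2) by(simp add: small_def)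

lemma base_far:
 assumes A: "piece A" "far A" shows "base A:maxcut" "A Int home x0 r (base A) = {}" 
  "base A = (SOME u. u:maxcut & A Int home x0 r u = {})"
proof -
 obtain p where "p:A" using pieceD(2)[OF A(1)] by blast
 hence p: "p:A" "p:Om" "p ~: core" using pieceD(3)[OF A(1)] farD(1)[OF A(2)] by auto
 then obtain u where u: "u:maxcut" "p ~: home x0 r u" by(auto simp: core_def)
 hence ex: "EX u. u:maxcut & A Int home x0 r u = {}"
  using subset_home'[OF u(1) pieceD(1)[OF A(1)] farD(2)[OF A(2) u(1)]] p(1) u by blast
 show eq: "base A = (SOME u. u:maxcut & A Int home x0 r u = {})" using A by(auto simp: base_def far_def)
 show "base A:maxcut" "A Int home x0 r (base A) = {}" unfolding eq using someI_ex[OF ex] by auto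
qed

lemma base_near:
 assumes "A Int core = {}" "~ far A" shows "base A:maxcut" "A Int nbh r (base A) ~= {}"
using assms someI_ex[of "%u. u:maxcut & A Int nbh r u ~= {}"] by(auto simp: far_def base_def)

lemma base_maxcut: "piece A ==> A Int core = {} ==> base A:maxcut"
 using base_far(1) base_near(1) by blast

lemma base_far_eq:
 assumes "piece A" "far A" "piece A'" "far A'" "A Int A' ~= {}" shows "base A = base A'"
proof -
 have *: "A' Int home x0 r u = {}" if u: "u:maxcut" "A Int home x0 r u = {}" 
  and A: "piece A'" "far A'" "A Int A' ~= {}" for u A A'
 using subset_home'[OF u(1) pieceD(1)[OF A(1)] farD(2)[OF A(2) u(1)]] A(3) u(2) by auto
 have "(u:maxcut & A Int home x0 r u = {}) = (u:maxcut & A' Int home x0 r u = {})" for u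
  using assms(5) *[of u A A', OF _ _ assms(3,4,5)] *[of u A' A, OF _ _ assms(1,2)] by blast
 thus ?thesis using base_far(3)[OF assms(1,2)] base_far(3)[OF assms(3,4)] by simp
qed

definition joined :: "real^'n => real^'n => bool" where
 "joined u y \<longleftrightarrow> (EX F. small (6 * sepC*r) F & u:F & y:F)"

lemma joined_sym: "joined u y ==> joined y u" by(auto simp: joined_def)

lemma r_le_sep: "r <= sepC*r"
 using mult_right_mono[OF sepC(1), of r] r_pos by simp

lemma nbh_maxcut:
 assumes "u:maxcut" shows "u:nbh r u" "small (2*(sepC*r)) (nbh r u)"
 using nbh_props[OF cutD(1)[OF maxcut_cut[OF assms]] r_pos] by auto

text \<open>The neighbourhood of the base point together with the pieces is a connected set of
 size comparable to \<open>r\<close>: a piece behind the base point can reach the core only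
 through that neighbourhood.\<close>

lemma joined_core:
 assumes A: "piece A" "A Int core = {}" and A': "piece A'" "A Int A' ~= {}" and z: "z:A'" "z:core"
 shows "joined (base A) z"
proof -
 define u where "u = base A"
 have u: "u:maxcut" using base_maxcut A by(simp add: u_def)
 note n = nbh_maxcut[OF u]
 show ?thesis
 proof (cases "far A")
  case False
  hence "nbh r u Int A ~= {}" using base_near A by(auto simp: u_def)
  hence "small (2*(sepC*r)+r) (nbh r u Un A)" by(rule small_Un[OF n(2) pieceD(1)[OF A(1)]])
  hence "small (2*(sepC*r)+r+r) (nbh r u Un A Un A')"
   by(rule small_Un[OF _ pieceD(1)[OF A'(1)]]) (use A'(2) in blast)
  hence "small (6 * sepC*r) (nbh r u Un A Un A')" by(rule small_mono) (use r_le_sep r_pos in linarith)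
  thus ?thesis unfolding joined_def u_def[symmetric] using n z by blast
 next
  case True
  have h: "A Int home x0 r u = {}" using base_far(2) A True by(simp add: u_def)
  have "z:home x0 r u" using z u by(simp add: core_def)
  hence "A' Int nbh r u ~= {}" using subset_home'[OF u pieceD(1)[OF A'(1)]] A'(2) z h by blast
  hence "nbh r u Int A' ~= {}" by blast
  hence "small (2*(sepC*r)+r) (nbh r u Un A')" by(rule small_Un[OF n(2) pieceD(1)[OF A'(1)]])
  hence "small (6 * sepC*r) (nbh r u Un A')" by(rule small_mono) (use r_le_sep r_pos in linarith)
  thus ?thesis unfolding joined_def u_def[symmetric] using n z by blast
 qed
qed

lemma joined_bases:
 assumes A: "piece A" "A Int core = {}" and A': "piece A'" "A' Int core = {}" "~ far A'" and m: "A Int A' ~= {}"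
 shows "joined (base A) (base A')"
proof -
 define u where "u = base A"
 define u' where "u' = base A'"
 have u: "u:maxcut" "u':maxcut" using base_maxcut A A' by(auto simp: u_def u'_def)
 note n = nbh_maxcut[OF u(1)] and n' = nbh_maxcut[OF u(2)]
 have "A' Int nbh r u' ~= {}" using base_near A' by(auto simp: u'_def)
 hence s': "small (r+2*(sepC*r)) (A' Un nbh r u')" by(rule small_Un[OF pieceD(1)[OF A'(1)] n'(2)])
 show ?thesis
 proof (cases "far A")
  case False
  hence "nbh r u Int A ~= {}" using base_near A by(auto simp: u_def)
  hence "small (2*(sepC*r)+r) (nbh r u Un A)" by(rule small_Un[OF n(2) pieceD(1)[OF A(1)]])
  hence "small ((2*(sepC*r)+r)+(r+2*(sepC*r))) ((nbh r u Un A) Un (A' Un nbh r u'))"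
   by(rule small_Un[OF _ s']) (use m in blast)
  hence "small (6 * sepC*r) ((nbh r u Un A) Un (A' Un nbh r u'))" by(rule small_mono) (use r_le_sep r_pos in linarith)
  thus ?thesis unfolding joined_def u_def[symmetric] u'_def[symmetric] using n n' by blast
 next
  case True
  have h: "A Int home x0 r u = {}" using base_far(2) A True by(simp add: u_def)
  have "nbh r u Int (A' Un nbh r u') ~= {}"
  proof (cases "nbh r u Int nbh r u' = {}")
   case True
   hence "nbh r u' <= home x0 r u" using maxcut_disjoint u by blast
   hence "A' Int home x0 r u ~= {}" using `A' \<inter> nbh r u' ~= {}` by blast
   hence "A' Int nbh r u ~= {}" using subset_home'[OF u(1) pieceD(1)[OF A'(1)]] h m by blast
   thus ?thesis by blast
  qed blast
  hence "small (2*(sepC*r)+(r+2*(sepC*r))) (nbh r u Un (A' Un nbh r u'))"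
   by(rule small_Un[OF n(2) s'])
  hence "small (6 * sepC*r) (nbh r u Un (A' Un nbh r u'))" by(rule small_mono) (use r_le_sep r_pos in linarith)
  thus ?thesis unfolding joined_def u_def[symmetric] u'_def[symmetric] using n n' by blast
 qed
qed

lemma maxcut_star:
 assumes "u:maxcut" obtains g where "geo x0 u g" "!!s. 0<=s ==> s <= K x0 u ==> r <= bd (g s)"
 using maxcut_cut[OF assms] by(auto simp: cut_def)

lemma core_star:
 assumes "emeasure lebesgue Om < \<infinity>" "z:core"
 obtains g where "geo x0 z g" "!!s. 0<=s ==> s <= K x0 z ==> r <= bd (g s)"
proof -
 have z: "z:Om" using assms by(simp add: core_def)
 obtain g where g: "geo x0 z g" using geo_exists[OF x0 z] .
 show ?thesis using that[OF g] home_star[OF z core_home[OF assms] g] by(simp add: less_imp_le)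
qed

end

context hyp_domain begin

definition is_piece :: "real => (real^'n) set => bool" where "is_piece r A \<longleftrightarrow> small r A & A ~= {}"

text \<open>The relation that allows a comparison of Taylor polynomials at \<open>u\<close> and
 \<open>y\<close>.\<close>

definition linked :: "real => real => real => real => real^'n => real^'n => bool" where
 "linked M c C r u y \<longleftrightarrow> u:Om & y:Om & K u y <= M & (EX g. geo u y g & (ALL s:{0..K u y}. c*r <= bd (g s) & dist u (g s) <= C*r))"

end

text \<open>\<open>Co\<close> is the core, \<open>b A\<close> the base point of a piece
 \<open>A\<close> outside the core, and \<open>far\<close> marks the pieces in the interior of a
 tentacle. \<open>B\<close> bounds the core and the base points, while the far pieces may be
 unbounded.\<close>

locale decomposition = hyp_domain Om delta for Om :: "(real^'n::finite) set" and delta +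
 fixes M c C r B :: real and x0 :: "real^'n" and Co :: "(real^'n) set" and b :: "(real^'n) set => real^'n" and far :: "(real^'n) set => bool"
 assumes r: "0<r" and c: "0<c" and C: "0<C"
  and Co: "Co<=Om" "!!z. z:Co ==> r <= bd z" "!!z. z:Co ==> dist x0 z <= B"
  and base_dist: "!!A. is_piece r A ==> A Int Co = {} ==> dist x0 (b A) <= B"
  and far_same: "!!A A'. is_piece r A ==> is_piece r A' ==> A Int A' ~= {} ==> A Int Co = {} ==> A' Int Co = {} ==> far A ==> far A' ==> b A = b A'"
  and near_linked: "!!A A'. is_piece r A ==> is_piece r A' ==> A Int A' ~= {} ==> A Int Co = {} ==> A' Int Co = {} ==> ~ (far A & far A') ==> linked M c C r (b A) (b A')"
  and core_linked: "!!A A' z. is_piece r A ==> is_piece r A' ==> A Int A' ~= {} ==> A Int Co = {} ==> z:A' Int Co ==> linked M c C r (b A) z"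
  and near_dist: "!!A x. is_piece r A ==> A Int Co = {} ==> ~ far A ==> x:A ==> dist (b A) x <= C*r"

context hyp_domain begin

text \<open>The constants \<open>M\<close>, \<open>c\<close>, \<open>C\<close> are those of
 \<open>linking\<close> and do not depend on the scale \<open>r\<close>; this uniformity is what
 the approximation rests on.\<close>

theorem tentacle_decomposition:
 assumes fin: "emeasure lebesgue Om < \<infinity>"
 shows "EX M c C. 0<c & 0<C & (ALL x0 r. small_scale x0 r --> (EX B Co b far. decomposition Om delta M c C r B x0 Co b far &
   (ALL Q. connected Q --> Q<=Om --> x0:Q --> (ALL q:Q. (sepC+1)*r <= bd q) --> Q<=Co)))"
proof -
 have L: "1 <= 6 * sepC" using sepC(1) by simp
 from linking[OF L] obtain M c C0 where cC: "0<c" "0<C0" and link: "ALL r x y E F. 0<r --> bd x = r --> connected E --> E<=Om -->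
   (ALL v:E. r <= bd v) --> x:E --> y:E --> connected F --> F <= Om Int cball x (6 * sepC*r) --> x:F --> y:F -->
   K x y <= M & (EX g. geo x y g & (ALL s:{0..K x y}. c*r <= bd (g s) & dist x (g s) <= C0*r))"
  by(elim exE conjE) (rule that; assumption)
 define C where "C = max C0 (2 * sepC+1)"
 have C: "0<C" "C0 <= C" "2 * sepC+1 <= C" using cC by(auto simp: C_def)
 show ?thesis
 proof (rule exI[of _ M], rule exI[of _ c], rule exI[of _ C], intro conjI allI impI cC(1) C(1))
  fix x0 r assume sc: "small_scale x0 r"
  interpret S: scaled_domain Om delta x0 r by unfold_locales (rule sc)
  note x0 = S.x0 and r = S.r_pos
  note mc = S.maxcut_cut
  have pc: "S.piece A" if "is_piece r A" for A using that by(simp add: is_piece_def S.piece_def)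
  have lk: "linked M c C r u y"
   if u: "u:S.maxcut" and y: "y:Om" "geo x0 y g" "!!s. 0<=s ==> s <= K x0 y ==> r <= bd (g s)" and j: "S.joined u y" for u y g
  proof -
   have uOm: "u:Om" "bd u = r" using S.cutD[OF mc[OF u]] by auto
   obtain g' where g': "geo x0 u g'" "!!s. 0<=s ==> s <= K x0 u ==> r <= bd (g' s)" using S.maxcut_star[OF u] by blast
   note i1 = geo_image_connected[OF x0 uOm(1) g'(1)] and i2 = geo_image_connected[OF x0 y(1,2)]
   let ?E = "g' ` {0..K x0 u} Un g ` {0..K x0 y}"
   obtain F where F: "small (6 * sepC*r) F" "u:F" "y:F" using j by(auto simp: S.joined_def)
   have "K u y <= M & (EX g. geo u y g & (ALL s:{0..K u y}. c*r <= bd (g s) & dist u (g s) <= C0*r))"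
   proof (rule link[THEN spec, THEN spec, THEN spec, THEN spec, THEN spec, rule_format, OF r uOm(2)])
    show "connected ?E" using i1 i2 by(intro connected_Un) auto
    show "?E <= Om" "u : ?E" "y : ?E" using i1 i2 by auto
    show "r <= bd v" if "v : ?E" for v using g'(2) y(3) that by auto
    show "connected F" "F <= Om Int cball u (6 * sepC*r)" "u:F" "y:F" using F by(auto simp: small_def)
   qed
   moreover have "C0*r <= C*r" using C r by simp
   ultimately show ?thesis using uOm(1) y(1) unfolding linked_def by(meson order_trans)
  qed
  obtain B where B: "!!z g. z:Om ==> geo x0 z g ==> (ALL s:{0..K x0 z}. r <= bd (g s)) ==> dist x0 z <= B"
   using star_bounded[OF fin x0 r] by blast
  have Bm: "dist x0 u <= B" "u:Om" "bd u = r" if "u:S.maxcut" for u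
   using S.maxcut_star[OF that] B S.cutD[OF mc[OF that]] by(metis atLeastAtMost_iff)+
  have co: "S.core <= Om" by(auto simp: S.core_def)
  have cor: "r <= bd z & dist x0 z <= B" if z: "z:S.core" for z
  proof -
   obtain g where g: "geo x0 z g" "!!s. 0<=s ==> s <= K x0 z ==> r <= bd (g s)" using S.core_star[OF fin z] by blast
   have zOm: "z:Om" using z co by blast
   show ?thesis
    using g(2) K_nonneg[OF x0 zOm] B[OF zOm g(1)] geo_ends[OF g(1)] by force
  qed
  have "decomposition Om delta M c C r B x0 S.core S.base S.far"
  proof unfold_locales
   fix A A' assume A: "is_piece r A" "is_piece r A'" "A Int A' ~= {}" "A Int S.core = {}" "A' Int S.core = {}"
   show "S.base A = S.base A'" if "S.far A" "S.far A'" using S.base_far_eq[OF pc[OF A(1)] that(1) pc[OF A(2)] that(2) A(3)] .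
   assume nf: "~ (S.far A & S.far A')"
   have m: "S.base A:S.maxcut" "S.base A':S.maxcut" using S.base_maxcut pc A by auto
   show "linked M c C r (S.base A) (S.base A')"
    using S.joined_bases[OF pc[OF A(1)] A(4) pc[OF A(2)] A(5)] A(3) S.joined_bases[OF pc[OF A(2)] A(5) pc[OF A(1)] A(4)] nf S.joined_sym S.maxcut_star[OF m(2)] lk[OF m(1) Bm(2)[OF m(2)]] by auto
  next
   fix A A' z assume A: "is_piece r A" "is_piece r A'" "A Int A' ~= {}" "A Int S.core = {}" "z:A' Int S.core"
   have m: "S.base A:S.maxcut" using S.base_maxcut pc A by auto
   have "S.joined (S.base A) z" using S.joined_core[OF pc[OF A(1)] A(4) pc[OF A(2)] A(3)] A(5) by blast
   moreover obtain g where "geo x0 z g" "!!s. 0<=s ==> s <= K x0 z ==> r <= bd (g s)" using S.core_star[OF fin] A(5) by blast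
   ultimately show "linked M c C r (S.base A) z" using lk[OF m] A(5) co by blast
  next
   fix A x assume A: "is_piece r A" "A Int S.core = {}" "~ S.far A" "x:A"
   define u where "u = S.base A"
   have u: "u:S.maxcut" "A Int nbh r u ~= {}" using S.base_near[OF A(2,3)] by(auto simp: u_def)
   have "nbh r u Int A ~= {}" using u by blast
   hence "small (2*(sepC*r)+r) (nbh r u Un A)"
    by(rule small_Un[OF S.nbh_maxcut(2)[OF u(1)] S.pieceD(1)[OF pc[OF A(1)]]])
   hence "dist u x <= 2*(sepC*r)+r" using S.nbh_maxcut(1)[OF u(1)] A(4) by(auto simp: small_def)
   also have "... = (2 * sepC+1)*r" by(simp add: algebra_simps)
   also have "... <= C*r" using C(3) r by simp
   finally show "dist (S.base A) x <= C*r" by(simp add: u_def)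
  qed (use cor Bm S.base_maxcut[OF pc] cC C(1) r co in blast)+
  thus "EX B Co b far. decomposition Om delta M c C r B x0 Co b far &
   (ALL Q. connected Q --> Q<=Om --> x0:Q --> (ALL q:Q. (sepC+1)*r <= bd q) --> Q<=Co)"
   using S.compact_in_core by blast
 qed
qed

end

section \<open>Partial derivatives of smooth functions\<close>

definition up :: "'n => ('n => nat) => 'n => nat" where
 "up i al = al(i := Suc (al i))"

text \<open>The linear map with the partial derivatives \<open>c\<close>, in which form they enter
 \<open>has_derivative\<close>.\<close>

definition lin :: "('n::finite => real) => real^'n => real" where
 "lin c h = (SUM i:UNIV. h $ i*c i)"

lemma mi_order_up [simp]: "mi_order (up i al) = Suc (mi_order al)"
proof -
 have "mi_order (up i al) = up i al i+(SUM j:UNIV - {i}. up i al j)"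
  unfolding mi_order_def by(rule sum.remove) auto
 also have "(SUM j:UNIV - {i}. up i al j) = (SUM j:UNIV - {i}. al j)" by(rule sum.cong) (auto simp: up_def)
 also have "up i al i+... = Suc (al i+(SUM j:UNIV - {i}. al j))" by(simp add: up_def)
 also have "al i+(SUM j:UNIV - {i}. al j) = mi_order al"
  unfolding mi_order_def by(rule sum.remove[symmetric]) auto
 finally show ?thesis .
qed

lemma lin_axis: "lin c (t *\<^sub>R axis i 1) = t*c i"
proof -
 have "lin c (t *\<^sub>R axis i 1) = (SUM j:UNIV. if j = i then t*c j else 0)"
  unfolding lin_def by(rule sum.cong) (auto simp: axis_def)
 thus ?thesis by simp
qed

lemma bounded_linear_lin: "bounded_linear (lin c)"
 unfolding lin_def by(intro bounded_linear_sum bounded_linear_mult_const bounded_linear_vec_nth) 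

lemma has_derivative_axis:
 assumes "(f has_derivative lin c) (at (x+s *\<^sub>R axis i 1))"
 shows "((%t. f (x+t *\<^sub>R axis i 1)) has_real_derivative c i) (at s)"
proof -
 have "((%t. x+t *\<^sub>R axis i 1) has_derivative (%t. t *\<^sub>R axis i 1)) (at s)"
  by(auto intro!: derivative_eq_intros)
 from has_derivative_compose[OF this assms]
 have "((%t. f (x+t *\<^sub>R axis i 1)) has_derivative (%t. lin c (t *\<^sub>R axis i 1))) (at s)" .
 moreover have "(%t. lin c (t *\<^sub>R axis i 1)) = (*) (c i)" by(auto simp: lin_axis)
 ultimately show ?thesis by(simp add: has_field_derivative_def)
qed

lemma partial_eq: "(f has_derivative lin c) (at x) ==> partial i f x = c i"
 unfolding partial_def using has_derivative_axis[of f c x 0 i] by(intro DERIV_imp_deriv) simp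

lemma linear_lin:
 assumes "linear (f :: real^'n::finite => real)" shows "f = lin (%i. f (axis i 1))"
proof
 fix h :: "real^'n"
 have "f h = f (SUM i:UNIV. h $ i *\<^sub>R axis i 1)"
  using basis_expansion[of h] by(simp add: scalar_mult_eq_scaleR)
 also have "... = (SUM i:UNIV. h $ i*f (axis i 1))"
  using assms by(simp add: linear_sum linear_cmul)
 finally show "f h = lin (%i. f (axis i 1)) h" by(simp add: lin_def)
qed

lemma differentiable_partials:
 assumes "f differentiable (at x)" shows "(f has_derivative lin (%i. partial i f x)) (at x)"
proof -
 obtain f' where f': "(f has_derivative f') (at x)" using assms by(auto simp: differentiable_def)
 hence l: "f' = lin (%i. f' (axis i 1))" using linear_lin has_derivative_linear by blast
 hence "partial i f x = f' (axis i 1)" for i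
  by(metis f' partial_eq)
 thus ?thesis using f' l by simp
qed

lemma smooth_has_derivative: "smooth f ==> (f has_derivative lin (%i. partial i f x)) (at x)"
proof -
 assume "smooth f"
 hence "(foldr partial [] f) differentiable_on UNIV" unfolding smooth_def by blast
 thus ?thesis by(intro differentiable_partials) (simp add: differentiable_on_def)
qed

lemma smooth_partial: "smooth f ==> smooth (partial i f)"
 unfolding smooth_def
proof
 fix "is" assume "ALL is. foldr partial is f differentiable_on UNIV"
 hence "foldr partial (is @ [i]) f differentiable_on UNIV" by blast
 thus "foldr partial is (partial i f) differentiable_on UNIV" by simp
qed

lemma smooth_continuous: "smooth f ==> continuous_on S f"
 by(intro continuous_at_imp_continuous_on ballI) (rule has_derivative_continuous[OF smooth_has_derivative])

lemma smooth_axis: "smooth f ==> ((%t. f (x+t *\<^sub>R axis i 1)) has_real_derivative partial i f (x+s *\<^sub>R axis i 1)) (at s)"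
 by(rule has_derivative_axis[OF smooth_has_derivative])

text \<open>The mean value theorem, applied twice to a second difference, turns it into a mixed
 partial derivative at a nearby point.\<close>

lemma second_difference:
 assumes "smooth f" "0<h"
 shows "EX s t. 0<s & s<h & 0<t & t<h &
  f (x+h *\<^sub>R axis i 1+h *\<^sub>R axis j 1) - f (x+h *\<^sub>R axis i 1) - (f (x+h *\<^sub>R axis j 1) - f x)
   = h*h*partial j (partial i f) (x+s *\<^sub>R axis i 1+t *\<^sub>R axis j 1)"
proof -
 define phi where "phi s = f ((x+h *\<^sub>R axis j 1)+s *\<^sub>R axis i 1) - f (x+s *\<^sub>R axis i 1)" for s
 have "DERIV phi s :> partial i f ((x+h *\<^sub>R axis j 1)+s *\<^sub>R axis i 1) - partial i f (x+s *\<^sub>R axis i 1)" for s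
  unfolding phi_def by(intro DERIV_diff smooth_axis assms)
 then obtain s where s: "0<s" "s<h"
  "phi h - phi 0 = (h - 0)*(partial i f ((x+h *\<^sub>R axis j 1)+s *\<^sub>R axis i 1) - partial i f (x+s *\<^sub>R axis i 1))"
  using MVT2[OF assms(2), of phi "%s. partial i f ((x+h *\<^sub>R axis j 1)+s *\<^sub>R axis i 1) - partial i f (x+s *\<^sub>R axis i 1)"] by blast
 define ps where "ps t = partial i f ((x+s *\<^sub>R axis i 1)+t *\<^sub>R axis j 1)" for t
 have "DERIV ps t :> partial j (partial i f) ((x+s *\<^sub>R axis i 1)+t *\<^sub>R axis j 1)" for t
  unfolding ps_def by(intro smooth_axis smooth_partial assms)
 then obtain t where t: "0<t" "t<h"
  "ps h - ps 0 = (h - 0)*partial j (partial i f) ((x+s *\<^sub>R axis i 1)+t *\<^sub>R axis j 1)"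
  using MVT2[OF assms(2), of ps "%t. partial j (partial i f) ((x+s *\<^sub>R axis i 1)+t *\<^sub>R axis j 1)"] by blast
 have "phi h - phi 0 = h*h*partial j (partial i f) (x+s *\<^sub>R axis i 1+t *\<^sub>R axis j 1)"
  using s(3) t(3) by(simp add: ps_def add_ac)
 moreover have "phi h - phi 0 = f (x+h *\<^sub>R axis i 1+h *\<^sub>R axis j 1) - f (x+h *\<^sub>R axis i 1) - (f (x+h *\<^sub>R axis j 1) - f x)"
  by(simp add: phi_def add_ac)
 ultimately show ?thesis using s t by auto
qed

text \<open>The second difference is symmetric in the two directions.\<close>

lemma partial_commute:
 assumes "smooth f" shows "partial i (partial j f) = partial j (partial i f)"
proof (rule ext, rule ccontr)
 fix x assume ne: "partial i (partial j f) x ~= partial j (partial i f) x"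
 define e where "e = abs(partial i (partial j f) x - partial j (partial i f) x)/2"
 have e: "0<e" using ne by(simp add: e_def)
 have c: "isCont (partial i (partial j f)) x" "isCont (partial j (partial i f)) x"
  using smooth_continuous[OF smooth_partial[OF smooth_partial[OF assms]], of UNIV]
  by(auto simp: continuous_on_eq_continuous_at)
 obtain d1 where d1: "d1 > 0" "!!y. dist y x < d1 ==> abs(partial i (partial j f) y - partial i (partial j f) x) < e"
  using c(1)[unfolded continuous_at_eps_delta, rule_format, OF e] by(auto simp: dist_real_def)
 obtain d2 where d2: "d2 > 0" "!!y. dist y x < d2 ==> abs(partial j (partial i f) y - partial j (partial i f) x) < e"
  using c(2)[unfolded continuous_at_eps_delta, rule_format, OF e] by(auto simp: dist_real_def)
 define h where "h = min d1 d2/4"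
 have h: "0<h" "4*h <= d1" "4*h <= d2" using d1 d2 by(auto simp: h_def)
 have near: "dist (x+s *\<^sub>R axis i 1+t *\<^sub>R axis j 1) x < 4*h" if "0<s" "s<h" "0<t" "t<h" for s t and i j :: 'a
 proof -
  have "dist (x+s *\<^sub>R axis i 1+t *\<^sub>R axis j 1) x = norm (s *\<^sub>R axis i 1+t *\<^sub>R axis j 1 :: real^'a)"
   unfolding dist_norm by simp
  also have "... <= norm (s *\<^sub>R axis i 1 :: real^'a)+norm (t *\<^sub>R axis j 1 :: real^'a)" by(rule norm_triangle_ineq)
  also have "... = s+t" using that by simp
  finally show ?thesis using that by simp
 qed
 obtain s t where st: "0<s" "s<h" "0<t" "t<h"
  "f (x+h *\<^sub>R axis i 1+h *\<^sub>R axis j 1) - f (x+h *\<^sub>R axis i 1) - (f (x+h *\<^sub>R axis j 1) - f x)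
   = h*h*partial j (partial i f) (x+s *\<^sub>R axis i 1+t *\<^sub>R axis j 1)" using second_difference[OF assms h(1)] by blast
 obtain s' t' where st': "0<s'" "s'<h" "0<t'" "t'<h"
  "f (x+h *\<^sub>R axis j 1+h *\<^sub>R axis i 1) - f (x+h *\<^sub>R axis j 1) - (f (x+h *\<^sub>R axis i 1) - f x)
   = h*h*partial i (partial j f) (x+s' *\<^sub>R axis j 1+t' *\<^sub>R axis i 1)" using second_difference[OF assms h(1)] by blast
 have sw: "x+h *\<^sub>R axis j 1+h *\<^sub>R axis i 1 = x+h *\<^sub>R axis i 1+h *\<^sub>R axis j 1" by simp
 hence "h*h*partial j (partial i f) (x+s *\<^sub>R axis i 1+t *\<^sub>R axis j 1) =
   h*h*partial i (partial j f) (x+s' *\<^sub>R axis j 1+t' *\<^sub>R axis i 1)"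
  using st(5) st'(5) unfolding sw by linarith
 hence "partial j (partial i f) (x+s *\<^sub>R axis i 1+t *\<^sub>R axis j 1) = partial i (partial j f) (x+s' *\<^sub>R axis j 1+t' *\<^sub>R axis i 1)"
  using h(1) by simp
 moreover have "abs(partial j (partial i f) (x+s *\<^sub>R axis i 1+t *\<^sub>R axis j 1) - partial j (partial i f) x) < e"
  using near[OF st(1-4), of i j] h by(intro d2(2)) simp
 moreover have "abs(partial i (partial j f) (x+s' *\<^sub>R axis j 1+t' *\<^sub>R axis i 1) - partial i (partial j f) x) < e"
  using near[OF st'(1-4), of j i] h by(intro d1(2)) simp
 moreover have "abs(partial i (partial j f) x - partial j (partial i f) x) = 2*e" by(simp add: e_def)
 ultimately show False by simp
qed

lemma smooth_partial_pow: "smooth f ==> smooth ((partial i ^^ m) f)"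
 by(induction m) (auto intro: smooth_partial)

lemma partial_pow_commute:
 assumes "smooth f" shows "partial i ((partial j ^^ m) f) = (partial j ^^ m) (partial i f)"
proof (induction m)
 case (Suc m)
 have "partial i (partial j ((partial j ^^ m) f)) = partial j (partial i ((partial j ^^ m) f))"
  by(rule partial_commute[OF smooth_partial_pow[OF assms]])
 thus ?case using Suc by simp
qed simp

lemma smooth_foldr: "smooth f ==> smooth (foldr (%i. partial i ^^ al i) xs f)"
 by(induction xs) (auto intro: smooth_partial_pow)

lemma foldr_partial_commute:
 "smooth f ==> partial i (foldr (%i. partial i ^^ al i) xs f) = foldr (%i. partial i ^^ al i) xs (partial i f)"
 by(induction xs) (auto simp: partial_pow_commute smooth_foldr)

lemma foldr_partial_up:
 assumes "smooth f" "distinct xs"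
 shows "foldr (%j. partial j ^^ up i al j) xs f =
   (if i:set xs then partial i (foldr (%j. partial j ^^ al j) xs f) else foldr (%j. partial j ^^ al j) xs f)"
 using assms(2)
proof (induction xs)
 case (Cons j xs)
 thus ?case
  using partial_pow_commute[OF smooth_foldr[OF assms(1), of al xs], where i = i and j = j and m = "al j"] by(auto simp: up_def)
qed simp

lemma coords: "distinct (coords :: 'n::finite list)" "set (coords :: 'n list) = UNIV"
proof -
 have "EX is :: 'n list. distinct is & set is = UNIV" using finite_distinct_list[of "UNIV :: 'n set"] by auto
 thus "distinct (coords :: 'n list)" "set (coords :: 'n list) = UNIV"
  unfolding coords_def by(rule someI_ex[THEN conjunct1], rule someI_ex[THEN conjunct2])
qed

lemma multi_partial_up:
 assumes "smooth f"
 shows "multi_partial (up i al) f = partial i (multi_partial al f)"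
  "multi_partial (up i al) f = multi_partial al (partial i f)"
 unfolding multi_partial_def using foldr_partial_up[OF assms coords(1), of i al]
 by(simp_all add: coords(2) foldr_partial_commute[OF assms])

lemma multi_partial_0: "multi_partial (%_. 0) f = f"
proof -
 have "foldr (%i. partial i ^^ 0) xs f = f" for xs by(induction xs) auto
 thus ?thesis by(simp add: multi_partial_def)
qed

lemma unit_mi_up: "unit_mi i = up i (%_. 0)" by(auto simp: unit_mi_def up_def)

lemma multi_partial_unit: "smooth f ==> multi_partial (unit_mi i) f = partial i f"
 by(simp add: unit_mi_up multi_partial_up(1) multi_partial_0)

lemma mi_order_0 [simp]: "mi_order (%_. 0) = 0" by(simp add: mi_order_def)

lemma mi_order_unit [simp]: "mi_order (unit_mi i) = 1" by(simp add: unit_mi_up)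

lemma mi_order_eq_0: "mi_order al = 0 \<longleftrightarrow> al = (%_. 0)"
 by(auto simp: mi_order_def)

lemma mi_order_SucE:
 assumes "mi_order al = Suc m" obtains i be where "al = up i be" "mi_order be = m"
proof -
 have "al ~= (%_. 0)" using assms by auto
 then obtain i where i: "al i ~= 0" by auto
 define be where "be = al(i := al i - 1)"
 have "al = up i be" using i by(auto simp: up_def be_def fun_eq_iff)
 thus ?thesis using that[OF _ ] assms by simp
qed

section \<open>Jets\<close>

text \<open>The family of all partial derivatives up to order \<open>k\<close> of one function.
 The derivatives of order \<open>k\<close> are only continuous, so that Taylor polynomials and
 mollifications of Sobolev functions fit.\<close>

definition is_jet :: "nat => (real^'n::finite) set => (('n => nat) => real^'n => real) => bool" where
 "is_jet k S V \<longleftrightarrow>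
   (ALL al. mi_order al < k --> (ALL x:S. (V al has_derivative lin (%i. V (up i al) x)) (at x))) &
   (ALL al. mi_order al <= k --> (ALL x:S. isCont (V al) x))"

lemma is_jetD: "is_jet k S V ==> mi_order al < k ==> x:S ==> (V al has_derivative lin (%i. V (up i al) x)) (at x)"
 "is_jet k S V ==> mi_order al <= k ==> x:S ==> isCont (V al) x"
 by(auto simp: is_jet_def)

lemma is_jet_subset: "is_jet k S V ==> T<=S ==> is_jet k T V"
 by(auto simp: is_jet_def)

lemma is_jet_all:
 assumes "!!al x. x:S ==> (V al has_derivative lin (%i. V (up i al) x)) (at x)"
 shows "is_jet k S V"
 using assms has_derivative_continuous by(fastforce simp: is_jet_def)

text \<open>This is what makes a locally finite sum with varying summands a jet.\<close>

lemma is_jet_local: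
 fixes V :: "('n::finite => nat) => real^'n => real"
 assumes "!!x. x:S ==> EX B W. open B & x:B & is_jet k B W & (ALL y:B. ALL al. mi_order al <= k --> V al y = W al y)"
 shows "is_jet k S V"
 unfolding is_jet_def
proof (intro conjI allI impI ballI)
 fix al :: "'n => nat" and x assume x: "x:S"
 from assms[OF x] obtain B W where B: "open B" "x:B" "is_jet k B W"
  and eqBW: "ALL y:B. ALL al. mi_order al <= k --> V al y = W al y"
  by auto
 have BW: "V al y = W al y" if "y:B" "mi_order al <= k" for y al using eqBW that by blast
 {
  assume "mi_order al < k"
  hence "(W al has_derivative lin (%i. V (up i al) x)) (at x)"
   using is_jetD(1)[OF B(3) _ B(2)] BW[OF B(2)] by simp
  thus "(V al has_derivative lin (%i. V (up i al) x)) (at x)"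
   by(rule has_derivative_transform_within_open[OF _ B(1,2)]) (use BW `mi_order al < k` in simp)
 }
 assume "mi_order al <= k"
 hence "isCont (W al) x" using is_jetD(2)[OF B(3) _ B(2)] by simp
 moreover have "\<forall>\<^sub>F y in nhds x. W al y = V al y"
  using BW `mi_order al <= k` eventually_nhds_in_open[OF B(1,2)] by(auto elim!: eventually_mono)
 ultimately show "isCont (V al) x" using isCont_cong by blast
qed

lemma is_jet_sum:
 fixes V :: "'b => ('n::finite => nat) => real^'n => real"
 assumes "finite A" "!!a. a:A ==> is_jet k S (V a)"
 shows "is_jet k S (%al x. SUM a:A. V a al x)"
 unfolding is_jet_def
proof (intro conjI allI impI ballI)
 fix al :: "'n => nat" and x assume x: "x:S"
 {
  assume "mi_order al < k"
  hence "((%x. SUM a:A. V a al x) has_derivative (%h. SUM a:A. lin (%i. V a (up i al) x) h)) (at x)"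
   using is_jetD(1)[OF assms(2)] x by(intro has_derivative_sum) auto
  also have "(%h. SUM a:A. lin (%i. V a (up i al) x) h) = lin (%i. SUM a:A. V a (up i al) x)"
   by(rule ext, unfold lin_def, subst sum.swap) (simp add: sum_distrib_left)
  finally show "((%x. SUM a:A. V a al x) has_derivative lin (%i. SUM a:A. V a (up i al) x)) (at x)" .
 }
 assume "mi_order al <= k"
 thus "isCont (%x. SUM a:A. V a al x) x" using is_jetD(2)[OF assms(2)] x by(intro continuous_intros) auto
qed

section \<open>The Leibniz rule\<close>

definition below :: "('n => nat) => ('n => nat) set" where "below al = {be. ALL i. be i <= al i}"

definition mbinom :: "('n::finite => nat) => ('n => nat) => real" where
 "mbinom al be = (PROD i:UNIV. real (al i choose be i))"

text \<open>Leibniz' formula, taken as the definition of the product of two jets.\<close>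

definition jmult where
 "jmult F H = (%al x. SUM be:below al. mbinom al be*(F be x*H (%i. al i - be i) x) :: real)"

lemma finite_below: "finite (below (al :: 'n::finite => nat))"
proof -
 have "below al = Pi\<^sub>E UNIV (%i. {..al i})" by(auto simp: below_def)
 thus ?thesis by(simp add: finite_PiE)
qed

lemma mi_order_below: 
 assumes "be:below al" shows "mi_order be <= mi_order al" "mi_order (%i. al i - be i) = mi_order al - mi_order be"
proof -
 show "mi_order be <= mi_order al" using assms unfolding mi_order_def below_def by(intro sum_mono) auto
 show "mi_order (%i. al i - be i) = mi_order al - mi_order be"
  unfolding mi_order_def using assms by(intro sum_subtractf_nat) (auto simp: below_def)
qed

lemma mbinom_split:
 "mbinom al be = real (al i choose be i)*(PROD j:UNIV - {i}. real (al j choose be j))"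
 unfolding mbinom_def by(rule prod.remove) auto

lemma mbinom_up_up: "mbinom (up i al) (up i be) = mbinom al be+mbinom al (up i be)"
proof -
 have "(PROD j:UNIV - {i}. real (up i al j choose up i be j)) = (PROD j:UNIV - {i}. real (al j choose be j))"
  "(PROD j:UNIV - {i}. real (al j choose up i be j)) = (PROD j:UNIV - {i}. real (al j choose be j))"
  by(rule prod.cong; auto simp: up_def)+
 thus ?thesis
  unfolding mbinom_split[of "up i al" "up i be" i] mbinom_split[of al be i] mbinom_split[of al "up i be" i]
  by(simp add: up_def algebra_simps)
qed

lemma mbinom_up_0: "be i = 0 ==> mbinom (up i al) be = mbinom al be"
proof -
 assume "be i = 0"
 moreover have "(PROD j:UNIV - {i}. real (up i al j choose be j)) = (PROD j:UNIV - {i}. real (al j choose be j))"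
  by(rule prod.cong) (auto simp: up_def)
 ultimately show ?thesis unfolding mbinom_split[of "up i al" be i] mbinom_split[of al be i] by simp
qed

lemma mbinom_zero: "be ~: below al ==> mbinom al be = 0"
 by(force simp: below_def mbinom_def not_le)

lemma inj_up: "inj (up i)"
proof (rule injI, rule ext)
 fix be ga :: "'a => nat" and j assume "up i be = up i ga"
 hence "up i be j = up i ga j" by simp
 thus "be j = ga j" by(simp add: up_def split: if_splits)
qed

text \<open>Pascal's rule in one coordinate, summed over all multi-indices.\<close>

lemma pascal_sum:
 "(SUM be:below (up i al). mbinom (up i al) be*T be) =
  (SUM be:below al. mbinom al be*T (up i be))+(SUM be:below al. mbinom al be*T be)"
proof -
 have sub: "below al <= below (up i al)" "up i ` below al <= below (up i al)"
  by(auto simp: below_def up_def intro: le_SucI)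
 have "below (up i al) = {be:below (up i al). be i = 0} Un up i ` below al"
 proof
  show "below (up i al) <= {be:below (up i al). be i = 0} Un up i ` below al"
  proof
   fix be assume b: "be:below (up i al)"
   show "be:{be:below (up i al). be i = 0} Un up i ` below al"
   proof (cases "be i = 0")
    case False
    have "be = up i (be(i := be i - 1))" using False by(auto simp: up_def)
    moreover have "be(i := be i - 1):below al" using b by(auto simp: below_def up_def split: if_splits)
    ultimately show ?thesis by blast
   qed (use b in simp)
  qed
 qed (use sub in auto)
 moreover have "{be:below (up i al). be i = 0} Int up i ` below al = {}" by(auto simp: up_def)
 ultimately have spl: "(SUM be:below (up i al). Z be) = (SUM be:{be:below (up i al). be i = 0}. Z be)+(SUM be:up i ` below al. Z be)"
  for Z :: "('a => nat) => real"
  using sum.union_disjoint[of "{be:below (up i al). be i = 0}" "up i ` below al" Z] finite_below[of "up i al"] finite_below[of al] by simp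
 have "(SUM be:below (up i al). mbinom (up i al) be*T be) =
   (SUM be:{be:below (up i al). be i = 0}. mbinom (up i al) be*T be)+(SUM be:up i ` below al. mbinom (up i al) be*T be)"
  by(rule spl)
 also have "(SUM be:up i ` below al. mbinom (up i al) be*T be) = (SUM be:below al. mbinom (up i al) (up i be)*T (up i be))"
  by(rule sum.reindex_cong[OF inj_on_subset[OF inj_up]]) auto
 also have "... = (SUM be:below al. mbinom al be*T (up i be))+(SUM be:below al. mbinom al (up i be)*T (up i be))"
  by(simp add: mbinom_up_up sum.distrib algebra_simps)
 also have "(SUM be:below al. mbinom al (up i be)*T (up i be)) = (SUM be:up i ` below al. mbinom al be*T be)"
  by(rule sum.reindex_cong[OF inj_on_subset[OF inj_up], symmetric]) auto
 also have "(SUM be:{be:below (up i al). be i = 0}. mbinom (up i al) be*T be) = (SUM be:{be:below (up i al). be i = 0}. mbinom al be*T be)"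
  by(rule sum.cong) (auto simp: mbinom_up_0)
 moreover have "(SUM be:{be:below (up i al). be i = 0}. mbinom al be*T be)+(SUM be:up i ` below al. mbinom al be*T be)
   = (SUM be:below (up i al). mbinom al be*T be)"
  by(rule spl[symmetric])
 moreover have "(SUM be:below (up i al). mbinom al be*T be) = (SUM be:below al. mbinom al be*T be)"
  by(rule sum.mono_neutral_right[OF finite_below sub(1)]) (auto simp: mbinom_zero)
 ultimately show ?thesis by simp
qed

lemma up_diff: "be:below al ==> (%j. up i al j - be j) = up i (%j. al j - be j)"
 "(%j. up i al j - up i be j) = (%j. al j - be j)"
 by(auto simp: up_def below_def Suc_diff_le)

lemma jmult_up:
 "jmult F H (up i al) x = (SUM be:below al. mbinom al be*(F (up i be) x*H (%j. al j - be j) x+F be x*H (up i (%j. al j - be j)) x))"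
 unfolding jmult_def pascal_sum
 by(simp add: up_diff(2) sum.distrib[symmetric] distrib_left) (rule sum.cong; simp add: up_diff(1))

text \<open>Differentiating either factor of Leibniz' formula gives two sums, which
 \<open>pascal_sum\<close> combines.\<close>

lemma is_jet_mult:
 fixes F H :: "('n::finite => nat) => real^'n => real"
 assumes F: "is_jet k S F" and H: "is_jet k S H" shows "is_jet k S (jmult F H)"
 unfolding is_jet_def
proof (intro conjI allI impI ballI)
 fix al :: "'n => nat" and x assume x: "x:S"
 {
  assume k: "mi_order al < k"
  have o: "mi_order be < k" "mi_order (%i. al i - be i) < k" if "be:below al" for be
   using mi_order_below[OF that] k by auto
  have "((%x. SUM be:below al. mbinom al be*(F be x*H (%i. al i - be i) x)) has_derivative
   (%h. SUM be:below al. mbinom al be*(F be x*lin (%i. H (up i (%i. al i - be i)) x) h+lin (%i. F (up i be) x) h*H (%i. al i - be i) x))) (at x)"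
   using is_jetD(1)[OF F o(1) x] is_jetD(1)[OF H o(2) x]
   by(intro has_derivative_sum has_derivative_mult_right has_derivative_mult) auto
  also have "(%h. SUM be:below al. mbinom al be*(F be x*lin (%i. H (up i (%i. al i - be i)) x) h+lin (%i. F (up i be) x) h*H (%i. al i - be i) x))
   = lin (%i. jmult F H (up i al) x)"
   unfolding jmult_up lin_def
   by(rule ext, simp only: sum_distrib_left sum_distrib_right sum.distrib[symmetric], subst sum.swap)
     (intro sum.cong HOL.refl, simp add: algebra_simps)
  finally show "(jmult F H al has_derivative lin (%i. jmult F H (up i al) x)) (at x)" by(simp add: jmult_def)
 }
 assume k: "mi_order al <= k"
 have o: "mi_order be <= k" "mi_order (%i. al i - be i) <= k" if "be:below al" for be
  using mi_order_below[OF that] k by auto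
 show "isCont (jmult F H al) x"
  unfolding jmult_def using is_jetD(2)[OF F o(1) x] is_jetD(2)[OF H o(2) x] by simp
qed

text \<open>The derivatives of a product of functions of one coordinate each; \<open>f i j\<close>
 is the \<open>j\<close>-th derivative of the factor in coordinate \<open>i\<close>. All kernels,
 partitions of unity, cutoffs and monomials have this form.\<close>

definition prod_jet :: "('n => nat => real => real) => ('n::finite => nat) => real^'n => real" where
 "prod_jet F be x = (PROD i:UNIV. F i (be i) (x $ i))"

lemma prod_jet_derivative:
 assumes "!!i j t. (F i j has_real_derivative F i (Suc j) t) (at t)"
 shows "(prod_jet F be has_derivative lin (%i. prod_jet F (up i be) x)) (at x)"
proof -
 have 1: "((%x. F i (be i) (x $ i)) has_derivative (%h. h $ i*F i (Suc (be i)) (x $ i))) (at x)" for i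
  using has_derivative_compose[OF bounded_linear_imp_has_derivative[OF bounded_linear_vec_nth] assms[of i "be i" "x $ i", unfolded has_field_derivative_def]]
  by(simp add: mult.commute)
 have "((%x. PROD i:UNIV. F i (be i) (x $ i)) has_derivative
   (%h. SUM i:UNIV. (h $ i*F i (Suc (be i)) (x $ i))*(PROD j:UNIV - {i}. F j (be j) (x $ j)))) (at x)"
  by(rule has_derivative_prod[OF 1])
 moreover have "F i (Suc (be i)) (x $ i)*(PROD j:UNIV - {i}. F j (be j) (x $ j)) = prod_jet F (up i be) x" for i
 proof -
  have "prod_jet F (up i be) x = F i (up i be i) (x $ i)*(PROD j:UNIV - {i}. F j (up i be j) (x $ j))"
   unfolding prod_jet_def by(rule prod.remove) auto
  also have "(PROD j:UNIV - {i}. F j (up i be j) (x $ j)) = (PROD j:UNIV - {i}. F j (be j) (x $ j))"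
   by(rule prod.cong) (auto simp: up_def)
  moreover have "up i be i = Suc (be i)" by(simp add: up_def)
  ultimately show ?thesis by simp
 qed
 ultimately show ?thesis by(simp add: prod_jet_def[abs_def] lin_def[abs_def] mult.assoc)
qed

lemma prod_jet_smooth:
 assumes "!!i j t. (F i j has_real_derivative F i (Suc j) t) (at t)"
 shows "smooth (prod_jet F be)" "partial i (prod_jet F be) = prod_jet F (up i be)"
proof -
 show p: "partial i (prod_jet F be) = prod_jet F (up i be)" for i be
  using partial_eq[OF prod_jet_derivative[of F, OF assms]] by blast
 have "EX ga. foldr partial is (prod_jet F be) = prod_jet F ga" for "is"
  by(induction "is") (auto, metis p)
 thus "smooth (prod_jet F be)"
  unfolding smooth_def differentiable_on_def differentiable_def
  by(metis prod_jet_derivative[of F, OF assms])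
qed

section \<open>A smooth step function\<close>

primrec cm :: "nat => (real => real) => bool" where
 "cm 0 f \<longleftrightarrow> (ALL t. (f has_real_derivative deriv f t) (at t))"
| "cm (Suc m) f \<longleftrightarrow> (ALL t. (f has_real_derivative deriv f t) (at t)) & cm m (deriv f)"

lemma cmD: "cm m f ==> (f has_real_derivative deriv f t) (at t)" by(cases m) auto

lemma cm_Suc_imp: "cm (Suc m) f ==> cm m f" by(induction m arbitrary: f) simp_all

lemma cmI: 
 assumes "!!t. (f has_real_derivative f' t) (at t)" "!!m'. m = Suc m' ==> cm m' f'" shows "cm m f"
proof -
 have d: "deriv f = f'" using assms(1) DERIV_imp_deriv by blast
 show ?thesis using assms by(cases m) (auto simp: d)
qed

lemma cm_const: "cm m (%_. c)"
proof (induction m arbitrary: c)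
 case 0 show ?case by simp
next
 case (Suc m) show ?case by(rule cmI[where f' = "%_. 0"]) (use Suc in simp_all)
qed

lemma cm_add: "cm m f ==> cm m g ==> cm m (%t. f t+g t)"
proof (induction m arbitrary: f g)
 case 0
 show ?case
  by(rule cmI[OF DERIV_add[OF cmD[OF 0(1)] cmD[OF 0(2)]]]) simp
next
 case (Suc m)
 show ?case
 proof (rule cmI[where f' = "%t. deriv f t+deriv g t"])
  show "((%t. f t+g t) has_real_derivative deriv f t+deriv g t) (at t)" for t
   by(rule DERIV_add[OF cmD[OF Suc.prems(1)] cmD[OF Suc.prems(2)]])
  show "cm m' (%t. deriv f t+deriv g t)" if "Suc m = Suc m'" for m'
   using Suc that by auto
 qed
qed

lemma cm_mult: "cm m f ==> cm m g ==> cm m (%t. f t*g t)"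
proof (induction m arbitrary: f g)
 case 0
 show ?case
  by(rule cmI[OF DERIV_mult[OF cmD[OF 0(1)] cmD[OF 0(2)]]]) simp
next
 case (Suc m)
 show ?case
 proof (rule cmI[where f' = "%t. deriv f t*g t+deriv g t*f t"])
  show "((%t. f t*g t) has_real_derivative deriv f t*g t+deriv g t*f t) (at t)" for t
   by(rule DERIV_mult[OF cmD[OF Suc.prems(1)] cmD[OF Suc.prems(2)]])
  show "cm m' (%t. deriv f t*g t+deriv g t*f t)" if "Suc m = Suc m'" for m'
  proof -
   have "cm m f" "cm m g" "cm m (deriv f)" "cm m (deriv g)" using Suc.prems cm_Suc_imp by auto
   from cm_add[OF Suc.IH[OF this(3,2)] Suc.IH[OF this(4,1)]]
   show ?thesis using that by simp
  qed
 qed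
qed

lemma cm_inverse: "cm m f ==> (!!t. f t ~= 0) ==> cm m (%t. inverse (f t))"
proof (induction m)
 case 0
 show ?case
  by(rule cmI[OF DERIV_inverse'[OF cmD[OF 0(1)] 0(2)]]) simp
next
 case (Suc m)
 show ?case
 proof (rule cmI[where f' = "%t. - (inverse (f t)*deriv f t*inverse (f t))"])
  show "((%t. inverse (f t)) has_real_derivative - (inverse (f t)*deriv f t*inverse (f t))) (at t)" for t
   by(rule DERIV_inverse'[OF cmD[OF Suc.prems(1)] Suc.prems(2)])
  show "cm m' (%t. - (inverse (f t)*deriv f t*inverse (f t)))" if "Suc m = Suc m'" for m'
  proof -
   have "cm m (%t. (-1)*(inverse (f t)*deriv f t*inverse (f t)))"
    using Suc.IH[OF cm_Suc_imp[OF Suc.prems(1)] Suc.prems(2)] Suc.prems(1) by(intro cm_mult cm_const) simp_all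
   thus ?thesis using that by simp
  qed
 qed
qed

lemma cm_affine: "cm m f ==> cm m (%t. f (a*t+b))"
proof (induction m arbitrary: f)
 case 0
 have l: "((%t. a*t+b) has_real_derivative a) (at t)" for t
  by(auto intro!: derivative_eq_intros)
 show ?case
  by(rule cmI[where f' = "%t. deriv f (a*t+b)*a", OF DERIV_chain2[OF cmD[OF 0] l]]) simp
next
 case (Suc m)
 have l: "((%t. a*t+b) has_real_derivative a) (at t)" for t
  by(auto intro!: derivative_eq_intros)
 show ?case
 proof (rule cmI[where f' = "%t. deriv f (a*t+b)*a"])
  show "((%t. f (a*t+b)) has_real_derivative deriv f (a*t+b)*a) (at t)" for t
   by(rule DERIV_chain2[OF cmD[OF Suc.prems] l])
  show "cm m' (%t. deriv f (a*t+b)*a)" if "Suc m = Suc m'" for m'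
  proof -
   have "cm m (deriv f)" using Suc.prems by simp
   from cm_mult[OF Suc.IH[OF this] cm_const[of m a]] show ?thesis using that by simp
  qed
 qed
qed

lemma cm_deriv_pow: "ALL m. cm m f ==> ALL m. cm m ((deriv ^^ j) f)"
proof (induction j)
 case (Suc j)
 hence "cm (Suc m) ((deriv ^^ j) f)" for m by blast
 thus ?case by simp
qed simp

text \<open>With \<open>p = 1\<close> this is the standard function \<open>exp (- 1/t)\<close>.
 Polynomial factors in \<open>1/t\<close> make the class closed under differentiation.\<close>

definition flat :: "real poly => real => real" where
 "flat p t = (if 0 < t then poly p (1/t)*exp (- (1/t)) else 0)"

lemma poly_exp_0: "((%u. poly p u*exp (- u)) \<longlongrightarrow> 0) (at_top :: real filter)"
proof -
 have "((%u. SUM i<=degree p. coeff p i*(u^i/exp u)) \<longlongrightarrow> (SUM i<=degree p. coeff p i*0)) at_top"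
  by(intro tendsto_intros tendsto_power_div_exp_0)
 thus ?thesis by(simp add: poly_altdef sum_distrib_right exp_minus divide_inverse mult.assoc)
qed

lemma flat_derivative:
 "(flat p has_real_derivative flat (monom 1 2*(p - pderiv p)) t) (at t)"
proof -
 consider "t<0" | "t = 0" | "0<t" by linarith
 thus ?thesis
 proof cases
  case 1
  have "((%_. 0) has_real_derivative 0) (at t)" by simp
  moreover have "flat (monom 1 2*(p - pderiv p)) t = 0" using 1 by(simp add: flat_def)
  ultimately have "((%_. 0) has_real_derivative flat (monom 1 2*(p - pderiv p)) t) (at t)" by simp
  thus ?thesis
   by(rule has_field_derivative_transform_within_open[where S = "{..<0}"]) (use 1 in "auto simp: flat_def")
 next
  case 3
  have "((%t. poly p (1/t)*exp (- (1/t))) has_real_derivative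
    (poly (pderiv p) (1/t)*(- 1/(t*t)))*exp (- (1/t))+exp (- (1/t))*(1/(t*t))*poly p (1/t)) (at t)"
   using 3 by(auto intro!: derivative_eq_intros)
  also have "(poly (pderiv p) (1/t)*(- 1/(t*t)))*exp (- (1/t))+exp (- (1/t))*(1/(t*t))*poly p (1/t)
    = flat (monom 1 2*(p - pderiv p)) t"
   using 3 by(simp add: flat_def poly_monom power2_eq_square algebra_simps)
  finally show ?thesis
   by(rule has_field_derivative_transform_within_open[where S = "{0<..}"]) (use 3 in "auto simp: flat_def")
 next
  case 2
  have "((%h. flat p h/h) \<longlongrightarrow> 0) (at_left 0)"
   by(rule tendsto_eventually) (auto simp: flat_def eventually_at_filter)
  moreover have "((%h. flat p h/h) \<longlongrightarrow> 0) (at_right 0)"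
  proof -
   have "((%h. poly (monom 1 1*p) (inverse h)*exp (- inverse h)) \<longlongrightarrow> 0) (at_right (0::real))"
    by(rule filterlim_compose[OF poly_exp_0 filterlim_inverse_at_top_right])
   thus ?thesis
    by(rule Lim_transform_eventually)
      (auto simp: flat_def eventually_at_filter poly_monom divide_inverse)
  qed
  ultimately have "((%h. flat p h/h) \<longlongrightarrow> 0) (at 0)" by(rule filterlim_split_at)
  thus ?thesis using 2 by(simp add: DERIV_def flat_def)
 qed
qed

lemma cm_flat: "cm m (flat p)"
proof (induction m arbitrary: p)
 case 0 show ?case by(rule cmI[OF flat_derivative]) simp
next
 case (Suc m) show ?case by(rule cmI[OF flat_derivative]) (use Suc in auto)
qed

definition psi :: "real => real" where "psi = flat 1"

lemma psi_pos: "0<t ==> 0 < psi t" "t<=0 ==> psi t = 0" "0 <= psi t"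
 by(auto simp: psi_def flat_def)

definition step_fun :: "real => real" where
 "step_fun t = psi t*inverse (psi t+psi (1 - t))"

lemma psi_sum_pos: "0 < psi t+psi (1 - t)"
 using psi_pos[of t] psi_pos[of "1 - t"] by(cases "0<t") (auto intro: add_pos_nonneg add_nonneg_pos)

lemma cm_step: "cm m step_fun"
proof -
 have "cm m (%t. psi ((-1)*t+1))" unfolding psi_def by(rule cm_affine[OF cm_flat])
 moreover have "(%t. psi ((-1)*t+1)) = (%t. psi (1 - t))" by simp
 ultimately have "cm m (%t. psi (1 - t))" by simp
 moreover have "cm m psi" unfolding psi_def by(rule cm_flat)
 ultimately have "cm m (%t. psi t+psi (1 - t))" by(intro cm_add)
 moreover have "psi t+psi (1 - t) ~= 0" for t using psi_sum_pos[of t] by simp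
 ultimately have "cm m (%t. inverse (psi t+psi (1 - t)))" by(rule cm_inverse)
 with `cm m psi` show ?thesis unfolding step_fun_def[abs_def] by(intro cm_mult)
qed

lemma step_fun_0: "t<=0 ==> step_fun t = 0" by(simp add: step_fun_def psi_pos(2))
lemma step_fun_1: "1<=t ==> step_fun t = 1"
 using psi_pos(1)[of t] by(simp add: step_fun_def psi_pos(2))
lemma step_fun_nonneg: "0 <= step_fun t"
 using psi_sum_pos[of t] psi_pos(3)[of t] by(simp add: step_fun_def)
lemma step_fun_le_1: "step_fun t <= 1"
by(smt (verit) psi_sum_pos[of t] psi_pos(3)[of "1 - t"] divide_le_eq_1_pos step_fun_def divide_inverse)

definition stepD :: "nat => real => real" where "stepD j = (deriv ^^ j) step_fun"

lemma stepD_0: "stepD 0 = step_fun" by(simp add: stepD_def)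

lemma stepD_deriv: "(stepD j has_real_derivative stepD (Suc j) t) (at t)"
 unfolding stepD_def using cm_deriv_pow[of step_fun j] cm_step cmD by simp

lemma stepD_cont: "isCont (stepD j) t" using stepD_deriv DERIV_isCont by blast

lemma stepD_locally_const:
 assumes "open U" "!!t. t:U ==> step_fun t = c" shows "t:U ==> stepD (Suc j) t = 0"
proof (induction j arbitrary: t)
 case 0
 have "((%_. c) has_real_derivative stepD 1 t) (at t)"
  by(rule has_field_derivative_transform_within_open[OF stepD_deriv[of 0 t, unfolded stepD_0 One_nat_def[symmetric]] assms(1) 0]) (use assms in auto)
 thus ?case using DERIV_unique[OF _ DERIV_const] by fastforce
next
 case (Suc j)
 have "((%_. 0) has_real_derivative stepD (Suc (Suc j)) t) (at t)"
  by(rule has_field_derivative_transform_within_open[OF stepD_deriv assms(1) Suc.prems]) (use Suc.IH in auto)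
 thus ?case using DERIV_unique[OF _ DERIV_const] by fastforce
qed

lemma stepD_neg: "t<0 ==> stepD j t = 0"
 using stepD_locally_const[of "{..<0}" 0] step_fun_0 by(cases j) (auto simp: stepD_0)

lemma stepD_gt1: "1<t ==> stepD j t = (if j = 0 then 1 else 0)"
 using stepD_locally_const[of "{1<..}" 1] step_fun_1 by(cases j) (auto simp: stepD_0)

text \<open>At the end points the values follow by continuity.\<close>

lemma stepD_le0: "t<=0 ==> stepD j t = 0"
proof (cases "t<0")
 case False
 assume "t<=0"
 hence t: "t = 0" using False by simp
 have "((%t. stepD j t) \<longlongrightarrow> stepD j 0) (at_left 0)"
  using stepD_cont[where j = j and t = 0] unfolding continuous_within by(rule tendsto_within_subset) auto
 moreover have "((%t. stepD j t) \<longlongrightarrow> 0) (at_left 0)"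
  by(rule tendsto_eventually) (auto simp: stepD_neg eventually_at_filter)
 ultimately show ?thesis using t tendsto_unique[of "at_left (0::real)"] by auto
qed (simp add: stepD_neg)

lemma stepD_ge1: "1<=t ==> stepD j t = (if j = 0 then 1 else 0)"
proof (cases "1<t")
 case False
 assume "1<=t"
 hence t: "t = 1" using False by simp
 have "((%t. stepD j t) \<longlongrightarrow> stepD j 1) (at_right 1)"
  using stepD_cont[where j = j and t = 1] unfolding continuous_within by(rule tendsto_within_subset) auto
 moreover have "((%t. stepD j t) \<longlongrightarrow> (if j = 0 then 1 else 0)) (at_right 1)"
  by(rule tendsto_eventually) (auto simp: stepD_gt1 eventually_at_filter)
 ultimately show ?thesis using t tendsto_unique[of "at_right (1::real)"] by auto
qed (simp add: stepD_gt1)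

lemma stepD_bounded: "EX C>=1. ALL j<=k. ALL t. abs(stepD j t) <= C"
proof (induction k)
 case 0
 show ?case using step_fun_nonneg step_fun_le_1 by(intro exI[of _ 1]) (auto simp: stepD_0)
next
 case (Suc k)
 then obtain C where C: "1<=C" "ALL j<=k. ALL t. abs(stepD j t) <= C" by blast
 have "bounded (stepD (Suc k) ` {0..1})"
  by(intro compact_imp_bounded compact_continuous_image continuous_at_imp_continuous_on) (auto simp: stepD_cont)
 then obtain B where B: "!!t. t:{0..1} ==> abs(stepD (Suc k) t) <= B" unfolding bounded_iff by(metis image_eqI real_norm_def)
 have "0<=B" using B[of 0] by simp
 have b: "abs(stepD (Suc k) t) <= B" for t
  using B[of t] stepD_le0[of t "Suc k"] stepD_ge1[of t "Suc k"] `0 <= B` by(cases "t<=0"; cases "1<=t") auto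
 have "abs(stepD j t) <= max B C" if "j <= Suc k" for j t
 proof (cases "j = Suc k")
  case False
  hence "abs(stepD j t) <= C" using C(2) that by simp
  thus ?thesis by simp
 qed (use b[of t] in simp)
 thus ?case using C by(intro exI[of _ "max B C"]) auto
qed

section \<open>Bumps with integer translates summing to one\<close>

text \<open>A difference of two steps, so that the integer translates telescope to one, with all
 derivatives.\<close>

definition bumpD :: "nat => real => real" where "bumpD j t = stepD j (t+1) - stepD j t"

lemma stepD_shift: "((%t. stepD j (t+c)) has_real_derivative stepD (Suc j) (t+c)) (at t)"
proof -
 have "((%t. t+c) has_real_derivative 1) (at t)" by(auto intro!: derivative_eq_intros)
 from DERIV_chain2[OF stepD_deriv this] show ?thesis by simp
qed

lemma bumpD_deriv: "(bumpD j has_real_derivative bumpD (Suc j) t) (at t)"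
 unfolding bumpD_def[abs_def] by(rule DERIV_diff[OF stepD_shift[of _ 1] stepD_deriv])

lemma bumpD_zero: "1 <= abs t ==> bumpD j t = 0"
 unfolding bumpD_def by(cases "0<=t") (auto simp: stepD_ge1 stepD_le0)

lemma bump_nonneg: "0 <= bumpD 0 t" "bumpD 0 t <= 1"
proof -
 show "0 <= bumpD 0 t"
  unfolding bumpD_def stepD_0 using step_fun_nonneg step_fun_le_1 step_fun_0[of t] step_fun_1[of "t+1"]
  by(cases "0<=t") auto
 show "bumpD 0 t <= 1" unfolding bumpD_def stepD_0 using step_fun_nonneg[of t] step_fun_le_1[of "t+1"] by simp
qed

lemma bump_0: "bumpD 0 0 = 1" by(simp add: bumpD_def stepD_0 step_fun_0 step_fun_1)

lemma bumpD_bounded: "EX C>=1. ALL j<=k. ALL t. abs(bumpD j t) <= C"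
proof -
 obtain C where C: "1<=C" "ALL j<=k. ALL t. abs(stepD j t) <= C" using stepD_bounded by blast
 have "abs(bumpD j t) <= 2*C" if "j<=k" for j t
 proof -
  have "abs(stepD j (t+1)) <= C" "abs(stepD j (t)) <= C" using C(2) that by auto
  thus ?thesis unfolding bumpD_def by simp
 qed
 thus ?thesis using C(1) by(intro exI[of _ "2*C"]) simp
qed

lemma bumpD_sum: "(SUM m:{\<lfloor>t\<rfloor> - 1..\<lfloor>t\<rfloor>+2}. bumpD j (t - of_int m)) = (if j = 0 then 1 else 0)"
proof -
 define a where "a = \<lfloor>t\<rfloor>"
 have a: "of_int a <= t" "t < of_int a+1" unfolding a_def by auto
 have "{a - 1..a+2} = {a - 1, a, a+1, a+2}" by auto
 hence "(SUM m:{a - 1..a+2}. bumpD j (t - of_int m)) =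
   bumpD j (t - of_int a+1)+bumpD j (t - of_int a)+bumpD j (t - of_int a - 1)+bumpD j (t - of_int a - 2)"
  by(simp add: algebra_simps)
 also have "... = stepD j (t - of_int a+2) - stepD j (t - of_int a - 2)"
  unfolding bumpD_def by(simp add: algebra_simps)
 also have "... = (if j = 0 then 1 else 0)" using a by(simp add: stepD_le0 stepD_ge1)
 finally show ?thesis by(simp add: a_def)
qed

definition plateauD :: "nat => real => real" where "plateauD j t = stepD j (t+2) - stepD j (t - 1)"

lemma plateauD_deriv: "(plateauD j has_real_derivative plateauD (Suc j) t) (at t)"
 unfolding plateauD_def[abs_def]
 using DERIV_diff[OF stepD_shift[of j 2 t] stepD_shift[of j "-1" t]] by simp

lemma plateauD_one: "abs t <= 1 ==> plateauD j t = (if j = 0 then 1 else 0)"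
 unfolding plateauD_def by(auto simp: stepD_le0 stepD_ge1)

lemma plateauD_zero: "2 <= abs t ==> plateauD j t = 0"
 unfolding plateauD_def by(cases "0<=t") (auto simp: stepD_ge1 stepD_le0)

lemma plateauD_bounded: "EX C>=1. ALL j<=k. ALL t. abs(plateauD j t) <= C"
proof -
 obtain C where C: "1<=C" "ALL j<=k. ALL t. abs(stepD j t) <= C" using stepD_bounded by blast
 have "abs(plateauD j t) <= 2*C" if "j<=k" for j t
 proof -
  have "abs(stepD j (t+2)) <= C" "abs(stepD j (t - 1)) <= C" using C(2) that by auto
  thus ?thesis unfolding plateauD_def by simp
 qed
 thus ?thesis using C(1) by(intro exI[of _ "2*C"]) simp
qed

section \<open>Integration by parts\<close>

lemma lborel_translate: "distr lborel borel (%x. t+x) = (lborel :: ('a::euclidean_space) measure)"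
 using lborel_affine[of 1 t] by(simp add: density_1)

lemma integral_translate:
 fixes f :: "'a::euclidean_space => real"
 shows "f:borel_measurable borel ==> (LINT x|lborel. f (t+x)) = (LINT x|lborel. f x)"
 by(subst (2) lborel_translate[of t, symmetric]) (simp add: integral_distr)

lemma integrable_translate:
 fixes f :: "'a::euclidean_space => real"
 assumes "integrable lborel f" shows "integrable lborel (%x. f (t+x))"
proof -
 have "integrable (distr lborel borel (%x. t+x)) f" using assms by(simp add: lborel_translate)
 thus ?thesis by(rule integrable_distr[rotated]) simp
qed

lemma compact_support_integrable:
 fixes f :: "'a::euclidean_space => real"
 assumes "continuous_on UNIV f" "!!x. R < norm x ==> f x = 0" shows "integrable lborel f"
proof -
 have "(%x. indicator (cball 0 R) x *\<^sub>R f x) = f" using assms(2) by(auto simp: indicator_def fun_eq_iff)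
 thus ?thesis
  using borel_integrable_compact[OF compact_cball continuous_on_subset[OF assms(1)], of 0 R] by simp
qed

text \<open>The difference quotients of \<open>F\<close> have integral zero by translation
 invariance, and they converge boundedly on a fixed ball. This avoids iterated integrals.\<close>

lemma integral_derivative_zero:
 fixes F :: "real^'n::finite => real"
 assumes F: "!!x. (F has_derivative lin (dF x)) (at x)" and c: "continuous_on UNIV (%x. dF x i)"
  and R: "!!x. R < norm x ==> F x = 0"
 shows "(LINT x|lborel. dF x i) = 0"
proof -
 have cF: "continuous_on UNIV F" by(intro continuous_at_imp_continuous_on ballI has_derivative_continuous[OF F])
 have dR: "dF x i = 0" if "R < norm x" for x
 proof -
  have "open {x::real^'n. R < norm x}" by(intro open_Collect_less continuous_intros)
  hence "((%_. 0) has_derivative lin (dF x)) (at x)"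
   by(rule has_derivative_transform_within_open[OF F]) (use that R in auto)
  hence "lin (dF x) = (%_. 0)" by(rule has_derivative_unique) simp
  hence "lin (dF x) (1 *\<^sub>R axis i 1) = 0" by simp
  thus ?thesis unfolding lin_axis by simp
 qed
 have iF: "integrable lborel F" by(rule compact_support_integrable[OF cF R])
 have "bounded ((%x. dF x i) ` cball 0 R)"
  by(intro compact_imp_bounded compact_continuous_image continuous_on_subset[OF c]) auto
 then obtain B0 where B0: "!!x. x:cball 0 R ==> abs(dF x i) <= B0" unfolding bounded_iff by(metis image_eqI real_norm_def)
 define B where "B = abs B0"
 have B: "abs(dF x i) <= B" for x
  using B0[of x] dR[of x] by(cases "R < norm x") (auto simp: B_def)
 define h where "h m = inverse (real (Suc m))" for m
 have h: "0 < h m" "h m <= 1" for m by(auto simp: h_def field_simps)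
 define s where "s m x = (F (h m *\<^sub>R axis i 1+x) - F x)/h m" for m x
 have sb: "abs(s m x) <= indicator (cball 0 (R+1)) x*B" for m x
 proof (cases "norm x <= R+1")
  case True
  have "((%t. F (x+t *\<^sub>R axis i 1)) has_real_derivative dF (x+t *\<^sub>R axis i 1) i) (at t)" for t
   by(rule has_derivative_axis[OF F])
  then obtain t where "F (x+h m *\<^sub>R axis i 1) - F (x+0 *\<^sub>R axis i 1) = (h m - 0)*dF (x+t *\<^sub>R axis i 1) i"
   using MVT2[OF h(1)[of m], of "%t. F (x+t *\<^sub>R axis i 1)" "%t. dF (x+t *\<^sub>R axis i 1) i"] by blast
  hence "s m x = dF (x+t *\<^sub>R axis i 1) i" using h(1)[of m] by(simp add: s_def add.commute)
  thus ?thesis using B True by simp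
 next
  case False
  show ?thesis
   using norm_triangle_ineq2[of x "- (h m *\<^sub>R axis i 1)"] False h[of m] R by(simp add: add.commute s_def)
 qed
 have mF [measurable]: "F:borel_measurable borel" using cF by(rule borel_measurable_continuous_onI)
 have "(%m. integral\<^sup>L lborel (s m)) \<longlonglongrightarrow> (LINT x|lborel. dF x i)"
 proof (rule integral_dominated_convergence)
  show "(%x. dF x i):borel_measurable lborel" using borel_measurable_continuous_onI[OF c] by simp
  show "s m:borel_measurable lborel" for m unfolding s_def by simp
  show "integrable lborel (%x. indicator (cball 0 (R+1)) x*B :: real)"
   using borel_integrable_compact[OF compact_cball continuous_on_const, of 0 "R+1" B] by simp
  show "AE x in lborel. norm (s m x) <= indicator (cball 0 (R+1)) x*B" for m using sb by simp
  have "(%m. s m x) \<longlonglongrightarrow> dF x i" for x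
  proof -
   have "((%t. F (x+t *\<^sub>R axis i 1)) has_real_derivative dF x i) (at 0)"
    by(rule has_derivative_axis) (simp add: F)
   hence "((%t. (F (x+t *\<^sub>R axis i 1) - F x)/t) \<longlongrightarrow> dF x i) (at 0)" by(simp add: DERIV_def)
   moreover have "filterlim h (at 0) sequentially"
    unfolding filterlim_at h_def using LIMSEQ_inverse_real_of_nat by auto
   ultimately have "((%m. (F (x+h m *\<^sub>R axis i 1) - F x)/h m) \<longlongrightarrow> dF x i) sequentially"
    by(rule filterlim_compose)
   thus ?thesis by(simp add: s_def add.commute)
  qed
  thus "AE x in lborel. (%m. s m x) \<longlonglongrightarrow> dF x i" by simp
 qed
 moreover have s0: "integral\<^sup>L lborel (s m) = 0" for m
  unfolding s_def using iF integrable_translate[OF iF] integral_translate[OF mF] by simp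
 ultimately have "(%m. 0) \<longlonglongrightarrow> (LINT x|lborel. dF x i)" by simp
 thus ?thesis by(rule LIMSEQ_unique[OF _ tendsto_const])
qed

section \<open>Test functions and weak derivatives\<close>

lemma test_functionD:
 assumes "phi:test_functions Om"
 shows "smooth phi" "compact (closure {x. phi x ~= 0})" "closure {x. phi x ~= 0} <= Om"
  "x ~: closure {x. phi x ~= 0} ==> phi x = 0" "x ~: Om ==> phi x = 0"
 using assms closure_subset[of "{x. phi x ~= 0}"] by(auto simp: test_functions_def)

lemma partial_locally_zero:
 fixes phi :: "real^'n::finite => real"
 assumes "x ~: closure {x. phi x ~= 0}" shows "partial i phi x = 0"
proof -
 have "((%_. 0) has_derivative lin (%_. 0)) (at x)" by(simp add: lin_def[abs_def])
 hence "(phi has_derivative lin (%_. 0)) (at x)"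
  by(rule has_derivative_transform_within_open[of _ _ _ _ "- closure {x. phi x ~= 0}"])
    (use assms closure_subset[of "{x. phi x ~= 0}"] in auto)
 thus ?thesis by(rule partial_eq)
qed

lemma partial_test_function:
 fixes phi :: "real^'n::finite => real"
 assumes "phi:test_functions Om" shows "partial i phi:test_functions Om"
proof -
 have "{x. partial i phi x ~= 0} <= closure {x. phi x ~= 0}" using partial_locally_zero by blast
 hence c: "closure {x. partial i phi x ~= 0} <= closure {x. phi x ~= 0}" by(simp add: closure_minimal)
 hence "compact (closure {x. partial i phi x ~= 0})"
  using test_functionD(2)[OF assms] compact_Int_closed[of "closure {x. phi x ~= 0}" "closure {x. partial i phi x ~= 0}"]
  by(simp add: Int_absorb1)
 thus ?thesis unfolding test_functions_def
  by(intro CollectI conjI smooth_partial test_functionD(1)[OF assms] subset_trans[OF c test_functionD(3)[OF assms]])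
qed

lemma multi_partial_test_function:
 fixes phi :: "real^'n::finite => real"
 assumes "phi:test_functions Om" shows "multi_partial al phi:test_functions Om"
proof (induction "mi_order al" arbitrary: al)
 case 0
 thus ?case
  by(smt (verit) mi_order_eq_0[of al] assms multi_partial_0)
next
 case (Suc m)
 then obtain i be where "al = up i be" "mi_order be = m" by(metis mi_order_SucE)
 thus ?case
  using partial_test_function[OF Suc(1)[of be]] multi_partial_up(1)[OF test_functionD(1)[OF assms]] by simp
qed

lemma locally_integrable_times_test:
 assumes "locally_integrable Om u" "phi:test_functions Om"
 shows "set_integrable lebesgue Om (%x. u x*phi x)"
proof -
 define S where "S = closure {x. phi x ~= 0}"
 have S: "compact S" "S<=Om" "!!x. x ~: S ==> phi x = 0" 
  unfolding S_def using test_functionD(2-4)[OF assms(2)] by blast+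
 have c: "continuous_on S phi" by(rule smooth_continuous[OF test_functionD(1)[OF assms(2)]])
 have iu: "integrable lebesgue (%x. indicator S x *\<^sub>R u x)"
  by(metis assms(1) S locally_integrable_def set_integrable_def)
 have "bounded (phi ` S)" by(intro compact_imp_bounded compact_continuous_image c S)
 then obtain B where B: "!!x. x:S ==> abs(phi x) <= B" unfolding bounded_iff by auto
 have m: "phi:borel_measurable lebesgue"
  using borel_measurable_continuous_onI[OF smooth_continuous[OF test_functionD(1)[OF assms(2)]]]
  by(intro measurable_completion) simp
 have "integrable lebesgue (%x. (indicator S x *\<^sub>R u x)*phi x)"
 proof (rule Bochner_Integration.integrable_bound)
  show "integrable lebesgue (%x. B*(indicator S x *\<^sub>R u x))" using iu by simp
  show "(%x. (indicator S x *\<^sub>R u x)*phi x):borel_measurable lebesgue" 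
   by(rule borel_measurable_times[OF borel_measurable_integrable[OF iu] m])
  have "abs(u x*phi x) <= abs(B*u x)" if "x:S" for x
  proof -
   have "abs(u x)*abs(phi x) <= abs(u x)*abs B"
    by(smt (verit) B[OF that] mult_left_mono)
   thus ?thesis by(simp add: abs_mult mult.commute)
  qed
  thus "AE x in lebesgue. norm ((indicator S x *\<^sub>R u x)*phi x) <= norm (B*(indicator S x *\<^sub>R u x))"
   by(intro AE_I2) (simp add: indicator_def)
 qed
 moreover have "(%x. (indicator S x *\<^sub>R u x)*phi x) = (%x. indicator Om x *\<^sub>R (u x*phi x))"
  using S by(auto simp: indicator_def fun_eq_iff)
 ultimately show ?thesis by(simp add: set_integrable_def)
qed

text \<open>The product of a derivative with a test function, extended by zero, has compact
 support; integrate its partial derivative.\<close>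

lemma jet_by_parts:
 fixes V :: "('n::finite => nat) => real^'n => real"
 assumes "open Om" and V: "is_jet k Om V" and k: "mi_order al < k" and phi: "phi:test_functions Om"
 shows "(LINT x:Om|lebesgue. V al x*partial i phi x) = - (LINT x:Om|lebesgue. V (up i al) x*phi x)"
proof -
 define S where "S = closure {x. phi x ~= 0}"
 have S: "compact S" "S<=Om" "!!x. x ~: S ==> phi x = 0" "!!x i. x ~: S ==> partial i phi x = 0"
  
  unfolding S_def using test_functionD(2-4)[OF phi] partial_locally_zero by blast+
 have sm: "smooth phi" using test_functionD(1)[OF phi] .
 define A where "A x = (if x:Om then V al x else 0)" for x
 define D where "D i x = (if x:Om then V (up i al) x else 0)" for i x
 have oS: "open (- S)" using S(1) by(simp add: compact_imp_closed open_Compl)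
 have c0: "continuous_on UNIV (%x. (if x:Om then W x else 0)*ps x)"
  if "!!x. x:Om ==> isCont W x" "continuous_on UNIV ps" "!!x. x ~: S ==> ps x = 0" for W ps :: "real^'n => real"
 proof -
  have "continuous_on (Om Un - S) (%x. (if x:Om then W x else 0)*ps x)"
  proof (rule continuous_on_open_Un[OF assms(1) oS])
   have "continuous_on Om (%x. W x*ps x)"
    using that(1) by(intro continuous_on_mult continuous_at_imp_continuous_on continuous_on_subset[OF that(2)]) auto
   thus "continuous_on Om (%x. (if x:Om then W x else 0)*ps x)" by simp
   have "continuous_on (- S) (%_. 0::real)" by simp
   thus "continuous_on (- S) (%x. (if x:Om then W x else 0)*ps x)" by(rule continuous_on_eq) (simp add: that)
  qed
  moreover have "Om Un - S = UNIV" using S(2) by auto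
  ultimately show ?thesis by simp
 qed
 have cA: "continuous_on UNIV (%x. A x*partial i phi x)" for i
  unfolding A_def using is_jetD(2)[OF V, of al] k S(4) by(intro c0 smooth_continuous smooth_partial sm) auto
 have cD: "continuous_on UNIV (%x. D i x*phi x)" for i
  unfolding D_def using is_jetD(2)[OF V, of "up i al"] k S(3) by(intro c0 smooth_continuous sm) auto
 obtain R where R: "!!x. x:S ==> norm x <= R" using compact_imp_bounded[OF S(1)] by(auto simp: bounded_iff)
 have der: "((%x. A x*phi x) has_derivative lin (%i. D i x*phi x+A x*partial i phi x)) (at x)" for x
 proof (cases "x:Om")
  case True
  have "((%x. V al x*phi x) has_derivative
    (%h. V al x*lin (%i. partial i phi x) h+lin (%i. V (up i al) x) h*phi x)) (at x)"
   by(rule has_derivative_mult[OF is_jetD(1)[OF V k True] smooth_has_derivative[OF sm]])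
  also have "(%h. V al x*lin (%i. partial i phi x) h+lin (%i. V (up i al) x) h*phi x)
    = lin (%i. D i x*phi x+A x*partial i phi x)"
   using True by(simp add: lin_def fun_eq_iff A_def D_def sum_distrib_left sum.distrib algebra_simps)
  finally show ?thesis
   by(rule has_derivative_transform_within_open[OF _ assms(1) True]) (simp add: A_def)
 next
  case False
  hence "x : - S" using S(2) by auto
  have "((%_. 0) has_derivative lin (%i. D i x*phi x+A x*partial i phi x)) (at x)"
   using False by(simp add: A_def D_def lin_def[abs_def])
  thus ?thesis
   by(rule has_derivative_transform_within_open[OF _ oS `x \<in> - S`]) (use S(3) in simp)
 qed
 have "(LINT x|lborel. D i x*phi x+A x*partial i phi x) = 0"
  by(rule integral_derivative_zero[OF der continuous_on_add[OF cD cA], where R = R]) (use R S(3) in force)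
 moreover have "integrable lborel (%x. D i x*phi x)" "integrable lborel (%x. A x*partial i phi x)"
  by(rule compact_support_integrable[OF cD, where R = R], use R S(3) in force,
    rule compact_support_integrable[OF cA, where R = R], use R S(4) in force)
 ultimately have "(LINT x|lborel. A x*partial i phi x) = - (LINT x|lborel. D i x*phi x)" by simp
 moreover have mA: "(%x. A x*partial i phi x):borel_measurable lborel"
  and mD: "(%x. D i x*phi x):borel_measurable lborel"
  using borel_measurable_continuous_onI[OF cA] borel_measurable_continuous_onI[OF cD] by auto
 moreover have "(LINT x:Om|lebesgue. V al x*partial i phi x) = (LINT x|lborel. A x*partial i phi x)"
  unfolding set_lebesgue_integral_def
  by(subst integral_completion[OF mA, symmetric])
    (auto intro!: Bochner_Integration.integral_cong simp: A_def)
 moreover have "(LINT x:Om|lebesgue. V (up i al) x*phi x) = (LINT x|lborel. D i x*phi x)"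
  unfolding set_lebesgue_integral_def
  by(subst integral_completion[OF mD, symmetric])
    (auto intro!: Bochner_Integration.integral_cong simp: D_def)
 ultimately show ?thesis by simp
qed

lemma continuous_locally_integrable:
 assumes "continuous_on Om f" shows "locally_integrable Om f"
 unfolding locally_integrable_def
proof (intro allI impI)
 fix K assume K: "compact K & K<=Om"
 hence "integrable lborel (%x. indicator K x *\<^sub>R f x)"
  by(intro borel_integrable_compact continuous_on_subset[OF assms]) auto
 thus "f absolutely_integrable_on K"
  unfolding set_integrable_def by(subst integrable_completion) auto
qed

lemma jet_weak_deriv:
 fixes V :: "('n::finite => nat) => real^'n => real"
 assumes "open Om" "is_jet k Om V" "mi_order al <= k"
 shows "has_weak_deriv Om al (V (%_. 0)) (V al)"
 using assms(3)
proof (induction "mi_order al" arbitrary: al)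
 have li: "locally_integrable Om (V be)" if "mi_order be <= k" for be
  using is_jetD(2)[OF assms(2) that] by(intro continuous_locally_integrable continuous_at_imp_continuous_on) auto
 case 0
 hence "al = (%_. 0)" using mi_order_eq_0[of al] by simp
 thus ?case using li by(simp add: has_weak_deriv_def multi_partial_0)
next
 have li: "locally_integrable Om (V be)" if "mi_order be <= k" for be
  using is_jetD(2)[OF assms(2) that] by(intro continuous_locally_integrable continuous_at_imp_continuous_on) auto
 case (Suc m)
 then obtain i be where b: "al = up i be" "mi_order be = m" by(metis mi_order_SucE)
 have mk: "m<k" using Suc by simp
 have "(LINT x:Om|lebesgue. V (%_. 0) x*multi_partial al phi x) = (-1)^mi_order al*(LINT x:Om|lebesgue. V al x*phi x)"
  if phi: "phi:test_functions Om" for phi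
  using Suc(1)[of be] b mk partial_test_function[OF phi] jet_by_parts[OF assms(1,2) _ phi, of be i] multi_partial_up(2)[OF test_functionD(1)[OF phi], of i be] by(simp add: has_weak_deriv_def)
 thus ?case using li Suc mk by(simp add: has_weak_deriv_def)
qed

lemma has_weak_deriv_diff:
 assumes "has_weak_deriv Om al u g" "has_weak_deriv Om al v h"
 shows "has_weak_deriv Om al (%x. u x - v x) (%x. g x - h x)"
 unfolding has_weak_deriv_def
proof (intro conjI ballI)
 have l: "locally_integrable Om u" "locally_integrable Om v" "locally_integrable Om g" "locally_integrable Om h"
  using assms by(auto simp: has_weak_deriv_def)
 thus "locally_integrable Om (%x. u x - v x)" "locally_integrable Om (%x. g x - h x)"
  unfolding locally_integrable_def by auto
 fix phi assume phi: "phi:test_functions Om"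
 note i = locally_integrable_times_test[OF _ phi] locally_integrable_times_test[OF _ multi_partial_test_function[OF phi, of al]]
 have "(LINT x:Om|lebesgue. (u x - v x)*multi_partial al phi x)
   = (LINT x:Om|lebesgue. u x*multi_partial al phi x) - (LINT x:Om|lebesgue. v x*multi_partial al phi x)"
  unfolding left_diff_distrib by(rule set_integral_diff(2)[OF i(2)[OF l(1)] i(2)[OF l(2)]])
 moreover have "(LINT x:Om|lebesgue. (g x - h x)*phi x) = (LINT x:Om|lebesgue. g x*phi x) - (LINT x:Om|lebesgue. h x*phi x)"
  unfolding left_diff_distrib by(rule set_integral_diff(2)[OF i(1)[OF l(3)] i(1)[OF l(4)]])
 moreover have "(LINT x:Om|lebesgue. u x*multi_partial al phi x) = (-1)^mi_order al*(LINT x:Om|lebesgue. g x*phi x)"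
  "(LINT x:Om|lebesgue. v x*multi_partial al phi x) = (-1)^mi_order al*(LINT x:Om|lebesgue. h x*phi x)"
  using assms phi by(auto simp: has_weak_deriv_def)
 ultimately show "(LINT x:Om|lebesgue. (u x - v x)*multi_partial al phi x) =
   (-1)^mi_order al*(LINT x:Om|lebesgue. (g x - h x)*phi x)" by(simp add: right_diff_distrib)
qed

text \<open>Test functions are closed under differentiation, so a weak derivative of higher order
 is a weak gradient of the one below.\<close>

lemma has_weak_deriv_unit:
 assumes "has_weak_deriv Om al u g" "has_weak_deriv Om (up i al) u g'"
 shows "has_weak_deriv Om (unit_mi i) g g'"
 unfolding has_weak_deriv_def
proof (intro conjI ballI)
 show "locally_integrable Om g" "locally_integrable Om g'" using assms by(auto simp: has_weak_deriv_def)
 fix phi assume phi: "phi:test_functions Om"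
 have "(LINT x:Om|lebesgue. u x*multi_partial al (partial i phi) x) = (-1)^mi_order al*(LINT x:Om|lebesgue. g x*partial i phi x)"
  using assms(1) partial_test_function[OF phi] by(auto simp: has_weak_deriv_def)
 moreover have "(LINT x:Om|lebesgue. u x*multi_partial (up i al) phi x) = (-1)^mi_order (up i al)*(LINT x:Om|lebesgue. g' x*phi x)"
  using assms(2) phi by(auto simp: has_weak_deriv_def)
 ultimately have "(-1)^mi_order al*(LINT x:Om|lebesgue. g x*partial i phi x) = (-1)^mi_order al*(- (LINT x:Om|lebesgue. g' x*phi x))"
  using multi_partial_up(2)[OF test_functionD(1)[OF phi], of i al] by simp
 hence "(LINT x:Om|lebesgue. g x*partial i phi x) = - (LINT x:Om|lebesgue. g' x*phi x)"
  by(simp only: mult_cancel_left) simp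
 thus "(LINT x:Om|lebesgue. g x*multi_partial (unit_mi i) phi x) = (-1)^mi_order (unit_mi i)*(LINT x:Om|lebesgue. g' x*phi x)"
  by(simp add: multi_partial_unit[OF test_functionD(1)[OF phi]])
qed

section \<open>Powers and averages\<close>

lemma powr_add_le:
 fixes a b p :: real assumes "0<=p"
 shows "abs(a+b) powr p <= 2 powr p*(abs a powr p+abs b powr p)"
proof -
 define m where "m = max (abs a) (abs b)"
 have "abs(a+b) powr p <= (2*m) powr p" by(rule powr_mono2[OF assms]) (auto simp: m_def)
 also have "... = 2 powr p*m powr p" by(rule powr_mult)
 also have "m powr p <= abs a powr p+abs b powr p" by(auto simp: m_def max_def)
 finally show ?thesis by simp
qed

text \<open>The tangent at \<open>m\<close> lies below the convex function
 \<open>a\<^sup>p\<close>; the boundary point \<open>a = 0\<close> is treated by hand.\<close>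

lemma powr_tangent:
 fixes a m p :: real assumes "1<=p" "0<=a" "0<m"
 shows "m powr p+p*m powr (p - 1)*(a - m) <= a powr p"
proof (cases "a = 0")
 case True
 have "m powr p = m powr (p - 1)*m powr 1" by(subst powr_add[symmetric]) simp
 hence "m powr p = m powr (p - 1)*m" using assms by simp
 hence "m powr p+p*m powr (p - 1)*(a - m) = (1 - p)*m powr p" using True by(simp add: algebra_simps)
 also have "... <= 0" using assms by(intro mult_nonpos_nonneg) auto
 finally show ?thesis by(rule order_trans) simp
next
 case False
 have "((%x. x powr p) has_real_derivative p*m powr (p - 1)) (at m within {0<..})"
  using has_real_derivative_powr[OF assms(3), of p] by(rule has_field_derivative_at_within)
 hence "p*m powr (p - 1)*(a - m) <= a powr p - m powr p"
  using assms False
  by(intro convex_on_imp_above_tangent[OF powr_convex[OF assms(1)]]) (auto simp: interior_open)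
 thus ?thesis by simp
qed

text \<open>Jensen's inequality for the mean over a ball: integrate the tangent inequality at the
 mean value.\<close>

lemma ball_mean_powr:
 fixes H :: "'a::euclidean_space => real"
 assumes "1<=p" "0<rho" and H: "!!y. 0 <= H y" "integrable lborel H" "integrable lborel (%y. H y powr p)"
 shows "(LINT y|lborel. H y*indicator (cball x rho) y) powr p
   <= measure lborel (cball x rho) powr (p - 1)*(LINT y|lborel. H y powr p*indicator (cball x rho) y)"
proof -
 define v where "v = measure lborel (cball x rho)"
 have v: "0<v" unfolding v_def using content_cball_pos[OF assms(2)] .
 define I where "I = (LINT y|lborel. H y*indicator (cball x rho) y)"
 define J where "J = (LINT y|lborel. H y powr p*indicator (cball x rho) y)"
 have B: "cball x rho:sets lborel" by simp
 have fin: "emeasure lborel (cball x rho) < \<infinity>" by(rule emeasure_compact_finite) simp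
 have i1: "integrable lborel (%y. H y*indicator (cball x rho) y)" using integrable_real_mult_indicator[OF B H(2)] .
 have i2: "integrable lborel (%y. H y powr p*indicator (cball x rho) y)" using integrable_real_mult_indicator[OF B H(3)] .
 have i3: "integrable lborel (indicator (cball x rho) :: _ => real)" using fin by simp
 have I0: "0<=I" unfolding I_def using H(1) by simp
 have J0: "0<=J" unfolding J_def by simp
 show ?thesis
 proof (cases "I = 0")
  case True
  thus ?thesis using J0 unfolding I_def[symmetric] J_def[symmetric] by simp
 next
  case False
  define m where "m = I/v"
  have m: "0<m" using False I0 v by(simp add: m_def)
  have "(LINT y|lborel. (m powr p - p*m powr (p - 1)*m)*indicator (cball x rho) y+(p*m powr (p - 1))*(H y*indicator (cball x rho) y))
    <= J" unfolding J_def
  proof (rule integral_mono)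
   show "integrable lborel (%y. (m powr p - p*m powr (p - 1)*m)*indicator (cball x rho) y+(p*m powr (p - 1))*(H y*indicator (cball x rho) y))"
    using i1 i3 by simp
   show "integrable lborel (%y. H y powr p*indicator (cball x rho) y)" by(rule i2)
   show "(m powr p - p*m powr (p - 1)*m)*indicator (cball x rho) y+(p*m powr (p - 1))*(H y*indicator (cball x rho) y)
     <= H y powr p*indicator (cball x rho) y" for y
    using powr_tangent[OF assms(1) H(1)[of y] m] by(simp add: indicator_def algebra_simps)
  qed
  moreover have "(LINT y|lborel. (m powr p - p*m powr (p - 1)*m)*indicator (cball x rho) y+(p*m powr (p - 1))*(H y*indicator (cball x rho) y))
    = (m powr p - p*m powr (p - 1)*m) * v+(p*m powr (p - 1))*I"
   using i1 i3 by(subst Bochner_Integration.integral_add) (auto simp: I_def v_def)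
  moreover have "I = m * v" using v by(simp add: m_def)
  ultimately have "m powr p * v <= J" by(simp add: algebra_simps)
  moreover have "I powr p = v powr (p - 1)*(m powr p * v)"
  proof -
   have "I powr p = m powr p * v powr p" using `I = m * v` v by(simp add: powr_mult)
   also have "v powr p = v powr (p - 1) * v powr 1" by(subst powr_add[symmetric]) simp
   finally show ?thesis using v by(simp add: mult_ac)
  qed
  ultimately show ?thesis unfolding I_def[symmetric] J_def[symmetric] v_def[symmetric]
   by(simp add: mult_left_mono)
 qed
qed

section \<open>The \<open>p\<close>-th power of the \<open>L\<^sup>p\<close> seminorm\<close>

text \<open>The integral is taken in \<open>ennreal\<close>, where sums and limits need no
 finiteness, and over a subset, since most functions are controlled on a part of the domain
 only.\<close>

definition Lpow :: "real => 'a measure => 'a set => ('a => real) => ennreal" where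
 "Lpow p M A f = (\<integral>\<^sup>+x\<in>A. ennreal (abs(f x) powr p) \<partial>M)"

lemma Lpow_mono:
 assumes "0<=p" "!!x. x:A ==> x:B & abs(f x) <= abs(g x)" shows "Lpow p M A f <= Lpow p M B g"
 unfolding Lpow_def using assms by(intro nn_integral_mono) (auto simp: indicator_def intro!: ennreal_leI powr_mono2)

lemma Lpow_split:
 assumes "0<=p" "B:sets M" "C:sets M" "v:borel_measurable M" "w:borel_measurable M"
  and "!!x. x:A ==> x:B & abs(u x) <= abs(v x) | x:C & abs(u x) <= abs(w x)"
 shows "Lpow p M A u <= Lpow p M B v+Lpow p M C w"
proof -
 note [measurable] = assms(2-5)
 have "Lpow p M A u <= (\<integral>\<^sup>+x. ennreal (abs(v x) powr p)*indicator B x+ennreal (abs(w x) powr p)*indicator C x \<partial>M)"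
  unfolding Lpow_def
 proof (rule nn_integral_mono)
  fix x
  have "ennreal (abs(u x) powr p) <= ennreal (abs(v x) powr p)" if "abs(u x) <= abs(v x)" for v using that assms(1) by(intro ennreal_leI powr_mono2) auto
  thus "ennreal (abs(u x) powr p)*indicator A x <= ennreal (abs(v x) powr p)*indicator B x+ennreal (abs(w x) powr p)*indicator C x"
   using assms(6)[of x] by(cases "x:A") (auto intro: add_increasing add_increasing2)
 qed
 thus ?thesis by(simp add: Lpow_def nn_integral_add)
qed

lemma Lpow_cmult:
 assumes "f:borel_measurable M" "A:sets M"
 shows "Lpow p M A (%x. c*f x) = ennreal (abs c powr p)*Lpow p M A f"
 using assms unfolding Lpow_def
 by(subst nn_integral_cmult[symmetric]) (auto simp: abs_mult powr_mult ennreal_mult mult.assoc)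

lemma Lpow_const: "A:sets M ==> Lpow p M A (%_. c) = ennreal (abs c powr p)*emeasure M A"
 by(simp add: Lpow_def nn_integral_cmult_indicator)

lemma Lpow_add:
 assumes "0<=p" "A:sets M" "f:borel_measurable M" "g:borel_measurable M"
 shows "Lpow p M A (%x. f x+g x) <= ennreal (2 powr p)*(Lpow p M A f+Lpow p M A g)"
proof -
 have "abs(f x+g x) <= max (abs(2*f x)) (abs(2*g x))" for x by simp
 hence "Lpow p M A (%x. f x+g x) <= Lpow p M A (%x. 2*f x)+Lpow p M A (%x. 2*g x)"
  using assms by(intro Lpow_split) (auto simp: le_max_iff_disj)
 thus ?thesis using assms by(simp only: Lpow_cmult distrib_left abs_numeral)
qed

lemma Lpow_dominated:
 assumes "0<p" and [measurable]: "!!n. u n:borel_measurable M" "w:borel_measurable M" "A:sets M"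
  and "!!n x. x:A ==> abs(u n x) <= abs(w x)" "Lpow p M A w < \<infinity>" "AE x in M. x:A --> (%n. u n x) \<longlonglongrightarrow> 0"
 shows "(%n. Lpow p M A (u n)) \<longlonglongrightarrow> 0"
proof -
 have "(%n. Lpow p M A (u n)) \<longlonglongrightarrow> (\<integral>\<^sup>+x. 0 \<partial>M)" unfolding Lpow_def
 proof (rule nn_integral_dominated_convergence)
  show "AE x in M. ennreal (abs(u n x) powr p)*indicator A x <= ennreal (abs(w x) powr p)*indicator A x" for n
   using assms(1,5) by(intro AE_I2) (auto simp: indicator_def intro!: ennreal_leI powr_mono2)
  show "(\<integral>\<^sup>+x\<in>A. ennreal (abs(w x) powr p) \<partial>M) < \<infinity>" using assms(6) by(simp add: Lpow_def)
  show "AE x in M. (%n. ennreal (abs(u n x) powr p)*indicator A x) \<longlonglongrightarrow> 0" using assms(7)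
  proof eventually_elim
   case (elim x)
   have "(%n. ennreal (abs(u n x) powr p)) \<longlonglongrightarrow> ennreal 0" if "x:A"
    using elim that assms(1) by(intro tendsto_ennrealI tendsto_zero_powrI[where b = p]) (auto intro!: tendsto_rabs_zero)
   thus ?case by(cases "x:A") auto
  qed
 qed measurable
 thus ?thesis by simp
qed

text \<open>Up to a constant the mean over a ball. The radius is \<open>L r\<close> but the
 normalisation is by \<open>r\<close>, so that balls of comparable radii can be compared.\<close>

definition avg :: "real => real => (real^'n::finite => real) => real^'n => real" where
 "avg L r H x = (LINT y|lborel. H y*indicator (cball x (L*r)) y)/r^CARD('n)"

lemma avg_nonneg: "0<=r ==> (!!y. 0 <= H y) ==> 0 <= avg L r H x"
 unfolding avg_def by simp

lemma avg_mono:
 assumes "0<=r" "integrable lborel H" "integrable lborel G" "!!y. 0 <= H y" "!!y. H y <= G y" "cball x (L*r) <= cball z (M*r)"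
 shows "avg L r H x <= avg M r G z"
 unfolding avg_def
proof (intro divide_right_mono integral_mono)
 show "integrable lborel (%y. H y*indicator (cball x (L*r)) y)" "integrable lborel (%y. G y*indicator (cball z (M*r)) y)"
  by(intro integrable_real_mult_indicator assms; simp)+
 have "0 <= G y" for y using assms(4,5)[of y] by simp
 thus "H y*indicator (cball x (L*r)) y <= G y*indicator (cball z (M*r)) y" for y
  using assms(4-6) by(auto simp: indicator_def)
qed (use assms in simp)


text \<open>Averages over balls are bounded on \<open>L\<^sup>p\<close>, uniformly in the radius:
 Jensen's inequality, then exchange the order of integration. Only points of \<open>E\<close> are
 seen from \<open>A\<close>, which localises the bound.\<close>

lemma avg_Lp:
 fixes H :: "real^'n::finite => real"
 assumes p: "1<=p" and L: "0<L" and r: "0<r" and H: "!!y. 0 <= H y" "integrable lborel H" "integrable lborel (%y. H y powr p)"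
  and A: "A:sets borel" "E:sets borel" "!!x y. x:A ==> dist x y <= L*r ==> y:E"
 shows "Lpow p lborel A (avg L r H) <= ennreal ((unit_ball_vol (CARD('n))*L^CARD('n)) powr p)*Lpow p lborel E H"
proof -
 define n where "n = CARD('n)"
 define \<omega> where "\<omega> = unit_ball_vol (real n)"
 define v where "v = \<omega>*(L*r)^n"
 have v: "0<v" using L r by(simp add: v_def \<omega>_def)
 define B where "B x = cball x (L*r)" for x :: "real^'n"
 have vol: "measure lborel (B x) = v" for x using L r by(simp add: B_def content_cball v_def n_def \<omega>_def)
 have evol: "emeasure lborel (B x) = ennreal v" for x
  using emeasure_eq_ennreal_measure[of lborel "B x"] emeasure_compact_finite[of "B x"] vol[of x] by(simp add: B_def)
 have B: "x:B y \<longleftrightarrow> y:B x" for x y by(simp add: B_def dist_commute)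
 have [measurable]: "B x:sets borel" for x by(simp add: B_def)
 define h where "h y = ennreal (H y powr p)" for y
 have [measurable]: "h:borel_measurable borel" "H:borel_measurable borel" "A:sets borel" "E:sets borel"
  using borel_measurable_integrable[OF H(2)] A by(simp_all add: h_def[abs_def])
 define a where "a = v powr (p - 1)/(r^n) powr p"
 have a0: "0<=a" by(simp add: a_def)
 have J: "ennreal (avg L r H x powr p) <= ennreal a*(\<integral>\<^sup>+y\<in>B x. h y \<partial>lborel)" for x
 proof -
  have i: "integrable lborel (%y. H y powr p*indicator (B x) y)" by(intro integrable_real_mult_indicator H) simp
  have "avg L r H x powr p = (LINT y|lborel. H y*indicator (B x) y) powr p/(r^n) powr p"
   unfolding avg_def n_def B_def by(rule powr_divide)
  also have "... <= v powr (p - 1)*(LINT y|lborel. H y powr p*indicator (B x) y)/(r^n) powr p"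
   using ball_mean_powr[OF p _ H, of "L*r" x] L r vol[of x] by(intro divide_right_mono) (auto simp: B_def)
  finally have "ennreal (avg L r H x powr p) <= ennreal (a*(LINT y|lborel. H y powr p*indicator (B x) y))"
   by(intro ennreal_leI) (simp add: a_def mult_ac)
  also have "... = ennreal a*(\<integral>\<^sup>+y. ennreal (H y powr p*indicator (B x) y) \<partial>lborel)"
   using i a0 by(subst nn_integral_eq_integral) (auto simp: ennreal_mult intro!: integral_nonneg_AE)
  also have "... = ennreal a*(\<integral>\<^sup>+y\<in>B x. h y \<partial>lborel)"
   by(intro arg_cong[where f = "(*) _"] nn_integral_cong) (auto simp: indicator_def h_def)
  finally show ?thesis .
 qed
 have "Lpow p lborel A (avg L r H) <= (\<integral>\<^sup>+x. ennreal a*(\<integral>\<^sup>+y. h y*(indicator (B y) x*indicator A x) \<partial>lborel) \<partial>lborel)"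
  unfolding Lpow_def
 proof (rule nn_integral_mono)
  fix x
  show "ennreal (abs(avg L r H x) powr p)*indicator A x <= ennreal a*(\<integral>\<^sup>+y. h y*(indicator (B y) x*indicator A x) \<partial>lborel)"
   using J[of x] avg_nonneg[of r H L x] H(1) r B by(cases "x:A") (auto simp: indicator_def)
 qed
 also have "... = ennreal a*(\<integral>\<^sup>+x. (\<integral>\<^sup>+y. h y*(indicator (B y) x*indicator A x) \<partial>lborel) \<partial>lborel)"
  by(rule nn_integral_cmult) (simp add: B_def indicator_def mem_cball, measurable)
 also have "(\<integral>\<^sup>+x. (\<integral>\<^sup>+y. h y*(indicator (B y) x*indicator A x) \<partial>lborel) \<partial>lborel)
   = (\<integral>\<^sup>+y. (\<integral>\<^sup>+x. h y*(indicator (B y) x*indicator A x) \<partial>lborel) \<partial>lborel)"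
  by(rule lborel_pair.Fubini') (simp add: B_def indicator_def mem_cball, measurable)
 also have "... <= (\<integral>\<^sup>+y. ennreal v * (h y*indicator E y) \<partial>lborel)"
 proof (rule nn_integral_mono)
  fix y
  have "(\<integral>\<^sup>+x. h y*(indicator (B y) x*indicator A x) \<partial>lborel) <= (\<integral>\<^sup>+x. h y*indicator E y*indicator (B y) x \<partial>lborel)"
   using A(3)[of _ y] by(intro nn_integral_mono) (auto simp: indicator_def B_def dist_commute)
  also have "... = h y*indicator E y*ennreal v" by(simp add: nn_integral_cmult_indicator evol)
  finally show "(\<integral>\<^sup>+x. h y*(indicator (B y) x*indicator A x) \<partial>lborel) <= ennreal v * (h y*indicator E y)" by(simp add: mult.commute)
 qed
 also have "... = ennreal v * Lpow p lborel E H"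
  using H(1) by(subst nn_integral_cmult) (auto simp: Lpow_def h_def)
 finally have "Lpow p lborel A (avg L r H) <= ennreal (a * v)*Lpow p lborel E H"
  using v a0 by(simp add: mult_left_mono ennreal_mult mult.assoc)
 also have "a * v = (\<omega>*L^n) powr p"
 proof -
  have "v powr p = v powr (p - 1) * v powr 1" by(subst powr_add[symmetric]) simp
  hence "a * v = (v/r^n) powr p" using v r by(simp add: a_def powr_divide)
  also have "v/r^n = \<omega>*L^n" using r by(simp add: v_def power_mult_distrib)
  finally show ?thesis .
 qed
 finally show ?thesis by(simp add: \<omega>_def n_def)
qed

section \<open>Approximation by bounded continuous functions\<close>

lemma half_add: "eta/2+eta/2 = (eta :: ennreal)"
 using mult_divide_eq_ennreal[of 2 eta]
 by(simp only: mult_2[symmetric] ennreal_times_divide mult.commute[of 2]) simp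

lemma eventually_small:
 fixes X :: "nat => ennreal"
 assumes "X \<longlonglongrightarrow> 0" "c < \<infinity>" "0<eta" shows "\<forall>\<^sub>F m in sequentially. c*X m < eta"
 using ennreal_tendsto_cmult[OF _ assms(1), of c] assms(2,3) by(intro order_tendstoD(2)[where y = 0]) auto

text \<open>Truncate the values, then use that a measurable function is a limit almost everywhere
 of continuous ones, truncated in the same way.\<close>

lemma Lp_continuous_approx:
 fixes h :: "real^'n::finite => real"
 assumes p: "1<=p" and Om: "Om:sets borel" "emeasure lborel Om < \<infinity>" and h: "h:borel_measurable borel"
  "Lpow p lborel Om h < \<infinity>" and eta: "(0::ennreal) < eta"
 shows "EX g M. continuous_on UNIV g & (ALL x. abs(g x) <= M) & Lpow p lborel Om (%x. h x - g x) < eta"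
proof -
 note [measurable] = Om(1) h(1)
 define cl :: "nat => real => real" where "cl m t = max (- real m) (min (real m) t)" for m t
 have clb: "abs(cl m t) <= real m" for m t by(auto simp: cl_def)
 have clc: "continuous_on UNIV (cl m)" for m unfolding cl_def by(intro continuous_intros)
 have [measurable]: "cl m:borel_measurable borel" for m by(rule borel_measurable_continuous_onI[OF clc])
 define c where "c = ennreal (2 powr p)"
 have c: "c < \<infinity>" by(simp add: c_def)
 have eta2: "0 < eta/2" using eta by(simp add: ennreal_zero_less_divide)
 have "(%m. Lpow p lborel Om (%x. h x - cl m (h x))) \<longlonglongrightarrow> 0"
 proof (rule Lpow_dominated[OF _ _ _ _ _ h(2)])
  have "(%m. h x - cl m (h x)) \<longlonglongrightarrow> 0" for x
  proof (rule tendsto_eventually)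
   have "\<forall>\<^sub>F m in sequentially. abs(h x) <= real m" by(meson eventually_at_top_linorder nat_ceiling_le_eq)
   thus "\<forall>\<^sub>F m in sequentially. h x - cl m (h x) = 0" by eventually_elim (auto simp: cl_def)
  qed
  thus "AE x in lborel. x:Om --> (%m. h x - cl m (h x)) \<longlonglongrightarrow> 0" by simp
 qed (use p in "auto simp: cl_def")
 from eventually_small[OF this c eta2] obtain m where m: "c*Lpow p lborel Om (%x. h x - cl m (h x)) < eta/2"
  by(auto simp: eventually_sequentially)
 have "h measurable_on UNIV"
  by(rule lebesgue_measurable_imp_measurable_on) (auto intro: measurable_completion)
 then obtain N g where g: "negligible N" "!!k. continuous_on UNIV (g k)" "!!x. x ~: N ==> (%k. g k x) \<longlonglongrightarrow> h x"
  unfolding measurable_on_def by auto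
 have "AE x in lebesgue. x ~: N" by(rule AE_not_in) (use g(1) in "simp add: negligible_iff_null_sets")
 hence AEN: "AE x in lborel. x ~: N" by(simp add: AE_completion_iff)
 have [measurable]: "g k:borel_measurable borel" for k by(rule borel_measurable_continuous_onI[OF g(2)])
 have "(%k. Lpow p lborel Om (%x. cl m (h x) - cl m (g k x))) \<longlonglongrightarrow> 0"
 proof (rule Lpow_dominated[where w = "%x. 2*real m"])
  show "abs(cl m (h x) - cl m (g k x)) <= abs(2*real m)" for k x using clb[of m "h x"] clb[of m "g k x"] by simp
  show "Lpow p lborel Om (%x. 2*real m) < \<infinity>" using Om by(simp add: Lpow_const ennreal_mult_less_top)
  show "AE x in lborel. x:Om --> (%k. cl m (h x) - cl m (g k x)) \<longlonglongrightarrow> 0" using AEN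
  proof eventually_elim
   case (elim x)
   have "(%k. cl m (g k x)) \<longlonglongrightarrow> cl m (h x)" by(rule continuous_on_tendsto_compose[OF clc g(3)[OF elim]]) auto
   thus ?case using tendsto_diff[OF tendsto_const[of "cl m (h x)"]] by fastforce
  qed
 qed (use p in auto)
 from eventually_small[OF this c eta2] obtain k where k: "c*Lpow p lborel Om (%x. cl m (h x) - cl m (g k x)) < eta/2"
  by(auto simp: eventually_sequentially)
 have "Lpow p lborel Om (%x. h x - cl m (g k x))
   <= c*(Lpow p lborel Om (%x. h x - cl m (h x))+Lpow p lborel Om (%x. cl m (h x) - cl m (g k x)))"
  unfolding c_def using Lpow_add[of p Om lborel "%x. h x - cl m (h x)" "%x. cl m (h x) - cl m (g k x)"] p by simp
 also have "... < eta/2+eta/2" unfolding distrib_left using m k by(rule add_strict_mono)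
 finally have "Lpow p lborel Om (%x. h x - cl m (g k x)) < eta" by(simp add: half_add)
 moreover have "continuous_on UNIV (%x. cl m (g k x))" by(rule continuous_on_compose2[OF clc g(2)]) auto
 ultimately show ?thesis using clb by blast
qed

section \<open>The mollifying kernel\<close>

text \<open>A product of profiles \<open>e 0\<close> of width \<open>tau\<close> centred at
 \<open>x\<close>, differentiated \<open>be\<close> times; the mollifying kernel, the
 partition of unity and the cutoff are of this form.\<close>

definition box_jet :: "(nat => real => real) => real => ('n::finite => nat) => real^'n => real^'n => real" where
 "box_jet e tau be x = prod_jet (%i j t. e j ((t - x $ i)/tau)/tau^j) be"

lemma box_jet_deriv:
 assumes "!!j t. (e j has_real_derivative e (Suc j) t) (at t)"
 shows "(box_jet e tau be x has_derivative lin (%i. box_jet e tau (up i be) x y)) (at y)"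
  "smooth (box_jet e tau be x)" "partial i (box_jet e tau be x) = box_jet e tau (up i be) x"
proof -
 have d: "((%t. e j ((t - c)/tau)/tau^j) has_real_derivative e (Suc j) ((t - c)/tau)/tau^Suc j) (at t)" for j c t
 proof -
  have "((%t. (t - c)/tau) has_real_derivative 1/tau) (at t)" by(intro DERIV_cdivide) (auto intro!: derivative_eq_intros)
  from DERIV_cdivide[OF DERIV_chain2[OF assms this], where c = "tau^j"] show ?thesis by simp
 qed
 let ?f = "%i j t. e j ((t - x $ i)/tau)/tau^j"
 show "(box_jet e tau be x has_derivative lin (%i. box_jet e tau (up i be) x y)) (at y)"
  "smooth (box_jet e tau be x)" "partial i (box_jet e tau be x) = box_jet e tau (up i be) x"
  unfolding box_jet_def by(rule prod_jet_derivative[of ?f] prod_jet_smooth[of ?f], rule d)+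
qed

lemma box_jet_bound:
 fixes be :: "'n::finite => nat" and C :: real
 assumes "ALL j<=k. ALL t. abs(e j t) <= C" "0<tau" "mi_order be <= k"
 shows "abs(box_jet e tau be x y) <= C^CARD('n)/tau^mi_order be"
proof -
 have "be i <= k" for i using member_le_sum[of i UNIV be] assms(3) by(simp add: mi_order_def)
 hence "abs(box_jet e tau be x y) <= (PROD i:UNIV. C/tau^be i)"
  unfolding box_jet_def prod_jet_def abs_prod using assms
  by(intro prod_mono conjI) (auto simp: abs_divide intro!: divide_right_mono)
 thus ?thesis by(simp add: prod_dividef mi_order_def power_sum)
qed

lemma box_jet_zero:
 fixes x y :: "real^'n::finite" and c tau :: real
 assumes e: "!!j t. c <= abs t ==> e j t = 0" and "0<tau" "CARD('n)*(c*tau) < dist x y"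
 shows "box_jet e tau be x y = 0"
proof -
 have "EX i. c*tau <= abs((y - x) $ i)"
 proof (rule ccontr)
  assume "\<nexists>i. c*tau <= abs((y - x) $ i)"
  hence "(SUM i:UNIV. abs((y - x) $ i)) <= (SUM i:(UNIV::'n set). c*tau)" by(intro sum_mono) (meson linear)
  thus False using norm_le_l1_cart[of "y - x"] assms(3) by(simp add: dist_norm norm_minus_commute)
 qed
 then obtain i where "c <= abs((y $ i - x $ i)/tau)" using assms(2) by(auto simp: abs_divide pos_le_divide_eq)
 hence "EX i:UNIV. e (be i) ((y $ i - x $ i)/tau)/tau^be i = 0" using e by(intro bexI[of _ i]) simp_all
 thus ?thesis unfolding box_jet_def prod_jet_def by simp
qed

text \<open>Not normalised; integrals against it are divided by its mass \<open>tau\<^sup>n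
 mass\<close>.\<close>

abbreviation kern :: "real => ('n::finite => nat) => real^'n => real^'n => real" where "kern == box_jet bumpD"

lemmas kern_deriv = box_jet_deriv(1)[of bumpD, OF bumpD_deriv] and kern_smooth = box_jet_deriv(2,3)[of bumpD, OF bumpD_deriv]

lemma kern_shift: "kern tau be x y = kern tau be 0 (y - x)"
 by(simp add: box_jet_def prod_jet_def)

text \<open>The kernel depends on \<open>y - x\<close> only.\<close>

lemma kern_deriv_left: "((%x. kern tau be x y) has_derivative lin (%i. - kern tau (up i be) x y)) (at x)"
proof -
 have "((%x. y - x) has_derivative (%h. - h)) (at x)" by(auto intro!: derivative_eq_intros)
 from has_derivative_compose[OF this kern_deriv[of tau be 0 "y - x"]]
 have "((%x. kern tau be 0 (y - x)) has_derivative (%h. lin (%i. kern tau (up i be) 0 (y - x)) (- h))) (at x)" .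
 moreover have "(%h. lin (%i. kern tau (up i be) 0 (y - x)) (- h)) = lin (%i. - kern tau (up i be) x y)"
  by(rule ext) (simp add: lin_def kern_shift[of tau _ x y])
 ultimately show ?thesis by(simp add: kern_shift[of tau be _ y])
qed

lemma kern_continuous: "continuous_on S (kern tau be x)"
 by(rule smooth_continuous[OF kern_smooth(1)])

lemma kern_support:
 fixes x y :: "real^'n::finite"
 assumes "0<tau" "kern tau be x y ~= 0" shows "dist x y <= real CARD('n)*tau"
 using box_jet_zero[of 1 bumpD, OF bumpD_zero assms(1), of x y be] assms(2) by force

lemma kern_bounded: "EX C>=0. ALL tau>0. ALL x y be. mi_order be <= k --> abs(kern tau be x (y :: real^'n::finite)) <= C/tau^mi_order be"
proof -
 obtain C where "1<=C" "ALL j<=k. ALL t. abs(bumpD j t) <= C" using bumpD_bounded by blast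
 thus ?thesis using box_jet_bound[of k bumpD C] by(intro exI[of _ "C^CARD('n)"]) auto
qed

lemma kern_0: "0 <= kern tau (%_. 0) x y" "kern tau (%_. 0) x y <= 1"
 unfolding box_jet_def prod_jet_def using bump_nonneg by(auto intro!: prod_nonneg prod_le_1)

definition mass :: "'n::finite itself => real" where
 "mass _ = (LINT y|lborel. kern 1 (%_. 0) 0 (y :: real^'n))"

lemma kern_integrable:
 fixes x :: "real^'n::finite"
 assumes "0<tau" shows "integrable lborel (kern tau be x)"
proof (rule compact_support_integrable[OF kern_continuous])
 fix y :: "real^'n" assume "norm x+real CARD('n)*tau < norm y"
 thus "kern tau be x y = 0"
  by(smt (verit) norm_triangle_ineq2[of y x] kern_support[OF assms, of be x y] dist_norm norm_minus_commute)
qed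

lemma mass_pos: "0 < mass TYPE('n::finite)"
proof -
 define k where "k = (kern 1 (%_. 0) 0 :: real^'n => real)"
 have k0: "k 0 = 1" by(simp add: k_def box_jet_def prod_jet_def bump_0)
 have "isCont k 0" using kern_continuous[of UNIV 1 "%_. 0" "0::real^'n"] by(simp add: k_def continuous_on_eq_continuous_at)
 then obtain d where d: "0<d" "!!y. dist y 0 < d ==> dist (k y) (k 0) < 1/2"
  unfolding continuous_at_eps_delta by(metis half_gt_zero zero_less_one)
 have "(LINT y|lborel. indicator (ball (0::real^'n) d) y/2) <= (LINT y|lborel. k y)"
 proof (rule integral_mono)
  show "integrable lborel (%y. indicator (ball (0::real^'n) d) y/2 :: real)"
   using emeasure_bounded_finite[OF bounded_ball, of "0::real^'n" d] by simp
  show "integrable lborel k" unfolding k_def by(rule kern_integrable) simp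
  show "indicator (ball 0 d) y/2 <= k y" for y
  proof (cases "y:ball 0 d")
   case True
   hence "abs(k y - 1) < 1/2" using d(2)[of y] k0 by(simp add: dist_real_def dist_commute)
   hence "1/2 <= k y" unfolding abs_less_iff by simp
   thus ?thesis using True by simp
  next
   case False thus ?thesis using kern_0(1) by(simp add: k_def)
  qed
 qed
 moreover have "(LINT y|lborel. indicator (ball (0::real^'n) d) y/2) = measure lborel (ball (0::real^'n) d)/2" by simp
 moreover have "0 < measure lborel (ball (0::real^'n) d)" by(rule content_ball_pos[OF d(1)])
 ultimately have "0 < (LINT y|lborel. k y)" by linarith
 thus ?thesis by(simp add: mass_def k_def)
qed

lemma kern_integral:
 fixes x :: "real^'n::finite"
 assumes "0<tau" shows "(LINT y|lborel. kern tau (%_. 0) x y) = tau^CARD('n)*mass TYPE('n)"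
proof -
 have m: "kern tau be z:borel_measurable borel" for tau be and z :: "real^'n"
  by(rule borel_measurable_continuous_onI[OF kern_continuous])
 have "(LINT y|lborel. kern tau (%_. 0) x y) = (LINT y|lborel. kern tau (%_. 0) x (x+y))"
  by(rule integral_translate[OF m, symmetric])
 also have "... = (LINT y|lborel. kern tau (%_. 0) 0 (y :: real^'n))" by(simp add: kern_shift[of tau _ x])
 also have "... = (LINT y|(density (distr lborel borel (%x::real^'n. 0+tau *\<^sub>R x)) (%_. abs(tau)^DIM(real^'n))). kern tau (%_. 0) 0 y)"
  using lborel_affine[of tau "0::real^'n"] assms by simp
 also have "... = (LINT y|lborel. tau^CARD('n)*kern tau (%_. 0) 0 (tau *\<^sub>R (y :: real^'n)))"
  using m assms by(subst integral_density) (auto simp: integral_distr)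
 also have "... = (LINT y|lborel. tau^CARD('n)*kern 1 (%_. 0) 0 (y :: real^'n))"
  using assms by(simp add: box_jet_def prod_jet_def)
 finally show ?thesis by(simp add: mass_def)
qed

section \<open>Mollification\<close>

definition mol :: "real => (real^'n::finite => real) => real^'n => real" where
 "mol tau h x = (LINT y|lborel. h y*kern tau (%_. 0) x y)/(tau^CARD('n)*mass TYPE('n))"

lemma times_kern_integrable:
 fixes x :: "real^'n::finite"
 assumes "0<tau" "integrable lborel h" shows "integrable lborel (%y. h y*kern tau be x y)"
proof -
 obtain B where B: "0<=B" "!!y. abs(kern tau be x y) <= B" using kern_bounded[of "mi_order be"] assms(1)
  by(metis divide_nonneg_nonneg less_imp_le order_refl zero_le_power)
 have [measurable]: "kern tau be x:borel_measurable borel" by(rule borel_measurable_continuous_onI[OF kern_continuous])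
 have [measurable]: "h:borel_measurable borel" using borel_measurable_integrable[OF assms(2)] by simp
 show ?thesis
 proof (rule Bochner_Integration.integrable_bound[where f = "%y. B*h y"])
  show "integrable lborel (%y. B*h y)" using assms(2) by simp
  show "AE y in lborel. norm (h y*kern tau be x y) <= norm (B*h y)"
  proof (rule AE_I2)
   fix y
   have "abs(h y)*abs(kern tau be x y) <= abs(h y)*B" using B by(intro mult_left_mono) auto
   thus "norm (h y*kern tau be x y) <= norm (B*h y)" using B by(simp add: abs_mult mult.commute)
  qed
 qed measurable
qed

lemma lin_bound: 
 assumes "!!i. abs(c i) <= B" shows "abs(lin c (h :: real^'n::finite)) <= real CARD('n)*B*norm h"
proof -
 have "abs(lin c h) <= (SUM i:UNIV. abs(h $ i*c i))" unfolding lin_def by simp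
 also have "... <= (SUM i:(UNIV::'n set). norm h*B)"
  using assms component_le_norm_cart[of h] by(intro sum_mono) (auto simp: abs_mult intro!: mult_mono)
 finally show ?thesis by(simp add: mult_ac)
qed

text \<open>Differentiation under the integral sign.\<close>

lemma has_derivative_integral:
 fixes k :: "real^'n::finite => 'b => real"
 assumes k: "!!x y. ((%x. k x y) has_derivative lin (%i. D i x y)) (at x)" and B: "!!i x y. abs(D i x y) <= B"
  and h: "integrable M h" "!!x. integrable M (%y. h y*k x y)" "!!i x. integrable M (%y. h y*D i x y)"
 shows "((%x. \<integral>y. h y*k x y \<partial>M) has_derivative lin (%i. \<integral>y. h y*D i x y \<partial>M)) (at x)"
proof -
 define L where "L = real CARD('n)*B"
 define R where "R x' y = k x' y - k x y - lin (%i. D i x y) (x' - x)" for x' y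
 have Rb: "abs(R x' y) <= 2*L*norm (x' - x)" for x' y
 proof -
  have on: "onorm (lin (%i. D i z y)) <= L" for z
  proof (rule onorm_le)
   show "norm (lin (%i. D i z y) h) <= L*norm h" for h using lin_bound[of "%i. D i z y" B h] B by(simp add: L_def)
  qed
  have "norm (k x' y - k x y) <= L*norm (x' - x)"
   by(rule differentiable_bound[OF convex_UNIV, of "%x. k x y" "%z. lin (%i. D i z y)" L x' x])
     (use k on has_derivative_at_withinI in auto)
  moreover have "abs(lin (%i. D i x y) (x' - x)) <= L*norm (x' - x)" using lin_bound[of "%i. D i x y" B "x' - x"] B by(simp add: L_def)
  ultimately show ?thesis unfolding R_def real_norm_def by simp
 qed
 have iL: "integrable M (%y. h y*lin (%i. D i x y) v)" and eL: "(LINT y|M. h y*lin (%i. D i x y) v) = lin (%i. \<integral>y. h y*D i x y \<partial>M) v" for v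
 proof -
  have "(%y. h y*lin (%i. D i x y) v) = (%y. SUM i:UNIV. v $ i*(h y*D i x y))"
   by(simp add: lin_def sum_distrib_left mult_ac)
  thus "integrable M (%y. h y*lin (%i. D i x y) v)" "(LINT y|M. h y*lin (%i. D i x y) v) = lin (%i. \<integral>y. h y*D i x y \<partial>M) v"
   using h(3) by(simp_all add: lin_def)
 qed
 have iR: "integrable M (%y. h y*R x' y)" for x'
  unfolding R_def right_diff_distrib using h(2) iL by simp
 have eR: "(LINT y|M. h y*R x' y) = (LINT y|M. h y*k x' y) - (LINT y|M. h y*k x y) - lin (%i. \<integral>y. h y*D i x y \<partial>M) (x' - x)" for x'
  unfolding R_def right_diff_distrib using h(2) iL eL by simp
 have "((%x'. (LINT y|M. h y*R x' y)/norm (x' - x)) \<longlongrightarrow> 0) (at x)"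
  unfolding tendsto_at_iff_sequentially comp_def
 proof (intro allI impI)
  fix X assume X: "ALL i. X i:UNIV - {x}" "X \<longlonglongrightarrow> x"
  have nz: "0 < norm (X i - x)" for i using X(1) by simp
  have "(%i. \<integral>y. h y*R (X i) y/norm (X i - x) \<partial>M) \<longlonglongrightarrow> (LINT y|M. 0)"
  proof (rule integral_dominated_convergence[where w = "%y. abs(h y)*(2*L)"])
   show "integrable M (%y. abs(h y)*(2*L))" using h(1) by simp
   show "(%y. h y*R (X i) y/norm (X i - x)):borel_measurable M" for i
    using borel_measurable_integrable[OF iR] by simp
   show "AE y in M. norm (h y*R (X i) y/norm (X i - x)) <= abs(h y)*(2*L)" for i
   proof (rule AE_I2)
    fix y
    have "abs(R (X i) y)/norm (X i - x) <= 2*L" using Rb[of "X i" y] nz[of i] by(simp add: field_simps)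
    hence "abs(h y)*(abs(R (X i) y)/norm (X i - x)) <= abs(h y)*(2*L)" by(rule mult_left_mono) simp
    thus "norm (h y*R (X i) y/norm (X i - x)) <= abs(h y)*(2*L)" by(simp add: abs_mult)
   qed
   have "(%i. h y*R (X i) y/norm (X i - x)) \<longlonglongrightarrow> 0" for y
   proof -
    have "((%x'. norm (R x' y)/norm (x' - x)) \<longlongrightarrow> 0) (at x)"
     using k[of y x] unfolding R_def has_derivative_iff_norm by auto
    hence "((%x'. R x' y/norm (x' - x)) \<longlongrightarrow> 0) (at x)"
     by(rule tendsto_norm_zero_cancel[OF tendsto_cong[THEN iffD1, rotated]]) simp
    hence "(%i. R (X i) y/norm (X i - x)) \<longlonglongrightarrow> 0"
     using X unfolding tendsto_at_iff_sequentially comp_def by blast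
    from tendsto_mult_right_zero[OF this, of "h y"] show ?thesis by simp
   qed
   thus "AE y in M. (%i. h y*R (X i) y/norm (X i - x)) \<longlonglongrightarrow> 0" by simp
  qed simp
  thus "(%i. (LINT y|M. h y*R (X i) y)/norm (X i - x)) \<longlonglongrightarrow> 0" by simp
 qed
 hence "((%x'. norm ((LINT y|M. h y*R x' y))/norm (x' - x)) \<longlongrightarrow> 0) (at x)"
  by(rule tendsto_cong[THEN iffD1, OF _ tendsto_norm_zero, rotated]) simp
 thus ?thesis unfolding has_derivative_iff_norm eR using bounded_linear_lin by blast
qed

lemma mol_derivative:
 fixes h :: "real^'n::finite => real"
 assumes tau: "0<tau" and h: "integrable lborel h"
 shows "(mol tau h has_derivative lin (%i. - (LINT y|lborel. h y*kern tau (unit_mi i) x y)/(tau^CARD('n)*mass TYPE('n)))) (at x)"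
proof -
 have "EX B. ALL i. ALL x y. abs(kern tau (unit_mi i) x (y :: real^'n)) <= B"
  using kern_bounded[of 1, where 'n = 'n] tau by(metis mi_order_unit order_refl)
 then obtain B where B: "!!i x y. abs(kern tau (unit_mi i) x (y :: real^'n)) <= B" by blast
 have "((%x. \<integral>y. h y*kern tau (%_. 0) x y \<partial>lborel) has_derivative
    lin (%i. \<integral>y. h y * - kern tau (unit_mi i) x y \<partial>lborel)) (at x)"
 proof (rule has_derivative_integral)
  show "((%x. kern tau (%_. 0) x y) has_derivative lin (%i. - kern tau (unit_mi i) x y)) (at x)" for x y :: "real^'n"
   using kern_deriv_left[of tau "%_. 0" y x] by(simp add: unit_mi_up)
  show "abs(- kern tau (unit_mi i) x y) <= B" for i and x y :: "real^'n" using B by simp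
  show "integrable lborel (%y. h y * - kern tau (unit_mi i) x y)" for i x
   using times_kern_integrable[OF tau h, of "unit_mi i" x] by simp
 qed (use h times_kern_integrable[OF tau h] in auto)
 from has_derivative_mult_left[OF this, of "inverse (tau^CARD('n)*mass TYPE('n))"]
 have "(mol tau h has_derivative
    (%v. lin (%i. \<integral>y. h y * - kern tau (unit_mi i) x y \<partial>lborel) v * inverse (tau^CARD('n)*mass TYPE('n)))) (at x)"
  unfolding mol_def divide_inverse .
 moreover have "(%v. lin (%i. \<integral>y. h y * - kern tau (unit_mi i) x y \<partial>lborel) v * inverse (tau^CARD('n)*mass TYPE('n)))
   = lin (%i. - (LINT y|lborel. h y*kern tau (unit_mi i) x y)/(tau^CARD('n)*mass TYPE('n)))"
  by(simp add: lin_def fun_eq_iff sum_distrib_right divide_inverse mult.assoc)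
 ultimately show ?thesis by simp
qed

lemma mol_isCont: "0<tau ==> integrable lborel h ==> isCont (mol tau h) x"
 using mol_derivative has_derivative_continuous by blast

lemma mol_measurable: "0<tau ==> integrable lborel h ==> mol tau h:borel_measurable borel"
 by(intro borel_measurable_continuous_onI continuous_at_imp_continuous_on) (simp add: mol_isCont)

lemma mol_bound:
 fixes h :: "real^'n::finite => real"
 assumes tau: "0<tau" and h: "integrable lborel h"
 shows "abs(mol tau h x) <= avg CARD('n) tau (%y. abs(h y)) x/mass TYPE('n)"
proof -
 have "abs(LINT y|lborel. h y*kern tau (%_. 0) x y) <= (LINT y|lborel. abs(h y*kern tau (%_. 0) x y))" by simp
 also have "... <= (LINT y|lborel. abs(h y)*indicator (cball x (real CARD('n)*tau)) y)"
 proof (rule integral_mono)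
  show "integrable lborel (%y. abs(h y*kern tau (%_. 0) x y))" using times_kern_integrable[OF tau h] by simp
  show "integrable lborel (%y. abs(h y)*indicator (cball x (real CARD('n)*tau)) y)"
   using h by(intro integrable_real_mult_indicator) auto
  show "abs(h y*kern tau (%_. 0) x y) <= abs(h y)*indicator (cball x (real CARD('n)*tau)) y" for y
   using kern_0[of tau x y] kern_support[OF tau, of "%_. 0" x y]
   by(cases "kern tau (%_. 0) x y = 0") (auto simp: abs_mult mult_left_le indicator_def)
 qed
 finally show ?thesis unfolding mol_def avg_def abs_divide using tau mass_pos[where 'n = 'n]
  by(simp add: divide_right_mono abs_mult)
qed

lemma mol_diff:
 assumes "0<tau" "integrable lborel g" "integrable lborel h"
 shows "mol tau (%x. g x - h x) x = mol tau g x - mol tau h x"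
 unfolding mol_def left_diff_distrib
 using times_kern_integrable[OF assms(1,2)] times_kern_integrable[OF assms(1,3)] by(simp add: diff_divide_distrib)

section \<open>Mollified weak derivatives\<close>

text \<open>A Borel function that vanishes outside \<open>Om\<close> and agrees with
 \<open>g\<close> on \<open>Om\<close> almost everywhere, so that it can be integrated
 against kernels on the whole space.\<close>

definition represents :: "(real^'n::finite) set => (real^'n => real) => (real^'n => real) => bool" where
 "represents Om g h \<longleftrightarrow> h:borel_measurable borel & (ALL x. x ~: Om --> h x = 0) & (AE x in lborel. x:Om --> g x = h x)"

lemma represents_integral:
 assumes "represents Om g h" "locally_integrable Om g" "phi:test_functions Om"
 shows "(LINT x:Om|lebesgue. g x*phi x) = (LINT x|lborel. h x*phi x)"
proof -
 have m: "h:borel_measurable lborel" "phi:borel_measurable lborel"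
  using assms(1) borel_measurable_continuous_onI[OF smooth_continuous[OF test_functionD(1)[OF assms(3)]]]
  by(auto simp: represents_def)
 have "AE x in lebesgue. x:Om --> g x = h x" using assms(1) by(simp add: represents_def AE_completion_iff AE_completion)
 hence ae: "AE x in lebesgue. indicator Om x *\<^sub>R (g x*phi x) = h x*phi x"
  by(rule eventually_mono) (use assms(1) in "auto simp: represents_def indicator_def")
 have "(LINT x:Om|lebesgue. g x*phi x) = (LINT x|lebesgue. h x*phi x)"
  unfolding set_lebesgue_integral_def
 proof (rule integral_cong_AE[OF _ _ ae])
  show "(%x. indicator Om x *\<^sub>R (g x*phi x)):borel_measurable lebesgue"
   using locally_integrable_times_test[OF assms(2,3)] by(simp add: set_integrable_def)
  show "(%x. h x*phi x):borel_measurable lebesgue"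
   by(intro measurable_completion borel_measurable_times m)
 qed
 also have "... = (LINT x|lborel. h x*phi x)"
  by(rule integral_completion) (intro borel_measurable_times m)
 finally show ?thesis .
qed

lemma represents_ex:
 assumes "Om:sets borel" "g:borel_measurable (lebesgue_on Om)" shows "EX h. represents Om g h"
proof -
 have "(%x. if x:Om then g x else 0):borel_measurable lebesgue"
  using assms by(subst borel_measurable_if) auto
 from completion_ex_borel_measurable_real[OF this]
 obtain g' where g': "g':borel_measurable lborel" "AE x in lborel. (if x:Om then g x else 0) = g' x" by auto
 have "represents Om g (%x. indicator Om x*g' x)"
  unfolding represents_def
 proof (intro conjI)
  show "(%x. indicator Om x*g' x):borel_measurable borel" using g'(1) assms(1) by simp
  show "AE x in lborel. x:Om --> g x = indicator Om x*g' x" using g'(2) by auto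
 qed auto
 thus ?thesis by blast
qed

lemma kern_test_function:
 fixes x :: "real^'n::finite"
 assumes "0<tau" "cball x (real CARD('n)*tau) <= Om" shows "kern tau be x:test_functions Om"
proof -
 have "{y. kern tau be x y ~= 0} <= cball x (real CARD('n)*tau)" using kern_support[OF assms(1)] by auto
 hence c: "closure {y. kern tau be x y ~= 0} <= cball x (real CARD('n)*tau)" by(rule closure_minimal) simp
 thus ?thesis
  using compact_Int_closed[OF compact_cball closed_closure, of x "real CARD('n)*tau" "{y. kern tau be x y ~= 0}"] c assms(2) by(auto simp: Int_absorb1 test_functions_def kern_smooth(1))
qed

text \<open>Test the weak derivative with the kernel centred at \<open>x\<close>.\<close>

lemma mol_weak_derivative:
 fixes g g' h h' :: "real^'n::finite => real"
 assumes "0<tau" and x: "cball x (real CARD('n)*tau) <= Om" and w: "has_weak_deriv Om (unit_mi i) g g'"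
  and r: "represents Om g h" "represents Om g' h'"
 shows "- (LINT y|lborel. h y*kern tau (unit_mi i) x y)/(tau^CARD('n)*mass TYPE('n)) = mol tau h' x"
proof -
 have phi: "kern tau (%_. 0) x:test_functions Om" by(rule kern_test_function[OF assms(1) x])
 have p: "partial i (kern tau (%_. 0) x) = kern tau (unit_mi i) x" by(simp add: kern_smooth(2) unit_mi_up)
 have l: "locally_integrable Om g" "locally_integrable Om g'" using w by(auto simp: has_weak_deriv_def)
 have "- (LINT y|lborel. h y*kern tau (unit_mi i) x y) = (LINT y|lborel. h' y*kern tau (%_. 0) x y)"
  using w phi multi_partial_unit[OF kern_smooth(1)[of tau "%_. 0" x], of i] p represents_integral[OF r(1) l(1) kern_test_function[OF assms(1) x]] represents_integral[OF r(2) l(2) phi] by(auto simp: has_weak_deriv_def)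
 thus ?thesis by(simp add: mol_def)
qed

text \<open>Mollifications of the weak derivatives of a function are the derivatives of one
 function, wherever the kernel stays inside the domain.\<close>

lemma mol_jet:
 fixes g h :: "('n::finite => nat) => real^'n => real"
 assumes "0<tau" and w: "!!al i. mi_order al < k ==> has_weak_deriv Om (unit_mi i) (g al) (g (up i al))"
  and r: "!!al. mi_order al <= k ==> represents Om (g al) (h al)"
  and h: "!!al. mi_order al <= k ==> integrable lborel (h al)"
 shows "is_jet k {x. cball x (real CARD('n)*tau) <= Om} (%al. mol tau (h al))"
 unfolding is_jet_def
proof (intro conjI allI impI ballI)
 fix al :: "'n => nat" and x assume x: "x:{x. cball x (real CARD('n)*tau) <= Om}"
 {
  assume k: "mi_order al < k"
  have "- (LINT y|lborel. h al y*kern tau (unit_mi i) x y)/(tau^CARD('n)*mass TYPE('n)) = mol tau (h (up i al)) x" for i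
   using x k by(intro mol_weak_derivative[OF assms(1) _ w[OF k] r r]) auto
  thus "(mol tau (h al) has_derivative lin (%i. mol tau (h (up i al)) x)) (at x)"
   using mol_derivative[OF assms(1) h, of al x] k by simp
 }
 show "isCont (mol tau (h al)) x" if "mi_order al <= k" using mol_isCont[OF assms(1) h[OF that]] .
qed

section \<open>Convergence of mollifications\<close>

lemma Lp_imp_integrable:
 fixes h :: "real^'n::finite => real"
 assumes p: "1<=p" and Om: "Om:sets borel" "emeasure lborel Om < \<infinity>" and h: "h:borel_measurable borel" "!!x. x ~: Om ==> h x = 0"
  "integrable lborel (%x. abs(h x) powr p)"
 shows "integrable lborel h"
proof (rule Bochner_Integration.integrable_bound)
 show "integrable lborel (%x. abs(h x) powr p+indicator Om x)" using h(3) Om by simp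
 show "AE x in lborel. norm (h x) <= norm (abs(h x) powr p+indicator Om x)"
 proof (rule AE_I2)
  fix x
  show "norm (h x) <= norm (abs(h x) powr p+indicator Om x)"
  proof (cases "1 <= abs(h x)")
   case True
   hence "abs(h x) powr 1 <= abs(h x) powr p" by(intro powr_mono p)
   hence "abs(h x) <= abs(h x) powr p+indicator Om x" using True by(intro add_increasing2) auto
   thus ?thesis by simp
  next
   case False
   show ?thesis
   proof (cases "x:Om")
    case True
    have "0 <= abs(h x) powr p" by simp
    hence "abs(h x) <= abs(h x) powr p+1" using False by linarith
    thus ?thesis using True by simp
   qed (use h in simp)
  qed
 qed
qed (use h in simp)

text \<open>Used twice: with a constant 0 for boundedness and with the value at \<open>x\<close>
 for convergence.\<close>

lemma mol_near_constant:
 fixes h :: "real^'n::finite => real"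
 assumes tau: "0<tau" and h: "integrable lborel h" and e: "!!y. dist x y <= real CARD('n)*tau ==> abs(h y - c) <= e"
 shows "abs(mol tau h x - c) <= e"
proof -
 define Z where "Z = tau^CARD('n)*mass TYPE('n)"
 have Z: "0<Z" using tau mass_pos[where 'n = 'n] by(simp add: Z_def)
 have i1: "integrable lborel (%y. h y*kern tau (%_. 0) x y)" by(rule times_kern_integrable[OF tau h])
 have i2: "integrable lborel (kern tau (%_. 0) x)" by(rule kern_integrable[OF tau])
 have eZ: "(LINT y|lborel. kern tau (%_. 0) x y) = Z" using kern_integral[OF tau, of x] by(simp add: Z_def)
 have "mol tau h x - c = (LINT y|lborel. h y*kern tau (%_. 0) x y - c*kern tau (%_. 0) x y)/Z"
  using i1 i2 eZ Z by(simp add: mol_def Z_def[symmetric] diff_divide_distrib)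
 moreover have "abs(LINT y|lborel. h y*kern tau (%_. 0) x y - c*kern tau (%_. 0) x y) <= e*Z"
 proof -
  have "abs(LINT y|lborel. h y*kern tau (%_. 0) x y - c*kern tau (%_. 0) x y)
   <= (LINT y|lborel. abs(h y*kern tau (%_. 0) x y - c*kern tau (%_. 0) x y))" by simp
  also have "... <= (LINT y|lborel. e*kern tau (%_. 0) x y)"
  proof (rule integral_mono)
   show "integrable lborel (%y. abs(h y*kern tau (%_. 0) x y - c*kern tau (%_. 0) x y))" using i1 i2 by simp
   show "integrable lborel (%y. e*kern tau (%_. 0) x y)" using i2 by simp
   fix y
   have "h y*kern tau (%_. 0) x y - c*kern tau (%_. 0) x y = (h y - c)*kern tau (%_. 0) x y" by(simp add: left_diff_distrib)
   moreover have "abs((h y - c)*kern tau (%_. 0) x y) <= e*kern tau (%_. 0) x y"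
    using e[of y] kern_support[OF tau, of "%_. 0" x y] kern_0(1)[of tau x y]
    by(cases "kern tau (%_. 0) x y = 0") (auto simp: abs_mult intro!: mult_right_mono)
   ultimately show "abs(h y*kern tau (%_. 0) x y - c*kern tau (%_. 0) x y) <= e*kern tau (%_. 0) x y" by simp
  qed
  also have "... = e*Z" using eZ by simp
  finally show ?thesis .
 qed
 ultimately show ?thesis using Z by(simp add: abs_divide pos_divide_le_eq)
qed

lemma avg_measurable: 
 fixes H :: "real^'a::finite => real"
 shows "H:borel_measurable borel ==> avg L r H:borel_measurable borel"
proof -
 assume [measurable]: "H:borel_measurable borel"
 have "avg L r H = (%x. (LINT y|lborel. (if dist x y <= L*r then H y else 0))/r^CARD('a))"
  unfolding avg_def by(intro ext arg_cong2[where f = "(/)"] Bochner_Integration.integral_cong) (auto simp: indicator_def)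
 thus ?thesis by simp
qed

lemma mol_Lp_bound:
 fixes h :: "real^'n::finite => real"
 assumes p: "1<=p" and tau: "0<tau" and h: "integrable lborel h" "integrable lborel (%x. abs(h x) powr p)"
 shows "Lpow p lborel UNIV (mol tau h)
  <= ennreal ((unit_ball_vol (CARD('n))*real CARD('n)^CARD('n)/mass TYPE('n)) powr p)*Lpow p lborel UNIV h"
proof -
 define m where "m = mass TYPE('n)"
 have m: "0<m" unfolding m_def by(rule mass_pos)
 define a where "a = avg CARD('n) tau (%y. abs(h y))"
 have "Lpow p lborel UNIV (mol tau h) <= Lpow p lborel UNIV (%x. inverse m*a x)"
  using p mol_bound[OF tau h(1)] by(intro Lpow_mono) (auto simp: m_def a_def divide_inverse mult.commute intro: order_trans[OF _ abs_ge_self])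
 also have "... = ennreal (inverse m powr p)*Lpow p lborel UNIV a"
  using avg_measurable[of "%y. abs(h y)" "CARD('n)" tau] borel_measurable_integrable[OF h(1)] m by(subst Lpow_cmult) (auto simp: a_def)
 also have "... <= ennreal (inverse m powr p)*(ennreal ((unit_ball_vol (CARD('n))*real CARD('n)^CARD('n)) powr p)*Lpow p lborel UNIV (%y. abs(h y)))"
  unfolding a_def using h p tau by(intro mult_left_mono avg_Lp) auto
 also have "... = ennreal (inverse m powr p*(unit_ball_vol (CARD('n))*real CARD('n)^CARD('n)) powr p)*Lpow p lborel UNIV h"
  by(subst ennreal_mult) (auto simp: mult.assoc Lpow_def)
 also have "inverse m powr p*(unit_ball_vol (CARD('n))*real CARD('n)^CARD('n)) powr p = (unit_ball_vol (CARD('n))*real CARD('n)^CARD('n)/m) powr p"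
  by(simp add: powr_mult[symmetric] divide_inverse mult.commute)
 finally show ?thesis by(simp add: m_def)
qed

text \<open>For bounded continuous functions mollifications converge pointwise inside the open
 set, and dominated convergence applies. The general case follows by density, since mollification
 is bounded on \<open>L\<^sup>p\<close> uniformly in the scale.\<close>

theorem mol_converges:
 fixes h :: "real^'n::finite => real"
 assumes p: "1<=p" and Om: "open Om" "emeasure lborel Om < \<infinity>" and h: "h:borel_measurable borel" "!!x. x ~: Om ==> h x = 0"
  "integrable lborel (%x. abs(h x) powr p)" and tau: "!!m. 0 < tau m" "tau \<longlonglongrightarrow> 0"
 shows "(%m. Lpow p lborel Om (%x. mol (tau m) h x - h x)) \<longlonglongrightarrow> 0"
proof (rule order_tendstoI)
 fix a' :: ennreal assume "0<a'"
 define a where "a = min a' 1"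
 have "a<=1" by(simp add: a_def)
 hence "a<top" using ennreal_one_less_top le_less_trans by blast
 hence a: "0<a" "a<=a'" "a ~= top" using `0 < a'` by(auto simp: a_def)
 have p0: "0<=p" "0<p" using p by auto
 have Omb [measurable]: "Om:sets borel" using Om(1) by simp
 note [measurable] = h(1)
 have ih: "integrable lborel h" by(rule Lp_imp_integrable[OF p Omb Om(2) h])
 define c where "c = ennreal (2 powr p)"
 define C where "C = ennreal ((unit_ball_vol (CARD('n))*real CARD('n)^CARD('n)/mass TYPE('n)) powr p)"
 define D where "D = c*C+c*c"
 have c: "0<c" "c < \<infinity>" "c*c < \<infinity>" by(auto simp: c_def ennreal_mult_less_top)
 have "0 < c*c" using c by(simp add: ennreal_zero_less_mult_iff)
 hence D: "0<D" unfolding D_def by(intro add_nonneg_pos) auto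
 have D': "D < \<infinity>" using c by(auto simp: D_def C_def ennreal_mult_less_top)
 have a2: "0 < a/2" "0 < a/2/D" using a D' by(auto simp: ennreal_zero_less_divide)
 have "Lpow p lborel Om h <= (\<integral>\<^sup>+x. ennreal (abs(h x) powr p) \<partial>lborel)"
  unfolding Lpow_def by(intro nn_integral_mono) (auto simp: indicator_def)
 also have "... < \<infinity>" using h(3) by(simp add: nn_integral_eq_integral)
 finally have "Lpow p lborel Om h < \<infinity>" .
 from Lp_continuous_approx[OF p Omb Om(2) h(1) this a2(2)]
 obtain g M where g: "continuous_on UNIV g" "!!x. abs(g x) <= M" "Lpow p lborel Om (%x. h x - g x) < a/2/D" by blast
 have [measurable]: "g:borel_measurable borel" by(rule borel_measurable_continuous_onI[OF g(1)])
 define G where "G x = indicator Om x*g x" for x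
 have [measurable]: "G:borel_measurable borel" unfolding G_def by simp
 have M0: "0<=M" using g(2)[of 0] by simp
 have Gb: "abs(G x) <= M" for x using g(2)[of x] by(auto simp: G_def indicator_def)
 have iG: "integrable lborel G"
 proof (rule Bochner_Integration.integrable_bound)
  show "integrable lborel (%x. M*indicator Om x)" using Om by simp
  show "AE x in lborel. norm (G x) <= norm (M*indicator Om x)"
   using g(2) M0 by(intro AE_I2) (auto simp: G_def indicator_def)
 qed simp
 have [measurable]: "mol (tau m) h:borel_measurable borel" "mol (tau m) G:borel_measurable borel" for m
  by(rule mol_measurable[OF tau(1)]; fact)+
 have "(%m. Lpow p lborel Om (%x. mol (tau m) G x - g x)) \<longlonglongrightarrow> 0"
 proof (rule Lpow_dominated[where w = "%_. 2*M"])
  have "abs(mol (tau m) G x - 0) <= M" for m x using Gb by(intro mol_near_constant[OF tau(1) iG]) simp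
  thus "abs(mol (tau m) G x - g x) <= abs(2*M)" for m x using g(2)[of x] by(smt (verit) abs_triangle_ineq4)
  show "Lpow p lborel Om (%_. 2*M) < \<infinity>" using Om by(simp add: Lpow_const ennreal_mult_less_top)
  have "(%m. mol (tau m) G x - g x) \<longlonglongrightarrow> 0" if x: "x:Om" for x
  proof (rule tendstoI)
   fix e :: real assume "0<e"
   hence e: "0 < e/2" "e/2 < e" by auto
   have "isCont g x" using g(1) by(simp add: continuous_on_eq_continuous_at)
   then obtain d1 where d1: "0<d1" "!!y. dist y x < d1 ==> dist (g y) (g x) < e/2"
    using e(1) unfolding continuous_at_eps_delta by blast
   obtain d2 where d2: "0<d2" "ball x d2 <= Om" using Om(1) x open_contains_ball by blast
   have "(%m. real CARD('n)*tau m) \<longlonglongrightarrow> 0" using tendsto_mult_right_zero[OF tau(2)] by blast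
   hence "\<forall>\<^sub>F m in sequentially. real CARD('n)*tau m < min d1 d2" using d1 d2 by(intro order_tendstoD(2)) auto
   thus "\<forall>\<^sub>F m in sequentially. dist (mol (tau m) G x - g x) 0 < e"
   proof eventually_elim
    case (elim m)
    have "abs(mol (tau m) G x - g x) <= e/2"
    proof (rule mol_near_constant[OF tau(1) iG])
     fix y assume "dist x y <= real CARD('n)*tau m"
     hence y: "dist y x < d1" "dist x y < d2" using elim by(auto simp: dist_commute)
     hence "y:Om" using d2(2) by auto
     thus "abs(G y - g x) <= e/2" using d1(2)[OF y(1)] by(simp add: G_def dist_real_def)
    qed
    thus ?case using e by(simp add: dist_real_def)
   qed
  qed
  thus "AE x in lborel. x:Om --> (%m. mol (tau m) G x - g x) \<longlonglongrightarrow> 0" by simp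
 qed (use p in auto)
 from eventually_small[OF this c(3) a2(1)]
 show "\<forall>\<^sub>F m in sequentially. Lpow p lborel Om (%x. mol (tau m) h x - h x) < a'"
 proof eventually_elim
  case (elim m)
  define F where "F y = h y - G y" for y
  have iF: "integrable lborel F" unfolding F_def using ih iG by simp
  have [measurable]: "F:borel_measurable borel" unfolding F_def by simp
  have [measurable]: "mol (tau m) F:borel_measurable borel" by(rule mol_measurable[OF tau(1) iF])
  have FI: "Lpow p lborel UNIV F = Lpow p lborel Om (%x. h x - g x)"
   unfolding Lpow_def using h(2) p0 by(intro nn_integral_cong) (auto simp: F_def G_def indicator_def)
  have iFp: "integrable lborel (%x. abs(F x) powr p)"
  proof (rule integrableI_nonneg)
   show "(\<integral>\<^sup>+x. ennreal (abs(F x) powr p) \<partial>lborel) < \<infinity>"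
    using FI order_less_le_trans[OF g(3) top_greatest] by(simp add: Lpow_def)
  qed auto
  have "Lpow p lborel Om (%x. mol (tau m) h x - h x) <= Lpow p lborel Om (%x. mol (tau m) F x+((mol (tau m) G x - g x) + - F x))"
   using mol_diff[OF tau(1) ih iG] by(intro Lpow_mono p0) (simp add: F_def[abs_def] G_def)
  also have "... <= c*(Lpow p lborel Om (mol (tau m) F)+Lpow p lborel Om (%x. (mol (tau m) G x - g x) + - F x))"
   unfolding c_def by(rule Lpow_add) (use p0 in auto)
  also have "... <= c*(C*Lpow p lborel UNIV F+c*(Lpow p lborel Om (%x. mol (tau m) G x - g x)+Lpow p lborel UNIV F))"
  proof (intro mult_left_mono add_mono)
   have "Lpow p lborel Om (mol (tau m) F) <= Lpow p lborel UNIV (mol (tau m) F)" by(intro Lpow_mono p0) simp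
   also have "... <= C*Lpow p lborel UNIV F" unfolding C_def by(rule mol_Lp_bound[OF p tau(1) iF iFp])
   finally show "Lpow p lborel Om (mol (tau m) F) <= C*Lpow p lborel UNIV F" .
   have "Lpow p lborel Om (%x. - F x) <= Lpow p lborel UNIV F" by(intro Lpow_mono p0) simp
   hence "c*(Lpow p lborel Om (%x. mol (tau m) G x - g x)+Lpow p lborel Om (%x. - F x)) <= c*(Lpow p lborel Om (%x. mol (tau m) G x - g x)+Lpow p lborel UNIV F)"
    by(intro mult_left_mono add_left_mono) auto
   thus "Lpow p lborel Om (%x. (mol (tau m) G x - g x) + - F x) <= c*(Lpow p lborel Om (%x. mol (tau m) G x - g x)+Lpow p lborel UNIV F)"
    unfolding c_def by(rule order_trans[rotated, OF _ Lpow_add]) (use p0 in auto)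
  qed auto
  also have "... = D*Lpow p lborel UNIV F+c*c*Lpow p lborel Om (%x. mol (tau m) G x - g x)" by(simp add: D_def algebra_simps)
  also have "... <= D*(a/2/D)+c*c*Lpow p lborel Om (%x. mol (tau m) G x - g x)"
   using g(3) FI by(intro add_right_mono mult_left_mono) auto
  also have "D*(a/2/D) = a/2"
  proof -
   have "a/2*D/D = a/2" by(rule mult_divide_eq_ennreal) (use D D' in auto)
   thus ?thesis unfolding ennreal_times_divide[of D "a/2" D] by(simp only: mult.commute[of D])
  qed
  also have "a/2+c*c*Lpow p lborel Om (%x. mol (tau m) G x - g x) < a/2+a/2"
   using elim a(3) by(simp add: ennreal_divide_eq_top_iff)
  finally show ?case unfolding half_add using a(2) by(rule less_le_trans)
 qed
qed simp

section \<open>Taylor polynomials\<close>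

text \<open>The \<open>c\<close>-th derivative of \<open>t\<^sup>b / b!\<close>.\<close>

definition pw :: "nat => nat => real => real" where
 "pw b c t = (if c <= b then t^(b - c)/fact (b - c) else 0)"

lemma pw_deriv: "(pw b c has_real_derivative pw b (Suc c) t) (at t)"
proof (cases "c<b")
 case True
 then obtain d where b: "b = Suc (c+d)" using less_iff_Suc_add by auto
 have "((%t. t^Suc d/fact (Suc d)) has_real_derivative (real (Suc d)*t^d)/fact (Suc d)) (at t)"
  using DERIV_pow[of "Suc d" t] by(intro DERIV_cdivide) simp
 moreover have "(real (Suc d)*t^d)/fact (Suc d) = t^d/fact d" by simp
 moreover have "pw b c = (%t. t^Suc d/fact (Suc d))" "pw b (Suc c) t = t^d/fact d"
  using b by(auto simp: pw_def)
 ultimately show ?thesis by simp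
next
 case False
 hence "pw b c = (%_. if c = b then 1 else 0)" "pw b (Suc c) t = 0" by(auto simp: pw_def)
 thus ?thesis by simp
qed

lemma pw_Suc [simp]: "pw (Suc b) (Suc c) = pw b c" "pw 0 (Suc c) = (%_. 0)"
 by(auto simp: pw_def)

lemma pw_0: "pw b c 0 = (if b = c then 1 else 0)"
 by(auto simp: pw_def)

definition monom_jet :: "('n::finite => nat) => ('n => nat) => real^'n => real" where
 "monom_jet be = prod_jet (%i. pw (be i))"

lemma monom_jet_derivative: "(monom_jet be ga has_derivative lin (%i. monom_jet be (up i ga) z)) (at z)"
 unfolding monom_jet_def by(rule prod_jet_derivative[of "%i. pw (be i)", OF pw_deriv])

lemma monom_jet_up: "monom_jet (up i be) (up i ga) = monom_jet be ga"
proof -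
 have "pw (up i be j) (up i ga j) = pw (be j) (ga j)" for j by(simp add: up_def)
 thus ?thesis by(simp add: monom_jet_def prod_jet_def fun_eq_iff)
qed

lemma monom_jet_zero: "be i < ga i ==> monom_jet be ga z = 0"
proof -
 assume "be i < ga i"
 hence "pw (be i) (ga i) (z $ i) = 0" by(simp add: pw_def)
 hence "EX i:UNIV. pw (be i) (ga i) (z $ i) = 0" by blast
 thus ?thesis unfolding monom_jet_def prod_jet_def by simp
qed

lemma monom_jet_at_0: "monom_jet be ga 0 = (if be = ga then 1 else 0)"
proof (cases "be = ga")
 case False
 then obtain i where "be i ~= ga i" by auto
 hence "EX i:UNIV. pw (be i) (ga i) ((0 :: real^'a) $ i) = 0" by(intro bexI[of _ i]) (auto simp: pw_0)
 hence "monom_jet be ga (0 :: real^'a) = 0" unfolding monom_jet_def prod_jet_def by simp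
 thus ?thesis using False by simp
qed (simp add: monom_jet_def prod_jet_def pw_0)

lemma monom_jet_bound:
 assumes "norm z <= D" "mi_order ga <= mi_order be" shows "abs(monom_jet be ga z) <= D^(mi_order be - mi_order ga)"
proof (cases "ga:below be")
 case True
 have D: "0<=D" using assms(1) norm_ge_zero order_trans by blast
 have "abs(monom_jet be ga z) <= (PROD i:UNIV. D^(be i - ga i))"
  unfolding monom_jet_def prod_jet_def abs_prod
 proof (intro prod_mono conjI)
  fix i
  have "abs(z $ i)^(be i - ga i) <= D^(be i - ga i)"
   by(smt (verit) component_le_norm_cart[of z i] assms(1) power_mono)
  moreover have "abs(z $ i)^(be i - ga i)/fact (be i - ga i) <= abs(z $ i)^(be i - ga i)/1"
   by(intro divide_left_mono) (auto simp: fact_ge_1)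
  ultimately have "abs(z $ i)^(be i - ga i)/fact (be i - ga i) <= D^(be i - ga i)" by simp
  thus "abs(pw (be i) (ga i) (z $ i)) <= D^(be i - ga i)"
   by(simp add: pw_def below_def power_abs)
 qed simp
 also have "... = D^(mi_order be - mi_order ga)"
  using mi_order_below(2)[OF True] by(simp add: power_sum[symmetric] mi_order_def)
 finally show ?thesis .
next
 case False
 then obtain i where "be i < ga i" by(auto simp: below_def not_le)
 hence "monom_jet be ga z = 0" by(rule monom_jet_zero)
 moreover have "0<=D" using assms(1) norm_ge_zero order_trans by blast
 ultimately show ?thesis by simp
qed

lemma finite_mi_order_less: "finite {be :: 'n::finite => nat. mi_order be < k}"
 by(rule finite_subset[OF _ finite_mi_order_le[of k]]) auto

lemma finite_mi_order_eq: "finite {be :: 'n::finite => nat. mi_order be = k}"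
 by(rule finite_subset[OF _ finite_mi_order_le[of k]]) auto

text \<open>The Taylor polynomial of degree \<open>k - 1\<close> at \<open>y\<close> with all its
 derivatives, as a jet in \<open>x\<close>.\<close>

definition taylor :: "nat => (('n::finite => nat) => real^'n => real) => real^'n => ('n => nat) => real^'n => real" where
 "taylor k f y ga x = (\<Sum>be | mi_order be < k. f be y*monom_jet be ga (x - y))"

lemma taylor_derivative: "(taylor k f y ga has_derivative lin (%i. taylor k f y (up i ga) x)) (at x)"
proof -
 have "((%x. f be y*monom_jet be ga (x - y)) has_derivative (%h. f be y*lin (%i. monom_jet be (up i ga) (x - y)) h)) (at x)" for be
 proof -
  have "((%x. x - y) has_derivative (%h. h)) (at x)" by(auto intro!: derivative_eq_intros)
  from has_derivative_compose[OF this monom_jet_derivative] show ?thesis by(intro has_derivative_mult_right)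
 qed
 hence "((%x. \<Sum>be | mi_order be < k. f be y*monom_jet be ga (x - y)) has_derivative
   (%h. \<Sum>be | mi_order be < k. f be y*lin (%i. monom_jet be (up i ga) (x - y)) h)) (at x)"
  by simp
 moreover have "(%h. \<Sum>be | mi_order be < k. f be y*lin (%i. monom_jet be (up i ga) (x - y)) h) = lin (%i. taylor k f y (up i ga) x)"
  unfolding lin_def taylor_def
  by(rule ext, simp only: sum_distrib_left, subst sum.swap) (simp add: mult_ac)
 ultimately show ?thesis by(simp add: taylor_def[abs_def])
qed

lemma taylor_jet: "is_jet m S (taylor k f y)"
 by(rule is_jet_all) (rule taylor_derivative)

lemma taylor_center: "mi_order ga < k ==> taylor k f y ga y = f ga y"
 unfolding taylor_def by(simp add: monom_jet_at_0 if_distrib[of "(*) _"] finite_mi_order_less cong: if_cong)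

lemma taylor_high:
 assumes "k <= mi_order ga" shows "taylor k f y ga x = 0"
 unfolding taylor_def
proof (intro sum.neutral ballI)
 fix be :: "'a => nat" assume "be:{be. mi_order be < k}"
 hence "ga ~: below be" using mi_order_below(1)[of ga be] assms by auto
 then obtain i where "be i < ga i" by(auto simp: below_def not_le)
 thus "f be y*monom_jet be ga (x - y) = 0" by(simp add: monom_jet_zero)
qed

text \<open>The dependence on the centre: in the derivative with respect to \<open>y\<close> each
 term of lower order appears twice with opposite signs, and only the derivatives of order
 \<open>k\<close> remain.\<close>

lemma taylor_centre_derivative:
 fixes f :: "('n::finite => nat) => real^'n => real"
 assumes f: "is_jet (Suc k) S f" and y: "y:S"
 shows "((%y. taylor (Suc k) f y ga x) has_derivative
   lin (%i. \<Sum>be | mi_order be = k. f (up i be) y*monom_jet be ga (x - y))) (at y)"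
proof -
 have 1: "((%y. f be y*monom_jet be ga (x - y)) has_derivative
   lin (%i. f (up i be) y*monom_jet be ga (x - y) - f be y*monom_jet be (up i ga) (x - y))) (at y)" if "mi_order be < Suc k" for be
 proof -
  have "((%y. x - y) has_derivative (%h. - h)) (at y)" by(auto intro!: derivative_eq_intros)
  from has_derivative_mult[OF is_jetD(1)[OF f that y] has_derivative_compose[OF this monom_jet_derivative]]
  have "((%y. f be y*monom_jet be ga (x - y)) has_derivative
    (%h. f be y*lin (%i. monom_jet be (up i ga) (x - y)) (- h)+lin (%i. f (up i be) y) h*monom_jet be ga (x - y))) (at y)" .
  moreover have "(%h. f be y*lin (%i. monom_jet be (up i ga) (x - y)) (- h)+lin (%i. f (up i be) y) h*monom_jet be ga (x - y))
    = lin (%i. f (up i be) y*monom_jet be ga (x - y) - f be y*monom_jet be (up i ga) (x - y))"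
   by(simp add: lin_def fun_eq_iff sum_distrib_left sum_negf sum_subtractf algebra_simps)
  ultimately show ?thesis by simp
 qed
 have "((%y. \<Sum>be | mi_order be < Suc k. f be y*monom_jet be ga (x - y)) has_derivative
   (%h. \<Sum>be | mi_order be < Suc k. lin (%i. f (up i be) y*monom_jet be ga (x - y) - f be y*monom_jet be (up i ga) (x - y)) h)) (at y)"
  using 1 by(intro has_derivative_sum) auto
 moreover have "(%h. \<Sum>be | mi_order be < Suc k. lin (%i. f (up i be) y*monom_jet be ga (x - y) - f be y*monom_jet be (up i ga) (x - y)) h)
   = lin (%i. \<Sum>be | mi_order be < Suc k. f (up i be) y*monom_jet be ga (x - y) - f be y*monom_jet be (up i ga) (x - y))"
  unfolding lin_def by(rule ext, subst sum.swap) (simp add: sum_distrib_left)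
 moreover have "(\<Sum>be | mi_order be < Suc k. f (up i be) y*monom_jet be ga (x - y) - f be y*monom_jet be (up i ga) (x - y))
   = (\<Sum>be | mi_order be = k. f (up i be) y*monom_jet be ga (x - y))" for i
 proof -
  have "(\<Sum>be | mi_order be < Suc k. f be y*monom_jet be (up i ga) (x - y))
    = (SUM be:up i ` {be. mi_order be < k}. f be y*monom_jet be (up i ga) (x - y))"
  proof (rule sum.mono_neutral_right[OF finite_mi_order_less])
   show "ALL be:{be. mi_order be < Suc k} - up i ` {be. mi_order be < k}. f be y*monom_jet be (up i ga) (x - y) = 0"
   proof
    fix be assume b: "be:{be. mi_order be < Suc k} - up i ` {be. mi_order be < k}"
    have "be i = 0"
    proof (rule ccontr)
     assume "be i ~= 0"
     hence e: "be = up i (be(i := be i - 1))" by(auto simp: up_def)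
     hence "mi_order be = Suc (mi_order (be(i := be i - 1)))" by(metis mi_order_up)
     thus False using b e by auto
    qed
    thus "f be y*monom_jet be (up i ga) (x - y) = 0"
     using monom_jet_zero[of be i "up i ga"] by(simp add: up_def)
   qed
  qed auto
  also have "... = (\<Sum>be | mi_order be < k. f (up i be) y*monom_jet be ga (x - y))"
   by(subst sum.reindex[OF inj_on_subset[OF inj_up]]) (auto simp: monom_jet_up)
  finally have "(\<Sum>be | mi_order be < Suc k. f (up i be) y*monom_jet be ga (x - y) - f be y*monom_jet be (up i ga) (x - y))
   = (\<Sum>be | mi_order be < Suc k. f (up i be) y*monom_jet be ga (x - y)) - (\<Sum>be | mi_order be < k. f (up i be) y*monom_jet be ga (x - y))"
   by(simp add: sum_subtractf)
  also have "(\<Sum>be | mi_order be < Suc k. f (up i be) y*monom_jet be ga (x - y))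
    = (\<Sum>be | mi_order be < k. f (up i be) y*monom_jet be ga (x - y))+(\<Sum>be | mi_order be = k. f (up i be) y*monom_jet be ga (x - y))"
  proof -
   have "{be. mi_order be < Suc k} = {be. mi_order be < k} Un {be :: 'n => nat. mi_order be = k}" by auto
   thus ?thesis by(simp only:) (rule sum.union_disjoint[OF finite_mi_order_less finite_mi_order_eq], auto)
  qed
  finally show ?thesis by simp
 qed
 ultimately show ?thesis by(simp add: taylor_def)
qed

text \<open>The mean value theorem for the Taylor polynomial as a function of its centre.\<close>

lemma taylor_segment:
 fixes f :: "('n::finite => nat) => real^'n => real" and S D :: real
 assumes f: "is_jet k (closed_segment y y') f" and ga: "mi_order ga < k"
  and S: "!!z al. z:closed_segment y y' ==> mi_order al = k ==> abs(f al z) <= S"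
  and D: "dist x y <= D" "dist x y' <= D"
 shows "abs(taylor k f y' ga x - taylor k f y ga x)
   <= 2*CARD('n)*card {be :: 'n => nat. mi_order be = k - 1}*S*D^(k - mi_order ga)"
proof -
 obtain l where l: "k = Suc l" using ga by(cases k) auto
 define N where "N = real (card {be :: 'n => nat. mi_order be = l})"
 have D0: "0<=D" using D(1) zero_le_dist order_trans by blast
 have "EX al :: 'n => nat. mi_order al = k"
 proof (induction k)
  case (Suc k)
  then obtain al :: "'n => nat" where "mi_order al = k" by blast
  hence "mi_order (up undefined al) = Suc k" by simp
  thus ?case by blast
 qed (rule exI[of _ "%_. 0"], simp)
 then obtain al :: "'n => nat" where "mi_order al = k" by blast
 hence S0: "0<=S"
  by(smt (verit) S[OF ends_in_segment(1)])
 have seg: "dist x z <= D" if "z:closed_segment y y'" for z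
 proof -
  have "closed_segment y y' <= cball x D" using D by(intro closed_segment_subset) auto
  thus ?thesis using that by auto
 qed
 define B where "B = N*(S*D^(l - mi_order ga))"
 have Bn: "norm (taylor k f y' ga x - taylor k f y ga x) <= real CARD('n)*B*norm (y' - y)"
 proof (rule differentiable_bound[where S = "closed_segment y y'" and
    f' = "%z. lin (%i. \<Sum>be | mi_order be = l. f (up i be) z*monom_jet be ga (x - z))"])
  fix z assume z: "z:closed_segment y y'"
  show "((%y. taylor k f y ga x) has_derivative lin (%i. \<Sum>be | mi_order be = l. f (up i be) z*monom_jet be ga (x - z)))
    (at z within closed_segment y y')"
   unfolding l by(rule has_derivative_at_withinI[OF taylor_centre_derivative[OF f[unfolded l] z]])
  have cB: "abs(\<Sum>be | mi_order be = l. f (up i be) z*monom_jet be ga (x - z)) <= B" for i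
  proof -
   have "abs(\<Sum>be | mi_order be = l. f (up i be) z*monom_jet be ga (x - z))
    <= (\<Sum>be | mi_order be = l. abs(f (up i be) z*monom_jet be ga (x - z)))" by simp
   also have "... <= (SUM be:{be :: 'n => nat. mi_order be = l}. S*D^(l - mi_order ga))"
   proof (rule sum_mono)
    fix be :: "'n => nat" assume b: "be:{be. mi_order be = l}"
    have "abs(f (up i be) z) <= S" using b l by(intro S[OF z]) simp
    moreover have "abs(monom_jet be ga (x - z)) <= D^(l - mi_order ga)"
     using monom_jet_bound[of "x - z" D ga be] seg[OF z] b ga l by(simp add: dist_norm)
    ultimately show "abs(f (up i be) z*monom_jet be ga (x - z)) <= S*D^(l - mi_order ga)"
     unfolding abs_mult using S0 by(intro mult_mono) auto
   qed
   finally show ?thesis by(simp add: B_def N_def)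
  qed
  show "onorm (lin (%i. \<Sum>be | mi_order be = l. f (up i be) z*monom_jet be ga (x - z))) <= real CARD('n)*B"
   unfolding real_norm_def by(rule onorm_le) (simp only: real_norm_def, rule lin_bound[OF cB])
 qed auto
 also have "... <= real CARD('n)*B*(2*D)"
 proof (rule mult_left_mono)
  show "norm (y' - y) <= 2*D" using D dist_triangle2[of y' y x] by(simp add: dist_norm norm_minus_commute)
  show "0 <= real CARD('n)*B" using S0 D0 by(simp add: B_def N_def)
 qed
 also have "... = 2*real CARD('n)*N*S*(D*D^(l - mi_order ga))" by(simp add: B_def)
 also have "D*D^(l - mi_order ga) = D^(k - mi_order ga)" using ga l by(simp add: Suc_diff_le)
 finally show ?thesis by(simp add: N_def l)
qed

section \<open>Taylor polynomials at linked points\<close>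

definition taylor_const :: "'n::finite itself => nat => real" where
 "taylor_const _ k = 2*CARD('n)*card {be :: 'n => nat. mi_order be = k - 1}"

lemma taylor_const_nonneg: "0 <= taylor_const T k" by(simp add: taylor_const_def)

text \<open>The number of steps into which a geodesic of length \<open>M\<close> is divided, each
 of quasihyperbolic length at most \<open>1/4\<close>.\<close>

definition steps :: "real => real" where "steps M = abs(of_int \<lceil>4*M\<rceil>)+1"

context hyp_domain
begin

text \<open>Points at quasihyperbolic distance at most \<open>1/4\<close> are joined by their
 segment, which stays away from the boundary.\<close>

lemma near_step:
 assumes p: "p:Om" and q: "q:Om" and K: "K p q <= 1/4" and z: "z:closed_segment p q"
 shows "z:Om" "bd p/2 <= bd z"
proof -
 have "exp (1/4 :: real) <= 4/3"
  using exp_ge_add_one_self[of "- (1/4)"] by(simp add: exp_minus field_simps)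
 moreover have "exp (K p q) <= exp (1/4)" using K by simp
 ultimately have "exp (K p q) - 1 <= 1/3" by linarith
 hence "(exp (K p q) - 1)*bd p <= 1/3*bd p" by(rule mult_right_mono) (rule bd_nonneg)
 hence "dist p q <= bd p/3" using dist_le_K[OF p q] by simp
 moreover have "dist p z <= dist p q" using z segment_bound1[of z p q] by(simp add: dist_norm norm_minus_commute)
 ultimately have pz: "dist p z <= bd p/3" by simp
 thus "z:Om" using bd_pos[OF p] in_dom_if_near[OF p, of z] by linarith
 show "bd p/2 <= bd z" using pz bd_lip[of p z] by simp
qed



text \<open>The centre is moved along the geodesic by short segments.\<close>

lemma taylor_along_geodesic:
 fixes f :: "('n => nat) => real^'n => real" and S D m :: real
 assumes u: "u:Om" and y: "y:Om" and M: "K u y <= M" and g: "geo u y g"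
  and m: "!!s. 0<=s ==> s <= K u y ==> 2*m <= bd (g s)" and D: "!!s. 0<=s ==> s <= K u y ==> dist x (g s) <= D"
  and f: "is_jet k {z:Om. m <= bd z} f" and ga: "mi_order ga < k" and S0: "0<=S"
  and S: "!!z al. z:Om ==> m <= bd z ==> dist x z <= D ==> mi_order al = k ==> abs(f al z) <= S"
 shows "abs(taylor k f y ga x - taylor k f u ga x) <= steps M*(taylor_const TYPE('n) k*S*D^(k - mi_order ga))"
proof -
 define kappa where "kappa = K u y"
 have kappa: "0<=kappa" "kappa<=M" using K_nonneg[OF u y] M by(auto simp: kappa_def)
 have "dist x (g 0) <= D" using D[of 0] kappa by(simp add: kappa_def)
 hence D0: "0<=D" by(rule order_trans[OF zero_le_dist])
 define N where "N = nat (\<lceil>4*M\<rceil>+1)"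
 have N: "real N = of_int \<lceil>4*M\<rceil>+1" "0<N" using kappa by(auto simp: N_def)
 have NM: "kappa <= real N/4" using N(1) kappa by linarith
 define t where "t j = kappa*real j/real N" for j
 have t: "0 <= t j" "t j <= kappa" if "j<=N" for j
  using kappa N(2) that by(auto simp: t_def field_simps intro!: mult_left_mono)
 define b where "b = taylor_const TYPE('n) k*S*D^(k - mi_order ga)"
 have b0: "0<=b" using S0 D0 by(simp add: b_def taylor_const_nonneg)
 have step: "abs(taylor k f (g (t (Suc j))) ga x - taylor k f (g (t j)) ga x) <= b" if j: "j<N" for j
 proof -
  define p q where "p = g (t j)" and "q = g (t (Suc j))"
  have tj: "0 <= t j" "t j <= kappa" "0 <= t (Suc j)" "t (Suc j) <= kappa" using t[of j] t[of "Suc j"] j by auto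
  have pq: "p:Om" "q:Om" using geo_in[OF g] tj by(auto simp: p_def q_def kappa_def)
  have "K p q = abs(t j - t (Suc j))" unfolding p_def q_def using geo_K[OF g] tj by(simp add: kappa_def)
  also have "... = kappa/real N" using kappa N(2) by(simp add: t_def field_simps)
  also have "... <= 1/4" using NM N(2) by simp
  finally have Kpq: "K p q <= 1/4" .
  have ns: "z:Om" "m <= bd z" if "z:closed_segment p q" for z
   using near_step[OF pq Kpq that] m[OF tj(1)] tj(2) by(auto simp: p_def kappa_def)
  have d: "dist x p <= D" "dist x q <= D" using D tj by(auto simp: p_def q_def kappa_def)
  have "closed_segment p q <= cball x D" using d by(intro closed_segment_subset) auto
  hence dz: "dist x z <= D" if "z:closed_segment p q" for z using that by auto
  have "abs(taylor k f q ga x - taylor k f p ga x) <= real (2*CARD('n)*card {be :: 'n => nat. mi_order be = k - 1})*S*D^(k - mi_order ga)"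
  proof (rule taylor_segment[OF _ ga _ d])
   show "is_jet k (closed_segment p q) f" by(rule is_jet_subset[OF f]) (use ns in auto)
   show "abs(f al z) <= S" if "z:closed_segment p q" "mi_order al = k" for z al
    using S[OF ns[OF that(1)] dz[OF that(1)] that(2)] .
  qed
  thus ?thesis by(simp add: b_def taylor_const_def p_def q_def)
 qed
 have sum: "abs(taylor k f (g (t j)) ga x - taylor k f (g (t 0)) ga x) <= real j*b" if "j<=N" for j
  using that
 proof (induction j)
  case (Suc j)
  have "abs(taylor k f (g (t j)) ga x - taylor k f (g (t 0)) ga x) <= real j*b" using Suc by simp
  moreover have "abs(taylor k f (g (t (Suc j))) ga x - taylor k f (g (t j)) ga x) <= b" using step Suc.prems by simp
  moreover have "real (Suc j)*b = real j*b+b" by(simp add: algebra_simps)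
  ultimately show ?case by simp
 qed simp
 have "abs(taylor k f y ga x - taylor k f u ga x) <= real N*b"
  using geo_ends[OF g] N(2) sum[of N] by(auto simp: t_def kappa_def)
 also have "... <= steps M*b" using N(1) b0 by(intro mult_right_mono) (auto simp: steps_def)
 finally show ?thesis by(simp add: b_def)
qed

end

section \<open>A partition of unity over a grid\<close>

text \<open>The open cube of side \<open>2 s\<close> around the lattice point \<open>s a\<close>;
 neighbouring cubes overlap.\<close>

definition grid_cube :: "real => ('n::finite => int) => (real^'n) set" where
 "grid_cube s a = {y. ALL i. abs(y $ i/s - of_int (a i)) < 1}"

definition grid_near :: "real => real^'n::finite => ('n => int) set" where
 "grid_near s x = {a. x:grid_cube s a}"

definition grid_bump :: "real => ('n::finite => int) => ('n => nat) => real^'n => real" where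
 "grid_bump s a be = kern s be (\<chi> i. s * of_int (a i))"

lemma grid_bump_jet: "is_jet k S (grid_bump s a)"
 unfolding grid_bump_def by(intro is_jet_all kern_deriv)

definition grid_box :: "real => real^'n::finite => ('n => int) set" where
 "grid_box s x = PiE UNIV (%i. {\<lfloor>x $ i/s\<rfloor> - 1..\<lfloor>x $ i/s\<rfloor>+2})"

lemma finite_grid_box: "finite (grid_box s x)" "card (grid_box s (x :: real^'n::finite)) = 4^CARD('n)"
 unfolding grid_box_def by(simp_all add: finite_PiE card_PiE)

lemma grid_near_box: "grid_near s x <= grid_box s x"
proof
 fix a assume "a:grid_near s x"
 hence n: "abs(x $ i/s - of_int (a i)) < 1" for i by(simp add: grid_near_def grid_cube_def)
 have "a i:{\<lfloor>x $ i/s\<rfloor> - 1..\<lfloor>x $ i/s\<rfloor>+2}" for i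
 proof -
  define m where "m = \<lfloor>x $ i/s\<rfloor>"
  have "of_int m <= x $ i/s" "x $ i/s < of_int m+1" unfolding m_def by auto
  hence "of_int (a i) < (of_int (m+2) :: real)" "(of_int (m - 1) :: real) < of_int (a i)"
   using n[of i] by linarith+
  hence "a i < m+2" "m - 1 < a i" unfolding of_int_less_iff .
  thus ?thesis unfolding m_def by simp
 qed
 thus "a:grid_box s x" by(simp add: grid_box_def PiE_iff)
qed

lemma grid_bump_zero:
 assumes "0<s" "x ~: grid_cube s a" shows "grid_bump s a be x = 0"
proof -
 obtain i where "1 <= abs(x $ i/s - of_int (a i))" using assms by(auto simp: grid_cube_def not_less)
 hence "1 <= abs((x $ i - s * of_int (a i))/s)" using assms by(simp add: diff_divide_distrib)
 hence "EX i:UNIV. bumpD (be i) ((x $ i - s * of_int (a i))/s)/s^be i = 0" using bumpD_zero by(intro bexI[of _ i]) auto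
 thus ?thesis unfolding grid_bump_def box_jet_def prod_jet_def by simp
qed

text \<open>Also the derivatives of the partition sum up to those of the constant one.\<close>

lemma grid_near_sum:
 assumes "0<s" shows "(SUM a:grid_near s x. grid_bump s a be x) = (if be = (%_. 0) then 1 else 0)"
proof -
 have "(SUM a:grid_near s x. grid_bump s a be x) = (SUM a:grid_box s x. grid_bump s a be x)"
  using grid_bump_zero[OF assms] by(intro sum.mono_neutral_left finite_grid_box(1) grid_near_box) (auto simp: grid_near_def)
 also have "... = (PROD i:UNIV. SUM m:{\<lfloor>x $ i/s\<rfloor> - 1..\<lfloor>x $ i/s\<rfloor>+2}. bumpD (be i) ((x $ i - s * of_int m)/s)/s^be i)"
  unfolding grid_box_def grid_bump_def box_jet_def prod_jet_def vec_lambda_beta by(rule prod_sum_PiE[symmetric]) auto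
 also have "... = (PROD i:UNIV. if be i = 0 then 1 else 0)"
 proof (rule prod.cong)
  fix i
  have "(SUM m:{\<lfloor>x $ i/s\<rfloor> - 1..\<lfloor>x $ i/s\<rfloor>+2}. bumpD (be i) ((x $ i - s * of_int m)/s)/s^be i)
    = (SUM m:{\<lfloor>x $ i/s\<rfloor> - 1..\<lfloor>x $ i/s\<rfloor>+2}. bumpD (be i) (x $ i/s - of_int m))/s^be i"
   using assms by(simp add: sum_divide_distrib diff_divide_distrib)
  thus "(SUM m:{\<lfloor>x $ i/s\<rfloor> - 1..\<lfloor>x $ i/s\<rfloor>+2}. bumpD (be i) ((x $ i - s * of_int m)/s)/s^be i) = (if be i = 0 then 1 else 0)"
   by(simp add: bumpD_sum)
 qed simp
 also have "... = (if be = (%_. 0) then 1 else 0)" by auto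
 finally show ?thesis .
qed

lemma grid_near_nonempty: "0<s ==> grid_near s x ~= {}"
 using grid_near_sum[where s = s and x = x and be = "%_. 0"] by auto

definition bump_const :: "'n::finite itself => nat => real" where
 "bump_const _ k = (SOME C. 0<=C & (ALL s>0. ALL x y be. mi_order be <= k --> abs(kern s be x (y :: real^'n)) <= C/s^mi_order be))"

lemma bump_const:
 "0 <= bump_const TYPE('n::finite) k"
 "0<s ==> mi_order be <= k ==> abs(grid_bump s a be (x :: real^'n)) <= bump_const TYPE('n) k/s^mi_order be"
 using someI_ex[OF kern_bounded[of k, where 'n = 'n]] unfolding bump_const_def grid_bump_def by auto

lemma jmult_bound:
 assumes F: "!!be. be:below al ==> abs(F be x) <= A be" and H: "!!be. be:below al ==> abs(H (%i. al i - be i) x) <= B be"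
  and AB: "!!be. be:below al ==> A be*B be <= P"
 shows "abs(jmult F H al x) <= (SUM be:below al. mbinom al be)*P"
proof -
 have m: "0 <= mbinom al be" for be by(simp add: mbinom_def prod_nonneg)
 have "abs(jmult F H al x) <= (SUM be:below al. abs(mbinom al be*(F be x*H (%i. al i - be i) x)))"
  unfolding jmult_def by simp
 also have "... <= (SUM be:below al. mbinom al be*P)"
 proof (rule sum_mono)
  fix be assume b: "be:below al"
  have "abs(F be x)*abs(H (%i. al i - be i) x) <= P"
   by(smt (verit) F[OF b] H[OF b] AB[OF b] mult_mono)
  thus "abs(mbinom al be*(F be x*H (%i. al i - be i) x)) <= mbinom al be*P"
   using m by(simp add: abs_mult mult_left_mono)
 qed
 finally show ?thesis by(simp add: sum_distrib_right)
qed

text \<open>A partition of unity acts as the identity on jets.\<close>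

lemma jmult_unit_sum:
 assumes "!!be. (SUM a:N. E a be x) = (if be = (%_. 0) then 1 else 0)"
 shows "(SUM a:N. jmult (E a) H al x) = H al x"
proof -
 have "(SUM a:N. jmult (E a) H al x) = (SUM be:below al. mbinom al be*((SUM a:N. E a be x)*H (%i. al i - be i) x))"
  unfolding jmult_def by(subst sum.swap) (simp add: sum_distrib_left sum_distrib_right)
 also have "... = (SUM be:below al. if be = (%_. 0) then H al x else 0)"
  unfolding assms by(intro sum.cong) (auto simp: mbinom_def)
 also have "... = H al x"
  by(simp add: sum.delta[OF finite_below]) (simp add: below_def)
 finally show ?thesis .
qed

lemma jmult_diff_right: "jmult F (%al x. G al x - H al x) al x = jmult F G al x - jmult F H al x"
 by(simp add: jmult_def right_diff_distrib sum_subtractf)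

lemma grid_cube_small:
 fixes x y :: "real^'n::finite" and s :: real
 assumes "0<s" "x:grid_cube s a" "y:grid_cube s a" shows "dist x y <= 2*CARD('n) * s"
proof -
 have "abs((x - y) $ i) <= 2 * s" for i
 proof -
  have "abs(x $ i/s - of_int (a i)) < 1" "abs(y $ i/s - of_int (a i)) < 1" using assms by(auto simp: grid_cube_def)
  hence "abs((x $ i - y $ i)/s) <= 2"
   by(simp add: diff_divide_distrib)
  thus ?thesis using assms(1) by(simp add: abs_divide pos_divide_le_eq)
 qed
 hence "(SUM i:UNIV. abs((x - y) $ i)) <= (SUM i:(UNIV::'n set). 2 * s)" by(intro sum_mono) auto
 thus ?thesis using norm_le_l1_cart[of "x - y"] by(simp add: dist_norm)
qed

lemma grid_cube_convex: "convex (grid_cube s a)"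
proof -
 have "grid_cube s a = (INT i. (%y. y $ i/s) -` {of_int (a i) - 1<..<of_int (a i)+1})"
  by(auto simp: grid_cube_def abs_less_iff algebra_simps)
 moreover have "convex ((%y::real^'a. y $ i/s) -` {of_int (a i) - 1<..<of_int (a i)+1})" for i
  by(intro convex_linear_vimage) (auto simp: linear_iff add_divide_distrib)
 ultimately show ?thesis by(simp only:) (intro convex_INT, simp)
qed

section \<open>Gluing along a decomposition\<close>

definition binom_const :: "'n::finite itself => nat => real" where
 "binom_const _ k = (SUM al:{al :: 'n => nat. mi_order al <= k}. SUM be:below al. mbinom al be)"

lemma mbinom_nonneg: "0 <= mbinom al be" by(simp add: mbinom_def prod_nonneg)

lemma binom_const: "mi_order (al :: 'n::finite => nat) <= k ==> (SUM be:below al. mbinom al be) <= binom_const TYPE('n) k"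
 unfolding binom_const_def by(rule member_le_sum) (auto simp: finite_mi_order_le intro!: sum_nonneg mbinom_nonneg)

lemma binom_const_nonneg: "0 <= binom_const T k"
 unfolding binom_const_def by(intro sum_nonneg mbinom_nonneg)

lemma jmult_le:
 fixes al :: "'n::finite => nat" and P :: real
 assumes "mi_order al <= k" "0<=P" "!!be. be:below al ==> abs(F be x) <= A be" "!!be. be:below al ==> abs(H (%i. al i - be i) x) <= B be"
  and "!!be. be:below al ==> A be*B be <= P"
 shows "abs(jmult F H al x) <= binom_const TYPE('n) k*P"
 using order_trans[OF jmult_bound[of al F x A H B P] mult_right_mono[OF binom_const[OF assms(1)] assms(2)]] assms(3-5) by blast

text \<open>Bounds the difference of the functions attached to two overlapping pieces: one chain
 of steps along a geodesic, one more segment from the core, and the term 1 for the derivatives of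
 order \<open>k\<close> themselves.\<close>

definition gap_const :: "'n::finite itself => real => real => nat => real" where
 "gap_const T M C k = (steps M+1)*taylor_const T k*(2*C+1)^k+1"

definition glue_const :: "'n::finite itself => real => real => nat => real" where
 "glue_const T M C k = 4^CARD('n)*(binom_const T k*(bump_const T k*(4*CARD('n))^k*gap_const T M C k))"

text \<open>Bounds the difference of the functions attached to two overlapping pieces: one chain
 of steps along a geodesic, one more segment from the core, and the term 1 for the derivatives of
 order \<open>k\<close> themselves.\<close>

lemma gap_const: "0<=C ==> 1 <= gap_const T M C k"
 by(simp add: gap_const_def steps_def taylor_const_nonneg)

lemma glue_const_nonneg: "0<=C ==> 0 <= glue_const TYPE('n::finite) M C k"
 using gap_const[of C "TYPE('n)" M k] by(simp add: glue_const_def binom_const_nonneg bump_const(1))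

lemma finite_cubes_near:
 fixes x :: "real^'n::finite"
 assumes "0<s" "rho<=s" shows "finite {a. ball x rho Int grid_cube s a ~= {}}"
proof (rule finite_subset)
 show "{a. ball x rho Int grid_cube s a ~= {}} <= PiE UNIV (%i. {\<lfloor>x $ i/s\<rfloor> - 2..\<lfloor>x $ i/s\<rfloor>+3})"
 proof
  fix a assume "a:{a. ball x rho Int grid_cube s a ~= {}}"
  then obtain y where y: "dist x y < rho" "y:grid_cube s a" by auto
  have "a i:{\<lfloor>x $ i/s\<rfloor> - 2..\<lfloor>x $ i/s\<rfloor>+3}" for i
  proof -
   define m where "m = \<lfloor>x $ i/s\<rfloor>"
   have "abs(x $ i - y $ i) < s" using component_le_norm_cart[of "x - y" i] y(1) assms(2) by(simp add: dist_norm)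
   hence "abs((x $ i - y $ i)/s) < 1" using assms(1) by(simp add: abs_divide)
   hence "abs(x $ i/s - y $ i/s) < 1" by(simp add: diff_divide_distrib)
   moreover have "abs(y $ i/s - of_int (a i)) < 1" using y(2) by(simp add: grid_cube_def)
   moreover have "of_int m <= x $ i/s" "x $ i/s < of_int m+1" unfolding m_def by linarith+
   ultimately have "of_int (a i) < (of_int (m+3) :: real)" "(of_int (m - 2) :: real) < of_int (a i)" by linarith+
   hence "a i < m+3" "m - 2 < a i" unfolding of_int_less_iff .
   thus ?thesis unfolding m_def by simp
  qed
  thus "a:PiE UNIV (%i. {\<lfloor>x $ i/s\<rfloor> - 2..\<lfloor>x $ i/s\<rfloor>+3})" by auto
 qed
qed (simp add: finite_PiE)

text \<open>The jet \<open>f\<close> to be continued is given only at distance comparable to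
 \<open>r\<close> from the boundary, which is where mollification at that scale makes
 sense.\<close>

locale gluing = decomposition Om delta M c C r B x0 Co b far
 for Om :: "(real^'n::finite) set" and delta M c C r B x0 Co b far +
 fixes k :: nat and f :: "('n => nat) => real^'n => real"
 assumes f: "is_jet k {z:Om. min c 1/4*r <= bd z} f"
begin

definition G :: "(real^'n) set => ('n => nat) => real^'n => real" where
 "G A = (if A Int Co ~= {} then f else taylor k f (b A))"

text \<open>\<open>S\<close> bounds the derivatives of order \<open>k\<close> of \<open>f\<close>
 at all points that are visible from \<open>x\<close> at scale \<open>r\<close>.\<close>

definition top_bound :: "real^'n => real => bool" where
 "top_bound x S \<longleftrightarrow> 0<=S & (ALL z:Om. min c 1/4*r <= bd z --> dist x z <= (2*C+1)*r --> (ALL al. mi_order al = k --> abs(f al z) <= S))"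

definition gap :: real where "gap = gap_const TYPE('n) M C k"

lemma m_le: "min c 1/4*r <= r/4" "2*(min c 1/4*r) <= c*r" "0 < min c 1/4*r"
using r c by auto

lemma steps_nonneg: "1 <= steps M" by(simp add: steps_def)

lemma power_scale: "j<=k ==> ((2*C+1)*r)^j <= (2*C+1)^k*r^j"
 unfolding power_mult_distrib using C r by simp

text \<open>\<open>taylor_along_geodesic\<close> for the geodesic of a link.\<close>

lemma linked_difference:
 assumes l: "linked M c C r u y" and x: "dist x u <= (C+1)*r" and S: "top_bound x S" and ga: "mi_order ga < k"
 shows "abs(taylor k f y ga x - taylor k f u ga x) <= steps M*taylor_const TYPE('n) k*(2*C+1)^k*S*r^(k - mi_order ga)"
proof -
 obtain g where g: "u:Om" "y:Om" "K u y <= M" "geo u y g" "!!s. s:{0..K u y} ==> c*r <= bd (g s) & dist u (g s) <= C*r"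
  using l by(auto simp: linked_def)
 have "abs(taylor k f y ga x - taylor k f u ga x) <= steps M*(taylor_const TYPE('n) k*S*((2*C+1)*r)^(k - mi_order ga))"
 proof (rule taylor_along_geodesic[OF g(1-4) _ _ f ga])
  fix s assume s: "0<=s" "s <= K u y"
  hence "c*r <= bd (g s)" "dist u (g s) <= C*r" using g(5) by auto
  thus "2*(min c 1/4*r) <= bd (g s)" "dist x (g s) <= (2*C+1)*r"
   using m_le(2) x dist_triangle[of x "g s" u] by(auto simp: distrib_right)
 qed (use S in "auto simp: top_bound_def")
 also have "... <= steps M*(taylor_const TYPE('n) k*S*((2*C+1)^k*r^(k - mi_order ga)))"
  using S steps_nonneg by(intro mult_left_mono power_scale mult_nonneg_nonneg taylor_const_nonneg) (auto simp: top_bound_def)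
 finally show ?thesis by(simp add: mult_ac)
qed

lemma gap_bounds: "0<=S ==> 0<=t ==> steps M*taylor_const TYPE('n) k*(2*C+1)^k*S*t <= gap*S*t"
 "0<=S ==> 0<=t ==> steps M*taylor_const TYPE('n) k*(2*C+1)^k*S*t+taylor_const TYPE('n) k*(2*C+1)^k*S*t <= gap*S*t"
 "1<=gap"
using C steps_nonneg by(auto simp: taylor_const_nonneg gap_def gap_const_def distrib_right)

lemma core_value:
 assumes A: "small (r/2) A" "A Int Co ~= {}" "x:A" shows "x:Om" "r/2 <= bd x"
proof -
 obtain z where z: "z:A" "z:Co" using A(2) by blast
 hence "dist z x <= r/2" using A by(auto simp: small_def)
 thus "r/2 <= bd x" using Co(2)[OF z(2)] bd_lip[of z x] by linarith
 show "x:Om" using A by(auto simp: small_def)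
qed

lemma small_piece: "small (r/2) A ==> x:A ==> is_piece r A"
 using r unfolding is_piece_def small_def by fastforce

lemma top_value:
 assumes "top_bound x S" "x:Om" "r/4 <= bd x" "mi_order ga = k" shows "abs(f ga x) <= S"
proof -
 have "min c 1/4*r <= bd x" using m_le(1) assms(3) by simp
 moreover have "dist x x <= (2*C+1)*r" using C r by simp
 ultimately show ?thesis using assms by(auto simp: top_bound_def)
qed

text \<open>A point of the first piece meets the core piece at \<open>x\<close>, and the core
 piece contains a core point \<open>z\<close>: compare the Taylor polynomials at the base point
 and at \<open>z\<close> by the link, and those at \<open>z\<close> and \<open>x\<close> along a
 segment. At its centre \<open>x\<close> the last one is \<open>f\<close> itself.\<close>

lemma core_noncore:
 assumes A: "small (r/2) A" "A Int Co = {}" and A': "small (r/2) A'" "A' Int Co ~= {}" and x: "x:A" "x:A'"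
  and S: "top_bound x S" and ga: "mi_order ga <= k"
 shows "abs(f ga x - taylor k f (b A) ga x) <= gap*S*r^(k - mi_order ga)"
proof (cases "mi_order ga = k")
 case True
 have S0: "0<=S" using S by(simp add: top_bound_def)
 have "abs(f ga x) <= S" using core_value[OF A' x(2)] r by(intro top_value[OF S _ _ True]) auto
 also have "S <= gap*S" using gap_bounds(3) S0 by(simp add: mult_le_cancel_right1)
 finally show ?thesis using True by(simp add: taylor_high)
next
 case False
 hence ga: "mi_order ga < k" using ga by simp
 have S0: "0<=S" using S by(simp add: top_bound_def)
 obtain z where z: "z:A' Int Co" using A'(2) by blast
 have l: "linked M c C r (b A) z"
  by(rule core_linked[OF small_piece[OF A(1) x(1)] small_piece[OF A'(1) x(2)] _ A(2) z]) (use x in auto)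
 have zx: "dist z x <= r/2" using z x A'(1) by(auto simp: small_def)
 have bz: "dist (b A) z <= C*r"
 proof -
  obtain g where g: "K (b A) z >= 0" "geo (b A) z g" "!!s. s:{0..K (b A) z} ==> c*r <= bd (g s) & dist (b A) (g s) <= C*r"
   using l K_nonneg by(auto simp: linked_def)
  thus ?thesis using g(3)[of "K (b A) z"] geo_ends(2)[OF g(2)] by simp
 qed
 have xb: "dist x (b A) <= (C+1)*r"
  using zx bz dist_triangle[of x "b A" z] r by(simp add: dist_commute distrib_right)
 have 1: "abs(taylor k f z ga x - taylor k f (b A) ga x) <= steps M*taylor_const TYPE('n) k*(2*C+1)^k*S*r^(k - mi_order ga)"
  by(rule linked_difference[OF l xb S ga])
 have d: "dist x z <= (2*C+1)*r" "dist x x <= (2*C+1)*r"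
 proof -
  have "0 < C*r" using C r by simp
  moreover have "(2*C+1)*r = 2*(C*r)+r" by(simp add: algebra_simps)
  ultimately show "dist x z <= (2*C+1)*r" "dist x x <= (2*C+1)*r" using zx r by(auto simp: dist_commute)
 qed
 have seg: "q:Om" "min c 1/4*r <= bd q" "dist x q <= (2*C+1)*r" if "q:closed_segment z x" for q
 proof -
  have "dist z q <= r/2" using segment_bound1[OF that] zx by(simp add: dist_norm norm_minus_commute)
  moreover have "r <= bd z" "z:Om" using z Co by auto
  ultimately have zq: "dist z q <= r/2" "r <= bd z" "z:Om" by auto
  thus "q:Om" using r by(intro in_dom_if_near[OF zq(3)]) linarith
  show "min c 1/4*r <= bd q" using zq m_le(1) bd_lip[of z q] by linarith
  have "closed_segment z x <= cball x ((2*C+1)*r)" using d by(intro closed_segment_subset) auto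
  thus "dist x q <= (2*C+1)*r" using that by auto
 qed
 have "abs(taylor k f x ga x - taylor k f z ga x) <= taylor_const TYPE('n) k*S*((2*C+1)*r)^(k - mi_order ga)"
  unfolding taylor_const_def
 proof (rule taylor_segment[OF _ ga _ d])
  show "is_jet k (closed_segment z x) f" by(rule is_jet_subset[OF f]) (use seg in auto)
  show "abs(f al q) <= S" if "q:closed_segment z x" "mi_order al = k" for q al
   using S seg[OF that(1)] that(2) by(auto simp: top_bound_def)
 qed
 also have "... <= taylor_const TYPE('n) k*S*((2*C+1)^k*r^(k - mi_order ga))"
  by(rule mult_left_mono[OF power_scale]) (simp_all add: S0 taylor_const_nonneg)
 finally have "abs(f ga x - taylor k f z ga x) <= taylor_const TYPE('n) k*(2*C+1)^k*S*r^(k - mi_order ga)"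
  by(simp add: taylor_center[OF ga] mult_ac)
 hence "abs(f ga x - taylor k f (b A) ga x) <= steps M*taylor_const TYPE('n) k*(2*C+1)^k*S*r^(k - mi_order ga)
  +taylor_const TYPE('n) k*(2*C+1)^k*S*r^(k - mi_order ga)" using 1 by linarith
 also have "... <= gap*S*r^(k - mi_order ga)" by(rule gap_bounds(2)) (use S0 r in auto)
 finally show ?thesis .
qed

lemma noncore_noncore:
 assumes A: "small (r/2) A" "A Int Co = {}" and A': "small (r/2) A'" "A' Int Co = {}" and x: "x:A" "x:A'"
  and nf: "~ far A" and S: "top_bound x S"
 shows "abs(taylor k f (b A') ga x - taylor k f (b A) ga x) <= gap*S*r^(k - mi_order ga)"
proof (cases "mi_order ga < k")
 case False
 show ?thesis
  using gap_bounds(3) S r False by(auto simp: top_bound_def taylor_high)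
next
 case True
 have S0: "0<=S" using S by(simp add: top_bound_def)
 note p = small_piece[OF A(1) x(1)] small_piece[OF A'(1) x(2)]
 have l: "linked M c C r (b A) (b A')" by(rule near_linked[OF p _ A(2) A'(2)]) (use x nf in auto)
 have "dist x (b A) <= (C+1)*r" using near_dist[OF p(1) A(2) nf x(1)] r by(simp add: dist_commute distrib_right)
 from linked_difference[OF l this S True]
 have "abs(taylor k f (b A') ga x - taylor k f (b A) ga x) <= steps M*taylor_const TYPE('n) k*(2*C+1)^k*S*r^(k - mi_order ga)" .
 also have "... <= gap*S*r^(k - mi_order ga)" by(rule gap_bounds(1)) (use S0 r in auto)
 finally show ?thesis .
qed

text \<open>The functions attached to two overlapping pieces agree up to the size of the
 derivatives of order \<open>k\<close>, with the power of \<open>r\<close> that scaling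
 dictates.\<close>

lemma G_difference:
 assumes A: "small (r/2) A" and A': "small (r/2) A'" and x: "x:A" "x:A'" and S: "top_bound x S" and ga: "mi_order ga <= k"
 shows "abs(G A' ga x - G A ga x) <= gap*S*r^(k - mi_order ga)"
proof -
 have nn: "0 <= gap*S*r^(k - mi_order ga)" using gap_bounds(3) S r by(auto simp: top_bound_def)
 consider "A Int Co ~= {}" "A' Int Co ~= {}" | "A Int Co = {}" "A' Int Co ~= {}" | "A Int Co ~= {}" "A' Int Co = {}"
  | "A Int Co = {}" "A' Int Co = {}" "~ far A" | "A Int Co = {}" "A' Int Co = {}" "~ far A'" | "A Int Co = {}" "A' Int Co = {}" "far A" "far A'"
  by blast
 thus ?thesis
 proof cases
  case 1 thus ?thesis using nn by(simp add: G_def)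
 next
  case 2 thus ?thesis using core_noncore[OF A 2(1) A' 2(2) x S ga] by(simp add: G_def)
 next
  case 3 thus ?thesis using core_noncore[OF A' 3(2) A 3(1) x(2,1) S ga] by(simp add: G_def abs_minus_commute)
 next
  case 4 thus ?thesis using noncore_noncore[OF A 4(1) A' 4(2) x 4(3) S] by(simp add: G_def)
 next
  case 5 thus ?thesis using noncore_noncore[OF A' 5(2) A 5(1) x(2,1) 5(3) S] by(simp add: G_def abs_minus_commute)
 next
  case 6
  have "A Int A' ~= {}" using x by blast
  from far_same[OF small_piece[OF A x(1)] small_piece[OF A' x(2)] this 6] have "b A = b A'" .
  thus ?thesis using nn 6 by(simp add: G_def)
 qed
qed

end

section \<open>The glued jet\<close>

context gluing
begin

definition side :: real where "side = r/(4*CARD('n))"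

text \<open>The components of a cube in the domain, not the cubes, are the pieces: two components
 of one cube may belong to different tentacles.\<close>

definition comp :: "('n => int) => real^'n => (real^'n) set" where
 "comp a x = connected_component_set (Om Int grid_cube side a) x"

text \<open>The function attached to a cube at \<open>x\<close> is the one of the component that
 contains \<open>x\<close>.\<close>

definition glued :: "('n => nat) => real^'n => real" where
 "glued al x = (SUM a:grid_near side x. jmult (grid_bump side a) (G (comp a x)) al x)"

lemma side: "0<side" "side <= r/4" "2*CARD('n) * side = r/2"
using r by(auto simp: side_def field_simps)

lemma comp_piece:
 assumes "x:Om" "a:grid_near side x" shows "small (r/2) (comp a x)" "x:comp a x"
proof -
 have x: "x:Om Int grid_cube side a" using assms by(simp add: grid_near_def)
 have sub: "comp a x <= Om Int grid_cube side a" unfolding comp_def by(rule connected_component_subset)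
 show "x:comp a x" using x by(simp add: comp_def)
 have "connected (comp a x)" by(simp add: comp_def)
 moreover have "dist p q <= r/2" if "p:comp a x" "q:comp a x" for p q
 proof -
  have "p:grid_cube side a" "q:grid_cube side a" using sub that by auto
  from grid_cube_small[OF side(1) this] show ?thesis unfolding side(3) .
 qed
 ultimately show "small (r/2) (comp a x)" using sub by(auto simp: small_def)
qed

text \<open>Near a point the components of the finitely many cubes around do not change, as a
 small ball meets a cube in a convex set; there the glued function is a finite sum of products of
 jets.\<close>

lemma glued_jet: "is_jet k Om glued"
proof (rule is_jet_local)
 fix x assume x: "x:Om"
 (* The ball is inside the domain, meets finitely many cubes, and is small against \<open>r\<close>. *)
 define rho where "rho = min (bd x) (min side (r/8))"
 have rho: "0<rho" "rho <= bd x" "rho<=side" "rho <= r/8" using bd_pos[OF x] side(1) r by(auto simp: rho_def)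
 define B where "B = ball x rho"
 have BOm: "B<=Om" using ball_subset_dom[OF x] rho(2) by(auto simp: B_def)
 define N where "N = {a. B Int grid_cube side a ~= {}}"
 have N: "finite N" unfolding N_def B_def by(rule finite_cubes_near[OF side(1) rho(3)])
 define q where "q a = (SOME q. q:B Int grid_cube side a)" for a
 have q: "q a:B Int grid_cube side a" if "a:N" for a
  using that someI_ex[of "%q. q:B Int grid_cube side a"] by(auto simp: N_def q_def)
 have same: "comp a y = comp a (q a)" if y: "y:B" "y:grid_cube side a" for a y
 proof -
  have a: "a:N" using y by(auto simp: N_def)
  have "convex (B Int grid_cube side a)" unfolding B_def by(intro convex_Int convex_ball grid_cube_convex)
  hence "connected (B Int grid_cube side a)" by(rule convex_connected)
  hence "connected_component (Om Int grid_cube side a) (q a) y"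
   unfolding connected_component_def using q[OF a] y BOm by blast
  thus ?thesis unfolding comp_def using connected_component_eq by blast
 qed
 define W where "W al y = (SUM a:N. jmult (grid_bump side a) (G (comp a (q a))) al y)" for al y
 have "is_jet k B W" unfolding W_def
 proof (rule is_jet_sum[OF N])
  fix a assume a: "a:N"
  have qOm: "q a:Om" "a:grid_near side (q a)" using q[OF a] BOm by(auto simp: grid_near_def)
  have "is_jet k B (G (comp a (q a)))"
  proof (cases "comp a (q a) Int Co = {}")
   case True thus ?thesis by(simp add: G_def taylor_jet)
  next
   case False
   have "r/2 <= bd (q a)" using core_value(2)[OF comp_piece(1)[OF qOm] False comp_piece(2)[OF qOm]] .
   have "min c 1/4*r <= bd y" if "y:B" for y
   proof -
    have "dist (q a) y <= r/4"
     using that q[OF a] rho(4) dist_triangle3[of "q a" y x] by(auto simp: B_def)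
    thus ?thesis using `r / 2 <= bd (q a)` bd_lip[of "q a" y] m_le(1) by linarith
   qed
   hence "is_jet k B f" using BOm by(intro is_jet_subset[OF f]) auto
   thus ?thesis using False by(simp add: G_def)
  qed
  thus "is_jet k B (jmult (grid_bump side a) (G (comp a (q a))))" by(intro is_jet_mult grid_bump_jet)
 qed
 moreover have "glued al y = W al y" if y: "y:B" for al y
 proof -
  have sub: "grid_near side y <= N" using y by(auto simp: grid_near_def N_def)
  have "glued al y = (SUM a:grid_near side y. jmult (grid_bump side a) (G (comp a (q a))) al y)"
   unfolding glued_def using same[OF y] by(intro sum.cong) (auto simp: grid_near_def)
  also have "... = W al y"
   unfolding W_def
  proof (rule sum.mono_neutral_left[OF N sub], intro ballI)
   fix a assume "a:N - grid_near side y"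
   hence "y ~: grid_cube side a" by(simp add: grid_near_def)
   from grid_bump_zero[OF side(1) this] have "grid_bump side a be y = 0" for be .
   thus "jmult (grid_bump side a) (G (comp a (q a))) al y = 0" by(simp add: jmult_def)
  qed
  finally show ?thesis .
 qed
 ultimately show "EX B W. open B & x:B & is_jet k B W & (ALL y:B. ALL al. mi_order al <= k --> glued al y = W al y)"
  using rho(1) by(intro exI[of _ B] exI[of _ W]) (auto simp: B_def)
qed

lemma glued_uniform:
 assumes "!!a. a:grid_near side x ==> G (comp a x) = H" shows "glued al x = H al x"
proof -
 have "glued al x = (SUM a:grid_near side x. jmult (grid_bump side a) H al x)"
  unfolding glued_def using assms by simp
 also have "... = H al x" by(rule jmult_unit_sum[where E = "grid_bump side", OF grid_near_sum[OF side(1)]])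
 finally show ?thesis .
qed

lemma glued_core:
 assumes "x:Co" shows "glued al x = f al x"
proof (rule glued_uniform)
 fix a assume "a:grid_near side x"
 hence "x:comp a x" using assms Co(1) by(intro comp_piece(2)) auto
 hence "comp a x Int Co ~= {}" using assms by blast
 thus "G (comp a x) = f" by(simp add: G_def)
qed

text \<open>In the interior of a tentacle only one Taylor polynomial is seen from a point.\<close>

lemma glued_far:
 assumes x: "x:Om" and far: "!!A. is_piece r A ==> x:A ==> A Int Co = {} & far A"
 shows "EX A. is_piece r A & A Int Co = {} & (ALL al. glued al x = taylor k f (b A) al x)"
proof -
 obtain a0 where a0: "a0:grid_near side x" using grid_near_nonempty[OF side(1)] by blast
 have p: "is_piece r (comp a x)" if "a:grid_near side x" for a using small_piece comp_piece[OF x that] by blast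
 have "G (comp a x) = taylor k f (b (comp a0 x))" if a: "a:grid_near side x" for a
 proof -
  note fa = far[OF p[OF a] comp_piece(2)[OF x a]] and f0 = far[OF p[OF a0] comp_piece(2)[OF x a0]]
  have "comp a x Int comp a0 x ~= {}" using comp_piece(2)[OF x a] comp_piece(2)[OF x a0] by blast
  hence "b (comp a x) = b (comp a0 x)" by(rule far_same[OF p[OF a] p[OF a0]]) (use fa f0 in auto)
  thus ?thesis using fa by(simp add: G_def)
 qed
 hence "glued al x = taylor k f (b (comp a0 x)) al x" for al by(rule glued_uniform)
 thus ?thesis using p[OF a0] far[OF p[OF a0] comp_piece(2)[OF x a0]] by blast
qed

lemma glued_difference:
 assumes x: "x:Om" and a0: "a0:grid_near side x"
 shows "glued al x = G (comp a0 x) al x+(SUM a:grid_near side x. jmult (grid_bump side a) (%be y. G (comp a x) be y - G (comp a0 x) be y) al x)"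
proof -
 have "(SUM a:grid_near side x. jmult (grid_bump side a) (G (comp a0 x)) al x) = G (comp a0 x) al x"
  by(rule jmult_unit_sum[where E = "grid_bump side", OF grid_near_sum[OF side(1)]])
 thus ?thesis by(simp add: jmult_diff_right sum_subtractf glued_def)
qed

text \<open>The derivatives of the partition of order \<open>j\<close> are of size
 \<open>r\<close> to the power \<open>- j\<close>, and \<open>G_difference\<close> gains the
 matching power.\<close>

lemma glued_near:
 assumes x: "x:Om" and a0: "a0:grid_near side x" and S: "top_bound x S" and al: "mi_order al <= k"
 shows "abs(glued al x - G (comp a0 x) al x) <= glue_const TYPE('n) M C k*(S*r^(k - mi_order al))"
proof -
 define Cb where "Cb = bump_const TYPE('n) k"
 define P where "P = Cb*(4*CARD('n))^k*gap*S*r^(k - mi_order al)"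
 have Q0: "0 <= Cb*gap*S*r^(k - mi_order al)" "0<=P"
  using S gap_bounds(3) r bump_const(1)[of k, where 'n = 'n] by(auto simp: P_def top_bound_def Cb_def)
 have tm: "abs(jmult (grid_bump side a) (%be y. G (comp a x) be y - G (comp a0 x) be y) al x) <= binom_const TYPE('n) k*P"
  if a: "a:grid_near side x" for a
 proof (rule jmult_le[OF al Q0(2), where A = "%be. Cb/side^mi_order be" and B = "%be. gap*S*r^(k - (mi_order al - mi_order be))"])
  fix be assume b: "be:below al"
  note o = mi_order_below[OF b]
  show "abs(grid_bump side a be x) <= Cb/side^mi_order be" unfolding Cb_def using o al by(intro bump_const(2) side(1)) auto
  show "abs(G (comp a x) (%i. al i - be i) x - G (comp a0 x) (%i. al i - be i) x) <= gap*S*r^(k - (mi_order al - mi_order be))"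
   using G_difference[OF comp_piece(1)[OF x a0] comp_piece(1)[OF x a] comp_piece(2)[OF x a0] comp_piece(2)[OF x a] S, of "%i. al i - be i"] o al
   by simp
  have "k - (mi_order al - mi_order be) = mi_order be+(k - mi_order al)" using o(1) al by simp
  hence e: "Cb/side^mi_order be*(gap*S*r^(k - (mi_order al - mi_order be)))
    = Cb*gap*S*r^(k - mi_order al)*(r/side)^mi_order be"
   by(simp add: power_add power_divide)
  have "1 <= real CARD('n)" by simp
  hence "1 <= 4*real CARD('n)" by linarith
  hence "(4*real CARD('n))^mi_order be <= (4*real CARD('n))^k" by(rule power_increasing[rotated]) (use o al in simp)
  moreover have "r/side = 4*CARD('n)" using r by(simp add: side_def)
  ultimately have "Cb*gap*S*r^(k - mi_order al)*(r/side)^mi_order be <= Cb*gap*S*r^(k - mi_order al)*(4*real CARD('n))^k"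
   by(intro mult_left_mono Q0) auto
  thus "Cb/side^mi_order be*(gap*S*r^(k - (mi_order al - mi_order be))) <= P"
   unfolding e by(simp add: P_def mult_ac)
 qed
 have "abs(glued al x - G (comp a0 x) al x) <= (SUM a:grid_near side x. abs(jmult (grid_bump side a) (%be y. G (comp a x) be y - G (comp a0 x) be y) al x))"
  unfolding glued_difference[OF x a0] by simp
 also have "... <= (SUM a:grid_near side x. binom_const TYPE('n) k*P)" by(rule sum_mono[OF tm])
 also have "... = real (card (grid_near side x))*(binom_const TYPE('n) k*P)" by simp
 also have "... <= 4^CARD('n)*(binom_const TYPE('n) k*P)"
 proof (rule mult_right_mono)
  have "card (grid_near side x) <= card (grid_box side x)" by(rule card_mono[OF finite_grid_box(1) grid_near_box])
  hence "card (grid_near side x) <= 4^CARD('n)" by(simp add: finite_grid_box)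
  thus "real (card (grid_near side x)) <= 4^CARD('n)" by simp
 qed (rule mult_nonneg_nonneg[OF binom_const_nonneg Q0(2)])
 finally show ?thesis by(simp add: P_def Cb_def glue_const_def gap_def)
qed

text \<open>The derivatives of order \<open>k\<close> of a Taylor polynomial vanish, and on a
 piece of the core \<open>f\<close> is bounded by assumption.\<close>

lemma glued_top:
 assumes x: "x:Om" and S: "top_bound x S" and al: "mi_order al = k"
 shows "abs(glued al x) <= (glue_const TYPE('n) M C k+1)*S"
proof -
 have S0: "0<=S" using S by(simp add: top_bound_def)
 obtain a0 where a0: "a0:grid_near side x" using grid_near_nonempty[OF side(1)] by blast
 have "abs(G (comp a0 x) al x) <= S"
 proof (cases "comp a0 x Int Co = {}")
  case True thus ?thesis using S0 al by(simp add: G_def taylor_high)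
 next
  case False
  have "r/2 <= bd x" using core_value(2)[OF comp_piece(1)[OF x a0] False comp_piece(2)[OF x a0]] .
  hence "abs(f al x) <= S" using r by(intro top_value[OF S x _ al]) linarith
  thus ?thesis using False by(simp add: G_def)
 qed
 moreover have "abs(glued al x - G (comp a0 x) al x) <= glue_const TYPE('n) M C k*(S*r^(k - mi_order al))"
  using al by(intro glued_near[OF x a0 S]) simp
 ultimately show ?thesis using al by(simp add: distrib_right)
qed

end

section \<open>Bounds at infinity\<close>

lemma taylor_bound:
 fixes f :: "('n::finite => nat) => real^'n => real" and F D :: real
 assumes F: "!!be. mi_order be < k ==> abs(f be y) <= F" and D: "norm (x - y) <= D" "1<=D"
 shows "abs(taylor k f y ga x) <= card {be :: 'n => nat. mi_order be < k}*(F*D^(k - 1 - mi_order ga))"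
proof -
 have "abs(taylor k f y ga x) <= (\<Sum>be | mi_order be < k. abs(f be y*monom_jet be ga (x - y)))"
  unfolding taylor_def by simp
 also have "... <= (SUM be:{be :: 'n => nat. mi_order be < k}. F*D^(k - 1 - mi_order ga))"
 proof (rule sum_mono)
  fix be :: "'n => nat" assume "be:{be. mi_order be < k}"
  hence b: "mi_order be < k" by simp
  have "abs(monom_jet be ga (x - y)) <= D^(k - 1 - mi_order ga)"
  proof (cases "mi_order ga <= mi_order be")
   case True
   have "abs(monom_jet be ga (x - y)) <= D^(mi_order be - mi_order ga)" by(rule monom_jet_bound[OF D(1) True])
   also have "... <= D^(k - 1 - mi_order ga)" using b D(2) by(intro power_increasing) auto
   finally show ?thesis .
  next
   case False
   hence "ga ~: below be" using mi_order_below(1)[of ga be] by auto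
   then obtain i where "be i < ga i" by(auto simp: below_def not_le)
   thus ?thesis using D(2) by(simp add: monom_jet_zero)
  qed
  hence "abs(f be y)*abs(monom_jet be ga (x - y)) <= F*D^(k - 1 - mi_order ga)"
   using F[OF b] order_trans[OF abs_ge_zero F[OF b]] by(intro mult_mono) auto
  thus "abs(f be y*monom_jet be ga (x - y)) <= F*D^(k - 1 - mi_order ga)" by(simp add: abs_mult)
 qed
 finally show ?thesis by simp
qed

section \<open>Cutting off\<close>

definition cutoff :: "real^'n::finite => real => ('n => nat) => real^'n => real" where
 "cutoff x0 R be = box_jet plateauD R be x0"

lemma cutoff_jet: "is_jet k S (cutoff x0 R)"
 unfolding cutoff_def by(intro is_jet_all box_jet_deriv plateauD_deriv)

lemma cutoff_one:
 assumes "0<R" "dist x0 x <= R" shows "cutoff x0 R be x = (if be = (%_. 0) then 1 else 0)"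
proof -
 have "abs((x $ i - x0 $ i)/R) <= 1" for i
  using component_le_norm_cart[of "x - x0" i] assms by(simp add: dist_norm norm_minus_commute)
 hence "cutoff x0 R be x = (PROD i:UNIV. if be i = 0 then 1 else 0)"
  unfolding cutoff_def box_jet_def prod_jet_def by(intro prod.cong) (auto simp: plateauD_one)
 also have "... = (if be = (%_. 0) then 1 else 0)" by auto
 finally show ?thesis .
qed

lemma cutoff_zero:
 fixes x :: "real^'n::finite" and R :: real
 assumes "0<R" "2*CARD('n)*R < dist x0 x" shows "cutoff x0 R be x = 0"
 unfolding cutoff_def by(rule box_jet_zero[OF plateauD_zero assms(1)]) (use assms(2) in "simp_all add: mult.assoc mult.left_commute[of 2]")

lemma cutoff_bound: "EX C>=0. ALL R>0. ALL x be. mi_order be <= k --> abs(cutoff x0 R be (x :: real^'n::finite)) <= C/R^mi_order be"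
proof -
 obtain C where "1<=C" "ALL j<=k. ALL t. abs(plateauD j t) <= C" using plateauD_bounded by blast
 thus ?thesis using box_jet_bound[of k plateauD C] by(intro exI[of _ "C^CARD('n)"]) (auto simp: cutoff_def)
qed

definition bounded_jet :: "nat => (real^'n::finite) set => (('n => nat) => real^'n => real) => bool" where
 "bounded_jet k S V \<longleftrightarrow> is_jet k S V & (EX b. ALL al. mi_order al <= k --> (ALL x:S. abs(V al x) <= b))"

context gluing
begin

text \<open>The Taylor polynomials grow at infinity, so the glued jet is multiplied with a cutoff
 at radius \<open>R\<close>. Outside a bounded set only far pieces are left, where the glued jet
 is a single polynomial of degree less than \<open>k\<close>; in a derivative of order
 \<open>k\<close> of the product at least one falls on the cutoff, and counting powers leaves
 \<open>1/R\<close>.\<close>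

lemma cutoff_glued:
 fixes F :: real
 assumes "ALL be z. mi_order be <= k --> abs(f be z) <= F"
 shows "EX A R0. 0<R0 & (ALL R>=R0. EX V. bounded_jet k Om V & (ALL al. ALL x:Om. dist x0 x <= R --> V al x = glued al x) &
  (ALL al. mi_order al = k --> (ALL x:Om. R < dist x0 x --> abs(V al x) <= A/R)))"
proof -
 note F = assms[rule_format]
 define kappa where "kappa = real (card {be :: 'n => nat. mi_order be < k})"
 define n where "n = real CARD('n)"
 have n: "1<=n" by(simp add: n_def)
 have kappa: "0<=kappa" by(simp add: kappa_def)
 have "abs(f (%_. 0) x0) <= F" by(rule F) simp
 hence F0: "0<=F" by simp
 define R0 where "R0 = abs B+(C+1)*r+1"
 have Cr: "0 < C*r" "(C+1)*r = C*r+r" using C r by(auto simp: algebra_simps)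
 have R0: "abs B+C*r < R0" "abs B+r < R0" "1<=R0" "0<R0" using Cr r by(auto simp: R0_def)
 have tay: "abs(taylor k f (b A) ga x) <= kappa*(F*(dist x0 x+abs B+1)^(k - 1 - mi_order ga))"
  if A: "is_piece r A" "A Int Co = {}" for A ga x
  unfolding kappa_def
 proof (rule taylor_bound)
  have "dist x (b A) <= dist x0 x+dist x0 (b A)" by(rule dist_triangle3)
  thus "norm (x - b A) <= dist x0 x+abs B+1" using base_dist[OF A] by(simp add: dist_norm)
  show "abs(f be (b A)) <= F" if "mi_order be < k" for be using F that by simp
 qed simp
 have farx: "A Int Co = {} & far A" if x: "R0 < dist x0 x" and A: "is_piece r A" "x:A" for x A
 proof -
  have nc: "A Int Co = {}"
  proof (rule ccontr)
   assume "A Int Co ~= {}"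
   then obtain z where z: "z:A" "z:Co" by blast
   have "dist z x <= r" using A z by(auto simp: is_piece_def small_def)
   thus False using Co(3)[OF z(2)] x R0(2) dist_triangle[of x0 x z] by linarith
  qed
  moreover have "far A"
  using near_dist[OF A(1) nc _ A(2)] base_dist[OF A(1) nc] x R0(1) dist_triangle[of x0 x "b A"] by force
  ultimately show ?thesis by simp
 qed
 obtain Cp where Cp: "0<=Cp" "!!R be y. 0<R ==> mi_order be <= k ==> abs(cutoff x0 R be (y :: real^'n)) <= Cp/R^mi_order be"
  using cutoff_bound[of k x0] by blast
 define A where "A = binom_const TYPE('n) k*(Cp*kappa*F*(4*n)^k)"
 show ?thesis
 proof (rule exI[of _ A], rule exI[of _ R0], intro conjI allI impI R0(4))
  fix R assume R: "R0 <= R"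
  have R1: "1<=R" "0<R" using R R0 by auto
  define V where "V = jmult (cutoff x0 R) glued"
  have V_eq: "V al x = glued al x" if "dist x0 x <= R" for al x
   using jmult_unit_sum[of "%_. cutoff x0 R" x "{()}" glued al] cutoff_one[OF R1(2) that] by(simp add: V_def)
  have V_zero: "V al x = 0" if "2*n*R < dist x0 x" for al x
   using cutoff_zero[OF R1(2), of x0 x] that by(simp add: V_def jmult_def n_def)
  have jet: "is_jet k Om V" unfolding V_def by(intro is_jet_mult cutoff_jet glued_jet)
  define D where "D = 2*n*R+abs B+1"
  have D: "1<=D" using n R1 by(simp add: D_def)
  define E where "E = F+kappa*(F*D^k)"
  have E: "0<=E" "F<=E" "kappa*(F*D^k) <= E" using F0 kappa D by(auto simp: E_def)
  have Gb: "abs(G (comp a x) ga x) <= E" if x: "x:Om" "dist x0 x <= 2*n*R" and a: "a:grid_near side x" and g: "mi_order ga <= k" for a x ga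
  proof (cases "comp a x Int Co = {}")
   case True
   have "abs(taylor k f (b (comp a x)) ga x) <= kappa*(F*(dist x0 x+abs B+1)^(k - 1 - mi_order ga))"
    by(rule tay[OF small_piece[OF comp_piece[OF x(1) a]] True])
   also have "... <= kappa*(F*D^(k - 1 - mi_order ga))"
    using x(2) by(intro mult_left_mono power_mono) (auto simp: D_def kappa F0)
   also have "... <= kappa*(F*D^k)" using D by(intro mult_left_mono power_increasing) (auto simp: kappa F0)
   also have "... <= E" by(rule E)
   finally show ?thesis using True by(simp add: G_def)
  next
   case False
   show ?thesis
    using F[OF g, of x] E(2) False by(simp add: G_def)
  qed
  define E2 where "E2 = E+glue_const TYPE('n) M C k*(F*(1+r)^k)"
  have E2: "0<=E2" unfolding E2_def using F0 r C E(1) by(intro add_nonneg_nonneg mult_nonneg_nonneg glue_const_nonneg) auto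
  have tb: "top_bound x F" for x using F0 F by(simp add: top_bound_def)
  have glued_b: "abs(glued ga x) <= E2" if x: "x:Om" "dist x0 x <= 2*n*R" and g: "mi_order ga <= k" for x ga
  proof -
   obtain a where a: "a:grid_near side x" using grid_near_nonempty[OF side(1)] by blast
   have "r^(k - mi_order ga) <= (1+r)^(k - mi_order ga)" using r by(intro power_mono) auto
   also have "... <= (1+r)^k" using r by simp
   finally have "glue_const TYPE('n) M C k*(F*r^(k - mi_order ga)) <= glue_const TYPE('n) M C k*(F*(1+r)^k)"
    using C by(intro mult_left_mono glue_const_nonneg F0) auto
   thus ?thesis using glued_near[OF x(1) a tb g] Gb[OF x a g] unfolding E2_def by simp
  qed
  have Vb: "abs(V al x) <= binom_const TYPE('n) k*(Cp*E2)" if a: "mi_order al <= k" and x: "x:Om" for al x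
  proof (cases "dist x0 x <= 2*n*R")
   case True
   show ?thesis unfolding V_def
   proof (rule jmult_le[where A = "%be. Cp" and B = "%_. E2", OF a])
    fix be assume b: "be:below al"
    note o = mi_order_below[OF b]
    have ok: "mi_order be <= k" "mi_order (%i. al i - be i) <= k" using o a by auto
    have "Cp/R^mi_order be <= Cp/1" using Cp(1) R1 by(intro divide_left_mono) (auto simp: one_le_power)
    thus "abs(cutoff x0 R be x) <= Cp" using Cp(2)[OF R1(2) ok(1), of x] by simp
    show "abs(glued (%i. al i - be i) x) <= E2" by(rule glued_b[OF x True ok(2)])
   qed (use Cp(1) E2 in simp_all)
  next
   case False
   show ?thesis
    by(smt (verit) Cp(1) E2 V_zero False mult_nonneg_nonneg binom_const_nonneg)
  qed
  have top: "abs(V al x) <= A/R" if a: "mi_order al = k" and x: "x:Om" "R < dist x0 x" for al x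
  proof (cases "dist x0 x <= 2*n*R")
   case True
   have "A Int Co = {} & far A" if "is_piece r A" "x:A" for A
    by(smt (verit) x R farx that)
   from glued_far[OF x(1) this] obtain P where P: "is_piece r P" "P Int Co = {}" "!!al. glued al x = taylor k f (b P) al x" by blast
   have "abs(V al x) <= binom_const TYPE('n) k*(Cp*kappa*F*(4*n)^k/R)" unfolding V_def
   proof (rule jmult_le[where A = "%be. Cp/R^mi_order be" and
      B = "%be. if mi_order be = 0 then 0 else kappa*(F*(4*n*R)^(mi_order be - 1))"])
    show "mi_order al <= k" "0 <= Cp*kappa*F*(4*n)^k/R" using a Cp(1) kappa F0 n R1 by auto
   next
    fix be assume b: "be:below al"
    note o = mi_order_below[OF b]
    have ok: "mi_order be <= k" "mi_order (%i. al i - be i) = k - mi_order be" using o a by auto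
    show "abs(cutoff x0 R be x) <= Cp/R^mi_order be" by(rule Cp(2)[OF R1(2) ok(1)])
    show "abs(glued (%i. al i - be i) x) <= (if mi_order be = 0 then 0 else kappa*(F*(4*n*R)^(mi_order be - 1)))"
    proof (cases "mi_order be = 0")
     case True
     thus ?thesis using P(3) ok by(simp add: taylor_high)
    next
     case False
     have "abs(taylor k f (b P) (%i. al i - be i) x) <= kappa*(F*(dist x0 x+abs B+1)^(k - 1 - mi_order (%i. al i - be i)))"
      by(rule tay[OF P(1,2)])
     also have "k - 1 - mi_order (%i. al i - be i) = mi_order be - 1" using ok by simp
     also have "kappa*(F*(dist x0 x+abs B+1)^(mi_order be - 1)) <= kappa*(F*(4*n*R)^(mi_order be - 1))"
     proof (intro mult_left_mono power_mono)
      have "abs B+1 <= R0" using Cr r by(simp add: R0_def)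
      moreover have "1*R <= n*R" using n R1 by simp
      ultimately show "dist x0 x+abs B+1 <= 4*n*R" using True R R1 by linarith
     qed (auto simp: kappa F0)
     finally show ?thesis using False P(3) by simp
    qed
    show "Cp/R^mi_order be*(if mi_order be = 0 then 0 else kappa*(F*(4*n*R)^(mi_order be - 1))) <= Cp*kappa*F*(4*n)^k/R"
    proof (cases "mi_order be = 0")
     case True
     thus ?thesis using Cp(1) kappa F0 n R1 by simp
    next
     case False
     then obtain j where j: "mi_order be = Suc j" by(cases "mi_order be") auto
     have "Cp/R^mi_order be*(kappa*(F*(4*n*R)^(mi_order be - 1))) = Cp*kappa*F*(4*n)^j/R"
      by(simp add: j power_mult_distrib)
     also have "... <= Cp*kappa*F*(4*n)^k/R"
      using R1 Cp(1) kappa F0 n ok j by(intro divide_right_mono mult_left_mono power_increasing) auto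
     finally show ?thesis using False by simp
    qed
   qed
   thus ?thesis by(simp add: A_def)
  next
   case False
   have "0<=A" unfolding A_def using Cp(1) kappa F0 n by(intro mult_nonneg_nonneg binom_const_nonneg) auto
   thus ?thesis using V_zero False R1 by simp
  qed
  show "EX V. bounded_jet k Om V & (ALL al. ALL x:Om. dist x0 x <= R --> V al x = glued al x) &
   (ALL al. mi_order al = k --> (ALL x:Om. R < dist x0 x --> abs(V al x) <= A/R))"
   using jet Vb V_eq top unfolding bounded_jet_def by(intro exI[of _ V]) auto
 qed
qed

end

section \<open>Mollification against averages\<close>

lemma integrable_powr_add:
 fixes f g :: "'a::euclidean_space => real"
 assumes "0<=p" "f:borel_measurable borel" "g:borel_measurable borel"
  "integrable lborel (%x. abs(f x) powr p)" "integrable lborel (%x. abs(g x) powr p)"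
 shows "integrable lborel (%x. abs(f x+g x) powr p)"
proof (rule Bochner_Integration.integrable_bound)
 show "integrable lborel (%x. 2 powr p*(abs(f x) powr p+abs(g x) powr p))" using assms by simp
 show "AE x in lborel. norm (abs(f x+g x) powr p) <= norm (2 powr p*(abs(f x) powr p+abs(g x) powr p))"
  using powr_add_le[OF assms(1)] by simp
qed (use assms in measurable)

lemma integrable_powr_sum:
 fixes f :: "'b => 'a::euclidean_space => real"
 assumes "1<=p" "finite I" "!!i. i:I ==> f i:borel_measurable borel" "!!i. i:I ==> integrable lborel (%x. abs(f i x) powr p)"
 shows "integrable lborel (%x. abs(SUM i:I. f i x) powr p)"
 using assms(2-4)
proof (induction I rule: finite_induct)
 case empty thus ?case by simp
next
 case (insert i I)
 have "integrable lborel (%x. abs(f i x+(SUM i:I. f i x)) powr p)"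
  using assms(1) insert by(intro integrable_powr_add) auto
 thus ?case using insert by simp
qed

text \<open>The mollifier at a point near \<open>x\<close> averages over a ball inside the larger
 ball around \<open>x\<close>.\<close>

lemma mol_le_avg:
 fixes h H :: "real^'n::finite => real"
 assumes sig: "0<sig" "sig<=1" and r: "0<r" and h: "integrable lborel h" and H: "integrable lborel H" "!!y. abs(h y) <= H y"
  and z: "dist x z <= L*r"
 shows "abs(mol (sig*r/CARD('n)) h z) <= (CARD('n)/sig)^CARD('n)/mass TYPE('n)*avg (L+1) r H x"
proof -
 define n where "n = real CARD('n)"
 have n: "1<=n" by(simp add: n_def)
 define tau where "tau = sig*r/n"
 have tau: "0<tau" "n*tau = sig*r" using sig r n by(auto simp: tau_def)
 have m: "0 < mass TYPE('n)" by(rule mass_pos)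
 have "avg n tau (%y. abs(h y)) z = (n/sig)^CARD('n)*avg sig r (%y. abs(h y)) z"
 proof -
  have "n/sig = r/tau" using tau sig by(simp add: field_simps)
  hence "I/tau^CARD('n) = (n/sig)^CARD('n)*(I/r^CARD('n))" for I
   using r by(simp add: power_divide)
  thus ?thesis unfolding avg_def tau(2) by blast
 qed
 also have "... <= (n/sig)^CARD('n)*avg (L+1) r H x"
 proof (intro mult_left_mono avg_mono)
  show "cball z (sig*r) <= cball x ((L+1)*r)"
  proof
   fix y assume "y:cball z (sig*r)"
   moreover have "sig*r <= 1*r" using sig r by simp
   ultimately show "y:cball x ((L+1)*r)" using z dist_triangle[of x y z] by(simp add: distrib_right)
  qed
 qed (use h H r n sig in auto)
 finally have "avg n tau (%y. abs(h y)) z/mass TYPE('n) <= (n/sig)^CARD('n)*avg (L+1) r H x/mass TYPE('n)"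
  using m by(intro divide_right_mono) auto
 moreover have "abs(mol tau h z) <= avg n tau (%y. abs(h y)) z/mass TYPE('n)" using mol_bound[OF tau(1) h, of z] by(simp add: n_def)
 ultimately show ?thesis by(simp add: tau_def n_def)
qed

lemma mol_bounded:
 fixes h :: "real^'n::finite => real"
 assumes "0<tau" "integrable lborel h" shows "abs(mol tau h x) <= (LINT y|lborel. abs(h y))/(tau^CARD('n)*mass TYPE('n))"
proof -
 have "abs(LINT y|lborel. h y*kern tau (%_. 0) x y) <= (LINT y|lborel. abs(h y*kern tau (%_. 0) x y))" by simp
 also have "... <= (LINT y|lborel. abs(h y))"
 proof (rule integral_mono)
  show "integrable lborel (%y. abs(h y*kern tau (%_. 0) x y))" using times_kern_integrable[OF assms] by simp
  show "abs(h y*kern tau (%_. 0) x y) <= abs(h y)" for y using kern_0[of tau x y] by(simp add: abs_mult mult_left_le)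
 qed (use assms in simp)
 finally show ?thesis unfolding mol_def abs_divide using assms(1) mass_pos[where 'n = 'n]
  by(simp add: divide_right_mono abs_mult)
qed

context hyp_domain
begin

lemma K_ball_connected: "x0:Om ==> connected {x:Om. K x0 x <= R}"
proof (cases "0<=R")
 case False
 assume "x0:Om"
 hence "{x:Om. K x0 x <= R} = {}" using False K_nonneg[of x0] by force
 thus ?thesis by(simp only: connected_empty)
next
 case True
 assume x0: "x0:Om"
 let ?S = "{x:Om. K x0 x <= R}"
 have 1: "connected_component ?S x0 x" if x: "x : ?S" for x
 proof -
  obtain g where g: "geo x0 x g" using geo_exists x0 x by blast
  note i = geo_image_connected[OF x0 _ g]
  have "K x0 (g s) <= R" if "s:{0..K x0 x}" for s
   using geo_K[OF g, of 0 s] geo_ends(1)[OF g] that x by auto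
  hence "g ` {0..K x0 x} <= ?S" using i(2) x by auto
  thus ?thesis unfolding connected_component_def using i x by blast
 qed
 show ?thesis
  unfolding connected_iff_connected_component using 1 connected_component_sym connected_component_trans by blast
qed

lemma K_ball_collar:
 assumes x0: "x0:Om" and R: "0<=R" and x: "x:Om" "R+1 < K x0 x" and y: "dist x y <= exp (- R)*bd x0/2"
 shows "y ~: {x:Om. K x0 x <= R}"
proof
 assume "y:{x:Om. K x0 x <= R}"
 hence yy: "y:Om" "K x0 y <= R" by auto
 define d where "d = exp (- R)*bd x0"
 have d: "0<d" using bd_pos[OF x0] by(simp add: d_def)
 have "exp (- R) <= exp (- K x0 y)" using yy(2) by simp
 hence "d <= exp (- K x0 y)*bd x0" unfolding d_def using bd_nonneg by(rule mult_right_mono)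
 hence "d <= bd y" using bd_ge_K[OF x0 yy(1)] by linarith
 have yx: "dist y x <= d/2" using y by(simp add: d_def dist_commute)
 hence "dist y x < bd y" using d `d <= bd y` by linarith
 hence "K y x <= dist y x/(bd y - dist y x)" using K_le_near[OF yy(1)] x(1) by blast
 also have "... <= 1" using yx `d <= bd y` d by simp
 finally show False using K_triangle[OF x0 yy(1) x(1)] yy(2) x(2) by linarith
qed

lemma compact_in_K_ball:
 assumes "x0:Om" "compact S" "S<=Om" shows "EX R. ALL x:S. K x0 x <= R"
proof -
 have "bounded (K x0 ` S)"
  by(intro compact_imp_bounded compact_continuous_image assms continuous_on_subset[OF continuous_K[OF assms(1)]])
 thus ?thesis unfolding bounded_iff by(metis abs_le_D1 image_eqI real_norm_def)
qed

end

section \<open>Approximation of jets\<close>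

context hyp_domain
begin

text \<open>A jet given at distance \<open>c0 r\<close> from the boundary has a bounded jet on the
 whole domain that agrees with it on \<open>Q\<close> and whose derivatives of order
 \<open>k\<close> at a point are bounded by those of the given jet nearby. The error
 \<open>eps\<close> comes from the cutoff.\<close>

definition jet_approximating :: "nat => real => real => real => bool" where
 "jet_approximating k c0 L E \<longleftrightarrow> (ALL x0 r f F Q eps. small_scale x0 r -->
   is_jet k {z:Om. c0*r <= bd z} f --> (ALL be z. mi_order be <= k --> abs(f be z) <= F) -->
   connected Q --> bounded Q --> Q<=Om --> x0:Q --> (ALL q:Q. (sepC+1)*r <= bd q) --> 0<eps -->
   (EX V. bounded_jet k Om V & (ALL al. ALL x:Q. V al x = f al x) &
    (ALL al x S. mi_order al = k --> x:Om --> 0<=S -->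
     (ALL z:Om. c0*r <= bd z --> dist x z <= L*r --> (ALL al. mi_order al = k --> abs(f al z) <= S)) --> abs(V al x) <= E*S+eps)))"

text \<open>The constants depend on the domain and on \<open>k\<close>, not on the scale
 \<open>r\<close>.\<close>

theorem jet_approximation:
 assumes fin: "emeasure lebesgue Om < \<infinity>"
 shows "EX c0 L E. 0<c0 & c0 <= 1 & 0<L & 0<=E & jet_approximating k c0 L E"
proof -
 from tentacle_decomposition[OF fin] obtain M c C where cC: "0<c" "0<C" and dec: "ALL x0 r. small_scale x0 r -->
   (EX B Co b far. decomposition Om delta M c C r B x0 Co b far &
    (ALL Q. connected Q --> Q<=Om --> x0:Q --> (ALL q:Q. (sepC+1)*r <= bd q) --> Q<=Co))"
  by auto
 define E where "E = glue_const TYPE('n) M C k+1"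
 have E0: "0<=E" using glue_const_nonneg[of C M k, where 'n = 'n] cC by(simp add: E_def)
 show ?thesis unfolding jet_approximating_def
 proof (rule exI[of _ "min c 1/4"], rule exI[of _ "2*C+1"], rule exI[of _ E], intro conjI allI impI E0)
  show "0 < min c 1/4" "min c 1/4 <= 1" "0 < 2*C+1" using cC by auto
  fix x0 r and f :: "('n => nat) => real^'n => real" and F Q and eps :: real
  assume sc: "small_scale x0 r" and f: "is_jet k {z:Om. min c 1/4*r <= bd z} f" and F: "ALL be z. mi_order be <= k --> abs(f be z) <= F"
   and Q: "connected Q" "bounded Q" "Q<=Om" "x0:Q" "ALL q:Q. (sepC+1)*r <= bd q" and eps: "0<eps"
  from dec[rule_format, OF sc] obtain B Co b far where D: "decomposition Om delta M c C r B x0 Co b far"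
   and Co: "ALL Q. connected Q --> Q<=Om --> x0:Q --> (ALL q:Q. (sepC+1)*r <= bd q) --> Q<=Co"
   by auto
  have QCo: "Q<=Co" using Co Q by blast
  interpret gl: gluing Om delta M c C r B x0 Co b far k f by(intro gluing.intro gluing_axioms.intro D f)
  obtain R1 where R1: "!!q. q:Q ==> dist x0 q <= R1" using Q(2) unfolding bounded_any_center[of Q x0] by blast
  from gl.cutoff_glued[OF F] obtain A R0 where R0: "0<R0" and AR: "ALL R>=R0. EX V. bounded_jet k Om V &
   (ALL al. ALL x:Om. dist x0 x <= R --> V al x = gl.glued al x) &
   (ALL al. mi_order al = k --> (ALL x:Om. R < dist x0 x --> abs(V al x) <= A/R))"
   by auto
  (* Within \<open>R\<close> the cutoff has no effect, which covers \<open>Q\<close>; beyond, the derivatives of order \<open>k\<close> are at most \<open>eps\<close>. *)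
  define R where "R = max R0 (max R1 (abs A/eps))"
  have R: "R0 <= R" "R1 <= R" "abs A/eps <= R" "0<R" using R0 by(auto simp: R_def)
  hence AR': "A/R <= eps"
   by(smt (verit) eps pos_divide_le_eq mult.commute)
  from AR[rule_format, OF R(1)] obtain V where V: "bounded_jet k Om V"
   "ALL al. ALL x:Om. dist x0 x <= R --> V al x = gl.glued al x"
   "ALL al. mi_order al = k --> (ALL x:Om. R < dist x0 x --> abs(V al x) <= A/R)"
   by auto
  show "EX V. bounded_jet k Om V & (ALL al. ALL x:Q. V al x = f al x) &
    (ALL al x S. mi_order al = k --> x:Om --> 0<=S -->
     (ALL z:Om. min c 1/4*r <= bd z --> dist x z <= (2*C+1)*r --> (ALL al. mi_order al = k --> abs(f al z) <= S)) --> abs(V al x) <= E*S+eps)"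
  proof (rule exI[of _ V], intro conjI allI impI ballI V(1))
   fix al :: "'n => nat" and x assume x: "x:Q"
   hence "dist x0 x <= R" using R1[OF x] R(2) by simp
   hence "V al x = gl.glued al x" using V(2) x Q(3) by blast
   also have "... = f al x" using gl.glued_core QCo x by blast
   finally show "V al x = f al x" .
  next
   fix al :: "'n => nat" and x S assume a: "mi_order al = k" and x: "x:Om" and S0: "0<=S"
    and S: "ALL z:Om. min c 1/4*r <= bd z --> dist x z <= (2*C+1)*r --> (ALL al. mi_order al = k --> abs(f al z) <= S)"
   show "abs(V al x) <= E*S+eps"
   proof (cases "dist x0 x <= R")
    case True
    have tb: "gl.top_bound x S" unfolding gl.top_bound_def using S0 S by blast
    have "abs(gl.glued al x) <= E*S" unfolding E_def by(rule gl.glued_top[OF x tb a])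
    thus ?thesis using V(2) True x eps by fastforce
   next
    case False
    hence "abs(V al x) <= A/R" using V(3) a x by simp
    moreover have "0 <= E*S" using E0 S0 by simp
    ultimately show ?thesis using AR' by linarith
   qed
  qed
 qed
qed

end

section \<open>Approximation of Sobolev functions\<close>

context hyp_domain
begin

text \<open>The domain is exhausted by the quasihyperbolic balls \<open>P R\<close>. Choose
 \<open>R\<close> so large that the derivatives \<open>H\<close> of order \<open>k\<close> carry
 little mass outside \<open>P R\<close>, then a scale \<open>r\<close> so small that \<open>P (R
 + 1)\<close> lies far from the boundary and that balls of radius \<open>(L + 1) r\<close> around
 points outside \<open>P (R + 1)\<close> miss \<open>P R\<close>. On \<open>P (R + 1)\<close> the
 approximating jet is the mollified one; outside, its derivatives of order \<open>k\<close> are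
 bounded by averages of \<open>H\<close>, and those averages see only the complement of \<open>P
 R\<close>.\<close>

theorem sobolev_approximation:
 fixes g h :: "('n => nat) => real^'n => real" and e :: real
 assumes fin: "emeasure lebesgue Om < \<infinity>" and k: "1<=k" and p: "1<=p"
  and w: "!!al i. mi_order al < k ==> has_weak_deriv Om (unit_mi i) (g al) (g (up i al))"
  and rep: "!!al. mi_order al <= k ==> represents Om (g al) (h al)"
  and hp: "!!al. mi_order al <= k ==> integrable lborel (%x. abs(h al x) powr p)"
  and K1: "compact K1" "K1 <= Om" and e: "0<e"
 shows "EX V. bounded_jet k Om V & (ALL al. mi_order al = k --> Lpow p lborel Om (%x. h al x - V al x) < ennreal e) &
  (ALL al. mi_order al <= k --> Lpow p lborel K1 (%x. h al x - V al x) < ennreal e)"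
proof -
 define n where "n = real CARD('n)"
 have n: "1<=n" by(simp add: n_def)
 have p0: "0<=p" "0<p" using p by auto
 have Omb [measurable]: "Om:sets borel" using open_dom by simp
 have fin': "emeasure lborel Om < \<infinity>" using fin by simp
 obtain x0 where x0: "x0:Om" using nonempty_dom by blast
 from jet_approximation[OF fin, of k] obtain c0 L E where c0: "0<c0" "c0 <= 1" and L: "0<L" and E: "0<=E"
  and app: "jet_approximating k c0 L E" by blast
 have hm [measurable]: "h al:borel_measurable borel" and h0: "!!x. x ~: Om ==> h al x = 0" if "mi_order al <= k" for al
  using rep[OF that] by(auto simp: represents_def)
 have hi: "integrable lborel (h al)" if "mi_order al <= k" for al
  by(rule Lp_imp_integrable[OF p Omb fin' hm[OF that] h0[OF that] hp[OF that]])
 define H where "H x = (\<Sum>al | mi_order al = k. abs(h al x))" for x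
 have H0: "0 <= H x" for x unfolding H_def by simp
 have hH: "abs(h al x) <= H x" if "mi_order al = k" for al x
  unfolding H_def using that by(intro member_le_sum) (auto simp: finite_mi_order_eq)
 have Hi: "integrable lborel H" unfolding H_def using hi by auto
 have Hm [measurable]: "H:borel_measurable borel" using borel_measurable_integrable[OF Hi] by simp
 have "integrable lborel (%x. abs(H x) powr p)" unfolding H_def
 proof (rule integrable_powr_sum[OF p finite_mi_order_eq])
  show "(%x. abs(h al x)):borel_measurable borel" if "al:{al. mi_order al = k}" for al using that by simp
  show "integrable lborel (%x. \<bar>\<bar>h al x\<bar>\<bar> powr p)" if "al:{al. mi_order al = k}" for al using hp[of al] that by simp
 qed
 hence Hp: "integrable lborel (%x. H x powr p)" using H0 by simp
 have HO: "H x = 0" if "x ~: Om" for x unfolding H_def using h0 that by simp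
 (* Half of the distance at which the jet must be defined, so that the mollifying kernels fit. *)
 define sig where "sig = c0/2"
 have sig: "0<sig" "sig<=1" using c0 by(auto simp: sig_def)
 define q where "q = (n/sig)^CARD('n)/mass TYPE('n)"
 have q: "0<=q" using n sig mass_pos[where 'n = 'n] by(simp add: q_def)
 define c where "c = ennreal (2 powr p)"
 define W where "W = ennreal ((unit_ball_vol (CARD('n))*(L+1)^CARD('n)) powr p)"
 define Y where "Y = ennreal ((E*q) powr p)"
 define T where "T = c+c*(c*(Y*W))"
 have fT: "c < \<infinity>" "T < \<infinity>" by(simp_all add: T_def c_def W_def Y_def ennreal_mult_less_top)
 define P where "P R = {x:Om. K x0 x <= R}" for R
 have Pc: "compact (P R)" for R unfolding P_def by(rule compact_K_ball[OF x0])
 have Pm [measurable]: "P R:sets borel" for R using Pc compact_imp_closed by(auto intro: borel_closed)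
 obtain R1 where R1: "!!x. x:K1 ==> K x0 x <= R1" using compact_in_K_ball[OF x0 K1] by blast
 have "(%m. Lpow p lborel UNIV (%x. H x*indicator (- P (real m)) x)) \<longlonglongrightarrow> 0"
 proof (rule Lpow_dominated[where w = H])
  show "Lpow p lborel UNIV H < \<infinity>" using Hp H0 by(simp add: Lpow_def nn_integral_eq_integral)
  have "(%m. H x*indicator (- P (real m)) x) \<longlonglongrightarrow> 0" for x
  proof (rule tendsto_eventually)
   have "\<forall>\<^sub>F m in sequentially. K x0 x <= real m" by(meson eventually_at_top_linorder nat_ceiling_le_eq)
   thus "\<forall>\<^sub>F m in sequentially. H x*indicator (- P (real m)) x = 0"
    by eventually_elim (use HO[of x] in "auto simp: P_def indicator_def")
  qed
  thus "AE x in lborel. x:UNIV --> (%m. H x*indicator (- P (real m)) x) \<longlonglongrightarrow> 0" by simp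
 qed (use p0 in "auto simp: indicator_def")
 moreover have "Lpow p lborel UNIV (%x. H x*indicator (- P (real m)) x) = Lpow p lborel (- P (real m)) H" for m
  unfolding Lpow_def using p0 by(intro nn_integral_cong) (auto simp: indicator_def)
 ultimately have "(%m. Lpow p lborel (- P (real m)) H) \<longlonglongrightarrow> 0" by simp
 from eventually_small[OF this fT(2), of "ennreal (e/4)"] e
 have "\<forall>\<^sub>F m in sequentially. T*Lpow p lborel (- P (real m)) H < ennreal (e/4)" by simp
 moreover have "\<forall>\<^sub>F m in sequentially. R1 <= real m" by(meson eventually_at_top_linorder nat_ceiling_le_eq)
 ultimately have "\<forall>\<^sub>F m in sequentially. T*Lpow p lborel (- P (real m)) H < ennreal (e/4) & R1 <= real m"
  by eventually_elim auto
 then obtain m0 where m0: "T*Lpow p lborel (- P (real m0)) H < ennreal (e/4)" "R1 <= real m0"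
  by(auto simp: eventually_sequentially)
 define R where "R = real m0"
 have R: "0<=R" "R1 <= R" using m0 by(auto simp: R_def)
 define Q where "Q = P (R+1)"
 have KQ: "K1 <= Q" using R1 R(2) K1(2) by(fastforce simp: Q_def P_def)
 have QOm: "Q<=Om" by(auto simp: Q_def P_def)
 have x0Q: "x0:Q" using x0 R by(simp add: Q_def P_def)
 have Qm [measurable]: "Q:sets borel" by(simp add: Q_def)
 define d where "d = exp (- (R+1))*bd x0"
 have d: "0<d" "d <= bd x0"
 using bd_pos[OF x0] R by(auto simp: d_def)
 have dQ: "d <= bd z" if "z:Q" for z
 proof -
  have z: "z:Om" "K x0 z <= R+1" using that by(auto simp: Q_def P_def)
  have "d <= exp (- K x0 z)*bd x0" unfolding d_def using z(2) bd_nonneg by(intro mult_right_mono) auto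
  thus ?thesis using bd_ge_K[OF x0 z(1)] by linarith
 qed
 define rho where "rho = exp (- R)*bd x0/2"
 have rho: "0<rho" using bd_pos[OF x0] by(simp add: rho_def)
 define rs where "rs m = inverse (real (Suc m))" for m
 have rs: "0 < rs m" "rs \<longlonglongrightarrow> 0" for m unfolding rs_def using LIMSEQ_inverse_real_of_nat by auto
 have rsC: "(%m. a*rs m) \<longlonglongrightarrow> 0" for a using tendsto_mult_right_zero[OF rs(2)] by blast
 define tau where "tau m = sig*rs m/n" for m
 have tau: "0 < tau m" "tau \<longlonglongrightarrow> 0" for m
  using sig rs(1) n rsC[of "sig/n"] by(auto simp: tau_def[abs_def])
 have "\<forall>\<^sub>F m in sequentially. ALL al:{al. mi_order al <= k}. Lpow p lborel Om (%x. mol (tau m) (h al) x - h al x) < ennreal (e/2)"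
  using e by(intro eventually_ball_finite[OF finite_mi_order_le] ballI order_tendstoD(2)[OF mol_converges[OF p open_dom fin' hm h0 hp tau]]) auto
 moreover have "\<forall>\<^sub>F m in sequentially. (sepC+1)*rs m < d" "\<forall>\<^sub>F m in sequentially. (L+1)*rs m < rho"
  using d rho by(auto intro!: order_tendstoD(2)[OF rsC])
 ultimately have "\<forall>\<^sub>F m in sequentially. (ALL al:{al. mi_order al <= k}. Lpow p lborel Om (%x. mol (tau m) (h al) x - h al x) < ennreal (e/2))
   & (sepC+1)*rs m < d & (L+1)*rs m < rho" by eventually_elim auto
 then obtain m where m: "ALL al:{al. mi_order al <= k}. Lpow p lborel Om (%x. mol (tau m) (h al) x - h al x) < ennreal (e/2)"
   "(sepC+1)*rs m < d" "(L+1)*rs m < rho"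
  by(auto simp: eventually_sequentially)
 define r where "r = rs m"
 have r: "0<r" "(sepC+1)*r < d" "(L+1)*r < rho" using rs(1) m by(auto simp: r_def)
 define t where "t = sig*r/n"
 have t: "0<t" "n*t = c0*r/2" "t = tau m" using sig r n by(auto simp: t_def sig_def r_def tau_def)
 define f where "f al = mol t (h al)" for al
 have moll: "Lpow p lborel Om (%x. f al x - h al x) < ennreal (e/2)" if "mi_order al <= k" for al
  using m(1) that by(simp add: f_def t(3))
 have fm: "f al:borel_measurable borel" if "mi_order al <= k" for al
  unfolding f_def by(rule mol_measurable[OF t(1) hi[OF that]])
 have sc: "small_scale x0 r" using x0 r d by(simp add: small_scale_def)
 have fjet: "is_jet k {z:Om. c0*r <= bd z} f"
 proof (rule is_jet_subset)
  show "is_jet k {x. cball x (real CARD('n)*t) <= Om} f" unfolding f_def by(rule mol_jet[OF t(1) w rep hi])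
  show "{z:Om. c0*r <= bd z} <= {x. cball x (real CARD('n)*t) <= Om}"
  proof clarify
   fix z y assume z: "z:Om" "c0*r <= bd z" and y: "y:cball z (real CARD('n)*t)"
   have "dist z y <= c0*r/2" using y t(2) by(simp add: n_def)
   moreover have "0 < c0*r" using c0 r by simp
   ultimately show "y:Om" using z by(intro in_dom_if_near[OF z(1)]) linarith
  qed
 qed
 define F where "F = (\<Sum>al | mi_order al <= k. (LINT y|lborel. abs(h al y))/(t^CARD('n)*mass TYPE('n)))"
 have F: "abs(f be z) <= F" if "mi_order be <= k" for be z
 proof -
  have "abs(f be z) <= (LINT y|lborel. abs(h be y))/(t^CARD('n)*mass TYPE('n))"
   unfolding f_def by(rule mol_bounded[OF t(1) hi[OF that]])
  also have "... <= F" unfolding F_def using that t(1) mass_pos[where 'n = 'n]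
   by(intro member_le_sum) (auto simp: finite_mi_order_le intro!: divide_nonneg_nonneg)
  finally show ?thesis .
 qed
 define v where "v = measure lborel Om"
 have v: "0<=v" "emeasure lborel Om = ennreal v" using fin' by(auto simp: v_def emeasure_eq_ennreal_measure)
 (* The error \<open>eps\<close> is spread over the domain of measure \<open>v\<close>; the powers of 2 come from splitting sums. *)
 define s where "s = e/(8*(2 powr p*2 powr p)*(v+1))"
 have s: "0<s" using e v by(simp add: s_def)
 define eps where "eps = s powr (1/p)"
 have eps: "0<eps" "eps powr p = s" using s p0 by(auto simp: eps_def powr_powr)
 have sv: "c*(c*(ennreal s*ennreal v)) < ennreal (e/4)"
 proof -
  have "2 powr p*(2 powr p*(s * v)) = e/8*(v/(v+1))" by(simp add: s_def)
  also have "... <= e/8*1" using e v by(intro mult_left_mono) auto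
  also have "... < e/4" using e by simp
  finally show ?thesis using s v e by(simp add: c_def ennreal_mult[symmetric] ennreal_lessI)
 qed
 have Qc: "connected Q" "bounded Q" unfolding Q_def P_def using K_ball_connected[OF x0] Pc compact_imp_bounded by(auto simp: P_def)
 have Qbd: "ALL z:Q. (sepC+1)*r <= bd z" using dQ r(2) by force
 have Fb: "ALL be z. mi_order be <= k --> abs(f be z) <= F" using F by blast
 from app[unfolded jet_approximating_def, THEN spec[of _ x0], THEN spec[of _ r], THEN spec[of _ f], THEN spec[of _ F], THEN spec[of _ Q], THEN spec[of _ eps],
   THEN mp, OF sc, THEN mp, OF fjet, THEN mp, OF Fb, THEN mp, OF Qc(1), THEN mp, OF Qc(2), THEN mp, OF QOm,
   THEN mp, OF x0Q, THEN mp, OF Qbd, THEN mp, OF eps(1)]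
 obtain V where V: "bounded_jet k Om V" "ALL al. ALL x:Q. V al x = f al x"
   "ALL al x S. mi_order al = k --> x:Om --> 0<=S -->
     (ALL z:Om. c0*r <= bd z --> dist x z <= L*r --> (ALL al. mi_order al = k --> abs(f al z) <= S)) --> abs(V al x) <= E*S+eps"
  by auto
 define a where "a x = avg (L+1) r H x" for x
 have a0: "0 <= a x" for x unfolding a_def using r H0 by(intro avg_nonneg) auto
 have am [measurable]: "a:borel_measurable borel" unfolding a_def by(rule avg_measurable[OF Hm])
 have Va: "abs(V al x) <= E*q*a x+eps" if al: "mi_order al = k" and x: "x:Om" for al x
 proof -
  have "abs(f be z) <= q*a x" if z: "dist x z <= L*r" "mi_order be = k" for be z
   unfolding f_def t_def q_def a_def n_def using z hH[OF z(2)]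
   by(intro mol_le_avg[OF sig r(1) hi Hi]) auto
  hence "abs(V al x) <= E*(q*a x)+eps" using V(3) al x q a0 by simp
  thus ?thesis by simp
 qed
 have top: "Lpow p lborel Om (%x. h al x - V al x) < ennreal e" if al: "mi_order al = k" for al
 proof -
  have alk: "mi_order al <= k" using al by simp
  note [measurable] = hm[OF alk] fm[OF alk]
  define X where "X = Lpow p lborel (- P R) H"
  have "Lpow p lborel Om (%x. h al x - V al x) <= Lpow p lborel Om (%x. f al x - h al x)+Lpow p lborel (Om - Q) (%x. H x+(E*q*a x+eps))"
  proof (rule Lpow_split)
   fix x assume "x:Om"
   moreover have "abs(h al x - V al x) <= abs(H x+(E*q*a x+eps))" if "x:Om" using hH[OF al, of x] Va[OF al that] by simp
   moreover have "abs(h al x - V al x) <= abs(f al x - h al x)" if "x:Q" using V(2) that by simp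
   ultimately show "x:Om & abs(h al x - V al x) <= abs(f al x - h al x) | x:Om - Q & abs(h al x - V al x) <= abs(H x+(E*q*a x+eps))" by blast
  qed (use p0 in auto)
  also have "Lpow p lborel (Om - Q) (%x. H x+(E*q*a x+eps)) <= c*(X+c*(Y*(W*X)+ennreal s*ennreal v))"
  proof -
   have "Lpow p lborel (Om - Q) (%x. H x+(E*q*a x+eps)) <= c*(Lpow p lborel (Om - Q) H+Lpow p lborel (Om - Q) (%x. E*q*a x+eps))"
    unfolding c_def by(rule Lpow_add) (use p0 in auto)
   also have "... <= c*(X+c*(Lpow p lborel (Om - Q) (%x. E*q*a x)+Lpow p lborel (Om - Q) (%x. eps)))"
   proof (intro mult_left_mono add_mono)
    show "Lpow p lborel (Om - Q) H <= X" unfolding X_def using p0 by(intro Lpow_mono) (auto simp: Q_def P_def)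
   qed (use p0 in "auto simp: c_def intro!: Lpow_add")
   also have "... <= c*(X+c*(Y*(W*X)+ennreal s*ennreal v))"
   proof (intro mult_left_mono add_left_mono add_mono)
    have "Lpow p lborel (Om - Q) a <= W*X"
     unfolding a_def[abs_def] W_def X_def
    proof (rule avg_Lp[OF p _ r(1) H0 Hi Hp])
     fix x y assume x: "x:Om - Q" and xy: "dist x y <= (L+1)*r"
     have "R+1 < K x0 x" using x by(auto simp: Q_def P_def)
     hence "y ~: P R" unfolding P_def
      using x xy r(3) by(intro K_ball_collar[OF x0 R(1), of x]) (auto simp: rho_def)
     thus "y : - P R" by simp
    qed (use L in auto)
    thus "Lpow p lborel (Om - Q) (%x. E*q*a x) <= Y*(W*X)"
     using E q by(simp add: Lpow_cmult Y_def mult_left_mono abs_mult)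
    have "emeasure lborel (Om - Q) <= ennreal v" unfolding v(2)[symmetric] by(rule emeasure_mono) auto
    thus "Lpow p lborel (Om - Q) (%x. eps) <= ennreal s*ennreal v" using eps by(simp add: Lpow_const mult_left_mono)
   qed auto
   finally show ?thesis .
  qed
  also have "c*(X+c*(Y*(W*X)+ennreal s*ennreal v)) = T*X+c*(c*(ennreal s*ennreal v))"
   by(simp add: T_def algebra_simps)
  also have "Lpow p lborel Om (%x. f al x - h al x)+(T*X+c*(c*(ennreal s*ennreal v))) < ennreal (e/2)+(ennreal (e/4)+ennreal (e/4))"
   using m0(1) sv by(intro add_strict_mono moll[OF alk]) (auto simp: X_def R_def)
  also have "... = ennreal e" using e by(simp add: ennreal_plus[symmetric])
  finally show ?thesis by simp
 qed
 have low: "Lpow p lborel K1 (%x. h al x - V al x) < ennreal e" if "mi_order al <= k" for al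
 proof -
  have "Lpow p lborel K1 (%x. h al x - V al x) <= Lpow p lborel Om (%x. f al x - h al x)"
  proof (intro Lpow_mono conjI p0)
   fix x assume "x:K1"
   thus "x:Om" "abs(h al x - V al x) <= abs(f al x - h al x)" using KQ K1(2) V(2) by(auto simp: abs_minus_commute subset_eq)
  qed
  also have "... < ennreal (e/2)" by(rule moll[OF that])
  also have "... < ennreal e" using e by(intro ennreal_lessI) auto
  finally show ?thesis .
 qed
 show ?thesis using V(1) top low by blast
qed

end

section \<open>Uniqueness of weak derivatives\<close>

context hyp_domain
begin

text \<open>The mollifications of \<open>w\<close> vanish, and they converge to \<open>w\<close>
 locally.\<close>

lemma weak_null:
 assumes w: "locally_integrable Om w" and z: "!!phi. phi:test_functions Om ==> (LINT x:Om|lebesgue. w x*phi x) = 0"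
 shows "AE x in lborel. x:Om --> w x = 0"
proof -
 obtain x0 where x0: "x0:Om" using nonempty_dom by blast
 define P where "P R = {x:Om. K x0 x <= R}" for R
 have Pc: "compact (P R)" for R unfolding P_def by(rule compact_K_ball[OF x0])
 have POm: "P R <= Om" for R by(auto simp: P_def)
 have "AE x in lborel. x:P (real m) --> w x = 0" for m
 proof -
  define R where "R = real m"
  have R: "0<=R" by(simp add: R_def)
  define d where "d = exp (- R)*bd x0"
  have d: "0<d" using bd_pos[OF x0] by(simp add: d_def)
  define U where "U = (UN x:P R. ball x (d/2))"
  have U: "open U" by(auto simp: U_def)
  have UP: "U <= P (R+1)"
  proof
   fix y assume "y:U"
   then obtain x where x: "x:P R" "dist x y < d/2" by(auto simp: U_def)
   have xx: "x:Om" "K x0 x <= R" using x by(auto simp: P_def)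
   have "d <= exp (- K x0 x)*bd x0" unfolding d_def using xx(2) bd_nonneg by(intro mult_right_mono) auto
   hence "d <= bd x" using bd_ge_K[OF x0 xx(1)] by linarith
   hence y: "y:Om" using x d by(intro in_dom_if_near[OF xx(1)]) linarith
   show "y:P (R+1)"
   proof (rule ccontr)
    assume "y ~: P (R+1)"
    hence "R+1 < K x0 y" using y by(auto simp: P_def)
    hence "x ~: {x:Om. K x0 x <= R}" using x by(intro K_ball_collar[OF x0 R y]) (auto simp: d_def dist_commute)
    thus False using x by(simp add: P_def)
   qed
  qed
  hence UOm: "U<=Om" using POm by blast
  have Ub: "U:sets borel" "U:sets lebesgue" using U by auto
  have "set_integrable lebesgue (P (R+1)) w" using w Pc POm by(auto simp: locally_integrable_def)
  hence wU: "set_integrable lebesgue U w" by(rule set_integrable_subset[OF _ Ub(2) UP])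
  have "w:borel_measurable (lebesgue_on U)"
  proof -
   have "(%x. indicator U x *\<^sub>R w x):borel_measurable lebesgue" using wU by(simp add: set_integrable_def)
   moreover have "(%x. indicator U x *\<^sub>R w x) = (%x. if x:U then w x else 0)" by auto
   ultimately show ?thesis using borel_measurable_if[OF Ub(2), of w] by simp
  qed
  from represents_ex[OF Ub(1) this] obtain h where h: "represents U w h" by blast
  have hm: "h:borel_measurable borel" and h0: "!!x. x ~: U ==> h x = 0" and hw: "AE x in lborel. x:U --> w x = h x"
   using h by(auto simp: represents_def)
  have "AE x in lebesgue. x:U --> w x = h x" using hw by(rule AE_completion)
  hence ae: "AE x in lebesgue. indicator U x *\<^sub>R w x = h x"
   by(rule eventually_mono) (use h0 in "auto simp: indicator_def")
  have iw: "integrable lebesgue (%x. indicator U x *\<^sub>R w x)" using wU by(simp add: set_integrable_def)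
  have "h:borel_measurable lebesgue" using hm by(intro measurable_completion) simp
  from integrable_cong_AE[OF borel_measurable_integrable[OF iw] this ae] iw have "integrable lebesgue h" by blast
  hence hi: "integrable lborel h" using hm by(subst (asm) integrable_completion) auto
  have Ufin: "emeasure lborel U < \<infinity>"
   using bounded_subset[OF compact_imp_bounded[OF Pc] UP] by(rule emeasure_bounded_finite)
  have lU: "locally_integrable U w" using w UOm by(auto simp: locally_integrable_def)
  have mol0: "mol tau h x = 0" if tau: "0<tau" "real CARD('n)*tau < d/2" and x: "x:P R" for tau x
  proof -
   have c: "cball x (real CARD('n)*tau) <= U"
    using tau x by(auto simp: U_def)
   note phiU = kern_test_function[OF tau(1) c, of "%_. 0"]
   have phi: "kern tau (%_. 0) x:test_functions Om" by(rule kern_test_function[OF tau(1)]) (use c UOm in blast)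
   have "(LINT y:U|lebesgue. w y*kern tau (%_. 0) x y) = (LINT y:Om|lebesgue. w y*kern tau (%_. 0) x y)"
    unfolding set_lebesgue_integral_def
    by(rule Bochner_Integration.integral_cong) (use test_functionD(5)[OF phiU] UOm in "auto simp: indicator_def")
   hence "(LINT y|lborel. h y*kern tau (%_. 0) x y) = 0"
    using represents_integral[OF h lU phiU] z[OF phi] by simp
   thus ?thesis by(simp add: mol_def)
  qed
  define tau where "tau j = inverse (real (Suc j))" for j
  have tau: "0 < tau j" "tau \<longlonglongrightarrow> 0" for j unfolding tau_def using LIMSEQ_inverse_real_of_nat by auto
  have lim: "(%j. Lpow 1 lborel U (%x. mol (tau j) h x - h x)) \<longlonglongrightarrow> 0"
   by(rule mol_converges[OF order_refl U Ufin hm h0 _ tau]) (use hi in auto)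
  have "(%j. real CARD('n)*tau j) \<longlonglongrightarrow> 0" using tendsto_mult_right_zero[OF tau(2)] by blast
  hence ev: "\<forall>\<^sub>F j in sequentially. real CARD('n)*tau j < d/2" by(rule order_tendstoD(2)) (use d in simp)
  have SU: "P R <= U" using d by(force simp: U_def)
  have "\<forall>\<^sub>F j in sequentially. Lpow 1 lborel (P R) h <= Lpow 1 lborel U (%x. mol (tau j) h x - h x)"
   using ev by eventually_elim (use mol0[OF tau(1)] SU in "auto intro!: Lpow_mono")
  hence "Lpow 1 lborel (P R) h <= 0" by(intro tendsto_lowerbound[OF lim]) auto
  moreover have "(%x. ennreal (abs(h x) powr 1)*indicator (P R) x):borel_measurable lborel"
   using hm compact_imp_closed[OF Pc] by simp
  ultimately have "AE x in lborel. ennreal (abs(h x) powr 1)*indicator (P R) x = 0" by(simp add: Lpow_def nn_integral_0_iff_AE)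
  with hw show ?thesis
  proof eventually_elim
   case (elim x)
   show ?case
   proof
    assume x: "x:P (real m)"
    thus "w x = 0"
     using SU elim x by(auto simp: R_def)
   qed
  qed
 qed
 hence "AE x in lborel. ALL m. x:P (real m) --> w x = 0" unfolding AE_all_countable by blast
 thus ?thesis
 proof eventually_elim
  case (elim x)
  show ?case
  proof
   assume "x:Om"
   hence "x:P (real (nat \<lceil>K x0 x\<rceil>))" by(simp add: P_def) linarith
   thus "w x = 0" using elim by blast
  qed
 qed
qed

lemma weak_deriv_unique:
 assumes "has_weak_deriv Om al u g" "has_weak_deriv Om al u g'" shows "AE x in lborel. x:Om --> g x = g' x"
proof -
 have d: "has_weak_deriv Om al (%x. u x - u x) (%x. g x - g' x)" by(rule has_weak_deriv_diff[OF assms])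
 have "AE x in lborel. x:Om --> g x - g' x = 0"
 proof (rule weak_null)
  show "locally_integrable Om (%x. g x - g' x)" using d by(simp add: has_weak_deriv_def)
  fix phi assume "phi:test_functions Om"
  hence "0 = (-1)^mi_order al*(LINT x:Om|lebesgue. (g x - g' x)*phi x)"
   using d by(simp add: has_weak_deriv_def)
  thus "(LINT x:Om|lebesgue. (g x - g' x)*phi x) = 0" by simp
 qed
 thus ?thesis by simp
qed

end

section \<open>Consequences of the Poincare inequality\<close>

lemma powr_sum_le:
 fixes a :: "'b => real"
 assumes "finite I" "I ~= {}" "0<=p" "!!i. i:I ==> 0 <= a i"
 shows "(SUM i:I. a i) powr p <= real (card I) powr p*(SUM i:I. a i powr p)"
proof -
 obtain j where j: "j:I" "!!i. i:I ==> a i <= a j"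
 proof -
  have "Max (a ` I):a ` I" using assms by simp
  then obtain j where "j:I" "a j = Max (a ` I)" by force
  thus ?thesis using assms(1) by(intro that[of j]) auto
 qed
 have "(SUM i:I. a i) powr p <= (real (card I)*a j) powr p"
  by(metis sum_bounded_above[of I a "a j"] j assms powr_mono2 sum_nonneg)
 also have "... = real (card I) powr p*a j powr p" by(simp add: powr_mult)
 also have "... <= real (card I) powr p*(SUM i:I. a i powr p)"
  using assms j by(intro mult_left_mono member_le_sum[of j I "%i. a i powr p"]) auto
 finally show ?thesis .
qed

text \<open>The mean \<open>m\<close> is controlled by its values on the part \<open>S\<close>,
 where it differs from \<open>w\<close> by the oscillation.\<close>

lemma Lp_from_oscillation:
 fixes w :: "'a => real"
 assumes p: "0<=p" and w [measurable]: "w:borel_measurable M" and S: "S:sets M"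
  and v: "emeasure M (space M) = ennreal v" "0<=v" and s: "emeasure M S = ennreal s" "0<s" and c: "c = ennreal (2 powr p)"
 shows "Lpow p M (space M) w <= (c+c*c*ennreal (v/s))*(Lpow p M (space M) (%x. w x - m)+Lpow p M S w)"
proof -
 define X where "X = Lpow p M (space M) (%x. w x - m)+Lpow p M S w"
 have X: "Lpow p M (space M) (%x. w x - m) <= X" by(simp add: X_def)
 have "Lpow p M S (%_. m) <= c*(Lpow p M S (%x. m - w x)+Lpow p M S w)"
  using Lpow_add[OF p S, of "%x. m - w x" w] c by simp
 also have "... <= c*X" unfolding X_def
  using sets.sets_into_space[OF S] p by(intro mult_left_mono add_right_mono Lpow_mono) auto
 finally have m: "Lpow p M S (%_. m) <= c*X" .
 have "Lpow p M (space M) (%_. m) = ennreal (v/s)*Lpow p M S (%_. m)"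
  using s v v(1) s(1) S by(simp add: ennreal_mult[symmetric] Lpow_const mult_ac)
 also have "... <= ennreal (v/s)*(c*X)" by(intro mult_left_mono m) simp
 finally have "Lpow p M (space M) (%x. w x - m)+Lpow p M (space M) (%_. m) <= X+ennreal (v/s)*(c*X)" by(rule add_mono[OF X])
 hence "c*(Lpow p M (space M) (%x. w x - m)+Lpow p M (space M) (%_. m)) <= c*(X+ennreal (v/s)*(c*X))" by(rule mult_left_mono) simp
 hence "Lpow p M (space M) w <= c*(X+ennreal (v/s)*(c*X))"
  using Lpow_add[OF p, of "space M" M "%x. w x - m" "%_. m"] c by(simp add: order_trans)
 thus ?thesis unfolding X_def[symmetric] by(simp add: algebra_simps)
qed

section \<open>Lebesgue spaces\<close>

lemma Lp_finite_iff: "1<=p ==> f:Lp (ennreal p) Om \<longleftrightarrow>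
  f:borel_measurable (lebesgue_on Om) & integrable (lebesgue_on Om) (%x. abs(f x) powr p)"
 by(simp add: Lp_def)

lemma Lp_infinity_subset:
 assumes fin: "emeasure lebesgue Om < \<infinity>" and Om: "Om:sets lebesgue" and p: "1<=p"
 shows "Lp \<infinity> Om <= Lp (ennreal p) Om"
proof
 fix f assume "f:Lp \<infinity> Om"
 hence m [measurable]: "f:borel_measurable (lebesgue_on Om)" and e: "esssup (lebesgue_on Om) (%x. ennreal (abs(f x))) < \<infinity>"
  by(auto simp: Lp_def)
 define C where "C = enn2real (esssup (lebesgue_on Om) (%x. ennreal (abs(f x))))"
 have C: "esssup (lebesgue_on Om) (%x. ennreal (abs(f x))) = ennreal C" using e by(simp add: C_def)
 have "AE x in lebesgue_on Om. ennreal (abs(f x)) <= ennreal C" using esssup_AE[of "%x. ennreal (abs(f x))" "lebesgue_on Om"] by(simp add: C)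
 hence ae: "AE x in lebesgue_on Om. abs(f x) <= C" by(rule eventually_mono) (simp add: C_def)
 have sp: "emeasure (lebesgue_on Om) (space (lebesgue_on Om)) < \<infinity>" using fin Om by(simp add: emeasure_restrict_space)
 interpret finite_measure "lebesgue_on Om" by standard (use sp in simp)
 have "integrable (lebesgue_on Om) (%x. abs(f x) powr p)"
 proof (rule Bochner_Integration.integrable_bound[where f = "%_. C powr p"])
  show "AE x in lebesgue_on Om. norm (abs(f x) powr p) <= norm (C powr p)"
   using ae by eventually_elim (use p in "auto intro!: powr_mono2")
 qed simp_all
 thus "f:Lp (ennreal p) Om" using m p by(simp add: Lp_finite_iff)
qed

lemma continuous_bounded_Lp_infinity:
 assumes "Om:sets borel" "continuous_on Om f" "!!x. x:Om ==> abs(f x) <= b" shows "f:Lp \<infinity> Om"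
proof -
 have "f:borel_measurable (restrict_space borel Om)" by(rule borel_measurable_continuous_on_restrict[OF assms(2)])
 hence "(%x. indicator Om x *\<^sub>R f x):borel_measurable borel" using assms(1) by(simp add: borel_measurable_restrict_space_iff)
 hence "(%x. indicator Om x *\<^sub>R f x):borel_measurable lebesgue" by(intro measurable_completion) simp
 hence m [measurable]: "f:borel_measurable (lebesgue_on Om)" using assms(1) by(subst borel_measurable_restrict_space_iff) auto
 have "esssup (lebesgue_on Om) (%x. ennreal (abs(f x))) <= ennreal b"
  using assms by(intro esssup_I) (auto intro!: AE_I2 ennreal_leI simp: space_restrict_space)
 also have "... < \<infinity>" by simp
 finally show ?thesis by(simp add: Lp_def)
qed

lemma Lp_diff:
 assumes p: "1<=p" and f: "f:Lp (ennreal p) Om" "g:Lp (ennreal p) Om" shows "(%x. f x - g x):Lp (ennreal p) Om"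
proof -
 have fg [measurable]: "f:borel_measurable (lebesgue_on Om)" "g:borel_measurable (lebesgue_on Om)"
  and i: "integrable (lebesgue_on Om) (%x. abs(f x) powr p)" "integrable (lebesgue_on Om) (%x. abs(g x) powr p)"
  using f p by(auto simp: Lp_finite_iff)
 have "integrable (lebesgue_on Om) (%x. abs(f x - g x) powr p)"
 proof (rule Bochner_Integration.integrable_bound)
  show "integrable (lebesgue_on Om) (%x. 2 powr p*(abs(f x) powr p+abs(g x) powr p))" using i by simp
  show "AE x in lebesgue_on Om. norm (abs(f x - g x) powr p) <= norm (2 powr p*(abs(f x) powr p+abs(g x) powr p))"
   using powr_add_le[of p "f _" "- g _"] p by simp
 qed measurable
 thus ?thesis using fg p by(simp add: Lp_finite_iff)
qed

lemma Lpow_lebesgue_on: "Lpow p (lebesgue_on Om) Om f = (\<integral>\<^sup>+x. ennreal (abs(f x) powr p) \<partial>lebesgue_on Om)"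
 unfolding Lpow_def by(intro nn_integral_cong) (simp add: space_restrict_space)

text \<open>Translates the integrals over \<open>Om\<close> in the definition of the Sobolev
 norm to Borel representatives on the whole space.\<close>

lemma Lpow_represents:
 assumes "Om:sets borel" "S<=Om" "represents Om g h"
 shows "Lpow p (lebesgue_on Om) S (%x. g x - V x) = Lpow p lborel S (%x. h x - V x)"
proof -
 have "Lpow p (lebesgue_on Om) S (%x. g x - V x) = (\<integral>\<^sup>+x. ennreal (abs(g x - V x) powr p)*indicator S x*indicator Om x \<partial>lborel)"
  using assms(1) unfolding Lpow_def by(subst nn_integral_restrict_space) (auto simp: nn_integral_completion)
 also have "... = Lpow p lborel S (%x. h x - V x)"
  unfolding Lpow_def
 proof (rule nn_integral_cong_AE)
  have "AE x in lborel. x:Om --> g x = h x" using assms(3) by(simp add: represents_def)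
  thus "AE x in lborel. ennreal (abs(g x - V x) powr p)*indicator S x*indicator Om x = ennreal (abs(h x - V x) powr p)*indicator S x"
   by(rule eventually_mono) (use assms(2) in "auto simp: indicator_def")
 qed
 finally show ?thesis .
qed

lemma represents_integrable:
 assumes "Om:sets borel" "represents Om g h" "0<p" "integrable (lebesgue_on Om) (%x. abs(g x) powr p)"
 shows "integrable lborel (%x. abs(h x) powr p)"
proof (rule integrableI_nonneg)
 have h: "h:borel_measurable borel" "!!x. x ~: Om ==> h x = 0" using assms(2) by(auto simp: represents_def)
 thus "(%x. abs(h x) powr p):borel_measurable lborel" by simp
 have "(\<integral>\<^sup>+x. ennreal (abs(h x) powr p) \<partial>lborel) = Lpow p lborel Om h"
  unfolding Lpow_def using h(2) assms(3) by(intro nn_integral_cong) (auto simp: indicator_def)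
 also have "... = (\<integral>\<^sup>+x. ennreal (abs(g x) powr p) \<partial>lebesgue_on Om)"
  using Lpow_represents[OF assms(1) order_refl assms(2), of p "%_. 0"] by(simp add: Lpow_lebesgue_on)
 also have "... < \<infinity>" using assms(4) by(simp add: nn_integral_eq_integral)
 finally show "(\<integral>\<^sup>+x. ennreal (abs(h x) powr p) \<partial>lborel) < \<infinity>" .
qed simp

text \<open>The Poincare inequality bounds the oscillation, \<open>Lp_from_oscillation\<close>
 removes the mean.\<close>

lemma poincare_local:
 fixes Om :: "(real^'n::finite) set"
 assumes P: "global_poincare p Om" and p: "1<=p" and Om: "Om:sets lebesgue"
  and S: "S:sets lebesgue" "S<=Om" "0 < emeasure lebesgue S"
 shows "EX D>=0. ALL w G. locally_integrable Om w --> w:borel_measurable (lebesgue_on Om) -->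
  (ALL i. has_weak_deriv Om (unit_mi i) w (G i) & G i:Lp (ennreal p) Om) -->
  Lpow p (lebesgue_on Om) Om w <= ennreal D*((SUM i:UNIV. Lpow p (lebesgue_on Om) Om (G i))+Lpow p (lebesgue_on Om) S w)"
proof -
 define M where "M = lebesgue_on Om"
 have p0: "0<=p" using p by simp
 have sM: "space M = Om" by(simp add: M_def)
 obtain C where fin: "emeasure lebesgue Om < \<infinity>" and C: "!!u G. locally_integrable Om u &
    (ALL i. has_weak_deriv Om (unit_mi i) u (%x. (G :: real^'n => real^'n) x $ i) & (%x. G x $ i):Lp (ennreal p) Om) ==>
    (let m = (LINT x|lebesgue_on Om. u x)/measure lebesgue Om in
      (\<integral>\<^sup>+x. ennreal (abs(u x - m) powr p) \<partial>lebesgue_on Om)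
       <= ennreal C*(\<integral>\<^sup>+x. ennreal (norm (G x) powr p) \<partial>lebesgue_on Om))"
  using P unfolding global_poincare_def by blast
 define v where "v = measure lebesgue Om"
 define s where "s = measure lebesgue S"
 have "emeasure M (space M) = emeasure lebesgue Om" using Om unfolding sM unfolding M_def by(subst emeasure_restrict_space) auto
 hence v: "emeasure M (space M) = ennreal v" "0<=v" using fin by(simp_all add: v_def emeasure_eq_ennreal_measure)
 have "emeasure lebesgue S < \<infinity>" using emeasure_mono[OF S(2) Om] fin by simp
 moreover have "emeasure M S = emeasure lebesgue S" using S Om unfolding M_def by(subst emeasure_restrict_space) auto
 ultimately have s: "emeasure M S = ennreal s" "0<s" using S(3) by(simp_all add: s_def emeasure_eq_ennreal_measure)
 have SM: "S:sets M" using S by(auto simp: M_def sets_restrict_space)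
 define c where "c = ennreal (2 powr p)"
 define Z where "Z = c+c*c*ennreal (v/s)"
 define n where "n = ennreal (real CARD('n) powr p)"
 define D where "D = Z*(ennreal C*n+1)"
 have De: "ennreal (enn2real D) = D"
  by(simp add: D_def Z_def c_def n_def ennreal_mult_less_top)
 have "Lpow p M Om w <= D*((SUM i:UNIV. Lpow p M Om (G i))+Lpow p M S w)"
  if w: "locally_integrable Om w" "w:borel_measurable M"
   and G: "ALL i. has_weak_deriv Om (unit_mi i) w (G i) & G i:Lp (ennreal p) Om" for w and G :: "'n => real^'n => real"
 proof -
  define F where "F x = (\<chi> i. G i x)" for x
  have FG: "(%x. F x $ i) = G i" for i by(simp add: F_def)
  define m where "m = (LINT x|M. w x)/measure lebesgue Om"
  have Gm: "G i:borel_measurable M" for i using G by(auto simp: M_def Lp_def)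
  define X where "X = (SUM i:UNIV. Lpow p M Om (G i))"
  define Y where "Y = Lpow p M S w"
  have "(\<integral>\<^sup>+x. ennreal (norm (F x) powr p) \<partial>M) <= (\<integral>\<^sup>+x. n*(SUM i:UNIV. ennreal (abs(G i x) powr p)) \<partial>M)"
  proof (rule nn_integral_mono)
   fix x
   have "norm (F x) <= (SUM i:UNIV. abs(G i x))" using norm_le_l1_cart[of "F x"] by(simp add: F_def)
   hence "norm (F x) powr p <= (SUM i:UNIV. abs(G i x)) powr p" using p0 by(intro powr_mono2) auto
   also have "... <= real CARD('n) powr p*(SUM i:UNIV. abs(G i x) powr p)" by(rule powr_sum_le) (use p0 in auto)
   finally have "ennreal (norm (F x) powr p) <= ennreal (real CARD('n) powr p*(SUM i:UNIV. abs(G i x) powr p))" by(rule ennreal_leI)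
   also have "... = n*(SUM i:UNIV. ennreal (abs(G i x) powr p))"
    by(subst ennreal_mult) (auto simp: n_def sum_nonneg sum_ennreal)
   finally show "ennreal (norm (F x) powr p) <= n*(SUM i:UNIV. ennreal (abs(G i x) powr p))" .
  qed
  also have "... = n*X"
   using Gm by(simp add: X_def M_def Lpow_lebesgue_on nn_integral_cmult nn_integral_sum del: sum_ennreal)
  finally have "ennreal C*(\<integral>\<^sup>+x. ennreal (norm (F x) powr p) \<partial>M) <= ennreal C*(n*X)" by(rule mult_left_mono) simp
  moreover have "Lpow p M Om (%x. w x - m) <= ennreal C*(\<integral>\<^sup>+x. ennreal (norm (F x) powr p) \<partial>M)"
   using C[of w F] w G unfolding FG m_def M_def Let_def Lpow_lebesgue_on by blast
  ultimately have "Lpow p M Om (%x. w x - m)+Y <= ennreal C*n*X+Y"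
   unfolding mult.assoc by auto
  also have "... <= (ennreal C*n+1)*(X+Y)" by(simp add: algebra_simps)
  finally have "Z*(Lpow p M Om (%x. w x - m)+Y) <= D*(X+Y)" unfolding D_def mult.assoc by(rule mult_left_mono) simp
  moreover have "Lpow p M Om w <= Z*(Lpow p M Om (%x. w x - m)+Y)"
   using Lp_from_oscillation[OF p0 w(2) SM v s c_def, of m] by(simp add: sM Z_def Y_def)
  ultimately show ?thesis by(simp add: X_def Y_def)
 qed
 thus ?thesis unfolding M_def by(intro exI[of _ "enn2real D"]) (simp add: De)
qed

section \<open>Density\<close>

context hyp_domain
begin

text \<open>The derivative chosen in the definition of the Sobolev norm agrees almost everywhere
 with any other one.\<close>

lemma Lp_norm_weak_deriv:
 assumes p: "1<=p" and w: "has_weak_deriv Om al u w" "w:Lp (ennreal p) Om" and t: "0<=t"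
  and N: "Lpow p (lebesgue_on Om) Om w <= ennreal (t powr p)"
 shows "Lp_norm (ennreal p) Om (weak_deriv Om al u) <= t"
proof -
 define M where "M = lebesgue_on Om"
 define d where "d = weak_deriv Om al u"
 have Om: "Om:sets lebesgue" using open_dom by simp
 have "has_weak_deriv Om al u d" unfolding d_def weak_deriv_def
  by(rule someI[where P = "has_weak_deriv Om al u", OF w(1)])
 from weak_deriv_unique[OF w(1) this] have "AE x in lebesgue. x:Om --> w x = d x" by(rule AE_completion)
 hence ae: "AE x in lebesgue. (if x:Om then w x else 0) = (if x:Om then d x else 0)" by simp
 have aeM: "AE x in M. w x = d x"
  using `AE x in lebesgue. x \<in> Om --> w x = d x` Om unfolding M_def by(subst AE_restrict_space_iff) auto
 have wm [measurable]: "w:borel_measurable M" using w(2) by(simp add: Lp_def M_def)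
 have "(%x. if x:Om then w x else 0):borel_measurable lebesgue" using wm Om by(simp add: borel_measurable_if M_def)
 from borel_measurable_AE[OF this ae] have dm [measurable]: "d:borel_measurable M" using Om by(simp add: borel_measurable_if M_def)
 have "(LINT x|M. abs(d x) powr p) = (LINT x|M. abs(w x) powr p)"
  by(rule integral_cong_AE) (use aeM in "auto elim: eventually_mono")
 also have "... = enn2real (\<integral>\<^sup>+x. ennreal (abs(w x) powr p) \<partial>M)" by(rule integral_eq_nn_integral) auto
 also have "... <= t powr p" using N by(intro enn2real_leI) (auto simp: M_def Lpow_lebesgue_on)
 finally have le: "(LINT x|M. abs(d x) powr p) <= t powr p" .
 have "Lp_norm (ennreal p) Om d = (LINT x|M. abs(d x) powr p) powr (1/p)" using p by(simp add: Lp_norm_def M_def)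
 also have "... <= (t powr p) powr (1/p)" using le p by(intro powr_mono2 integral_nonneg_AE) auto
 also have "... = t" using p t by(simp add: powr_powr)
 finally show ?thesis by(simp add: d_def)
qed

text \<open>Downward induction on the order: the derivatives of order \<open>k\<close> of the
 difference are small on \<open>Om\<close>, and each application of
 \<open>poincare_local\<close> descends by one order at the cost of a factor \<open>B\<close>.
 The tolerance \<open>e\<close> anticipates \<open>k\<close> such factors.\<close>

theorem sobolev_density:
 assumes k: "1<=k" and p: "1<=p" and P: "global_poincare p Om" and u: "u:sobolev k (ennreal p) Om" and eta: "0<eta"
 shows "EX v:sobolev k \<infinity> Om. sobolev_norm k (ennreal p) Om (%x. u x - v x) < eta"
proof -
 define M where "M = lebesgue_on Om"
 have fin: "emeasure lebesgue Om < \<infinity>" using P by(simp add: global_poincare_def)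
 have Om: "Om:sets borel" "Om:sets lebesgue" using open_dom by auto
 have "ALL al. EX g. mi_order al <= k --> g:Lp (ennreal p) Om & has_weak_deriv Om al u g"
  using u unfolding sobolev_def by blast
 from choice[OF this] obtain g where g: "!!al. mi_order al <= k ==> g al:Lp (ennreal p) Om"
  "!!al. mi_order al <= k ==> has_weak_deriv Om al u (g al)" by blast
 have "EX h. mi_order al <= k --> represents Om (g al) h" for al
  using represents_ex[OF Om(1), of "g al"] g(1)[of al] by(auto simp: Lp_def)
 hence "ALL al. EX h. mi_order al <= k --> represents Om (g al) h" by blast
 from choice[OF this] obtain h where h: "!!al. mi_order al <= k ==> represents Om (g al) (h al)" by blast
 have gu: "has_weak_deriv Om (unit_mi i) (g al) (g (up i al))" if "mi_order al < k" for al i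
  using that by(intro has_weak_deriv_unit[OF g(2) g(2)]) auto
 have hp: "integrable lborel (%x. abs(h al x) powr p)" if "mi_order al <= k" for al
  using represents_integrable[OF Om(1) h[OF that], of p] g(1)[OF that] p by(simp add: Lp_finite_iff)
 obtain x0 where x0: "x0:Om" using nonempty_dom by blast
 define S where "S = cball x0 (bd x0/2)"
 have S: "compact S" "S<=Om" "S:sets lebesgue" "0 < emeasure lebesgue S"
 proof -
  show "compact S" "S:sets lebesgue" by(auto simp: S_def)
  show "S<=Om" using bd_pos[OF x0] by(auto simp: S_def intro!: in_dom_if_near[OF x0])
  have "0 < measure lborel S" unfolding S_def using bd_pos[OF x0] by simp
  thus "0 < emeasure lebesgue S"
   by(simp add: measure_def enn2real_positive_iff S_def)
 qed
 from poincare_local[OF P p Om(2) S(3,2,4)] obtain D where D: "0<=D" and Dw: "!!w G. locally_integrable Om w ==> w:borel_measurable (lebesgue_on Om) ==>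
  (ALL i. has_weak_deriv Om (unit_mi i) w (G i) & G i:Lp (ennreal p) Om) ==>
  Lpow p (lebesgue_on Om) Om w <= ennreal D*((SUM i:UNIV. Lpow p (lebesgue_on Om) Om (G i))+Lpow p (lebesgue_on Om) S w)"
  by blast
 define n where "n = real CARD('n)"
 define B where "B = D*(n+1)+1"
 have B: "1<=B" "D*(n+1) <= B" using D by(auto simp: B_def n_def)
 define m where "m = card {al :: 'n => nat. mi_order al <= k}"
 (* The Sobolev norm has \<open>m\<close> summands. *)
 define t where "t = eta/(2*(real m+1))"
 have t: "0<t" "real m*t < eta"
 proof -
  show "0<t" using eta by(simp add: t_def)
  have "real m*t = eta*(real m/(2*(real m+1)))" by(simp add: t_def)
  also have "... < eta*1" using eta by(intro mult_strict_left_mono) auto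
  finally show "real m*t < eta" by simp
 qed
 (* Each of the at most \<open>k\<close> descents costs a factor \<open>B\<close>. *)
 define e where "e = t powr p/B^k"
 have e: "0<e" "B^k*e = t powr p" using t B by(auto simp: e_def)
 obtain V where V: "bounded_jet k Om V" "ALL al. mi_order al = k --> Lpow p lborel Om (%x. h al x - V al x) < ennreal e"
  "ALL al. mi_order al <= k --> Lpow p lborel S (%x. h al x - V al x) < ennreal e"
  using sobolev_approximation[OF fin k p gu h hp S(1,2) e(1)] by blast
 obtain b where Vj: "is_jet k Om V" and b: "!!al x. mi_order al <= k ==> x:Om ==> abs(V al x) <= b"
  using V(1) by(auto simp: bounded_jet_def)
 define v where "v = V (%_. 0)"
 have Vinf: "V al:Lp \<infinity> Om" if "mi_order al <= k" for al
 proof (rule continuous_bounded_Lp_infinity[OF Om(1)])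
  show "continuous_on Om (V al)" using is_jetD(2)[OF Vj that] by(intro continuous_at_imp_continuous_on) auto
  show "abs(V al x) <= b" if "x:Om" for x by(rule b) fact+
 qed
 have vw: "has_weak_deriv Om al v (V al)" if "mi_order al <= k" for al
  unfolding v_def by(rule jet_weak_deriv[OF open_dom Vj that])
 have "locally_integrable Om v" using vw[of "%_. 0"] by(simp add: has_weak_deriv_def)
 hence vS: "v:sobolev k \<infinity> Om" unfolding sobolev_def using Vinf vw by blast
 define w where "w al x = g al x - V al x" for al x
 have ww: "has_weak_deriv Om al (%x. u x - v x) (w al)" if "mi_order al <= k" for al
  unfolding w_def by(rule has_weak_deriv_diff[OF g(2)[OF that] vw[OF that]])
 have wu: "has_weak_deriv Om (unit_mi i) (w al) (w (up i al))" if "mi_order al < k" for al i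
  using that by(intro has_weak_deriv_unit[OF ww ww]) auto
 have wL: "w al:Lp (ennreal p) Om" if "mi_order al <= k" for al
  unfolding w_def using g(1)[OF that] Vinf[OF that] Lp_infinity_subset[OF fin Om(2) p] by(intro Lp_diff[OF p]) auto
 define N where "N A al = Lpow p (lebesgue_on Om) A (w al)" for A al
 have NV: "N A al = Lpow p lborel A (%x. h al x - V al x)" if "A<=Om" "mi_order al <= k" for A al
  unfolding N_def w_def by(rule Lpow_represents[OF Om(1) that(1) h[OF that(2)]])
 have Ntop: "N Om al <= ennreal e" if "mi_order al = k" for al using V(2) that NV[of Om al] by auto
 have NS: "N S al <= ennreal e" if "mi_order al <= k" for al using V(3) that NV[OF S(2)] by auto
 have Nj: "N Om al <= ennreal (B^j*e)" if "mi_order al+j = k" for al j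
  using that
 proof (induction j arbitrary: al)
  case 0 thus ?case using Ntop by simp
 next
  case (Suc j)
  hence ak: "mi_order al < k" "mi_order al <= k" by auto
  have Be: "e <= B^j*e" using B e by simp
  have "N Om al <= ennreal D*((SUM i:UNIV. N Om (up i al))+N S al)"
   unfolding N_def
  proof (rule Dw)
   show "locally_integrable Om (w al)" using ww[OF ak(2)] by(simp add: has_weak_deriv_def)
   show "w al:borel_measurable (lebesgue_on Om)" using wL[OF ak(2)] by(simp add: Lp_def)
   show "ALL i. has_weak_deriv Om (unit_mi i) (w al) (w (up i al)) & w (up i al):Lp (ennreal p) Om"
    using wu[OF ak(1)] wL ak by simp
  qed
  also have "... <= ennreal D*((SUM i:(UNIV :: 'n set). ennreal (B^j*e))+ennreal (B^j*e))"
   using Suc NS[OF ak(2)] Be by(intro mult_left_mono add_mono sum_mono) (auto intro: order_trans ennreal_leI)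
  also have "... = ennreal (D*((n+1)*(B^j*e)))"
  using B e D by(simp add: n_def ennreal_mult ennreal_of_nat_eq_real_of_nat distrib_right)
  also have "... <= ennreal (B^Suc j*e)"
  using B e mult_right_mono by simp
  finally show ?case .
 qed
 have NB: "N Om al <= ennreal (t powr p)" if "mi_order al <= k" for al
 proof -
  have "N Om al <= ennreal (B^(k - mi_order al)*e)" using that by(intro Nj) simp
  also have "... <= ennreal (B^k*e)" using B e by(intro ennreal_leI mult_right_mono power_increasing) auto
  finally show ?thesis by(simp add: e)
 qed
 have "sobolev_norm k (ennreal p) Om (%x. u x - v x) <= (SUM al:{al :: 'n => nat. mi_order al <= k}. t)"
  unfolding sobolev_norm_def
 proof (rule sum_mono)
  fix al :: "'n => nat" assume "al:{al. mi_order al <= k}"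
  hence a: "mi_order al <= k" by simp
  show "Lp_norm (ennreal p) Om (weak_deriv Om al (%x. u x - v x)) <= t"
   using NB[OF a] t by(intro Lp_norm_weak_deriv[OF p ww[OF a] wL[OF a]]) (auto simp: N_def)
 qed
 also have "... < eta" using t(2) by(simp add: m_def)
 finally show ?thesis using vS by blast
qed

end


theorem corollary1p4:
  fixes \<Omega> :: "(real^'n::finite) set" and \<delta> p :: real and k :: nat
  assumes "0 \<le> \<delta>" and "1 \<le> k" and "1 \<le> p"
    and "is_domain \<Omega>" and "\<Omega> \<noteq> UNIV"
    and "gromov_hyperbolic \<delta> \<Omega>"
    and "global_poincare p \<Omega>"
  shows "sobolev k \<infinity> \<Omega> \<subseteq> sobolev k (ennreal p) \<Omega> \<and>
    (\<forall>u\<in>sobolev k (ennreal p) \<Omega>. \<forall>\<epsilon>>0. \<exists>v\<in>sobolev k \<infinity> \<Omega>.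
       sobolev_norm k (ennreal p) \<Omega> (\<lambda>x. u x - v x) < \<epsilon>)"
proof (intro conjI ballI allI impI)
  interpret hyp_domain \<Omega> \<delta>
    by unfold_locales (use assms in \<open>auto simp: is_domain_def\<close>)
  have "emeasure lebesgue \<Omega> < \<infinity>" using assms(7) by (simp add: global_poincare_def)
  then have "Lp \<infinity> \<Omega> \<subseteq> Lp (ennreal p) \<Omega>" using open_dom by (intro Lp_infinity_subset assms(3)) auto
  then show "sobolev k \<infinity> \<Omega> \<subseteq> sobolev k (ennreal p) \<Omega>" unfolding sobolev_def by blast
  show "\<exists>v\<in>sobolev k \<infinity> \<Omega>. sobolev_norm k (ennreal p) \<Omega> (\<lambda>x. u x - v x) < \<epsilon>"
    if "u \<in> sobolev k (ennreal p) \<Omega>" "0 < \<epsilon>" for u \<epsilon>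
    by (rule sobolev_density[OF assms(2,3,7) that])
qed

end
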